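(* Let $k\ge0$ be a fixed integer, $m\ge1$, $T>0$, and assume that $$U\in C^\infty(\mathbb{T}^d),\quad \mathbf{g}_m\in \mathrm{H}^{k+1}_\eta(\mathbb{T}^d),\quad \mathbf{f}_m\in \mathrm{H}^{k+1}_{t,x}((0,T)\times\mathbb{T}^d).$$ Then there exists a unique weak solution $\mathbf{c}_m\in \mathrm{H}^{k+1}_{t,x}((0,T)\times\mathbb{T}^d)$ to the initial value problem $$\partial_t\mathbf{c}_m+H\mathbf{c}_m=\mathbf{f}_m\ \text{ in }(0,T)\times\mathbb{T}^d,\qquad \mathbf{c}_m=\mathbf{g}_m\ \text{ on }\{t=0\}\times\mathbb{T}^d.$$ Furthermore, there exists a constant $C=C(d,T,m,U,k)>0$ such that $$\|\mathbf{c}_m\|^2_{\mathrm{H}^{k+1}_{t,x}((0,T)\times\mathbb{T}^d)}\le C\bigl(\|\mathbf{g}_m\|^2_{\mathrm{H}^{k+1}_\eta(\mathbb{T}^d)}+\|\mathbf{f}_m\|^2_{\mathrm{H}^{k+1}_{t,x}((0,T)\times\mathbb{T}^d)}\bigr).$$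
   Context: $d\eta=e^{-U(x)}dx$ on $\mathbb{T}^d$; $\mathrm{H}^k_\eta(\mathbb{T}^d)$ is the corresponding weighted Sobolev space; $\mathrm{H}^k_{t,x}((0,T)\times\mathbb{T}^d)$ has norm$^2$ $\sum_{i+j\le k}\|\partial_t^i\nabla_x^ju\|^2_{\mathrm{L}^2((0,T);\mathrm{L}^2_\eta)}$. All are used componentwise for $\mathbb{R}^n$-valued functions. Let $\alpha^1,\dots,\alpha^n$ enumerate all multi-indices $\alpha\in\mathbb{N}^d$ with $|\alpha|\le m$, ordered so that $|\alpha^i|\le|\alpha^j|$ for $i\le j$. $\mathbf{c}_m=(c_m^{\alpha^1},\dots,c_m^{\alpha^n})$, and $\mathbf{f}_m,\mathbf{g}_m$ are the $\mathbb{R}^n$-valued functions with $j$-th components $(f,\Psi_{\alpha^j})_{\mathrm{L}^2_\mu}$, $(g,\Psi_{\alpha^j})_{\mathrm{L}^2_\mu}$ (Hermite coefficients in $v$ of the source $f(t,x,v)$ and initial datum $g(x,v)$; $\Psi_\alpha$ are the tensor Hermite polynomials orthonormal in $L^2(e^{-|v|^2/2}dv)$). Let $$H=A-\sum_{i=1}^dB_i\partial_{x_i}^*+\sum_{i=1}^dB_i^T\partial_{x_i},\qquad \partial_{x_i}^*=-\partial_{x_i}+\partial_{x_i}U,$$ where $A=\mathrm{diag}(|\alpha^1|,\dots,|\alpha^n|)$ and $B_i$ is the $n\times n$ matrix with $(B_i)_{jl}=\sqrt{\alpha^j_i+1}$ if $\alpha^l=\alpha^j+\mathbf{e}_i$,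 and $0$ otherwise ($\mathbf{e}_i$ the $i$-th unit multi-index). A weak solution is a function $\mathbf{c}_m\in \mathrm{L}^2((0,T);\mathrm{H}^1_\eta(\mathbb{T}^d;\mathbb{R}^n))$ with $\partial_t\mathbf{c}_m\in \mathrm{L}^2((0,T);\mathrm{L}^2_\eta(\mathbb{T}^d;\mathbb{R}^n))$, $\mathbf{c}_m(0)=\mathbf{g}_m$, and for a.e. $t\in[0,T]$ and all $\varphi\in \mathrm{H}^1_\eta(\mathbb{T}^d;\mathbb{R}^n)$, $(\partial_t\mathbf{c}_m(t,\cdot)+H\mathbf{c}_m(t,\cdot),\varphi)_{\mathrm{L}^2_\eta}=(\mathbf{f}_m(t,\cdot),\varphi)_{\mathrm{L}^2_\eta}$. *)

theory Defs
  imports "HOL-Analysis.Analysis"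
begin

section \<open>Smooth functions on \<open>\<real>\<^sup>N\<close>\<close>

fun iter_pderiv :: "'e::euclidean_space list \<Rightarrow> ('e \<Rightarrow> real) \<Rightarrow> 'e \<Rightarrow> real" where
  "iter_pderiv [] f = f"
| "iter_pderiv (b # bs) f = (\<lambda>x. frechet_derivative (iter_pderiv bs f) (at x) b)"

text \<open>If all iterated partial derivatives are differentiable everywhere, then they are all
  continuous, so this is \<open>C\<^sup>\<infinity>\<close>.\<close>

definition smooth_fun :: "('e::euclidean_space \<Rightarrow> real) \<Rightarrow> bool" where
  "smooth_fun f \<longleftrightarrow> (\<forall>bs. set bs \<subseteq> Basis \<longrightarrow> iter_pderiv bs f differentiable_on UNIV)"

section \<open>The torus and the weighted measures\<close>

text \<open>The torus is \<open>\<real>\<^sup>d / \<int>\<^sup>d\<close>. Continuous and smooth functions on it are \<open>\<int>\<^sup>d\<close>-periodic functions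
  on \<open>\<real>\<^sup>d\<close>. Measurable functions are identified up to null sets, so only their values on the
  fundamental cell matter; the periodic boundary behaviour of their weak derivatives is
  enforced by the test functions, which do not vanish on the boundary of the cell.\<close>

definition periodic :: "(real^'d \<Rightarrow> real) \<Rightarrow> bool" where
  "periodic f \<longleftrightarrow> (\<forall>x i. f (x + axis i 1) = f x)"

definition Cinf_torus :: "(real^'d \<Rightarrow> real) set" where
  "Cinf_torus = {f. smooth_fun f \<and> periodic f}"

definition torus_cell :: "(real^'d) set" where
  "torus_cell = {x. \<forall>i. 0 \<le> x $ i \<and> x $ i < 1}"

definition torus_leb :: "(real^'d) measure" where
  "torus_leb = restrict_space lborel torus_cell"

definition eta :: "(real^'d \<Rightarrow> real) \<Rightarrow> (real^'d) measure" where
  "eta U = density torus_leb (\<lambda>x. ennreal (exp (- U x)))"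

definition time_leb :: "real \<Rightarrow> real measure" where
  "time_leb T = restrict_space lborel {0<..<T}"

definition cyl_leb :: "real \<Rightarrow> (real \<times> (real^'d)) measure" where
  "cyl_leb T = restrict_space lborel ({0<..<T} \<times> torus_cell)"

definition cyl_eta :: "real \<Rightarrow> (real^'d \<Rightarrow> real) \<Rightarrow> (real \<times> (real^'d)) measure" where
  "cyl_eta T U = density (cyl_leb T) (\<lambda>(t, x). ennreal (exp (- U x)))"

section \<open>Weak derivatives and Sobolev spaces\<close>

definition L2 :: "'a measure \<Rightarrow> ('a \<Rightarrow> real) set" where
  "L2 M = {u. u \<in> borel_measurable M \<and> integrable M (\<lambda>x. (u x)\<^sup>2)}"

definition L2_normsq :: "'a measure \<Rightarrow> ('a \<Rightarrow> real) \<Rightarrow> real" where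
  "L2_normsq M u = (\<integral>x. (u x)\<^sup>2 \<partial>M)"

text \<open>\<open>v\<close> is a distributional derivative of \<open>u\<close> in the directions \<open>bs\<close> (with respect to the
  unweighted measure \<open>M\<close> and the test functions \<open>\<D>\<close>) that lies in \<open>L\<^sup>2\<close> of the weighted
  measure \<open>W\<close>.\<close>

definition is_weak_deriv ::
  "('e::euclidean_space \<Rightarrow> real) set \<Rightarrow> 'e measure \<Rightarrow> 'e measure \<Rightarrow> 'e list
    \<Rightarrow> ('e \<Rightarrow> real) \<Rightarrow> ('e \<Rightarrow> real) \<Rightarrow> bool" where
  "is_weak_deriv \<D> M W bs u v \<longleftrightarrow> v \<in> L2 W \<and>
     (\<forall>\<phi>\<in>\<D>. (\<integral>x. u x * iter_pderiv bs \<phi> x \<partial>M) = (-1) ^ length bs * (\<integral>x. v x * \<phi> x \<partial>M))"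

definition space_dirs :: "'d list \<Rightarrow> (real^'d) list" where
  "space_dirs is = map (\<lambda>i. axis i 1) is"

definition is_Dx :: "(real^'d \<Rightarrow> real) \<Rightarrow> 'd list \<Rightarrow> (real^'d \<Rightarrow> real) \<Rightarrow> (real^'d \<Rightarrow> real) \<Rightarrow> bool" where
  "is_Dx U is = is_weak_deriv Cinf_torus torus_leb (eta U) (space_dirs is)"

text \<open>Weak derivatives are unique up to null sets, so the choice of a representative here and
  in \<open>Dtx\<close> below is immaterial.\<close>

definition Dx :: "(real^'d \<Rightarrow> real) \<Rightarrow> 'd list \<Rightarrow> (real^'d \<Rightarrow> real) \<Rightarrow> real^'d \<Rightarrow> real" where
  "Dx U is u = (SOME v. is_Dx U is u v)"

definition Heta :: "(real^'d \<Rightarrow> real) \<Rightarrow> nat \<Rightarrow> (real^'d \<Rightarrow> real) set" where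
  "Heta U k = {u \<in> L2 (eta U). \<forall>is. length is \<le> k \<longrightarrow> (\<exists>v. is_Dx U is u v)}"

text \<open>The \<open>j\<close>-th gradient \<open>\<nabla>\<^sup>j u\<close> is the tensor of all \<open>d\<^sup>j\<close> derivatives of order \<open>j\<close>, measured in
  the Euclidean (Frobenius) norm.\<close>

definition Heta_normsq :: "(real^'d \<Rightarrow> real) \<Rightarrow> nat \<Rightarrow> (real^'d \<Rightarrow> real) \<Rightarrow> real" where
  "Heta_normsq U k u = (\<Sum>j\<le>k. \<Sum>is | length is = j. L2_normsq (eta U) (Dx U is u))"

definition cyl_tests :: "real \<Rightarrow> (real \<times> (real^'d) \<Rightarrow> real) set" where
  "cyl_tests T = {\<phi>. smooth_fun \<phi> \<and> (\<forall>t. periodic (\<lambda>x. \<phi> (t, x))) \<and>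
     (\<exists>a b. 0 < a \<and> b < T \<and> (\<forall>t x. t \<notin> {a..b} \<longrightarrow> \<phi> (t, x) = 0))}"

definition cyl_dirs :: "nat \<Rightarrow> 'd list \<Rightarrow> (real \<times> (real^'d)) list" where
  "cyl_dirs i is = replicate i (1, 0) @ map (\<lambda>b. (0, b)) (space_dirs is)"

definition is_Dtx :: "real \<Rightarrow> (real^'d \<Rightarrow> real) \<Rightarrow> nat \<Rightarrow> 'd list
    \<Rightarrow> (real \<times> (real^'d) \<Rightarrow> real) \<Rightarrow> (real \<times> (real^'d) \<Rightarrow> real) \<Rightarrow> bool" where
  "is_Dtx T U i is = is_weak_deriv (cyl_tests T) (cyl_leb T) (cyl_eta T U) (cyl_dirs i is)"

definition Dtx :: "real \<Rightarrow> (real^'d \<Rightarrow> real) \<Rightarrow> nat \<Rightarrow> 'd list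
    \<Rightarrow> (real \<times> (real^'d) \<Rightarrow> real) \<Rightarrow> real \<times> (real^'d) \<Rightarrow> real" where
  "Dtx T U i is u = (SOME v. is_Dtx T U i is u v)"

definition Htx :: "real \<Rightarrow> (real^'d \<Rightarrow> real) \<Rightarrow> nat \<Rightarrow> (real \<times> (real^'d) \<Rightarrow> real) set" where
  "Htx T U k = {u \<in> L2 (cyl_eta T U).
     \<forall>i is. i + length is \<le> k \<longrightarrow> (\<exists>v. is_Dtx T U i is u v)}"

definition Htx_normsq :: "real \<Rightarrow> (real^'d \<Rightarrow> real) \<Rightarrow> nat \<Rightarrow> (real \<times> (real^'d) \<Rightarrow> real) \<Rightarrow> real" where
  "Htx_normsq T U k u = (\<Sum>(i, j) | i + j \<le> k. \<Sum>is | length is = j.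
     L2_normsq (cyl_eta T U) (Dtx T U i is u))"

text \<open>\<open>L\<^sup>2((0,T); H\<^sup>k\<^sub>\<eta>)\<close>, its elements written as functions of \<open>(t,x)\<close>.\<close>

definition L2_Heta :: "real \<Rightarrow> (real^'d \<Rightarrow> real) \<Rightarrow> nat \<Rightarrow> (real \<times> (real^'d) \<Rightarrow> real) set" where
  "L2_Heta T U k = {u \<in> L2 (cyl_eta T U).
     (AE t in time_leb T. (\<lambda>x. u (t, x)) \<in> Heta U k) \<and>
     (\<integral>\<^sup>+t. ennreal (Heta_normsq U k (\<lambda>x. u (t, x))) \<partial>time_leb T) < \<infinity>}"

text \<open>\<open>u(0) = g\<close>, for \<open>u\<close> with \<open>u, \<partial>\<^sub>t u \<in> L\<^sup>2((0,T); L\<^sup>2\<^sub>\<eta>)\<close>: the representative of \<open>u\<close> in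
  \<open>C([0,T]; L\<^sup>2\<^sub>\<eta>)\<close> takes the value \<open>g\<close> at time \<open>0\<close>.\<close>

definition has_initial_value ::
  "real \<Rightarrow> (real^'d \<Rightarrow> real) \<Rightarrow> (real \<times> (real^'d) \<Rightarrow> real) \<Rightarrow> (real^'d \<Rightarrow> real) \<Rightarrow> bool" where
  "has_initial_value T U u g \<longleftrightarrow> (\<exists>w :: real \<Rightarrow> real^'d \<Rightarrow> real.
     (\<forall>t\<in>{0..T}. w t \<in> L2 (eta U)) \<and>
     (\<forall>s\<in>{0..T}. ((\<lambda>t. L2_normsq (eta U) (\<lambda>x. w t x - w s x)) \<longlongrightarrow> 0) (at s within {0..T})) \<and>
     (AE t in time_leb T. AE x in eta U. w t x = u (t, x)) \<and>
     (AE x in eta U. w 0 x = g x))"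

section \<open>\<open>\<real>\<^sup>n\<close>-valued functions\<close>

text \<open>Vectors in \<open>\<real>\<^sup>n\<close> are functions \<open>nat \<Rightarrow> real\<close> of which only the entries \<open>1, \<dots>, n\<close> count;
  likewise for matrices.\<close>

definition in_comps :: "nat \<Rightarrow> ('a \<Rightarrow> nat \<Rightarrow> real) \<Rightarrow> ('a \<Rightarrow> real) set \<Rightarrow> bool" where
  "in_comps n u X \<longleftrightarrow> (\<forall>j\<in>{1..n}. (\<lambda>z. u z j) \<in> X)"

definition normsq_comps :: "nat \<Rightarrow> (('a \<Rightarrow> real) \<Rightarrow> real) \<Rightarrow> ('a \<Rightarrow> nat \<Rightarrow> real) \<Rightarrow> real" where
  "normsq_comps n N u = (\<Sum>j=1..n. N (\<lambda>z. u z j))"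

definition inner_L2 :: "(real^'d \<Rightarrow> real) \<Rightarrow> nat
    \<Rightarrow> (real^'d \<Rightarrow> nat \<Rightarrow> real) \<Rightarrow> (real^'d \<Rightarrow> nat \<Rightarrow> real) \<Rightarrow> real" where
  "inner_L2 U n u v = (\<integral>x. (\<Sum>j=1..n. u x j * v x j) \<partial>eta U)"

definition mat_vec :: "nat \<Rightarrow> (nat \<Rightarrow> nat \<Rightarrow> real) \<Rightarrow> (nat \<Rightarrow> real) \<Rightarrow> nat \<Rightarrow> real" where
  "mat_vec n M y = (\<lambda>j. \<Sum>l=1..n. M j l * y l)"

definition mat_transpose :: "(nat \<Rightarrow> nat \<Rightarrow> real) \<Rightarrow> nat \<Rightarrow> nat \<Rightarrow> real" where
  "mat_transpose M = (\<lambda>j l. M l j)"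

section \<open>Multi-indices and Hermite coefficients\<close>

definition mi_size :: "('d::finite \<Rightarrow> nat) \<Rightarrow> nat" where
  "mi_size \<beta> = (\<Sum>i\<in>UNIV. \<beta> i)"

definition num_mi :: "'d::finite itself \<Rightarrow> nat \<Rightarrow> nat" where
  "num_mi (_ :: 'd itself) m = card {\<beta> :: 'd \<Rightarrow> nat. mi_size \<beta> \<le> m}"

definition mi_enum :: "nat \<Rightarrow> (nat \<Rightarrow> 'd::finite \<Rightarrow> nat) \<Rightarrow> bool" where
  "mi_enum m \<alpha> \<longleftrightarrow>
     bij_betw \<alpha> {1..num_mi TYPE('d) m} {\<beta>. mi_size \<beta> \<le> m} \<and>
     (\<forall>i j. 1 \<le> i \<longrightarrow> i \<le> j \<longrightarrow> j \<le> num_mi TYPE('d) m \<longrightarrow> mi_size (\<alpha> i) \<le> mi_size (\<alpha> j))"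

definition hermite :: "nat \<Rightarrow> real \<Rightarrow> real" where
  "hermite k s = (-1) ^ k * exp (s\<^sup>2 / 2) * (deriv ^^ k) (\<lambda>r. exp (- r\<^sup>2 / 2)) s"

text \<open>The factor comes from \<open>\<integral> He\<^sub>k(s)\<^sup>2 e\<^bsup>-s\<^sup>2/2\<^esup> ds = k! (2\<pi>)\<^bsup>1/2\<^esup>\<close>; \<open>mu\<close> is not normalised.\<close>

definition Psi :: "('d::finite \<Rightarrow> nat) \<Rightarrow> real^'d \<Rightarrow> real" where
  "Psi \<beta> v = (\<Prod>i\<in>UNIV. hermite (\<beta> i) (v $ i) / sqrt (fact (\<beta> i) * sqrt (2 * pi)))"

definition mu :: "(real^'d) measure" where
  "mu = density lborel (\<lambda>v. ennreal (exp (- (norm v)\<^sup>2 / 2)))"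

definition hermite_coeff :: "('d::finite \<Rightarrow> nat) \<Rightarrow> (real^'d \<Rightarrow> real) \<Rightarrow> real" where
  "hermite_coeff \<beta> h = (\<integral>v. h v * Psi \<beta> v \<partial>mu)"

definition fm :: "(nat \<Rightarrow> 'd::finite \<Rightarrow> nat) \<Rightarrow> (real \<Rightarrow> real^'d \<Rightarrow> real^'d \<Rightarrow> real)
    \<Rightarrow> real \<times> (real^'d) \<Rightarrow> nat \<Rightarrow> real" where
  "fm \<alpha> f = (\<lambda>(t, x) j. hermite_coeff (\<alpha> j) (f t x))"

definition gm :: "(nat \<Rightarrow> 'd::finite \<Rightarrow> nat) \<Rightarrow> (real^'d \<Rightarrow> real^'d \<Rightarrow> real)
    \<Rightarrow> real^'d \<Rightarrow> nat \<Rightarrow> real" where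
  "gm \<alpha> g = (\<lambda>x j. hermite_coeff (\<alpha> j) (g x))"

section \<open>The moment system\<close>

definition matA :: "(nat \<Rightarrow> 'd::finite \<Rightarrow> nat) \<Rightarrow> nat \<Rightarrow> nat \<Rightarrow> real" where
  "matA \<alpha> = (\<lambda>j l. if j = l then real (mi_size (\<alpha> j)) else 0)"

definition matB :: "(nat \<Rightarrow> 'd::finite \<Rightarrow> nat) \<Rightarrow> 'd \<Rightarrow> nat \<Rightarrow> nat \<Rightarrow> real" where
  "matB \<alpha> i = (\<lambda>j l. if \<alpha> l = (\<alpha> j)(i := \<alpha> j i + 1) then sqrt (real (\<alpha> j i + 1)) else 0)"

definition grad_comps :: "(real^'d \<Rightarrow> real) \<Rightarrow> 'd \<Rightarrow> (real^'d \<Rightarrow> nat \<Rightarrow> real)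
    \<Rightarrow> real^'d \<Rightarrow> nat \<Rightarrow> real" where
  "grad_comps U i w = (\<lambda>x l. Dx U [i] (\<lambda>y. w y l) x)"

definition adj_grad_comps :: "(real^'d \<Rightarrow> real) \<Rightarrow> 'd \<Rightarrow> (real^'d \<Rightarrow> nat \<Rightarrow> real)
    \<Rightarrow> real^'d \<Rightarrow> nat \<Rightarrow> real" where
  "adj_grad_comps U i w =
     (\<lambda>x l. - grad_comps U i w x l + iter_pderiv [axis i 1] U x * w x l)"

definition Hop :: "(real^'d \<Rightarrow> real) \<Rightarrow> nat \<Rightarrow> (nat \<Rightarrow> 'd::finite \<Rightarrow> nat)
    \<Rightarrow> (real^'d \<Rightarrow> nat \<Rightarrow> real) \<Rightarrow> real^'d \<Rightarrow> nat \<Rightarrow> real" where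
  "Hop U n \<alpha> w = (\<lambda>x j. mat_vec n (matA \<alpha>) (w x) j
     - (\<Sum>i\<in>UNIV. mat_vec n (matB \<alpha> i) (adj_grad_comps U i w x) j)
     + (\<Sum>i\<in>UNIV. mat_vec n (mat_transpose (matB \<alpha> i)) (grad_comps U i w x) j))"

definition weak_solution :: "real \<Rightarrow> (real^'d \<Rightarrow> real) \<Rightarrow> nat \<Rightarrow> (nat \<Rightarrow> 'd::finite \<Rightarrow> nat)
    \<Rightarrow> (real \<times> (real^'d) \<Rightarrow> nat \<Rightarrow> real) \<Rightarrow> (real^'d \<Rightarrow> nat \<Rightarrow> real)
    \<Rightarrow> (real \<times> (real^'d) \<Rightarrow> nat \<Rightarrow> real) \<Rightarrow> bool" where
  "weak_solution T U n \<alpha> F G c \<longleftrightarrow>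
     in_comps n c (L2_Heta T U 1) \<and>
     (\<forall>j\<in>{1..n}. \<exists>v. is_Dtx T U 1 [] (\<lambda>z. c z j) v) \<and>
     (\<forall>j\<in>{1..n}. has_initial_value T U (\<lambda>z. c z j) (\<lambda>x. G x j)) \<and>
     (AE t in time_leb T. \<forall>\<phi>. in_comps n \<phi> (Heta U 1) \<longrightarrow>
        inner_L2 U n
          (\<lambda>x j. Dtx T U 1 [] (\<lambda>z. c z j) (t, x) + Hop U n \<alpha> (\<lambda>y. c (t, y)) x j) \<phi>
        = inner_L2 U n (\<lambda>x. F (t, x)) \<phi>)"

end

theory Submission
  imports Defs "HOL-Analysis.Analysis"
begin

text \<open>Since \<open>\<partial>\<^sub>i\<^sup>* = - \<partial>\<^sub>i + \<partial>\<^sub>i U\<close>, the system is \<open>\<partial>\<^sub>t c + \<Sum>\<^sub>i (B\<^sub>i + B\<^sub>i\<^sup>T) \<partial>\<^sub>i c + R c = f\<close> with the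
  smooth matrix \<open>R = A - \<Sum>\<^sub>i (\<partial>\<^sub>i U) B\<^sub>i\<close>: a symmetric hyperbolic system with constant principal part. The weight
  \<open>e\<^sup>-\<^sup>U\<close> is bounded above and below, so everything can be measured with respect to the Lebesgue measure. In
  the Fourier basis of the torus the principal part is skew-symmetric and commutes with all Sobolev weights,
  so that it drops out of every \<open>H\<^sup>s\<close> energy identity, and Gronwall's lemma bounds \<open>c(t)\<close> in \<open>H\<^sup>s\<close>. The
  same computation for truncated systems gives a Galerkin sequence that is Cauchy in \<open>C([0,T]; L\<^sup>2)\<close>, hence a
  solution, and for the difference of two solutions gives uniqueness. Time regularity follows by solving the
  equation for \<open>\<partial>\<^sub>t c\<close>: each time derivative costs one space derivative.\<close>

text \<open>Multiplication by \<open>\<partial>\<^sub>i U\<close> couples all Fourier modes, so the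
  system does not split into one ODE per mode. This forces a Galerkin truncation, on cubes symmetric
  under \<open>\<xi> \<mapsto> - \<xi>\<close> so that skew-symmetry survives it. Truncating at size
  N leaves an error on modes whose H^q weight is at least \<open>(N + 1)\<^sup>2\<close>; having q =
  k + 1 \<ge> 1 derivatives of the data is therefore what makes the sequence Cauchy. Along powers of
  two the rate is geometric, fast enough for a pointwise limit that exists at every time in L2 and
  is jointly measurable in (t, x). The forcing is only integrable in time, so equations stay in
  integrated form: \<open>prim\<close> and its product rule replace differentiation. The constant
  must be fixed before the enumeration \<alpha> and the data, hence every estimate is explicit in a
  bound on the matrix entries and in the multiplier constant of \<open>\<partial>\<^sub>i U\<close>.
  The norms of the statement are built from arbitrarily selected weak derivatives; almost-everywhere
  uniqueness of weak derivatives carries the bounds over to them.\<close>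

type_synonym 'd st_fun = "real \<times> (real^'d) \<Rightarrow> real"

abbreviation slice :: "('a \<times> 'b \<Rightarrow> real) \<Rightarrow> 'a \<Rightarrow> 'b \<Rightarrow> real" where
  "slice u t \<equiv> \<lambda>x. u (t, x)"

abbreviation pd :: "'a::real_normed_vector \<Rightarrow> ('a \<Rightarrow> real) \<Rightarrow> 'a \<Rightarrow> real" where
  "pd b f \<equiv> \<lambda>x. frechet_derivative f (at x) b"

abbreviation "dt \<equiv> time_leb"
abbreviation "dx \<equiv> torus_leb"
abbreviation "dtx \<equiv> cyl_leb"

section \<open>Square-integrable functions\<close>

lemma L2_iff: "u \<in> L2 M \<longleftrightarrow> u \<in> borel_measurable M \<and> integrable M (\<lambda>x. (u x)\<^sup>2)"
  by (simp add: L2_def)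

lemma L2_meas: "u \<in> L2 M \<Longrightarrow> u \<in> borel_measurable M"
  and L2_sq_integrable: "u \<in> L2 M \<Longrightarrow> integrable M (\<lambda>x. (u x)\<^sup>2)"
  by (auto simp: L2_def)

lemma L2_mult_integrable:
  assumes "u \<in> L2 M" "v \<in> L2 M"
  shows "integrable M (\<lambda>x. u x * v x)"
proof (rule Bochner_Integration.integrable_bound)
  show "integrable M (\<lambda>x. (u x)\<^sup>2 + (v x)\<^sup>2)"
    using assms by (auto simp: L2_iff)
  show "(\<lambda>x. u x * v x) \<in> borel_measurable M"
    using assms by (auto simp: L2_iff)
  show "AE x in M. norm (u x * v x) \<le> norm ((u x)\<^sup>2 + (v x)\<^sup>2)"
  proof (rule AE_I2)
    fix x
    have "2 * (\<bar>u x\<bar> * \<bar>v x\<bar>) \<le> (u x)\<^sup>2 + (v x)\<^sup>2"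
      using sum_squares_bound[of "\<bar>u x\<bar>" "\<bar>v x\<bar>"] by simp
    moreover have "0 \<le> \<bar>u x\<bar> * \<bar>v x\<bar>" by simp
    ultimately show "norm (u x * v x) \<le> norm ((u x)\<^sup>2 + (v x)\<^sup>2)"
      unfolding abs_mult real_norm_def by linarith
  qed
qed

lemma L2_zero [simp]: "(\<lambda>x. 0) \<in> L2 M"
  by (simp add: L2_iff)

lemma L2_cmult: "u \<in> L2 M \<Longrightarrow> (\<lambda>x. a * u x) \<in> L2 M"
  by (auto simp: L2_iff power_mult_distrib)

lemma L2_add:
  assumes "u \<in> L2 M" "v \<in> L2 M"
  shows "(\<lambda>x. u x + v x) \<in> L2 M"
proof -
  have "integrable M (\<lambda>x. (u x)\<^sup>2 + (v x)\<^sup>2 + 2 * (u x * v x))"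
    using assms L2_mult_integrable[OF assms] by (auto simp: L2_iff)
  then show ?thesis
    using assms by (auto simp: L2_iff power2_sum algebra_simps)
qed

lemma L2_uminus: "u \<in> L2 M \<Longrightarrow> (\<lambda>x. - u x) \<in> L2 M"
  using L2_cmult[of u M "-1"] by simp

lemma L2_diff: "u \<in> L2 M \<Longrightarrow> v \<in> L2 M \<Longrightarrow> (\<lambda>x. u x - v x) \<in> L2 M"
  using L2_add[of u M "\<lambda>x. - v x"] L2_uminus[of v M] by simp

lemma L2_sum: "(\<And>i. i \<in> I \<Longrightarrow> u i \<in> L2 M) \<Longrightarrow> (\<lambda>x. \<Sum>i\<in>I. u i x) \<in> L2 M"
  by (induction I rule: infinite_finite_induct) (auto intro: L2_add)

lemma L2_bounded_mult:
  assumes "r \<in> borel_measurable M" "\<And>x. x \<in> space M \<Longrightarrow> \<bar>r x\<bar> \<le> B" "u \<in> L2 M"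
  shows "(\<lambda>x. r x * u x) \<in> L2 M"
    and "L2_normsq M (\<lambda>x. r x * u x) \<le> B\<^sup>2 * L2_normsq M u"
proof -
  have *: "(r x * u x)\<^sup>2 \<le> B\<^sup>2 * (u x)\<^sup>2" if "x \<in> space M" for x
    using power_mono[OF assms(2)[OF that], of 2]
    by (simp add: power_mult_distrib mult_right_mono)
  have "integrable M (\<lambda>x. (r x * u x)\<^sup>2)"
  proof (rule Bochner_Integration.integrable_bound)
    show "integrable M (\<lambda>x. B\<^sup>2 * (u x)\<^sup>2)" using assms by (auto simp: L2_iff)
    show "(\<lambda>x. (r x * u x)\<^sup>2) \<in> borel_measurable M"
      using assms by (auto simp: L2_iff)
  qed (use * in \<open>auto intro!: AE_I2\<close>)
  then show "(\<lambda>x. r x * u x) \<in> L2 M"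
    using assms by (auto simp: L2_iff)
  then show "L2_normsq M (\<lambda>x. r x * u x) \<le> B\<^sup>2 * L2_normsq M u"
    unfolding L2_normsq_def integral_mult_right_zero[symmetric] using assms(3) *
    by (intro integral_mono) (auto simp: L2_iff)
qed

lemma L2_normsq_nonneg [simp]: "0 \<le> L2_normsq M u"
  by (simp add: L2_normsq_def)

lemma L2_normsq_cong_AE:
  assumes "u \<in> borel_measurable M" "v \<in> borel_measurable M" "AE x in M. u x = v x"
  shows "L2_normsq M u = L2_normsq M v"
  unfolding L2_normsq_def
  by (rule integral_cong_AE) (use assms in auto)

lemma L2_normsq_zero_AE:
  assumes "u \<in> L2 M" "L2_normsq M u = 0"
  shows "AE x in M. u x = 0"
  using integral_nonneg_eq_0_iff_AE[of M "\<lambda>x. (u x)\<^sup>2"] assms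
  by (auto simp: L2_iff L2_normsq_def)

lemma L2_normsq_eq_nn:
  assumes "u \<in> L2 M"
  shows "ennreal (L2_normsq M u) = (\<integral>\<^sup>+x. ennreal ((u x)\<^sup>2) \<partial>M)"
  unfolding L2_normsq_def
  by (rule nn_integral_eq_integral[symmetric]) (use assms in \<open>auto simp: L2_iff\<close>)

lemma L2_I_nn:
  assumes "u \<in> borel_measurable M" "(\<integral>\<^sup>+x. ennreal ((u x)\<^sup>2) \<partial>M) < \<infinity>"
  shows "u \<in> L2 M"
  unfolding L2_iff using assms by (auto intro!: integrableI_bounded)

lemma L2_normsq_add_eq:
  assumes "u \<in> L2 M" "v \<in> L2 M"
  shows "L2_normsq M (\<lambda>x. u x + v x) = L2_normsq M u + 2 * (\<integral>x. u x * v x \<partial>M) + L2_normsq M v"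
proof -
  have "L2_normsq M (\<lambda>x. u x + v x) = (\<integral>x. ((u x)\<^sup>2 + 2 * (u x * v x)) + (v x)\<^sup>2 \<partial>M)"
    unfolding L2_normsq_def by (intro Bochner_Integration.integral_cong) (auto simp: power2_sum algebra_simps)
  also have "\<dots> = L2_normsq M u + 2 * (\<integral>x. u x * v x \<partial>M) + L2_normsq M v"
    using assms L2_mult_integrable[OF assms] by (simp add: L2_normsq_def L2_iff)
  finally show ?thesis .
qed

lemma L2_normsq_cmult: "L2_normsq M (\<lambda>x. a * u x) = a\<^sup>2 * L2_normsq M u"
  by (simp add: L2_normsq_def power_mult_distrib)

lemma L2_normsq_minus_commute: "L2_normsq M (\<lambda>x. u x - v x) = L2_normsq M (\<lambda>x. v x - u x)"
  by (simp add: L2_normsq_def power2_commute)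

text \<open>The quadratic t -> ||t u + v||^2 is nonnegative; degenerate and genuine quadratics are
  treated separately.\<close>

lemma L2_Cauchy_Schwarz:
  assumes "u \<in> L2 M" "v \<in> L2 M"
  shows "(\<integral>x. u x * v x \<partial>M)\<^sup>2 \<le> L2_normsq M u * L2_normsq M v"
proof -
  let ?b = "\<integral>x. u x * v x \<partial>M" and ?a = "L2_normsq M u" and ?c = "L2_normsq M v"
  have q: "0 \<le> t\<^sup>2 * ?a + 2 * t * ?b + ?c" for t
  proof -
    have "0 \<le> L2_normsq M (\<lambda>x. t * u x + v x)" by simp
    also have "\<dots> = t\<^sup>2 * ?a + 2 * (\<integral>x. (t * u x) * v x \<partial>M) + ?c"
      using L2_normsq_add_eq[OF L2_cmult[OF assms(1)] assms(2)] by (simp add: L2_normsq_cmult)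
    also have "(\<integral>x. (t * u x) * v x \<partial>M) = t * ?b"
      by (simp add: mult.assoc)
    finally show ?thesis by simp
  qed
  show ?thesis
  proof (cases "?a = 0")
    case True
    have "?b = 0"
    proof (rule ccontr)
      assume b: "?b \<noteq> 0"
      \<comment> \<open>With vanishing leading coefficient the quadratic is affine in t, and this t
        makes it equal to -1.\<close>
      have "0 \<le> 2 * (- (?c + 1) / (2 * ?b)) * ?b + ?c"
        using q[of "- (?c + 1) / (2 * ?b)"] True by simp
      also have "\<dots> = -1" using b by (simp add: field_simps)
      finally show False by simp
    qed
    then show ?thesis by simp
  next
    case False
    then have a: "?a > 0" by (simp add: order.strict_iff_order)
    \<comment> \<open>The minimiser t = - b / a, scaled by a.\<close>
    have "0 \<le> ((- ?b / ?a)\<^sup>2 * ?a + 2 * (- ?b / ?a) * ?b + ?c) * ?a"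
      using q[of "- ?b / ?a"] a by (intro mult_nonneg_nonneg) auto
    also have "\<dots> = ?a * ?c - ?b\<^sup>2"
      using a by (simp add: field_simps power2_eq_square)
    finally show ?thesis by simp
  qed
qed

lemma L2_norm_triangle:
  assumes "u \<in> L2 M" "v \<in> L2 M"
  shows "sqrt (L2_normsq M (\<lambda>x. u x + v x)) \<le> sqrt (L2_normsq M u) + sqrt (L2_normsq M v)"
proof (rule real_le_lsqrt)
  have "\<bar>\<integral>x. u x * v x \<partial>M\<bar> \<le> sqrt (L2_normsq M u) * sqrt (L2_normsq M v)"
    using real_le_rsqrt[OF order_trans[OF _ L2_Cauchy_Schwarz[OF assms]], of "\<bar>\<integral>x. u x * v x \<partial>M\<bar>"]
    by (simp add: real_sqrt_mult)
  then show "L2_normsq M (\<lambda>x. u x + v x) \<le> (sqrt (L2_normsq M u) + sqrt (L2_normsq M v))\<^sup>2"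
    using L2_normsq_add_eq[OF assms] by (simp add: power2_sum)
qed auto

lemma L2_norm_triangle_diff:
  assumes "u \<in> L2 M" "v \<in> L2 M" "w \<in> L2 M"
  shows "sqrt (L2_normsq M (\<lambda>x. u x - w x)) \<le>
    sqrt (L2_normsq M (\<lambda>x. u x - v x)) + sqrt (L2_normsq M (\<lambda>x. v x - w x))"
  using L2_norm_triangle[OF L2_diff[OF assms(1,2)] L2_diff[OF assms(2,3)]] by simp

text \<open>Parallelogram identity, with the square of the difference dropped.\<close>

lemma L2_normsq_add_le:
  assumes "u \<in> L2 M" "v \<in> L2 M"
  shows "L2_normsq M (\<lambda>x. u x + v x) \<le> 2 * L2_normsq M u + 2 * L2_normsq M v"
proof -
  have "0 \<le> L2_normsq M (\<lambda>x. u x + (-1) * v x)" by simp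
  then show ?thesis
    using L2_normsq_add_eq[OF assms] L2_normsq_add_eq[OF assms(1) L2_cmult[OF assms(2), of "-1"]]
      L2_normsq_cmult[of M "-1" v] L2_normsq_nonneg[of M "\<lambda>x. u x - v x"]
    by simp
qed

lemma (in finite_measure) L2_const [simp]: "(\<lambda>x. c) \<in> L2 M"
  by (simp add: L2_iff)

lemma (in finite_measure) L2_integrable: "u \<in> L2 M \<Longrightarrow> integrable M u"
  using L2_mult_integrable[of u M "\<lambda>x. 1"] by simp

lemma L2_inner_tendsto:
  assumes u: "\<And>n. u n \<in> L2 M" "v \<in> L2 M" "w \<in> L2 M"
    and lim: "(\<lambda>n. L2_normsq M (\<lambda>x. u n x - v x)) \<longlonglongrightarrow> 0"
  shows "(\<lambda>n. \<integral>x. u n x * w x \<partial>M) \<longlonglongrightarrow> (\<integral>x. v x * w x \<partial>M)"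
proof -
  have "(\<lambda>n. (\<integral>x. u n x * w x \<partial>M) - (\<integral>x. v x * w x \<partial>M)) \<longlonglongrightarrow> 0"
  proof (rule Lim_null_comparison)
    show "\<forall>\<^sub>F n in sequentially. norm ((\<integral>x. u n x * w x \<partial>M) - (\<integral>x. v x * w x \<partial>M))
        \<le> sqrt (L2_normsq M (\<lambda>x. u n x - v x)) * sqrt (L2_normsq M w)"
    proof (rule always_eventually, rule allI)
      fix n
      have "(\<integral>x. u n x * w x \<partial>M) - (\<integral>x. v x * w x \<partial>M) = (\<integral>x. (u n x - v x) * w x \<partial>M)"
        using L2_mult_integrable[OF u(1)[of n] u(3)] L2_mult_integrable[OF u(2,3)]
        by (simp add: left_diff_distrib)
      moreover have "\<bar>\<integral>x. (u n x - v x) * w x \<partial>M\<bar> \<le> sqrt (L2_normsq M (\<lambda>x. u n x - v x) * L2_normsq M w)"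
        using L2_Cauchy_Schwarz[OF L2_diff[OF u(1)[of n] u(2)] u(3)] by (intro real_le_rsqrt) simp
      ultimately show "norm ((\<integral>x. u n x * w x \<partial>M) - (\<integral>x. v x * w x \<partial>M))
          \<le> sqrt (L2_normsq M (\<lambda>x. u n x - v x)) * sqrt (L2_normsq M w)"
        by (simp add: real_sqrt_mult)
    qed
    show "(\<lambda>n. sqrt (L2_normsq M (\<lambda>x. u n x - v x)) * sqrt (L2_normsq M w)) \<longlonglongrightarrow> 0"
      using tendsto_mult_left_zero[OF tendsto_real_sqrt[OF lim, simplified]] by simp
  qed
  then show ?thesis by (simp add: LIM_zero_iff)
qed

text \<open>The limit is an explicit pointwise one, so that it inherits joint measurability when \<open>u\<close>
  depends on a parameter.\<close>

lemma (in finite_measure) L2_fast_limit: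
  assumes u: "\<And>k. u k \<in> L2 M"
    and K: "\<And>k. L2_normsq M (\<lambda>x. u (Suc k) x - u k x) \<le> K / 4 ^ k"
  defines "v \<equiv> \<lambda>x. lim (\<lambda>k. u k x)"
  shows "v \<in> L2 M" and "(\<lambda>k. L2_normsq M (\<lambda>x. u k x - v x)) \<longlonglongrightarrow> 0"
proof -
  have [measurable]: "u k \<in> borel_measurable M" for k using u L2_meas by blast
  have v_meas [measurable]: "v \<in> borel_measurable M"
    unfolding v_def by (rule borel_measurable_lim_metric) measurable
  have K0: "0 \<le> K" using order_trans[OF L2_normsq_nonneg K[of 0]] by simp
  \<comment> \<open>The full geometric sum of the step bounds \<open>sqrt K / 2 ^ k\<close>. Keeping
    the partial sum factor \<open>1 - 1 / 2 ^ j\<close> below is what lets the induction on j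
    close.\<close>
  define c where "c = 2 * sqrt K"
  have dist: "sqrt (L2_normsq M (\<lambda>x. u (n + j) x - u n x)) \<le> c / 2 ^ n * (1 - 1 / 2 ^ j)" for n j
  proof (induction j)
    case 0
    then show ?case by (simp add: L2_normsq_def)
  next
    case (Suc j)
    have "sqrt (L2_normsq M (\<lambda>x. u (n + Suc j) x - u n x)) \<le>
        sqrt (L2_normsq M (\<lambda>x. u (Suc (n + j)) x - u (n + j) x)) + sqrt (L2_normsq M (\<lambda>x. u (n + j) x - u n x))"
      using L2_norm_triangle_diff[OF u u u] by simp
    also have "sqrt (L2_normsq M (\<lambda>x. u (Suc (n + j)) x - u (n + j) x)) \<le> sqrt (K / 4 ^ (n + j))"
      using K by simp
    also have "sqrt (K / 4 ^ (n + j)) = sqrt K / 2 ^ (n + j)"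
    proof -
      have "(4::real) ^ (n + j) = (2 ^ (n + j))\<^sup>2" by (simp add: power2_eq_square power_mult_distrib[symmetric])
      then show ?thesis by (simp add: real_sqrt_divide)
    qed
    also have "sqrt K / 2 ^ (n + j) + sqrt (L2_normsq M (\<lambda>x. u (n + j) x - u n x))
        \<le> sqrt K / 2 ^ (n + j) + c / 2 ^ n * (1 - 1 / 2 ^ j)"
      using Suc by simp
    also have "\<dots> = c / 2 ^ n * (1 - 1 / 2 ^ Suc j)"
      by (simp add: c_def field_simps power_add)
    finally show ?case by simp
  qed
  have c0: "0 \<le> c" using K0 by (simp add: c_def)
  have dist2: "L2_normsq M (\<lambda>x. u n x - u k x) \<le> (c / 2 ^ n)\<^sup>2" if nk: "n \<le> k" for n k
  proof -
    obtain j where j: "k = n + j" using le_Suc_ex[OF nk] by blast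
    have "sqrt (L2_normsq M (\<lambda>x. u k x - u n x)) \<le> c / 2 ^ n * (1 - 1 / 2 ^ j)"
      using dist[of n j] unfolding j .
    also have "\<dots> \<le> c / 2 ^ n * 1"
      using c0 by (intro mult_left_mono) auto
    finally have "(sqrt (L2_normsq M (\<lambda>x. u k x - u n x)))\<^sup>2 \<le> (c / 2 ^ n)\<^sup>2"
      by (intro power_mono) auto
    then show ?thesis by (simp add: L2_normsq_minus_commute[of M "u n"])
  qed
  have ae: "AE x in M. (\<lambda>k. u k x) \<longlonglongrightarrow> v x"
  proof -
    let ?d = "\<lambda>k x. \<bar>u (Suc k) x - u k x\<bar>"
    have b: "(\<integral>\<^sup>+x. ennreal (?d k x) \<partial>M) \<le> ennreal ((K + measure M (space M)) / 2 ^ k)" for k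
    proof -
      \<comment> \<open>Young's inequality weighted by 2^k converts the rate 4^-k of the squares
        into a summable rate 2^-k for the absolute values; the price is the total mass of the finite
        measure.\<close>
      have *: "?d k x \<le> 2 ^ k * (u (Suc k) x - u k x)\<^sup>2 + 1 / 2 ^ k" for x
      proof -
        let ?s = "(2::real) ^ k"
        have "?s * ?d k x \<le> (?s * ?d k x)\<^sup>2 + 1"
        proof -
          have "2 * y * 1 \<le> y\<^sup>2 + 1\<^sup>2" for y :: real by (rule sum_squares_bound)
          moreover have "0 \<le> ?s * ?d k x" by simp
          ultimately show ?thesis by (smt (verit) one_power2)
        qed
        then have "?s * ?d k x \<le> ?s\<^sup>2 * (u (Suc k) x - u k x)\<^sup>2 + 1"
          by (simp only: power_mult_distrib power2_abs)
        then show ?thesis by (simp add: field_simps power2_eq_square)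
      qed
      have i: "integrable M (\<lambda>x. (u (Suc k) x - u k x)\<^sup>2)"
        using L2_diff[OF u u] by (auto simp: L2_iff)
      have "(\<integral>\<^sup>+x. ennreal (?d k x) \<partial>M) \<le> (\<integral>\<^sup>+x. ennreal (2 ^ k * (u (Suc k) x - u k x)\<^sup>2 + 1 / 2 ^ k) \<partial>M)"
        using * by (intro nn_integral_mono ennreal_leI)
      also have "\<dots> = ennreal (\<integral>x. 2 ^ k * (u (Suc k) x - u k x)\<^sup>2 + 1 / 2 ^ k \<partial>M)"
        using i by (intro nn_integral_eq_integral) auto
      also have "(\<integral>x. 2 ^ k * (u (Suc k) x - u k x)\<^sup>2 + 1 / 2 ^ k \<partial>M)
          = 2 ^ k * L2_normsq M (\<lambda>x. u (Suc k) x - u k x) + measure M (space M) / 2 ^ k"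
        using i by (simp add: L2_normsq_def)
      also have "\<dots> \<le> 2 ^ k * (K / 4 ^ k) + measure M (space M) / 2 ^ k"
        using K[of k] by (intro add_right_mono mult_left_mono) auto
      also have "2 ^ k * (K / 4 ^ k) = K / 2 ^ k"
      proof -
        have "(4::real) ^ k = 2 ^ k * 2 ^ k" by (simp flip: power_mult_distrib)
        then show ?thesis by simp
      qed
      finally show ?thesis by (simp add: add_divide_distrib ennreal_leI)
    qed
    have "(\<integral>\<^sup>+x. (\<Sum>k. ennreal (?d k x)) \<partial>M) = (\<Sum>k. \<integral>\<^sup>+x. ennreal (?d k x) \<partial>M)"
      by (rule nn_integral_suminf) measurable
    also have "\<dots> \<le> (\<Sum>k. ennreal ((K + measure M (space M)) / 2 ^ k))"
      by (intro suminf_le b) auto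
    also have "\<dots> = ennreal (\<Sum>k. (K + measure M (space M)) * (1 / 2) ^ k)"
    proof -
      have "summable (\<lambda>k. (K + measure M (space M)) * (1 / 2) ^ k)"
        by (intro summable_mult summable_geometric) simp
      then show ?thesis
        using K0 by (subst suminf_ennreal2) (auto simp: power_divide)
    qed
    also have "\<dots> < \<infinity>" by simp
    finally have "AE x in M. (\<Sum>k. ennreal (?d k x)) \<noteq> \<infinity>"
      by (intro nn_integral_PInf_AE) auto
    then show ?thesis
    proof eventually_elim
      case (elim x)
      have "summable (\<lambda>k. ?d k x)"
        using elim by (intro summable_suminf_not_top) (simp_all add: infinity_ennreal_def)
      then have "summable (\<lambda>k. u (Suc k) x - u k x)"
        by (rule summable_rabs_cancel)
      moreover have "(\<Sum>i<n. u (Suc i) x - u i x) = u n x - u 0 x" for n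
        using sum_lessThan_telescope[of "\<lambda>k. u k x" n] by simp
      ultimately have "convergent (\<lambda>k. u k x - u 0 x)"
        by (simp add: summable_iff_convergent)
      then have "convergent (\<lambda>k. (u k x - u 0 x) + u 0 x)"
        by (intro convergent_add convergent_const)
      then show ?case by (simp add: v_def convergent_LIMSEQ_iff)
    qed
  qed
  \<comment> \<open>Fatou's lemma in the second index. It yields the convergence and also that the
    limit lies in L2.\<close>
  have fat: "(\<integral>\<^sup>+x. ennreal ((u n x - v x)\<^sup>2) \<partial>M) \<le> ennreal ((c / 2 ^ n)\<^sup>2)" for n
  proof -
    have "(\<integral>\<^sup>+x. ennreal ((u n x - v x)\<^sup>2) \<partial>M) = (\<integral>\<^sup>+x. liminf (\<lambda>k. ennreal ((u n x - u k x)\<^sup>2)) \<partial>M)"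
    proof (rule nn_integral_cong_AE, use ae in eventually_elim)
      case (elim x)
      have "(\<lambda>k. ennreal ((u n x - u k x)\<^sup>2)) \<longlonglongrightarrow> ennreal ((u n x - v x)\<^sup>2)"
        by (intro tendsto_intros tendsto_ennrealI elim)
      then show ?case by (rule lim_imp_Liminf[symmetric, rotated]) simp
    qed
    also have "\<dots> \<le> liminf (\<lambda>k. \<integral>\<^sup>+x. ennreal ((u n x - u k x)\<^sup>2) \<partial>M)"
      by (rule nn_integral_liminf) measurable
    also have "\<dots> \<le> liminf (\<lambda>k::nat. ennreal ((c / 2 ^ n)\<^sup>2))"
    proof (rule Liminf_mono, rule eventually_sequentiallyI)
      fix k assume "n \<le> k"
      then show "(\<integral>\<^sup>+x. ennreal ((u n x - u k x)\<^sup>2) \<partial>M) \<le> ennreal ((c / 2 ^ n)\<^sup>2)"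
        using dist2 L2_normsq_eq_nn[OF L2_diff[OF u[of n] u[of k]]]
        by (metis ennreal_leI)
    qed
    finally show ?thesis by (simp add: Liminf_const)
  qed
  have dv: "(\<lambda>x. u n x - v x) \<in> L2 M" for n
    by (rule L2_I_nn) (use le_less_trans[OF fat] in auto)
  have "(\<lambda>x. u 0 x - (u 0 x - v x)) \<in> L2 M"
    by (rule L2_diff[OF u dv])
  then show "v \<in> L2 M" by simp
  show "(\<lambda>k. L2_normsq M (\<lambda>x. u k x - v x)) \<longlonglongrightarrow> 0"
  proof (rule tendsto_sandwich[of "\<lambda>_. 0" _ _ "\<lambda>k. (c / 2 ^ k)\<^sup>2"])
    show "\<forall>\<^sub>F k in sequentially. L2_normsq M (\<lambda>x. u k x - v x) \<le> (c / 2 ^ k)\<^sup>2"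
    proof (rule always_eventually, rule allI)
      fix k
      have "ennreal (L2_normsq M (\<lambda>x. u k x - v x)) \<le> ennreal ((c / 2 ^ k)\<^sup>2)"
        using fat[of k] L2_normsq_eq_nn[OF dv[of k]] by simp
      then show "L2_normsq M (\<lambda>x. u k x - v x) \<le> (c / 2 ^ k)\<^sup>2"
        by (subst (asm) ennreal_le_iff) auto
    qed
    have "(\<lambda>k. (c * (1 / 2) ^ k)\<^sup>2) \<longlonglongrightarrow> (c * 0)\<^sup>2"
      by (intro tendsto_intros LIMSEQ_power_zero) auto
    then show "(\<lambda>k. (c / 2 ^ k)\<^sup>2) \<longlonglongrightarrow> 0"
      by (simp add: power_divide)
  qed auto
qed

text \<open>Tailored to orthogonal partial sums, whose squared distances are increments of the sum
  of squared coefficients \<open>A\<close>. A bounded monotone \<open>A\<close> converges, so a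
  subsequence has increments below 4^-k and \<open>L2_fast_limit\<close> applies to it.\<close>

lemma (in finite_measure) L2_complete_mono:
  assumes u: "\<And>n. u n \<in> L2 M"
    and A: "\<And>m n. n \<le> m \<Longrightarrow> L2_normsq M (\<lambda>x. u m x - u n x) \<le> A m - A n"
    and B: "\<And>n. A n \<le> (B::real)"
  obtains v where "v \<in> L2 M" "(\<lambda>n. L2_normsq M (\<lambda>x. u n x - v x)) \<longlonglongrightarrow> 0"
proof -
  have mono: "A n \<le> A m" if "n \<le> m" for m n
    using order_trans[OF L2_normsq_nonneg A[OF that]] by simp
  obtain L where L: "A \<longlonglongrightarrow> L" "\<And>n. A n \<le> L"
    using incseq_convergent[of A B] mono B unfolding incseq_def by blast
  have "\<exists>N. \<forall>n\<ge>N. L - A n < 1 / 4 ^ k" for k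
  proof -
    have "\<forall>\<^sub>F n in sequentially. L - 1 / 4 ^ k < A n"
      using L(1) by (intro order_tendstoD) auto
    then show ?thesis
      unfolding eventually_sequentially by (auto simp: algebra_simps)
  qed
  then obtain N where N: "\<And>k n. n \<ge> N k \<Longrightarrow> L - A n < 1 / 4 ^ k" by metis
  \<comment> \<open>Summing the thresholds makes them monotone while keeping each one above
    \<open>N k\<close>.\<close>
  define r where "r k = (\<Sum>j\<le>k. N j)" for k
  have rN: "N k \<le> r k" for k
    unfolding r_def by (rule member_le_sum) auto
  have rm: "r k \<le> r (Suc k)" for k
    unfolding r_def by simp
  have d: "L2_normsq M (\<lambda>x. u m x - u n x) \<le> 1 / 4 ^ k" if "r k \<le> n" "n \<le> m" for m n k
    using A[OF that(2)] L(2)[of m] N[of k n] rN[of k] that(1) by simp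
  define v where "v = (\<lambda>x. lim (\<lambda>k. u (r k) x))"
  have v: "v \<in> L2 M" "(\<lambda>k. L2_normsq M (\<lambda>x. u (r k) x - v x)) \<longlonglongrightarrow> 0"
    using L2_fast_limit[of "\<lambda>k. u (r k)" 1] u d[OF order.refl rm] unfolding v_def by auto
  have "(\<lambda>n. L2_normsq M (\<lambda>x. u n x - v x)) \<longlonglongrightarrow> 0"
  proof (rule LIMSEQ_I)
    fix e :: real assume e: "0 < e"
    have "\<forall>\<^sub>F k in sequentially. L2_normsq M (\<lambda>x. u (r k) x - v x) < e / 4"
      using v(2) e by (intro order_tendstoD) auto
    moreover have "(\<lambda>k. (1 / 4 :: real) ^ k) \<longlonglongrightarrow> 0" by (rule LIMSEQ_power_zero) simp
    then have "\<forall>\<^sub>F k in sequentially. (1 / 4 :: real) ^ k < e / 4"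
      using e by (intro order_tendstoD) auto
    ultimately obtain k where k: "L2_normsq M (\<lambda>x. u (r k) x - v x) < e / 4" "(1 / 4 :: real) ^ k < e / 4"
      using eventually_happens[OF eventually_conj] by force
    show "\<exists>no. \<forall>n\<ge>no. norm (L2_normsq M (\<lambda>x. u n x - v x) - 0) < e"
    proof (intro exI allI impI)
      fix n assume n: "r k \<le> n"
      have "L2_normsq M (\<lambda>x. u n x - v x) \<le>
          2 * L2_normsq M (\<lambda>x. u n x - u (r k) x) + 2 * L2_normsq M (\<lambda>x. u (r k) x - v x)"
        using L2_normsq_add_le[OF L2_diff[OF u[of n] u[of "r k"]] L2_diff[OF u[of "r k"] v(1)]] by simp
      also have "\<dots> < 2 * (e / 4) + 2 * (e / 4)"
        using d[OF order.refl n] k by (intro add_strict_mono) (auto simp: power_divide)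
      finally show "norm (L2_normsq M (\<lambda>x. u n x - v x) - 0) < e" by simp
    qed
  qed
  with v(1) that show ?thesis by blast
qed

section \<open>Primitives on the time interval\<close>

text \<open>With this normalisation \<open>prim T h\<close> is defined and continuous on the whole line, vanishes on
  \<open>t \<le> 0\<close> and is constant on \<open>t \<ge> T\<close>.\<close>

definition prim :: "real \<Rightarrow> (real \<Rightarrow> real) \<Rightarrow> real \<Rightarrow> real" where
  "prim T h t = (\<integral>s. indicator {..t} s * h s \<partial>dt T)"

lemma space_time_leb [simp]: "space (dt T) = {0<..<T}"
  and sets_time_leb: "sets (dt T) = sets (restrict_space borel {0<..<T})"
  by (auto simp: time_leb_def space_restrict_space intro!: sets_restrict_space_cong)

lemma finite_measure_time_leb: "finite_measure (dt T)"
proof (rule finite_measureI)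
  have "emeasure (dt T) (space (dt T)) = emeasure lborel {0<..<T}"
    unfolding space_time_leb unfolding time_leb_def by (subst emeasure_restrict_space) auto
  then show "emeasure (dt T) (space (dt T)) \<noteq> \<infinity>"
    by (cases "0 \<le> T") auto
qed

interpretation time: finite_measure "dt T" for T
  by (rule finite_measure_time_leb)

lemma borel_measurable_time_leb:
  "f \<in> borel_measurable borel \<Longrightarrow> f \<in> borel_measurable (dt T)"
  unfolding time_leb_def by (intro measurable_restrict_space1) simp

lemma measure_time_leb: "0 \<le> T \<Longrightarrow> measure (dt T) {0<..<T} = T"
  unfolding time_leb_def by (subst measure_restrict_space) auto

lemma indicator_time_measurable [measurable]:
  "(indicator {..t} :: real \<Rightarrow> real) \<in> borel_measurable (dt T)"
  by (intro borel_measurable_time_leb) measurable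

lemma AE_time_leb: "(AE s in dt T. P s) \<longleftrightarrow> (AE s in lborel. s \<in> {0<..<T} \<longrightarrow> P s)"
  unfolding time_leb_def by (rule AE_restrict_space_iff) simp

lemma AE_time_neq: "AE s in dt T. s \<noteq> t"
  unfolding AE_time_leb using AE_lborel_singleton[of t] by eventually_elim simp

lemma prim_integrable:
  fixes h :: "real \<Rightarrow> real"
  assumes "integrable (dt T) h"
  shows "integrable (dt T) (\<lambda>s. indicator {..t} s * h s)"
proof (rule Bochner_Integration.integrable_bound[OF assms])
  show "(\<lambda>s. indicator {..t} s * h s) \<in> borel_measurable (dt T)"
    using assms by measurable
qed (auto intro!: AE_I2 simp: indicator_def)

lemma prim_add:
  "integrable (dt T) h \<Longrightarrow> integrable (dt T) q \<Longrightarrow>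
    prim T (\<lambda>s. h s + q s) t = prim T h t + prim T q t"
  using prim_integrable[of T h t] prim_integrable[of T q t] by (simp add: prim_def distrib_left)

lemma prim_diff:
  "integrable (dt T) h \<Longrightarrow> integrable (dt T) q \<Longrightarrow>
    prim T (\<lambda>s. h s - q s) t = prim T h t - prim T q t"
  using prim_integrable[of T h t] prim_integrable[of T q t] by (simp add: prim_def right_diff_distrib)

lemma prim_cmult: "prim T (\<lambda>s. a * h s) t = a * prim T h t"
proof -
  have "prim T (\<lambda>s. a * h s) t = (\<integral>s. a * (indicator {..t} s * h s) \<partial>dt T)"
    by (simp add: prim_def mult.left_commute)
  then show ?thesis by (simp add: prim_def)
qed

lemma prim_sum:
  "(\<And>i. i \<in> I \<Longrightarrow> integrable (dt T) (h i)) \<Longrightarrow>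
    prim T (\<lambda>s. \<Sum>i\<in>I. h i s) t = (\<Sum>i\<in>I. prim T (h i) t)"
proof (induction I rule: infinite_finite_induct)
  case (insert i I)
  then show ?case by (simp add: prim_add)
qed (simp_all add: prim_def)

lemma prim_cong_AE:
  assumes "h \<in> borel_measurable (dt T)" "q \<in> borel_measurable (dt T)"
    "AE s in dt T. h s = q s"
  shows "prim T h t = prim T q t"
  unfolding prim_def
  by (rule integral_cong_AE) (use assms in auto)

lemma prim_cong:
  assumes "\<And>s. 0 < s \<Longrightarrow> s < T \<Longrightarrow> s \<le> t \<Longrightarrow> h s = q s"
  shows "prim T h t = prim T q t"
  unfolding prim_def
  by (rule Bochner_Integration.integral_cong) (use assms in \<open>auto simp: indicator_def\<close>)

lemma prim_mono:
  assumes "integrable (dt T) h" "integrable (dt T) q"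
    "\<And>s. 0 < s \<Longrightarrow> s < T \<Longrightarrow> s \<le> t \<Longrightarrow> h s \<le> q s"
  shows "prim T h t \<le> prim T q t"
  unfolding prim_def
  using prim_integrable[OF assms(1), of t] prim_integrable[OF assms(2), of t] assms(3)
  by (intro integral_mono) (auto simp: indicator_def)

lemma prim_mono_AE:
  assumes "integrable (dt T) h" "integrable (dt T) q"
    "AE s in dt T. h s \<le> q s"
  shows "prim T h t \<le> prim T q t"
  unfolding prim_def
proof (rule integral_mono_AE)
  show "AE s in dt T. indicator {..t} s * h s \<le> indicator {..t} s * q s"
    using assms(3) by eventually_elim (auto simp: indicator_def)
qed (use prim_integrable assms in auto)

lemma prim_le_total:
  assumes "integrable (dt T) h" "\<And>s. 0 < s \<Longrightarrow> s < T \<Longrightarrow> 0 \<le> h s"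
  shows "prim T h t \<le> (\<integral>s. h s \<partial>dt T)" "0 \<le> prim T h t"
  unfolding prim_def
  using assms prim_integrable[OF assms(1), of t]
  by (auto intro!: integral_mono Bochner_Integration.integral_nonneg simp: indicator_def)

lemma prim_abs_le:
  assumes "integrable (dt T) h"
  shows "\<bar>prim T h t\<bar> \<le> prim T (\<lambda>s. \<bar>h s\<bar>) t"
proof -
  have "\<bar>prim T h t\<bar> \<le> (\<integral>s. \<bar>indicator {..t} s * h s\<bar> \<partial>dt T)"
    unfolding prim_def using integral_norm_bound[of "dt T" "\<lambda>s. indicator {..t} s * h s"] by simp
  then show ?thesis by (simp add: prim_def abs_mult)
qed

lemma prim_0: "t \<le> 0 \<Longrightarrow> prim T h t = 0"
proof -
  assume "t \<le> 0"
  then have "prim T h t = (\<integral>s. 0 \<partial>dt T)"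
    unfolding prim_def by (intro Bochner_Integration.integral_cong) (auto simp: indicator_def)
  then show ?thesis by simp
qed

lemma prim_T: "T \<le> t \<Longrightarrow> prim T h t = (\<integral>s. h s \<partial>dt T)"
  unfolding prim_def by (intro Bochner_Integration.integral_cong) (auto simp: indicator_def)

lemma continuous_prim:
  assumes "integrable (dt T) h"
  shows "continuous_on UNIV (prim T h)"
proof (rule continuous_at_imp_continuous_on, rule ballI)
  fix t
  show "isCont (prim T h) t"
    unfolding continuous_at_sequentially comp_def
  proof (intro allI impI)
    fix r :: "nat \<Rightarrow> real" assume r: "r \<longlonglongrightarrow> t"
    show "(\<lambda>n. prim T h (r n)) \<longlonglongrightarrow> prim T h t"
      unfolding prim_def
    proof (rule integral_dominated_convergence[where w = "\<lambda>s. \<bar>h s\<bar>"])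
      show "AE s in dt T. (\<lambda>n. indicator {..r n} s * h s) \<longlonglongrightarrow> indicator {..t} s * h s"
        using AE_time_neq[of t T]
      proof eventually_elim
        case (elim s)
        have "\<forall>\<^sub>F n in sequentially. indicator {..r n} s * h s = indicator {..t} s * h s"
        proof (cases "s < t")
          case True
          then have "\<forall>\<^sub>F n in sequentially. s < r n" using r by (intro order_tendstoD)
          then show ?thesis by (rule eventually_mono) (use True in \<open>simp add: indicator_def\<close>)
        next
          case False
          with elim have "t < s" by simp
          then have "\<forall>\<^sub>F n in sequentially. r n < s" using r by (intro order_tendstoD)
          then show ?thesis by (rule eventually_mono) (use \<open>t < s\<close> in \<open>simp add: indicator_def\<close>)
        qed
        then show ?case by (rule tendsto_eventually)
      qed
      show "(\<lambda>s. indicator {..t} s * h s) \<in> borel_measurable (dt T)"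
        "(\<lambda>s. indicator {..r n} s * h s) \<in> borel_measurable (dt T)" for n
        using prim_integrable[OF assms] by auto
    qed (use assms in \<open>auto simp: indicator_def\<close>)
  qed
qed

lemma prim_measurable:
  "integrable (dt T) h \<Longrightarrow> prim T h \<in> borel_measurable borel"
  by (rule borel_measurable_continuous_onI[OF continuous_prim])

lemma prim_bounded:
  assumes "integrable (dt T) h"
  shows "\<bar>prim T h t\<bar> \<le> (\<integral>s. \<bar>h s\<bar> \<partial>dt T)"
  using prim_abs_le[OF assms, of t] prim_le_total(1)[of T "\<lambda>s. \<bar>h s\<bar>" t] assms by simp

lemma time_integrable_bounded:
  fixes f :: "real \<Rightarrow> real"
  assumes "f \<in> borel_measurable (dt T)" "\<And>s. 0 < s \<Longrightarrow> s < T \<Longrightarrow> \<bar>f s\<bar> \<le> B"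
  shows "integrable (dt T) f"
  using assms by (intro time.integrable_const_bound[where B = B]) (auto intro!: AE_I2)

lemma time_integrable_mult_bounded:
  fixes f h :: "real \<Rightarrow> real"
  assumes "integrable (dt T) h" "f \<in> borel_measurable (dt T)"
    "\<And>s. 0 < s \<Longrightarrow> s < T \<Longrightarrow> \<bar>f s\<bar> \<le> B"
  shows "integrable (dt T) (\<lambda>s. f s * h s)"
proof (rule Bochner_Integration.integrable_bound)
  show "integrable (dt T) (\<lambda>s. B * h s)" using assms by simp
  show "(\<lambda>s. f s * h s) \<in> borel_measurable (dt T)" using assms by measurable
  show "AE x in dt T. norm (f x * h x) \<le> norm (B * h x)"
    using assms(3) by (intro AE_I2) (force simp: abs_mult intro!: mult_right_mono)
qed

lemma prim_FTC:
  assumes d: "\<And>s. (f has_real_derivative f' s) (at s)" and c: "continuous_on UNIV f'"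
    and t: "0 \<le> t" "t \<le> T"
  shows "prim T f' t = f t - f 0"
proof -
  have "prim T f' t = (\<integral>s. indicator {0<..<T} s * (indicator {..t} s * f' s) \<partial>lborel)"
    unfolding prim_def time_leb_def by (subst integral_restrict_space) auto
  also have "\<dots> = (\<integral>s. f' s * indicator {0..t} s \<partial>lborel)"
  proof (rule integral_cong_AE)
    show "AE s in lborel. indicator {0<..<T} s * (indicator {..t} s * f' s) = f' s * indicator {0..t} s"
      using AE_lborel_singleton[of 0] AE_lborel_singleton[of T]
      by eventually_elim (use t in \<open>auto simp: indicator_def\<close>)
    have "f' \<in> borel_measurable borel" by (rule borel_measurable_continuous_onI[OF c])
    then show "(\<lambda>s. indicator {0<..<T} s * (indicator {..t} s * f' s)) \<in> borel_measurable lborel"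
      "(\<lambda>s. f' s * indicator {0..t} s) \<in> borel_measurable lborel" by measurable
  qed
  also have "\<dots> = f t - f 0"
    using c d t by (intro integral_FTC_Icc_real)
      (auto simp: continuous_on_eq_continuous_within)
  finally show ?thesis .
qed

lemma (in pair_sigma_finite) integrable_pair_mult:
  fixes a :: "'a \<Rightarrow> real" and b :: "'b \<Rightarrow> real"
  assumes a: "integrable M1 a" and b: "integrable M2 b"
  shows "integrable (M1 \<Otimes>\<^sub>M M2) (\<lambda>(x, y). a x * b y)"
proof (rule Fubini_integrable)
  have [measurable]: "a \<in> borel_measurable M1" "b \<in> borel_measurable M2"
    using a b by auto
  show "(\<lambda>(x, y). a x * b y) \<in> borel_measurable (M1 \<Otimes>\<^sub>M M2)" by measurable
qed (use a b in \<open>auto simp: abs_mult\<close>)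

text \<open>Integration by parts for merely integrable functions: the product is a double integral
  over a square, which Fubini's theorem splits along the diagonal.\<close>

lemma prim_mult:
  assumes h: "integrable (dt T) h" and q: "integrable (dt T) q"
  shows "prim T h t * prim T q t = prim T (\<lambda>s. h s * prim T q s + prim T h s * q s) t"
proof -
  let ?M = "dt T"
  interpret P: pair_sigma_finite ?M ?M by standard
  let ?h = "\<lambda>s. indicator {..t} s * h s" and ?q = "\<lambda>s. indicator {..t} s * q s"
  let ?F = "\<lambda>(s, r). ?h s * ?q r"
  have ih: "integrable ?M ?h" and iq: "integrable ?M ?q" using h q by (auto intro: prim_integrable)
  have [measurable]: "h \<in> borel_measurable ?M" "q \<in> borel_measurable ?M" using h q by auto
  have [measurable]: "(\<lambda>x. x) \<in> borel_measurable ?M"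
    by (intro borel_measurable_time_leb) simp
  have F: "integrable (?M \<Otimes>\<^sub>M ?M) ?F"
    by (rule P.integrable_pair_mult[OF ih iq])
  \<comment> \<open>The closed triangle below the diagonal and its complement. The diagonal itself
    is counted in \<open>?L\<close>, which costs an almost-everywhere argument when
    \<open>?U\<close> is integrated in s.\<close>
  let ?L = "\<lambda>(s, r). if r \<le> s then ?h s * ?q r else 0" and ?U = "\<lambda>(s, r). if r \<le> s then 0 else ?h s * ?q r"
  have m: "?L \<in> borel_measurable (?M \<Otimes>\<^sub>M ?M)" "?U \<in> borel_measurable (?M \<Otimes>\<^sub>M ?M)"
    by measurable
  have L: "integrable (?M \<Otimes>\<^sub>M ?M) ?L" and U: "integrable (?M \<Otimes>\<^sub>M ?M) ?U"
    by (rule Bochner_Integration.integrable_bound[OF F]; use m in \<open>auto intro!: AE_I2\<close>)+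
  have bq: "\<bar>prim T q s\<bar> \<le> (\<integral>s. \<bar>q s\<bar> \<partial>?M)" and bh: "\<bar>prim T h s\<bar> \<le> (\<integral>s. \<bar>h s\<bar> \<partial>?M)" for s
    using prim_bounded h q by auto
  have mp: "prim T q \<in> borel_measurable ?M" "prim T h \<in> borel_measurable ?M"
    using h q by (auto intro!: borel_measurable_time_leb prim_measurable)
  have i1: "integrable ?M (\<lambda>s. h s * prim T q s)"
    using time_integrable_mult_bounded[OF h mp(1) bq] by (simp add: mult.commute)
  have i2: "integrable ?M (\<lambda>s. prim T h s * q s)"
    using time_integrable_mult_bounded[OF q mp(2) bh] by simp
  have "prim T h t * prim T q t = (\<integral>s. (\<integral>r. ?F (s, r) \<partial>?M) \<partial>?M)"
    by (simp add: prim_def)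
  also have "\<dots> = integral\<^sup>L (?M \<Otimes>\<^sub>M ?M) ?F"
    by (rule P.integral_fst'[OF F])
  also have "\<dots> = integral\<^sup>L (?M \<Otimes>\<^sub>M ?M) (\<lambda>z. ?L z + ?U z)"
    by (intro Bochner_Integration.integral_cong) auto
  also have "\<dots> = integral\<^sup>L (?M \<Otimes>\<^sub>M ?M) ?L + integral\<^sup>L (?M \<Otimes>\<^sub>M ?M) ?U"
    using L U by simp
  also have "integral\<^sup>L (?M \<Otimes>\<^sub>M ?M) ?L = (\<integral>s. (\<integral>r. ?L (s, r) \<partial>?M) \<partial>?M)"
    by (rule P.integral_fst'[OF L, symmetric])
  also have "\<dots> = prim T (\<lambda>s. h s * prim T q s) t"
    unfolding prim_def
  proof (rule Bochner_Integration.integral_cong[OF refl])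
    fix s
    have "(\<integral>r. ?L (s, r) \<partial>?M) = (\<integral>r. ?h s * (indicator {..s} r * q r) \<partial>?M)"
      by (rule Bochner_Integration.integral_cong) (auto simp: indicator_def)
    then show "(\<integral>r. ?L (s, r) \<partial>?M) = indicator {..t} s * (h s * (\<integral>r. indicator {..s} r * q r \<partial>?M))"
      by (simp add: mult.assoc)
  qed
  also have "integral\<^sup>L (?M \<Otimes>\<^sub>M ?M) ?U = (\<integral>r. (\<integral>s. ?U (s, r) \<partial>?M) \<partial>?M)"
    using P.integral_snd[of "\<lambda>s r. ?U (s, r)"] U by simp
  also have "\<dots> = prim T (\<lambda>s. prim T h s * q s) t"
    unfolding prim_def
  proof (rule Bochner_Integration.integral_cong[OF refl])
    fix r
    have "(\<integral>s. ?U (s, r) \<partial>?M) = (\<integral>s. ?q r * (indicator {..r} s * h s) \<partial>?M)"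
    proof (rule integral_cong_AE)
      show "AE s in ?M. ?U (s, r) = ?q r * (indicator {..r} s * h s)"
        using AE_time_neq[of r T] by eventually_elim (auto simp: indicator_def)
      show "(\<lambda>s. ?U (s, r)) \<in> borel_measurable ?M" "(\<lambda>s. ?q r * (indicator {..r} s * h s)) \<in> borel_measurable ?M"
        unfolding prod.case by measurable
    qed
    then show "(\<integral>s. ?U (s, r) \<partial>?M) = indicator {..t} r * ((\<integral>s. indicator {..r} s * h s \<partial>?M) * q r)"
      by simp
  qed
  also have "prim T (\<lambda>s. h s * prim T q s) t + prim T (\<lambda>s. prim T h s * q s) t
      = prim T (\<lambda>s. h s * prim T q s + prim T h s * q s) t"
    by (rule prim_add[OF i1 i2, symmetric])
  finally show ?thesis .
qed

text \<open>The form in which squares of modes are differentiated: both factors are known only as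
  initial value plus primitive of an integrable function, and only on [0,T].\<close>

lemma prim_product_rule:
  assumes h: "integrable (dt T) h" and q: "integrable (dt T) q"
    and y: "\<And>s. s \<in> {0..T} \<Longrightarrow> y s = y0 + prim T h s" and z: "\<And>s. s \<in> {0..T} \<Longrightarrow> z s = z0 + prim T q s"
    and t: "t \<in> {0..T}"
  shows "y t * z t = y0 * z0 + prim T (\<lambda>s. h s * z s + y s * q s) t"
    and "integrable (dt T) (\<lambda>s. h s * z s + y s * q s)"
proof -
  let ?M = "dt T"
  have bq: "\<bar>prim T q s\<bar> \<le> (\<integral>s. \<bar>q s\<bar> \<partial>?M)" and bh: "\<bar>prim T h s\<bar> \<le> (\<integral>s. \<bar>h s\<bar> \<partial>?M)" for s
    using prim_bounded h q by auto
  have mp: "prim T q \<in> borel_measurable ?M" "prim T h \<in> borel_measurable ?M"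
    using h q by (auto intro!: borel_measurable_time_leb prim_measurable)
  have i: "integrable ?M (\<lambda>s. h s * prim T q s)" "integrable ?M (\<lambda>s. prim T h s * q s)"
    using time_integrable_mult_bounded[OF h mp(1) bq] time_integrable_mult_bounded[OF q mp(2) bh]
    by (simp_all add: mult.commute)
  have eq: "h s * z s + y s * q s = (h s * prim T q s + prim T h s * q s) + (z0 * h s + y0 * q s)"
    if "s \<in> {0..T}" for s
    using y[OF that] z[OF that] by (simp add: algebra_simps)
  have "prim T (\<lambda>s. h s * z s + y s * q s) t
      = prim T (\<lambda>s. (h s * prim T q s + prim T h s * q s) + (z0 * h s + y0 * q s)) t"
    using eq by (intro prim_cong) auto
  also have "\<dots> = prim T h t * prim T q t + (z0 * prim T h t + y0 * prim T q t)"
    using h q i by (subst prim_add) (auto simp: prim_mult prim_add prim_cmult)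
  finally show "y t * z t = y0 * z0 + prim T (\<lambda>s. h s * z s + y s * q s) t"
    using y[OF t] z[OF t] by (simp add: algebra_simps)
  have "integrable ?M (\<lambda>s. (h s * prim T q s + prim T h s * q s) + (z0 * h s + y0 * q s))"
    using h q i by auto
  moreover have "integrable ?M (\<lambda>s. h s * z s + y s * q s) \<longleftrightarrow>
      integrable ?M (\<lambda>s. (h s * prim T q s + prim T h s * q s) + (z0 * h s + y0 * q s))"
    by (rule Bochner_Integration.integrable_cong) (auto simp: eq)
  ultimately show "integrable ?M (\<lambda>s. h s * z s + y s * q s)" by simp
qed

text \<open>The integrating factor \<open>exp (- C * s)\<close> is applied to the primitive of
  \<open>E\<close>, not to \<open>E\<close>, so that \<open>E\<close> may be merely integrable.
  Integrating the resulting inequality bounds the primitive, and the hypothesis then bounds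
  \<open>E\<close> itself.\<close>

lemma Gronwall_prim:
  assumes E: "integrable (dt T) E" and C: "C > 0"
    and le: "\<And>t. t \<in> {0..T} \<Longrightarrow> E t \<le> K + C * prim T E t" and t: "t \<in> {0..T}"
  shows "E t \<le> K * exp (C * t)"
proof -
  define e where "e s = exp (- C * s)" for s
  have e': "(e has_real_derivative (- C * e s)) (at s)" for s
    unfolding e_def by (auto intro!: derivative_eq_intros)
  have ce: "continuous_on UNIV e" unfolding e_def by (intro continuous_intros)
  then have ce': "continuous_on UNIV (\<lambda>s. - C * e s)" by (intro continuous_intros)
  have be: "\<bar>e s\<bar> \<le> 1" if "0 < s" for s using that C by (simp add: e_def)
  have me: "e \<in> borel_measurable (dt T)"
    by (intro borel_measurable_time_leb borel_measurable_continuous_onI ce)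
  have ie: "integrable (dt T) e"
    using me be by (rule time_integrable_bounded)
  then have ie': "integrable (dt T) (\<lambda>s. - C * e s)" by simp
  have e_eq: "e s = 1 + prim T (\<lambda>s. - C * e s) s" if "s \<in> {0..T}" for s
    using prim_FTC[OF e' ce', of s T] that by (simp add: e_def)
  have P: "e t * prim T E t = 1 * 0 + prim T (\<lambda>s. (- C * e s) * prim T E s + e s * E s) t"
    by (rule prim_product_rule[OF ie' E e_eq _ t]) auto
  have iP: "integrable (dt T) (\<lambda>s. (- C * e s) * prim T E s + e s * E s)"
    by (rule prim_product_rule[OF ie' E e_eq _ t, where z = "prim T E" and ?z0.0 = 0]) auto
  have "e t * prim T E t \<le> prim T (\<lambda>s. K * e s) t"
    unfolding P mult_zero_right add_0
  proof (rule prim_mono[OF iP])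
    show "integrable (dt T) (\<lambda>s. K * e s)" using ie by simp
    fix s assume "0 < s" "s < T"
    then have "e s * (E s - C * prim T E s) \<le> e s * K"
      using le[of s] by (intro mult_left_mono) (auto simp: e_def)
    then show "- C * e s * prim T E s + e s * E s \<le> K * e s"
      by (simp add: algebra_simps)
  qed
  also have "prim T (\<lambda>s. K * e s) t = (K / C) * (1 - e t)"
    using e_eq[OF t] C by (simp add: prim_cmult[of T "-C", simplified] prim_cmult)
  finally have "C * (e t * prim T E t) \<le> K * (1 - e t)"
    using C by (simp add: field_simps)
  then have "(C * prim T E t) * e t \<le> (K * (exp (C * t) - 1)) * e t"
    using C by (simp add: e_def algebra_simps flip: exp_add)
  then have "C * prim T E t \<le> K * (exp (C * t) - 1)"
    by (simp add: e_def)
  with le[OF t] show ?thesis by (simp add: algebra_simps)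
qed

section \<open>Finite linear systems\<close>

text \<open>The Picard iteration as a series: each term is the integral operator applied to the
  previous one. Working with the integral equation allows an inhomogeneity that is only measurable
  and bounded.\<close>

lemma linear_system_exists:
  fixes G :: "'i \<Rightarrow> real \<Rightarrow> real" and M :: "'i \<Rightarrow> 'i \<Rightarrow> real"
  assumes I: "finite I"
    and Gm: "\<And>i. i \<in> I \<Longrightarrow> G i \<in> borel_measurable borel"
    and Gb: "\<And>i t. i \<in> I \<Longrightarrow> \<bar>G i t\<bar> \<le> B"
  shows "\<exists>y B'. (\<forall>i. y i \<in> borel_measurable borel) \<and> (\<forall>i\<in>I. \<forall>t\<in>{0..T}. \<bar>y i t\<bar> \<le> B') \<and>
    (\<forall>i\<in>I. \<forall>t\<in>{0..T}. y i t = G i t + prim T (\<lambda>s. \<Sum>j\<in>I. M i j * y j s) t)"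
proof -
  \<comment> \<open>The absolute value keeps the majorants nonnegative even for an empty index set,
    where \<open>B\<close> may be negative.\<close>
  define B0 where "B0 = \<bar>B\<bar>"
  define C where "C = (\<Sum>i\<in>I. \<Sum>j\<in>I. \<bar>M i j\<bar>)"
  have C0: "0 \<le> C" unfolding C_def by (intro sum_nonneg) auto
  define Z where "Z = rec_nat (\<lambda>i t. if i \<in> I then G i t else 0)
    (\<lambda>_ z i t. if i \<in> I then prim T (\<lambda>s. \<Sum>j\<in>I. M i j * z j s) t else 0)"
  have Z0: "Z 0 i t = (if i \<in> I then G i t else 0)"
    and ZS: "Z (Suc m) i t = (if i \<in> I then prim T (\<lambda>s. \<Sum>j\<in>I. M i j * Z m j s) t else 0)" for m i t
    by (simp_all add: Z_def)
  \<comment> \<open>The terms of \<open>B0 * exp (C * t)\<close>: the derivative of the next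
    majorant is C times the present one, which is the induction step for the bound on the
    terms.\<close>
  define b where "b m t = B0 * (C * t) ^ m / fact m" for m t
  have b': "(b (Suc m) has_real_derivative C * b m t) (at t)" for m t
  proof -
    have "(b (Suc m) has_real_derivative B0 * (real (Suc m) * (C * t) ^ m * C) / fact (Suc m)) (at t)"
      unfolding b_def by (rule derivative_eq_intros refl | simp)+
    moreover have "B0 * (real (Suc m) * (C * t) ^ m * C) / fact (Suc m) = C * b m t"
    proof -
      have "(fact (Suc m) :: real) = real (Suc m) * fact m" by simp
      then show ?thesis unfolding b_def by (simp del: fact_Suc of_nat_Suc)
    qed
    ultimately show ?thesis by simp
  qed
  have b_cont: "continuous_on UNIV (\<lambda>t. C * b m t)" for m
    unfolding b_def by (intro continuous_intros) auto
  have Mle: "(\<Sum>j\<in>I. \<bar>M i j\<bar>) \<le> C" if "i \<in> I" for i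
    unfolding C_def using member_le_sum[of i I "\<lambda>i. \<Sum>j\<in>I. \<bar>M i j\<bar>"] that I by (auto intro: sum_nonneg)
  have main: "(\<forall>i. Z m i \<in> borel_measurable borel) \<and> (\<forall>i. \<forall>t\<in>{0..T}. \<bar>Z m i t\<bar> \<le> b m t)" for m
  proof (induction m)
    case 0
    have "Z 0 i \<in> borel_measurable borel" for i
      using Gm[of i] by (cases "i \<in> I") (simp_all add: Z_def)
    moreover have "\<bar>Z 0 i t\<bar> \<le> b 0 t" for i t
      using Gb[of i t] by (auto simp: Z0 b_def B0_def)
    ultimately show ?case by blast
  next
    case (Suc m)
    let ?S = "\<lambda>i s. \<Sum>j\<in>I. M i j * Z m j s"
    have Sm: "?S i \<in> borel_measurable (dt T)" for i
      using Suc by (intro borel_measurable_time_leb borel_measurable_sum borel_measurable_times) auto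
    have Sb: "\<bar>?S i s\<bar> \<le> C * b m s" if "i \<in> I" "s \<in> {0..T}" for i s
    proof -
      have "\<bar>?S i s\<bar> \<le> (\<Sum>j\<in>I. \<bar>M i j\<bar> * b m s)"
        using Suc that by (intro order_trans[OF sum_abs] sum_mono) (auto simp: abs_mult intro!: mult_left_mono)
      also have "\<dots> \<le> C * b m s"
        unfolding sum_distrib_right[symmetric] using Mle that C0
        by (intro mult_right_mono) (auto simp: b_def B0_def)
      finally show ?thesis .
    qed
    have bmono: "b m s \<le> b m T" if "s \<in> {0..T}" for s
      unfolding b_def using that C0
      by (intro divide_right_mono mult_left_mono power_mono) (auto simp: B0_def intro: mult_left_mono)
    have Si: "integrable (dt T) (?S i)" if "i \<in> I" for i
    proof (rule time_integrable_bounded[OF Sm, where B = "C * b m T"])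
      fix s assume "0 < s" "s < T"
      then show "\<bar>?S i s\<bar> \<le> C * b m T"
        using order_trans[OF Sb[OF that] mult_left_mono[OF bmono C0], of s] by auto
    qed
    have bi: "integrable (dt T) (\<lambda>s. C * b m s)"
    proof (rule time_integrable_bounded[where B = "C * b m T"])
      show "(\<lambda>s. C * b m s) \<in> borel_measurable (dt T)"
        by (intro borel_measurable_time_leb borel_measurable_continuous_onI b_cont)
      fix s assume "0 < s" "s < T"
      then show "\<bar>C * b m s\<bar> \<le> C * b m T"
        using mult_left_mono[OF bmono C0, of s] C0 by (auto simp: b_def B0_def)
    qed
    have "Z (Suc m) i \<in> borel_measurable borel" for i
      using prim_measurable[OF Si, of i] by (cases "i \<in> I") (auto simp: ZS[abs_def])
    moreover have "\<bar>Z (Suc m) i t\<bar> \<le> b (Suc m) t" if t: "t \<in> {0..T}" for i t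
    proof (cases "i \<in> I")
      case True
      have "\<bar>Z (Suc m) i t\<bar> \<le> prim T (\<lambda>s. \<bar>?S i s\<bar>) t"
        using True prim_abs_le[OF Si[OF True]] by (simp add: ZS)
      also have "\<dots> \<le> prim T (\<lambda>s. C * b m s) t"
        using Sb[OF True] Si[OF True] bi by (intro prim_mono) auto
      also have "\<dots> = b (Suc m) t - b (Suc m) 0"
        using prim_FTC[OF b' b_cont, of t T] t by auto
      finally show ?thesis by (simp add: b_def)
    next
      case False
      then show ?thesis using C0 t by (simp add: ZS b_def B0_def)
    qed
    ultimately show ?case by blast
  qed
  have Zm [measurable]: "Z m i \<in> borel_measurable borel" for m i using main by blast
  have Zb: "\<bar>Z m i t\<bar> \<le> b m T" if "t \<in> {0..T}" for m i t
  proof -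
    have "b m t \<le> b m T"
      unfolding b_def using that C0
      by (intro divide_right_mono mult_left_mono power_mono) (auto simp: B0_def intro: mult_left_mono)
    with main that show ?thesis by (meson order_trans)
  qed
  have bs: "summable (\<lambda>m. b m T)"
  proof -
    have "summable (\<lambda>m. B0 * ((C * T) ^ m /\<^sub>R fact m))"
      by (intro summable_mult summable_exp_generic)
    then show ?thesis by (simp add: b_def divide_inverse_commute mult.left_commute)
  qed
  have Zs: "summable (\<lambda>m. Z m i t)" if "t \<in> {0..T}" for i t
    using Zb[OF that] by (intro summable_comparison_test'[OF bs, of 0]) auto
  define y where "y i t = (\<Sum>m. Z m i t)" for i t
  have ym: "y i \<in> borel_measurable borel" for i
    unfolding y_def[abs_def] by measurable
  have yb: "\<bar>y i t\<bar> \<le> (\<Sum>m. b m T)" if "t \<in> {0..T}" for i t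
    unfolding y_def using Zb[OF that] bs order_trans[OF abs_ge_zero Zb[OF that]]
    by (intro order_trans[OF summable_rabs] suminf_le summable_comparison_test'[OF bs, of 0]) auto
  have eq: "y i t = G i t + prim T (\<lambda>s. \<Sum>j\<in>I. M i j * y j s) t" if i: "i \<in> I" and t: "t \<in> {0..T}" for i t
  proof -
    let ?f = "\<lambda>m s. indicator {..t} s * (\<Sum>j\<in>I. M i j * Z m j s)"
    have fb: "\<bar>?f m s\<bar> \<le> C * b m T" if "s \<in> {0..T}" for m s
    proof -
      have "\<bar>\<Sum>j\<in>I. M i j * Z m j s\<bar> \<le> (\<Sum>j\<in>I. \<bar>M i j\<bar> * b m T)"
        using Zb that by (intro order_trans[OF sum_abs] sum_mono) (auto simp: abs_mult intro!: mult_left_mono)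
      also have "\<dots> \<le> C * b m T"
        unfolding sum_distrib_right[symmetric] using Mle[OF i] C0 t
        by (intro mult_right_mono) (auto simp: b_def B0_def)
      finally show ?thesis
        using C0 t by (auto simp: indicator_def abs_mult b_def B0_def)
    qed
    have fm: "?f m \<in> borel_measurable (dt T)" for m
      by (rule borel_measurable_time_leb) measurable
    have fi: "integrable (dt T) (?f m)" for m
      by (rule time_integrable_bounded[OF fm fb]) auto
    have Cbs: "summable (\<lambda>m. C * b m T)" using bs by (rule summable_mult)
    have "(\<lambda>m. \<integral>s. ?f m s \<partial>dt T) sums (\<integral>s. (\<Sum>m. ?f m s) \<partial>dt T)"
    proof (rule sums_integral[OF fi])
      show "AE s in dt T. summable (\<lambda>m. norm (?f m s))"
      proof (rule AE_I2)
        fix s assume "s \<in> space (dt T)"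
        then show "summable (\<lambda>m. norm (?f m s))"
          using fb[of s] by (intro summable_comparison_test'[OF Cbs, of 0]) auto
      qed
      show "summable (\<lambda>m. \<integral>s. norm (?f m s) \<partial>dt T)"
      proof (rule summable_comparison_test'[of "\<lambda>m. measure (dt T) (space (dt T)) * (C * b m T)" 0])
        show "summable (\<lambda>m. measure (dt T) (space (dt T)) * (C * b m T))"
          using Cbs by (rule summable_mult)
        fix m
        have "(\<integral>s. norm (?f m s) \<partial>dt T) \<le> (\<integral>s. C * b m T \<partial>dt T)"
          using fi[of m] fb by (intro integral_mono) auto
        then show "norm (\<integral>s. norm (?f m s) \<partial>dt T) \<le> measure (dt T) (space (dt T)) * (C * b m T)"
          by simp
      qed
    qed
    moreover have "(\<integral>s. (\<Sum>m. ?f m s) \<partial>dt T) = prim T (\<lambda>s. \<Sum>j\<in>I. M i j * y j s) t"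
      unfolding prim_def
    proof (rule Bochner_Integration.integral_cong[OF refl])
      fix s assume "s \<in> space (dt T)"
      then have s: "s \<in> {0..T}" by auto
      have "(\<lambda>m. ?f m s) sums (indicator {..t} s * (\<Sum>j\<in>I. M i j * y j s))"
        unfolding y_def using Zs[OF s]
        by (intro sums_mult sums_sum summable_sums) auto
      then show "(\<Sum>m. ?f m s) = indicator {..t} s * (\<Sum>j\<in>I. M i j * y j s)"
        by (rule sums_unique[symmetric])
    qed
    ultimately have "(\<lambda>m. Z (Suc m) i t) sums prim T (\<lambda>s. \<Sum>j\<in>I. M i j * y j s) t"
      using i by (simp add: ZS prim_def)
    then have "(\<lambda>m. Z m i t) sums (prim T (\<lambda>s. \<Sum>j\<in>I. M i j * y j s) t + Z 0 i t)"
      by (rule sums_Suc)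
    then show ?thesis
      using i by (simp add: y_def sums_iff Z0)
  qed
  show ?thesis
    using ym yb eq by blast
qed

section \<open>Smooth functions and test functions\<close>

lemma frechet_derivative_eqI:
  "(f has_derivative D) (at x) \<Longrightarrow> pd b f x = D b"
  using frechet_derivative_at by metis

lemma iter_pderiv_append: "iter_pderiv (bs @ cs) f = iter_pderiv bs (iter_pderiv cs f)"
  by (induction bs) auto

text \<open>Proving smoothness of a concrete function amounts to finding a family of differentiable
  functions around it that is stable under basis derivatives.\<close>

lemma smooth_fun_coinduct:
  assumes f: "f \<in> S" and d: "\<And>g x. g \<in> S \<Longrightarrow> g differentiable (at x)"
    and c: "\<And>g b. g \<in> S \<Longrightarrow> b \<in> Basis \<Longrightarrow> pd b g \<in> S"
  shows "smooth_fun f"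
proof -
  have "iter_pderiv bs f \<in> S" if "set bs \<subseteq> Basis" for bs
    using that by (induction bs) (auto simp: f c)
  then show ?thesis
    unfolding smooth_fun_def differentiable_on_def
    using d differentiable_at_withinI by blast
qed

lemma smooth_fun_differentiable: "smooth_fun f \<Longrightarrow> f differentiable (at x)"
  unfolding smooth_fun_def differentiable_on_def by (auto dest: spec[of _ "[]"])

lemma smooth_fun_has_derivative:
  "smooth_fun f \<Longrightarrow> (f has_derivative frechet_derivative f (at x)) (at x)"
  using smooth_fun_differentiable frechet_derivative_works by blast

lemma smooth_fun_iter_pderiv:
  assumes "smooth_fun f" "set bs \<subseteq> Basis"
  shows "smooth_fun (iter_pderiv bs f)"
  unfolding smooth_fun_def
proof (intro allI impI)
  fix cs :: "'a list" assume "set cs \<subseteq> Basis"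
  then have "iter_pderiv (cs @ bs) f differentiable_on UNIV"
    using assms unfolding smooth_fun_def by (metis Un_subset_iff set_append)
  then show "iter_pderiv cs (iter_pderiv bs f) differentiable_on UNIV"
    by (simp add: iter_pderiv_append)
qed

lemma smooth_fun_pderiv:
  "smooth_fun f \<Longrightarrow> b \<in> Basis \<Longrightarrow> smooth_fun (pd b f)"
  using smooth_fun_iter_pderiv[of f "[b]"] by simp

lemma smooth_fun_continuous: "smooth_fun f \<Longrightarrow> continuous_on S f"
  by (meson continuous_on_eq_continuous_within continuous_on_subset differentiable_imp_continuous_within
      smooth_fun_differentiable subset_UNIV)

lemma smooth_fun_measurable: "smooth_fun f \<Longrightarrow> f \<in> borel_measurable borel"
  by (intro borel_measurable_continuous_onI smooth_fun_continuous)

lemma smooth_fun_const [simp]: "smooth_fun (\<lambda>x. c)"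
  by (rule smooth_fun_coinduct[where S = "range (\<lambda>c x. c)"]) (auto simp: frechet_derivative_const)

text \<open>Leibniz's rule turns one product into a sum of two, so the stable family for products
  has to be the whole algebra generated by smooth functions.\<close>

inductive_set smooth_algebra :: "('e::euclidean_space \<Rightarrow> real) set" where
  base: "smooth_fun f \<Longrightarrow> f \<in> smooth_algebra"
| add: "f \<in> smooth_algebra \<Longrightarrow> g \<in> smooth_algebra \<Longrightarrow> (\<lambda>x. f x + g x) \<in> smooth_algebra"
| mult: "f \<in> smooth_algebra \<Longrightarrow> g \<in> smooth_algebra \<Longrightarrow> (\<lambda>x. f x * g x) \<in> smooth_algebra"

lemma smooth_algebra_deriv:
  assumes "f \<in> smooth_algebra"
  shows "(\<forall>x. f differentiable (at x)) \<and> (\<forall>b\<in>Basis. pd b f \<in> smooth_algebra)"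
  using assms
proof induction
  case (base f)
  then show ?case
    by (auto intro: smooth_algebra.base smooth_fun_pderiv smooth_fun_differentiable)
next
  case (add f g)
  have "((\<lambda>x. f x + g x) has_derivative (\<lambda>h. pd h f x + pd h g x)) (at x)" for x
    using add.IH by (intro has_derivative_add) (auto simp: frechet_derivative_works[symmetric])
  then have "(\<lambda>x. f x + g x) differentiable (at x)"
    and "pd b (\<lambda>x. f x + g x) x = pd b f x + pd b g x" for x b
    using frechet_derivative_eqI by (blast intro: differentiableI, fast)
  then show ?case
    using add.IH by (auto intro!: smooth_algebra.add)
next
  case (mult f g)
  have D: "((\<lambda>x. f x * g x) has_derivative (\<lambda>h. f x * pd h g x + pd h f x * g x)) (at x)" for x
    using mult.IH by (intro has_derivative_mult) (auto simp: frechet_derivative_works[symmetric])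
  have "(\<lambda>x. f x * g x) differentiable (at x)" for x
    using D by (rule differentiableI)
  moreover have "(\<lambda>x. pd b (\<lambda>x. f x * g x) x) \<in> smooth_algebra" if "b \<in> Basis" for b
  proof -
    have "(\<lambda>x. f x * pd b g x) \<in> smooth_algebra"
      by (rule smooth_algebra.mult[OF mult.hyps(1)]) (use mult.IH that in blast)
    moreover have "(\<lambda>x. pd b f x * g x) \<in> smooth_algebra"
      by (rule smooth_algebra.mult[OF _ mult.hyps(2)]) (use mult.IH that in blast)
    ultimately show ?thesis
      unfolding frechet_derivative_eqI[OF D] by (rule smooth_algebra.add)
  qed
  ultimately show ?case by blast
qed

lemma smooth_fun_algebra: "f \<in> smooth_algebra \<Longrightarrow> smooth_fun f"
  using smooth_algebra_deriv by (intro smooth_fun_coinduct[where S = smooth_algebra]) auto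

lemma smooth_fun_add: "smooth_fun f \<Longrightarrow> smooth_fun g \<Longrightarrow> smooth_fun (\<lambda>x. f x + g x)"
  by (rule smooth_fun_algebra, rule smooth_algebra.add; rule smooth_algebra.base)

lemma smooth_fun_mult: "smooth_fun f \<Longrightarrow> smooth_fun g \<Longrightarrow> smooth_fun (\<lambda>x. f x * g x)"
  by (rule smooth_fun_algebra, rule smooth_algebra.mult; rule smooth_algebra.base)

lemma smooth_fun_cmult: "smooth_fun f \<Longrightarrow> smooth_fun (\<lambda>x. c * f x)"
  using smooth_fun_mult[of "\<lambda>x. c" f] by simp

lemma smooth_fun_diff: "smooth_fun f \<Longrightarrow> smooth_fun g \<Longrightarrow> smooth_fun (\<lambda>x. f x - g x)"
  using smooth_fun_add[of f "\<lambda>x. (-1) * g x"] smooth_fun_cmult[of g "-1"] by simp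

lemma frechet_derivative_smooth_mult:
  assumes "smooth_fun f" "smooth_fun g"
  shows "pd b (\<lambda>x. f x * g x) x =
    f x * pd b g x + pd b f x * g x"
  by (rule frechet_derivative_eqI[OF has_derivative_mult]) (auto intro!: smooth_fun_has_derivative assms)

text \<open>Smoothness only speaks of derivatives along basis vectors, whence the condition that L
  sends each basis vector to a multiple of one. Projections, time slices, shifts and reflections are
  of this kind. The scalar in \<open>?S\<close> absorbs the multiples that accumulate.\<close>

lemma smooth_fun_compose_affine:
  fixes f :: "'b::euclidean_space \<Rightarrow> real" and L :: "'a::euclidean_space \<Rightarrow> 'b"
  assumes f: "smooth_fun f" and L: "bounded_linear L"
    and B: "\<And>b. b \<in> Basis \<Longrightarrow> \<exists>r. \<exists>e\<in>Basis. L b = r *\<^sub>R e"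
  shows "smooth_fun (\<lambda>z. f (a + L z))" and "pd c (\<lambda>z. f (a + L z)) z = pd (L c) f (a + L z)"
proof -
  have D: "((\<lambda>z. k * f (a + L z)) has_derivative (\<lambda>h. k * pd (L h) f (a + L z))) (at z)" if f: "smooth_fun f" for f k z
  proof -
    have "((\<lambda>z. a + L z) has_derivative L) (at z)"
      using bounded_linear_imp_has_derivative[OF L] by (auto intro!: derivative_eq_intros)
    from has_derivative_compose[OF this smooth_fun_has_derivative[OF f]]
    show ?thesis by (intro has_derivative_mult_right)
  qed
  show "pd c (\<lambda>z. f (a + L z)) z = pd (L c) f (a + L z)"
    using frechet_derivative_eqI[OF D[OF f, of 1 z], of c] by simp
  let ?S = "{\<lambda>z. k * f (a + L z) |k f. smooth_fun f}"
  show "smooth_fun (\<lambda>z. f (a + L z))"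
  proof (rule smooth_fun_coinduct[where S = ?S])
    show "(\<lambda>z. f (a + L z)) \<in> ?S" using f by (force intro: exI[of _ 1])
    fix g assume "g \<in> ?S"
    then obtain k f where g: "g = (\<lambda>z. k * f (a + L z))" and f: "smooth_fun f" by blast
    show "g differentiable (at z)" for z unfolding g by (rule differentiableI[OF D[OF f]])
    fix b :: 'a assume "b \<in> Basis"
    then obtain r e where e: "e \<in> Basis" "L b = r *\<^sub>R e" using B by blast
    have "pd b g = (\<lambda>z. (k * r) * pd e f (a + L z))"
      unfolding g frechet_derivative_eqI[OF D[OF f]] e(2)
      by (simp add: linear_scale[OF linear_frechet_derivative[OF smooth_fun_differentiable[OF f]]] mult.assoc)
    with smooth_fun_pderiv[OF f e(1)] show "pd b g \<in> ?S"
      by (intro CollectI exI[of _ "k * r"] exI[of _ "pd e f"] conjI)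
  qed
qed

lemma smooth_fun_compose_fst:
  fixes f :: "'a::euclidean_space \<Rightarrow> real"
  assumes "smooth_fun f"
  shows "smooth_fun (\<lambda>z :: 'a \<times> 'b::euclidean_space. f (fst z))"
    and "pd c (\<lambda>z :: 'a \<times> 'b. f (fst z)) z = pd (fst c) f (fst z)"
proof -
  obtain e :: 'a where e: "e \<in> Basis" using nonempty_Basis by blast
  have "\<exists>r. \<exists>e\<in>Basis. fst b = r *\<^sub>R e" if "b \<in> Basis" for b :: "'a \<times> 'b"
    using that e unfolding Basis_prod_def by (force intro: exI[of _ 1] exI[of _ 0])
  from smooth_fun_compose_affine[OF assms bounded_linear_fst this, of 0]
  show "smooth_fun (\<lambda>z :: 'a \<times> 'b. f (fst z))" "pd c (\<lambda>z :: 'a \<times> 'b. f (fst z)) z = pd (fst c) f (fst z)"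
    by simp_all
qed

lemma smooth_fun_compose_snd:
  fixes f :: "'b::euclidean_space \<Rightarrow> real"
  assumes "smooth_fun f"
  shows "smooth_fun (\<lambda>z :: 'a::euclidean_space \<times> 'b. f (snd z))"
    and "pd c (\<lambda>z :: 'a \<times> 'b. f (snd z)) z = pd (snd c) f (snd z)"
proof -
  obtain e :: 'b where e: "e \<in> Basis" using nonempty_Basis by blast
  have "\<exists>r. \<exists>e\<in>Basis. snd b = r *\<^sub>R e" if "b \<in> Basis" for b :: "'a \<times> 'b"
    using that e unfolding Basis_prod_def by (force intro: exI[of _ 1] exI[of _ 0])
  from smooth_fun_compose_affine[OF assms bounded_linear_snd this, of 0]
  show "smooth_fun (\<lambda>z :: 'a \<times> 'b. f (snd z))" "pd c (\<lambda>z :: 'a \<times> 'b. f (snd z)) z = pd (snd c) f (snd z)"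
    by simp_all
qed

lemma smooth_fun_slice:
  fixes f :: "'a::euclidean_space \<times> 'b::euclidean_space \<Rightarrow> real"
  assumes "smooth_fun f"
  shows "smooth_fun (slice f t)" and "pd b (slice f t) x = pd (0, b) f (t, x)"
proof -
  have L: "bounded_linear (\<lambda>x :: 'b. (0 :: 'a, x))" by (intro bounded_linear_Pair bounded_linear_zero bounded_linear_ident)
  have "\<exists>r. \<exists>e\<in>Basis. (0 :: 'a, b) = r *\<^sub>R e" if "b \<in> Basis" for b :: 'b
    using that by (intro exI[of _ 1] bexI[of _ "(0, b)"]) (auto simp: Basis_prod_def)
  from smooth_fun_compose_affine[OF assms L this, of "(t, 0)"]
  show "smooth_fun (slice f t)" "pd b (slice f t) x = pd (0, b) f (t, x)" by simp_all
qed

lemma smooth_fun_line_derivative: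
  assumes f: "smooth_fun f"
  shows "((\<lambda>s. f (z + s *\<^sub>R a)) has_real_derivative pd a f (z + s *\<^sub>R a)) (at s)"
proof -
  have "((\<lambda>s. z + s *\<^sub>R a) has_derivative (\<lambda>t. t *\<^sub>R a)) (at s)"
    by (auto intro!: derivative_eq_intros)
  from has_derivative_compose[OF this smooth_fun_has_derivative[OF f]]
  have "((\<lambda>s. f (z + s *\<^sub>R a)) has_derivative (\<lambda>t. pd (t *\<^sub>R a) f (z + s *\<^sub>R a))) (at s)" .
  moreover have "(\<lambda>t. pd (t *\<^sub>R a) f (z + s *\<^sub>R a)) = (*) (pd a f (z + s *\<^sub>R a))"
    using linear_scale[OF linear_frechet_derivative[OF smooth_fun_differentiable[OF f]]]
    by (auto simp: mult.commute)
  ultimately show ?thesis by (simp add: has_field_derivative_def)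
qed

text \<open>Both mixed derivatives are the limit of the symmetric second difference quotient.\<close>

lemma second_difference_tendsto:
  fixes f :: "'e::euclidean_space \<Rightarrow> real"
  assumes f: "smooth_fun f" and a: "a \<in> Basis"
  shows "((\<lambda>h. (f (x + h *\<^sub>R a + h *\<^sub>R b) - f (x + h *\<^sub>R a) - f (x + h *\<^sub>R b) + f x) / h\<^sup>2)
    \<longlongrightarrow> pd b (\<lambda>y. frechet_derivative f (at y) a) x) (at_right 0)"
proof -
  define p where "p y = pd a f y" for y
  define L where "L = frechet_derivative p (at x)"
  have "smooth_fun p" unfolding p_def using smooth_fun_pderiv[OF f a] .
  then have dp: "(p has_derivative L) (at x)"
    unfolding L_def by (rule smooth_fun_has_derivative)
  then have lin: "linear L" by (rule has_derivative_linear)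
  have est: "\<exists>d>0. \<forall>h. 0 < h \<and> h < d \<longrightarrow>
      \<bar>(f (x + h *\<^sub>R a + h *\<^sub>R b) - f (x + h *\<^sub>R a) - f (x + h *\<^sub>R b) + f x) / h\<^sup>2 - L b\<bar> \<le> e * (2 * norm a + norm b)"
    if "e > 0" for e
  proof -
    obtain d where d: "d > 0" "\<And>y. norm (y - x) < d \<Longrightarrow> norm (p y - p x - L (y - x)) \<le> e * norm (y - x)"
      using dp \<open>e > 0\<close> unfolding has_derivative_at_alt by blast
    \<comment> \<open>Chosen so that \<open>h * K < d\<close> puts both evaluation points within d
      of x; the summand 1 makes it positive.\<close>
    define K where "K = norm a + norm b + 1"
    have K: "K > 0" by (simp add: K_def add_nonneg_pos)
    show ?thesis
    proof (intro exI[of _ "d / K"] conjI allI impI)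
      show "0 < d / K" using d K by simp
      fix h assume h: "0 < h \<and> h < d / K"
      then have hK: "h * K < d" using K by (simp add: pos_less_divide_eq)
      \<comment> \<open>The difference in direction b is treated by the mean value theorem in
        direction a. Only first-order differentiability of the derivative p at x is then needed to
        expand the two values of p.\<close>
      define g where "g s = f ((x + h *\<^sub>R b) + s *\<^sub>R a) - f (x + s *\<^sub>R a)" for s
      have g': "(g has_real_derivative (p ((x + h *\<^sub>R b) + s *\<^sub>R a) - p (x + s *\<^sub>R a))) (at s)" for s
      proof -
        have 1: "((\<lambda>s. f (z + s *\<^sub>R a)) has_real_derivative p (z + s *\<^sub>R a)) (at s)" for z
          unfolding p_def by (rule smooth_fun_line_derivative[OF f])
        show ?thesis unfolding g_def by (intro DERIV_diff 1)
      qed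
      obtain th where th: "0 < th" "th < h"
        "g h - g 0 = (h - 0) * (p ((x + h *\<^sub>R b) + th *\<^sub>R a) - p (x + th *\<^sub>R a))"
        using MVT2[of 0 h g "\<lambda>s. p ((x + h *\<^sub>R b) + s *\<^sub>R a) - p (x + s *\<^sub>R a)"] h g' by auto
      let ?u = "h *\<^sub>R b + th *\<^sub>R a" and ?v = "th *\<^sub>R a"
      have nv: "norm ?v \<le> h * norm a" using th by (simp add: mult_right_mono)
      have nu: "norm ?u \<le> h * (norm a + norm b)"
        using norm_triangle_ineq[of "h *\<^sub>R b" "th *\<^sub>R a"] nv th by (simp add: distrib_left)
      have "0 \<le> h * norm b" using h by simp
      then have "h * (norm a + norm b) < d" "h * norm a < d"
        using hK h unfolding K_def distrib_left by linarith+
      then have s: "norm ?u < d" "norm ?v < d" using nu nv by linarith+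
      have "\<bar>p (x + ?u) - p x - L ?u\<bar> \<le> e * norm ?u" "\<bar>p (x + ?v) - p x - L ?v\<bar> \<le> e * norm ?v"
        using d(2)[of "x + ?u"] d(2)[of "x + ?v"] s by auto
      moreover have "L ?u = h * L b + L ?v"
        using lin by (simp add: linear_add linear_scale)
      ultimately have "\<bar>(p (x + ?u) - p (x + ?v)) - h * L b\<bar> \<le> e * norm ?u + e * norm ?v"
        by linarith
      also have "\<dots> \<le> e * (h * (norm a + norm b)) + e * (h * norm a)"
        using nu nv \<open>e > 0\<close> by (intro add_mono mult_left_mono) auto
      also have "\<dots> = h * (e * (2 * norm a + norm b))" by (simp add: algebra_simps)
      finally have B: "\<bar>(p (x + ?u) - p (x + ?v)) - h * L b\<bar> \<le> h * (e * (2 * norm a + norm b))" .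
      have "(f (x + h *\<^sub>R a + h *\<^sub>R b) - f (x + h *\<^sub>R a) - f (x + h *\<^sub>R b) + f x) / h\<^sup>2 - L b
          = (g h - g 0) / h\<^sup>2 - L b"
        by (simp add: g_def algebra_simps)
      also have "\<dots> = ((p (x + ?u) - p (x + ?v)) - h * L b) / h"
      proof -
        have "g h - g 0 = h * (p (x + ?u) - p (x + ?v))" using th(3) by (simp add: add.assoc)
        then have "(g h - g 0) / h\<^sup>2 = (p (x + ?u) - p (x + ?v)) / h"
          using h by (simp add: power2_eq_square)
        then show ?thesis using h by (simp add: diff_divide_distrib)
      qed
      finally show "\<bar>(f (x + h *\<^sub>R a + h *\<^sub>R b) - f (x + h *\<^sub>R a) - f (x + h *\<^sub>R b) + f x) / h\<^sup>2 - L b\<bar>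
          \<le> e * (2 * norm a + norm b)"
        using B h by (simp add: abs_divide pos_divide_le_eq mult.commute)
    qed
  qed
  show ?thesis
    unfolding p_def[symmetric] L_def[symmetric]
  proof (rule tendstoI)
    fix e :: real assume e: "0 < e"
    define N where "N = 2 * norm a + norm b + 1"
    have N: "N > 0" by (simp add: N_def add_nonneg_pos)
    obtain d where d: "d > 0" "\<And>h. 0 < h \<Longrightarrow> h < d \<Longrightarrow>
        \<bar>(f (x + h *\<^sub>R a + h *\<^sub>R b) - f (x + h *\<^sub>R a) - f (x + h *\<^sub>R b) + f x) / h\<^sup>2 - L b\<bar> \<le> e / N * (2 * norm a + norm b)"
      using est[of "e / N"] e N by auto
    have "e / N * (2 * norm a + norm b) < e"
      using e N by (simp add: N_def field_simps)
    then show "\<forall>\<^sub>F h in at_right 0. dist ((f (x + h *\<^sub>R a + h *\<^sub>R b) - f (x + h *\<^sub>R a) - f (x + h *\<^sub>R b) + f x) / h\<^sup>2) (L b) < e"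
      unfolding eventually_at_right_field dist_real_def using d by (intro exI[of _ d]) force
  qed
qed

lemma mixed_derivatives_commute:
  fixes f :: "'e::euclidean_space \<Rightarrow> real"
  assumes f: "smooth_fun f" and a: "a \<in> Basis" and b: "b \<in> Basis"
  shows "pd b (\<lambda>y. frechet_derivative f (at y) a) x =
    pd a (\<lambda>y. frechet_derivative f (at y) b) x"
proof (rule tendsto_unique)
  show "((\<lambda>h. (f (x + h *\<^sub>R a + h *\<^sub>R b) - f (x + h *\<^sub>R a) - f (x + h *\<^sub>R b) + f x) / h\<^sup>2)
    \<longlongrightarrow> pd b (\<lambda>y. frechet_derivative f (at y) a) x) (at_right 0)"
    by (rule second_difference_tendsto[OF f a])
  show "((\<lambda>h. (f (x + h *\<^sub>R a + h *\<^sub>R b) - f (x + h *\<^sub>R a) - f (x + h *\<^sub>R b) + f x) / h\<^sup>2)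
    \<longlongrightarrow> pd a (\<lambda>y. frechet_derivative f (at y) b) x) (at_right 0)"
    using second_difference_tendsto[OF f b, of x a] by (simp add: algebra_simps)
qed simp

subsection \<open>Periodic functions\<close>

lemma Cinf_torusI: "smooth_fun f \<Longrightarrow> periodic f \<Longrightarrow> f \<in> Cinf_torus"
  by (simp add: Cinf_torus_def)

lemma Cinf_torusD: "f \<in> Cinf_torus \<Longrightarrow> smooth_fun f" "f \<in> Cinf_torus \<Longrightarrow> periodic f"
  by (auto simp: Cinf_torus_def)

lemma Cinf_torus_const [simp]: "(\<lambda>x. c) \<in> Cinf_torus"
  by (simp add: Cinf_torus_def periodic_def)

lemma Cinf_torus_add: "f \<in> Cinf_torus \<Longrightarrow> g \<in> Cinf_torus \<Longrightarrow> (\<lambda>x. f x + g x) \<in> Cinf_torus"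
  and Cinf_torus_mult: "f \<in> Cinf_torus \<Longrightarrow> g \<in> Cinf_torus \<Longrightarrow> (\<lambda>x. f x * g x) \<in> Cinf_torus"
  and Cinf_torus_diff: "f \<in> Cinf_torus \<Longrightarrow> g \<in> Cinf_torus \<Longrightarrow> (\<lambda>x. f x - g x) \<in> Cinf_torus"
  and Cinf_torus_cmult: "f \<in> Cinf_torus \<Longrightarrow> (\<lambda>x. c * f x) \<in> Cinf_torus"
  by (auto simp: Cinf_torus_def periodic_def
      intro: smooth_fun_add smooth_fun_mult smooth_fun_diff smooth_fun_cmult)

lemma Cinf_torus_sum: "(\<And>i. i \<in> I \<Longrightarrow> f i \<in> Cinf_torus) \<Longrightarrow> (\<lambda>x. \<Sum>i\<in>I. f i x) \<in> Cinf_torus"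
  by (induction I rule: infinite_finite_induct) (auto intro: Cinf_torus_add)

lemma frechet_derivative_shift:
  fixes f :: "'a::real_normed_vector \<Rightarrow> real"
  assumes "\<And>x. f (x + a) = f x" "\<And>x. f differentiable (at x)"
  shows "frechet_derivative f (at (x + a)) = frechet_derivative f (at x)"
proof -
  have "((\<lambda>x. f (x + a)) has_derivative frechet_derivative f (at (x + a))) (at x)"
  proof (rule has_derivative_compose[where f = "\<lambda>x. x + a" and f' = "\<lambda>h. h"])
    show "((\<lambda>x. x + a) has_derivative (\<lambda>h. h)) (at x)" by (auto intro!: derivative_eq_intros)
    show "(f has_derivative frechet_derivative f (at (x + a))) (at (x + a))"
      using assms(2) frechet_derivative_works by blast
  qed
  then have "(f has_derivative frechet_derivative f (at (x + a))) (at x)"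
    using assms(1) by simp
  then show ?thesis by (rule frechet_derivative_at)
qed

lemma Cinf_torus_pderiv:
  assumes "f \<in> Cinf_torus"
  shows "pd (axis i 1) f \<in> Cinf_torus"
  using assms smooth_fun_pderiv[of f "axis i 1"] frechet_derivative_shift[of f]
  by (auto simp: Cinf_torus_def periodic_def smooth_fun_differentiable)

lemma Cinf_torus_iter: "f \<in> Cinf_torus \<Longrightarrow> iter_pderiv (space_dirs is) f \<in> Cinf_torus"
  by (induction "is") (auto simp: space_dirs_def intro: Cinf_torus_pderiv)

lemma periodic_of_int:
  fixes f :: "real^'a \<Rightarrow> real"
  assumes "periodic f"
  shows "f (x + (\<Sum>i\<in>UNIV. axis i (of_int (k i)))) = f x"
proof -
  have axis0: "axis i 0 = (0 :: real^'a)" for i by (simp add: vec_eq_iff axis_def)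
  have nat: "f (x + axis i (real m)) = f x" for x i m
  proof (induction m)
    case (Suc m)
    have "x + axis i (real (Suc m)) = (x + axis i (real m)) + axis i 1"
      by (simp add: vec_eq_iff axis_def)
    then show ?case using assms Suc unfolding periodic_def by metis
  qed (simp add: axis0)
  have int: "f (x + axis i (of_int m)) = f x" for x i and m :: int
  proof (cases m)
    case (nonneg n)
    then show ?thesis using nat by simp
  next
    case (neg n)
    have "(x + axis i (of_int m)) + axis i (real (Suc n)) = x"
      using neg by (simp add: vec_eq_iff axis_def)
    then show ?thesis using nat[of "x + axis i (of_int m)" i "Suc n"] by metis
  qed
  have "f (x + (\<Sum>i\<in>I. axis i (of_int (k i)))) = f x" if "finite I" for I x
    using that
  proof (induction I arbitrary: x)
    case (insert i I)
    then show ?case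
      using int[of "x + (\<Sum>i\<in>I. axis i (of_int (k i)))" i "k i"] by (simp add: add_ac)
  qed simp
  then show ?thesis by simp
qed

text \<open>Subtracting integer parts moves any point into the compact unit cube.\<close>

lemma Cinf_torus_bounded:
  fixes f :: "real^'d \<Rightarrow> real"
  assumes "f \<in> Cinf_torus"
  obtains B where "\<And>x. \<bar>f x\<bar> \<le> B"
proof -
  have "compact (f ` cbox 0 1)"
    by (intro compact_continuous_image smooth_fun_continuous Cinf_torusD(1) assms compact_cbox)
  then obtain B where B: "\<And>x. x \<in> cbox 0 1 \<Longrightarrow> \<bar>f x\<bar> \<le> B"
    using compact_imp_bounded bounded_iff by (metis imageI real_norm_def)
  have "\<bar>f x\<bar> \<le> B" for x
  proof -
    let ?y = "x + (\<Sum>i\<in>UNIV. axis i (of_int (- floor (x $ i))))"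
    have "?y $ i = x $ i - of_int (floor (x $ i))" for i
    proof -
      have "(\<Sum>j\<in>UNIV. axis j (of_int (- floor (x $ j)) :: real) $ i) = of_int (- floor (x $ i))"
        by (simp add: axis_def if_distrib[of "\<lambda>h. h = _"] cong: if_cong)
      then show ?thesis by simp
    qed
    then have "?y \<in> cbox 0 1"
      by (auto simp: mem_box_cart) linarith
    then show ?thesis
      using B periodic_of_int[OF Cinf_torusD(2)[OF assms], of x "\<lambda>i. - floor (x $ i)"] by metis
  qed
  with that show ?thesis by blast
qed

subsection \<open>Test functions in time\<close>

definition time_tests :: "real \<Rightarrow> (real \<Rightarrow> real) set" where
  "time_tests T = {\<psi>. smooth_fun \<psi> \<and> (\<exists>a b. 0 < a \<and> b < T \<and> (\<forall>t. t \<notin> {a..b} \<longrightarrow> \<psi> t = 0))}"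

lemma time_testsI:
  "smooth_fun \<psi> \<Longrightarrow> 0 < a \<Longrightarrow> b < T \<Longrightarrow> (\<And>t. t \<notin> {a..b} \<Longrightarrow> \<psi> t = 0) \<Longrightarrow> \<psi> \<in> time_tests T"
  unfolding time_tests_def by blast

lemma smooth_fun_has_real_derivative:
  fixes f :: "real \<Rightarrow> real"
  assumes "smooth_fun f"
  shows "(f has_real_derivative pd 1 f x) (at x)"
proof -
  have "frechet_derivative f (at x) = (*) (pd 1 f x)"
  proof
    fix r
    show "pd r f x = pd 1 f x * r"
      using linear_scale[OF linear_frechet_derivative[OF smooth_fun_differentiable[OF assms]], of x r 1]
      by simp
  qed
  then show ?thesis
    using smooth_fun_has_derivative[OF assms, of x] by (simp add: has_field_derivative_def)
qed

lemma frechet_derivative_real: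
  "(f has_real_derivative D) (at x) \<Longrightarrow> pd b f x = D * b"
  by (rule frechet_derivative_eqI) (simp add: has_field_derivative_def)

text \<open>The family containing the classical flat function \<open>exp (- \<epsilon> / x)\<close>
  (k = 0) together with the inverse powers that differentiation produces. The parameter \<epsilon>
  is sent to 0 later to approximate indicators.\<close>

definition cutoff :: "real \<Rightarrow> nat \<Rightarrow> real \<Rightarrow> real" where
  "cutoff \<epsilon> k x = (if x > 0 then inverse x ^ k * exp (- \<epsilon> * inverse x) else 0)"

lemma cutoff_tendsto_0:
  assumes "\<epsilon> > 0"
  shows "(cutoff \<epsilon> k \<longlongrightarrow> 0) (at 0)"
proof -
  have "((\<lambda>y. (\<epsilon> * y) ^ k / exp (\<epsilon> * y)) \<longlongrightarrow> 0) at_top"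
    by (rule filterlim_compose[OF tendsto_power_div_exp_0])
       (use assms in \<open>auto intro!: filterlim_tendsto_pos_mult_at_top filterlim_ident\<close>)
  then have "((\<lambda>y. inverse \<epsilon> ^ k * ((\<epsilon> * y) ^ k / exp (\<epsilon> * y))) \<longlongrightarrow> inverse \<epsilon> ^ k * 0) at_top"
    by (intro tendsto_intros)
  then have "((\<lambda>y. y ^ k * exp (- \<epsilon> * y)) \<longlongrightarrow> 0) at_top"
    using assms by (simp add: exp_minus field_simps power_mult_distrib)
  then have "((\<lambda>x. inverse x ^ k * exp (- \<epsilon> * inverse x)) \<longlongrightarrow> 0) (at_right 0)"
    by (rule filterlim_compose[OF _ filterlim_inverse_at_top_right])
  then have R: "(cutoff \<epsilon> k \<longlongrightarrow> 0) (at_right 0)"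
    by (rule Lim_transform_eventually) (auto simp: eventually_at_right_field cutoff_def intro: exI[of _ 1])
  have L: "(cutoff \<epsilon> k \<longlongrightarrow> 0) (at_left 0)"
    by (rule tendsto_eventually) (auto simp: eventually_at_left_field cutoff_def intro: exI[of _ "-1"])
  show ?thesis using R L by (simp add: filterlim_split_at_real)
qed

lemma cutoff_deriv:
  assumes e: "\<epsilon> > 0"
  shows "(cutoff \<epsilon> k has_real_derivative (- real k * cutoff \<epsilon> (Suc k) x + \<epsilon> * cutoff \<epsilon> (Suc (Suc k)) x)) (at x)"
proof -
  consider "x > 0" | "x < 0" | "x = 0" by linarith
  then show ?thesis
  proof cases
    case 1
    have "((\<lambda>x. inverse x ^ k * exp (- \<epsilon> * inverse x)) has_real_derivative
        (- real k * cutoff \<epsilon> (Suc k) x + \<epsilon> * cutoff \<epsilon> (Suc (Suc k)) x)) (at x)"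
    proof (cases k)
      case (Suc n)
      have "n = 0 \<or> inverse x ^ n = inverse x * inverse x ^ (n - Suc 0)"
        by (cases n) auto
      then show ?thesis
        using 1 Suc by (auto intro!: derivative_eq_intros simp: cutoff_def power2_eq_square algebra_simps)
    qed (use 1 in \<open>auto intro!: derivative_eq_intros simp: cutoff_def power2_eq_square algebra_simps\<close>)
    then show ?thesis
      by (rule has_field_derivative_transform_within_open[where S = "{0<..}"]) (use 1 in \<open>auto simp: cutoff_def\<close>)
  next
    case 2
    have "((\<lambda>x. 0) has_real_derivative 0) (at x)" by simp
    then have "(cutoff \<epsilon> k has_real_derivative 0) (at x)"
      by (rule has_field_derivative_transform_within_open[where S = "{..<0}"]) (use 2 in \<open>auto simp: cutoff_def\<close>)
    then show ?thesis using 2 by (simp add: cutoff_def)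
  next
    case 3
    \<comment> \<open>The difference quotient at 0 is again a member of the family, with k raised by
      one, and all members tend to 0.\<close>
    have "((\<lambda>y. (cutoff \<epsilon> k y - cutoff \<epsilon> k 0) / (y - 0)) \<longlongrightarrow> 0) (at 0)"
      by (rule Lim_transform_eventually[OF cutoff_tendsto_0[OF e, of "Suc k"]])
         (auto simp: eventually_at_filter cutoff_def divide_inverse)
    then show ?thesis
      by (simp add: 3 has_field_derivative_iff cutoff_def)
  qed
qed

inductive_set cutoff_space :: "real \<Rightarrow> (real \<Rightarrow> real) set" for \<epsilon> where
  base: "(\<lambda>x. c * cutoff \<epsilon> k x) \<in> cutoff_space \<epsilon>"
| add: "f \<in> cutoff_space \<epsilon> \<Longrightarrow> g \<in> cutoff_space \<epsilon> \<Longrightarrow> (\<lambda>x. f x + g x) \<in> cutoff_space \<epsilon>"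

lemma cutoff_space_deriv:
  assumes "\<epsilon> > 0" "f \<in> cutoff_space \<epsilon>"
  shows "\<exists>f'\<in>cutoff_space \<epsilon>. \<forall>x. (f has_real_derivative f' x) (at x)"
  using assms(2)
proof induction
  case (base c k)
  have "((\<lambda>x. c * cutoff \<epsilon> k x) has_real_derivative
      (- c * real k) * cutoff \<epsilon> (Suc k) x + (c * \<epsilon>) * cutoff \<epsilon> (Suc (Suc k)) x) (at x)" for x
    using DERIV_cmult[OF cutoff_deriv[OF assms(1)], of c k x] by (simp add: algebra_simps)
  then show ?case
    by (intro bexI[of _ "\<lambda>x. (- c * real k) * cutoff \<epsilon> (Suc k) x + (c * \<epsilon>) * cutoff \<epsilon> (Suc (Suc k)) x"] allI
        cutoff_space.intros)
next
  case (add f g)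
  then obtain f' g' where "f' \<in> cutoff_space \<epsilon>" "g' \<in> cutoff_space \<epsilon>"
    "\<And>x. (f has_real_derivative f' x) (at x)" "\<And>x. (g has_real_derivative g' x) (at x)" by blast
  then show ?case by (intro bexI[of _ "\<lambda>x. f' x + g' x"]) (auto intro: DERIV_add cutoff_space.add)
qed

lemma smooth_fun_cutoff:
  assumes e: "\<epsilon> > 0"
  shows "smooth_fun (cutoff \<epsilon> k)"
proof (rule smooth_fun_coinduct[where S = "cutoff_space \<epsilon>"])
  show "cutoff \<epsilon> k \<in> cutoff_space \<epsilon>" using cutoff_space.base[of 1 \<epsilon> k] by simp
  fix g assume "g \<in> cutoff_space \<epsilon>"
  then obtain g' where g: "g' \<in> cutoff_space \<epsilon>" "\<And>x. (g has_real_derivative g' x) (at x)"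
    using cutoff_space_deriv[OF e] by blast
  then show "g differentiable (at x)" for x by (auto simp: real_differentiable_def)
  fix b :: real assume "b \<in> Basis"
  then have "pd b g = g'" using frechet_derivative_real[OF g(2)] by (simp add: fun_eq_iff)
  then show "pd b g \<in> cutoff_space \<epsilon>" using g(1) by simp
qed

definition bump :: "real \<Rightarrow> real \<Rightarrow> real \<Rightarrow> real \<Rightarrow> real" where
  "bump \<epsilon> a b t = cutoff \<epsilon> 0 (t - a) * cutoff \<epsilon> 0 (b - t)"

lemma bump_time_test:
  assumes "\<epsilon> > 0" "0 < a" "b < T"
  shows "bump \<epsilon> a b \<in> time_tests T"
proof -
  have "smooth_fun (\<lambda>t. cutoff \<epsilon> 0 (- a + 1 * t) * cutoff \<epsilon> 0 (b + (-1) * t))"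
    by (intro smooth_fun_mult smooth_fun_compose_affine(1) smooth_fun_cutoff assms bounded_linear_mult_right) auto
  then have "smooth_fun (bump \<epsilon> a b)" by (simp add: bump_def[abs_def])
  moreover have "bump \<epsilon> a b t = 0" if "t \<notin> {a..b}" for t
    using that by (auto simp: bump_def cutoff_def)
  ultimately show ?thesis
    unfolding time_tests_def using assms by blast
qed

lemma bump_bounds: "\<epsilon> > 0 \<Longrightarrow> 0 \<le> bump \<epsilon> a b t" "\<epsilon> > 0 \<Longrightarrow> bump \<epsilon> a b t \<le> 1"
  and bump_pos: "a < t \<Longrightarrow> t < b \<Longrightarrow> 0 < bump \<epsilon> a b t"
  by (auto simp: bump_def cutoff_def intro: mult_le_one)

text \<open>The link from smooth test functions to indicators of open intervals: pointwise
  convergence of functions bounded by 1, as dominated convergence wants it.\<close>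

lemma bump_tendsto: "(\<lambda>n. bump (inverse (real (Suc n))) a b t) \<longlonglongrightarrow> indicator {a<..<b} t"
proof -
  have "(\<lambda>n. cutoff (inverse (real (Suc n))) 0 x) \<longlonglongrightarrow> (if x > 0 then 1 else 0)" for x
  proof -
    have "(\<lambda>n. exp (- inverse (real (Suc n)) * inverse x)) \<longlonglongrightarrow> exp (- 0 * inverse x)"
      by (intro tendsto_intros LIMSEQ_inverse_real_of_nat)
    then show ?thesis by (simp add: cutoff_def)
  qed
  from tendsto_mult[OF this[of "t - a"] this[of "b - t"]]
  have "(\<lambda>n. bump (inverse (real (Suc n))) a b t) \<longlonglongrightarrow> (if t - a > 0 then 1 else 0) * (if b - t > 0 then 1 else 0)"
    by (simp only: bump_def)
  moreover have "(if t - a > 0 then 1 else 0) * (if b - t > 0 then 1 else 0) = (indicator {a<..<b} t :: real)"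
    by (simp add: indicator_def)
  ultimately show ?thesis by simp
qed

lemma time_testsD: "\<psi> \<in> time_tests T \<Longrightarrow> smooth_fun \<psi>" by (simp add: time_tests_def)

lemma time_tests_cont_meas:
  assumes "\<psi> \<in> time_tests T"
  shows "continuous_on UNIV \<psi>" "\<psi> \<in> borel_measurable borel"
  using smooth_fun_continuous[OF time_testsD[OF assms]] smooth_fun_measurable[OF time_testsD[OF assms]] by auto

lemma time_tests_bounded:
  assumes "\<psi> \<in> time_tests T"
  obtains B where "\<And>t. \<bar>\<psi> t\<bar> \<le> B"
proof -
  obtain a b where ab: "\<And>t. t \<notin> {a..b} \<Longrightarrow> \<psi> t = 0" using assms by (auto simp: time_tests_def)
  have "compact (\<psi> ` {a..b})"
    by (intro compact_continuous_image compact_Icc continuous_on_subset[OF time_tests_cont_meas(1)[OF assms]]) auto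
  then obtain B where B: "\<And>x. x \<in> {a..b} \<Longrightarrow> \<bar>\<psi> x\<bar> \<le> B"
    using compact_imp_bounded bounded_iff by (metis imageI real_norm_def)
  have "\<bar>\<psi> x\<bar> \<le> max B 0" for x
    using B[of x] ab[of x] by (cases "x \<in> {a..b}") auto
  with that show ?thesis by blast
qed

lemma time_tests_deriv:
  assumes "\<psi> \<in> time_tests T"
  shows "pd 1 \<psi> \<in> time_tests T"
proof -
  obtain a b where ab: "0 < a" "b < T" "\<And>t. t \<notin> {a..b} \<Longrightarrow> \<psi> t = 0" using assms by (auto simp: time_tests_def)
  have "pd 1 \<psi> t = 0" if "t \<notin> {a..b}" for t
  proof -
    have "((\<lambda>t. 0) has_real_derivative 0) (at t)" by simp
    then have "(\<psi> has_real_derivative 0) (at t)"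
      by (rule has_field_derivative_transform_within_open[where S = "- {a..b}"]) (use that ab in auto)
    from frechet_derivative_real[OF this] show ?thesis by simp
  qed
  moreover have "smooth_fun (pd 1 \<psi>)"
    by (rule smooth_fun_pderiv[OF time_testsD[OF assms]]) simp
  ultimately show ?thesis using ab unfolding time_tests_def by blast
qed

lemma time_tests_prim:
  assumes "\<psi> \<in> time_tests T" "t \<in> {0..T}"
  shows "\<psi> t = 0 + prim T (pd 1 \<psi>) t"
proof -
  have "\<psi> 0 = 0" using assms by (auto simp: time_tests_def)
  moreover have "prim T (pd 1 \<psi>) t = \<psi> t - \<psi> 0"
    by (rule prim_FTC)
       (use assms in \<open>auto intro: smooth_fun_has_real_derivative time_testsD time_tests_cont_meas time_tests_deriv\<close>)
  ultimately show ?thesis by simp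
qed

lemma time_tests_integrable_mult:
  assumes "integrable (dt T) v" "\<psi> \<in> time_tests T"
  shows "integrable (dt T) (\<lambda>t. v t * \<psi> t)"
proof -
  obtain B where "\<And>t. \<bar>\<psi> t\<bar> \<le> B" using time_tests_bounded[OF assms(2)] by blast
  from time_integrable_mult_bounded[OF assms(1) borel_measurable_time_leb[OF time_tests_cont_meas(2)[OF assms(2)]] this]
  show ?thesis by (simp add: mult.commute)
qed

lemma time_tests_integrable: "\<psi> \<in> time_tests T \<Longrightarrow> integrable (dt T) \<psi>"
  using time_tests_integrable_mult[of T "\<lambda>_. 1" \<psi>] by simp

text \<open>A pi-lambda argument for the signed integral of \<open>v\<close>, pulled back along
  \<open>q\<close>. It serves twice, for half-lines on the time interval and for closed sets around
  the embedded torus.\<close>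

lemma integral_zero_generator:
  fixes v :: "'a \<Rightarrow> real" and q :: "'a \<Rightarrow> 'b::topological_space"
  assumes v: "integrable M v" and q [measurable]: "q \<in> measurable M borel"
    and E: "Int_stable E" "sets (borel :: 'b measure) = sigma_sets UNIV E"
    and zE: "\<And>A. A \<in> E \<Longrightarrow> (\<integral>x. indicator A (q x) * v x \<partial>M) = 0" and z: "(\<integral>x. v x \<partial>M) = 0"
    and A: "A \<in> sets borel"
  shows "(\<integral>x. indicator A (q x) * v x \<partial>M) = 0"
proof -
  have i: "integrable M (\<lambda>x. indicator A (q x) * v x)" if [measurable]: "A \<in> sets borel" for A
    by (rule Bochner_Integration.integrable_bound[OF v]) (use v in \<open>auto simp: indicator_def intro!: AE_I2\<close>)
  have sub: "E \<subseteq> Pow UNIV" by simp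
  have "A \<in> sigma_sets UNIV E" using A E(2) by simp
  with E(1) sub show ?thesis
  proof (induction rule: sigma_sets_induct_disjoint)
    case (compl A)
    then have "A \<in> sets borel" using E(2) by simp
    have "(\<integral>x. indicator (UNIV - A) (q x) * v x \<partial>M) = (\<integral>x. v x - indicator A (q x) * v x \<partial>M)"
      by (intro Bochner_Integration.integral_cong) (auto simp: indicator_def)
    then show ?case using compl v i[OF \<open>A \<in> sets borel\<close>] z by simp
  next
    case (union A)
    have Ab [measurable]: "A i \<in> sets borel" for i using union(2) E(2) by auto
    have s: "(\<lambda>i. indicator (A i) (q x) * \<bar>v x\<bar>) sums (indicator (\<Union>i. A i) (q x) * \<bar>v x\<bar>)" 
            "(\<lambda>i. indicator (A i) (q x) * v x) sums (indicator (\<Union>i. A i) (q x) * v x)" for x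
      using union(1) by (intro sums_mult2 indicator_sums; auto simp: disjoint_family_on_def)+
    have "(\<lambda>i. \<integral>x. indicator (A i) (q x) * v x \<partial>M) sums (\<integral>x. (\<Sum>i. indicator (A i) (q x) * v x) \<partial>M)"
    proof (rule sums_integral)
      show "AE x in M. summable (\<lambda>i. norm (indicator (A i) (q x) * v x))"
        using s(1) by (auto simp: abs_mult sums_iff intro!: AE_I2)
      \<comment> \<open>By disjointness all partial sums stay below the integral of
        \<bar>v\<bar>.\<close>
      show "summable (\<lambda>i. \<integral>x. norm (indicator (A i) (q x) * v x) \<partial>M)"
      proof (rule summableI_nonneg_bounded)
        fix n
        have "(\<Sum>i<n. \<integral>x. norm (indicator (A i) (q x) * v x) \<partial>M) = (\<integral>x. (\<Sum>i<n. norm (indicator (A i) (q x) * v x)) \<partial>M)"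
          using i[OF Ab] by (intro Bochner_Integration.integral_sum[symmetric]) auto
        also have "\<dots> \<le> (\<integral>x. \<bar>v x\<bar> \<partial>M)"
        proof (rule integral_mono)
          show "integrable M (\<lambda>x. \<Sum>i<n. norm (indicator (A i) (q x) * v x))" using i[OF Ab] by auto
          fix x
          have "(\<Sum>i<n. norm (indicator (A i) (q x) * v x)) = (\<Sum>i<n. indicator (A i) (q x) * \<bar>v x\<bar>)"
            by (simp add: abs_mult)
          also have "\<dots> \<le> indicator (\<Union>i. A i) (q x) * \<bar>v x\<bar>"
            using s(1)[of x] by (metis sum_le_suminf sums_iff abs_ge_zero finite_lessThan indicator_pos_le mult_nonneg_nonneg)
          also have "\<dots> \<le> \<bar>v x\<bar>" by (auto simp: indicator_def)
          finally show "(\<Sum>i<n. norm (indicator (A i) (q x) * v x)) \<le> \<bar>v x\<bar>" .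
        qed (use v in auto)
        finally show "(\<Sum>i<n. \<integral>x. norm (indicator (A i) (q x) * v x) \<partial>M) \<le> (\<integral>x. \<bar>v x\<bar> \<partial>M)" .
      qed simp
    qed (use i[OF Ab] in auto)
    then show ?case using union.IH s(2) by (simp add: sums_iff)
  qed (use zE z in auto)
qed

text \<open>Fundamental lemma of the calculus of variations: bumps converge to indicators of
  intervals, the primitive of \<open>v\<close> is thus constant, and half-lines generate the Borel
  sets.\<close>

lemma time_tests_fundamental:
  assumes v: "integrable (dt T) v"
    and z: "\<And>\<psi>. \<psi> \<in> time_tests T \<Longrightarrow> (\<integral>t. v t * \<psi> t \<partial>dt T) = 0"
  shows "AE t in dt T. v t = 0"
proof -
  have [measurable]: "v \<in> borel_measurable (dt T)" using v by simp
  have id [measurable]: "(\<lambda>x. x) \<in> measurable (dt T) borel"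
    by (intro borel_measurable_time_leb) simp
  have int: "(\<integral>t. indicator {a<..<b} t * v t \<partial>dt T) = 0" if "0 < a" "b < T" for a b
  proof -
    have [measurable]: "bump (inverse (real (Suc n))) a b \<in> borel_measurable (dt T)" for n
      using time_tests_cont_meas(2)[OF bump_time_test[OF _ that]] by (intro borel_measurable_time_leb) simp
    have "(\<lambda>n. \<integral>t. bump (inverse (real (Suc n))) a b t * v t \<partial>dt T) \<longlonglongrightarrow> (\<integral>t. indicator {a<..<b} t * v t \<partial>dt T)"
    proof (rule integral_dominated_convergence[where w = "\<lambda>t. \<bar>v t\<bar>"])
      show "AE t in dt T. (\<lambda>n. bump (inverse (real (Suc n))) a b t * v t) \<longlonglongrightarrow> indicator {a<..<b} t * v t"
        by (intro AE_I2 tendsto_mult bump_tendsto tendsto_const)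
      show "AE t in dt T. norm (bump (inverse (real (Suc n))) a b t * v t) \<le> \<bar>v t\<bar>" for n
        using bump_bounds[of "inverse (real (Suc n))" a b]
        by (intro AE_I2) (simp add: abs_mult mult_left_le_one_le)
      show "(\<lambda>t. bump (inverse (real (Suc n))) a b t * v t) \<in> borel_measurable (dt T)" for n
        by measurable
      show "(\<lambda>t. indicator {a<..<b} t * v t) \<in> borel_measurable (dt T)"
        by (rule borel_measurable_times[OF measurable_compose[OF id]]) auto
    qed (use v in auto)
    moreover have "(\<integral>t. bump (inverse (real (Suc n))) a b t * v t \<partial>dt T) = 0" for n
      using z[OF bump_time_test[OF _ that, of "inverse (real (Suc n))"]] by (simp add: mult.commute)
    ultimately show ?thesis by (simp only: LIMSEQ_const_iff)
  qed
  \<comment> \<open>Test functions vanish near 0 and T, so intervals compactly inside come first;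
    continuity of the primitive then reaches both end points.\<close>
  have p: "prim T v b = prim T v a" if "0 < a" "a \<le> b" "b < T" for a b
  proof -
    have "prim T v b - prim T v a = (\<integral>t. indicator {..b} t * v t - indicator {..a} t * v t \<partial>dt T)"
      unfolding prim_def using prim_integrable[OF v] by simp
    also have "\<dots> = (\<integral>t. indicator {a<..<b} t * v t \<partial>dt T)"
    proof (rule integral_cong_AE)
      show "AE t in dt T. indicator {..b} t * v t - indicator {..a} t * v t = indicator {a<..<b} t * v t"
        using AE_time_neq[of b T] by eventually_elim (use that in \<open>auto simp: indicator_def\<close>)
    qed (auto intro: measurable_compose[OF id])
    finally show ?thesis using int[of a b] that by simp
  qed
  have p0: "prim T v b = 0" if b: "0 < b" "b < T" for b
  proof -
    have "((prim T v) \<longlongrightarrow> prim T v 0) (at_right 0)"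
      using continuous_prim[OF v] by (auto simp: continuous_on_def intro: tendsto_within_subset)
    moreover have "((prim T v) \<longlongrightarrow> prim T v b) (at_right 0)"
    proof (rule tendsto_eventually)
      show "\<forall>\<^sub>F y in at_right 0. prim T v y = prim T v b"
        unfolding eventually_at_right_field
      proof (intro exI[of _ b] conjI allI impI)
        fix y assume "0 < y" "y < b"
        then show "prim T v y = prim T v b" using p[of y b] b by simp
      qed (rule b)
    qed
    ultimately show ?thesis
      using tendsto_unique[of "at_right (0::real)"] prim_0[of 0 T v] by auto
  qed
  have pT: "prim T v T = 0"
  proof (cases "0 < T")
    case True
    have "((prim T v) \<longlongrightarrow> prim T v T) (at_left T)"
      using continuous_prim[OF v] by (auto simp: continuous_on_def intro: tendsto_within_subset)
    moreover have "((prim T v) \<longlongrightarrow> 0) (at_left T)"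
      by (rule tendsto_eventually) (use p0 True in \<open>auto simp: eventually_at_left_field intro!: exI[of _ 0]\<close>)
    ultimately show ?thesis
      using tendsto_unique[of "at_left T"] by auto
  qed (auto intro: prim_0)
  have pt: "prim T v t = 0" for t
    using p0[of t] pT prim_0[of t T v] prim_T[of T t v] prim_T[of T T v]
    by (cases "t \<le> 0"; cases "t < T") auto
  have "(\<integral>x. indicator A x * v x \<partial>dt T) = 0" if "A \<in> sets borel" for A
  proof (rule integral_zero_generator[OF v id, where E = "range atMost"])
    show "Int_stable (range (atMost :: real \<Rightarrow> real set))"
    proof (rule Int_stableI_image)
      fix i j :: real show "\<exists>k\<in>UNIV. {..i} \<inter> {..j} = {..k}" by (rule bexI[of _ "min i j"]) auto
    qed
    have "(borel :: real measure) = sigma UNIV (range atMost)"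
      by (rule borel_eq_atMost)
    then show "sets (borel :: real measure) = sigma_sets UNIV (range atMost)"
      by (metis sets_measure_of subset_UNIV Pow_UNIV)
    show "(\<integral>x. v x \<partial>dt T) = 0" using pT prim_T[of T T v] by simp
  qed (use pt that in \<open>auto simp: prim_def\<close>)
  then have "set_lebesgue_integral (dt T) A v = 0" if A: "A \<in> sets (dt T)" for A
  proof -
    obtain B where B: "B \<in> sets borel" "A = {0<..<T} \<inter> B"
      using A by (auto simp: sets_time_leb sets_restrict_space)
    have "set_lebesgue_integral (dt T) A v = (\<integral>x. indicator B x * v x \<partial>dt T)"
      unfolding set_lebesgue_integral_def B(2)
      by (rule Bochner_Integration.integral_cong) (auto simp: indicator_def)
    then show ?thesis using \<open>\<And>A. A \<in> sets borel \<Longrightarrow> (\<integral>x. indicator A x * v x \<partial>dt T) = 0\<close>[OF B(1)] by simp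
  qed
  then show ?thesis by (intro time.density_zero v)
qed

text \<open>The vanishing mean makes the primitive return to 0 to the right of the support.\<close>

lemma time_tests_primitive:
  assumes f: "f \<in> time_tests T" and z: "(\<integral>t. f t \<partial>dt T) = 0" and T: "T > 0"
  obtains F where "F \<in> time_tests T" "\<And>t. pd 1 F t = f t"
proof -
  obtain a b where ab: "0 < a" "b < T" "\<And>t. t \<notin> {a..b} \<Longrightarrow> f t = 0" using f by (auto simp: time_tests_def)
  have cf: "continuous_on S f" for S
    using time_tests_cont_meas(1)[OF f] by (rule continuous_on_subset) simp
  \<comment> \<open>The lower limit -1 lies strictly left of the support, so the derivative of the
    integral can be computed at every point from the support onwards.\<close>
  define F where "F u = integral {-1..u} f" for u
  have F0: "F u = 0" if "u < a" for u
  proof -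
    have "F u = integral {-1..u} (\<lambda>x. 0)" unfolding F_def
      by (rule integral_cong) (use that ab in auto)
    then show ?thesis by simp
  qed
  have D: "(F has_real_derivative f x) (at x)" for x
  proof (cases "x < a")
    case True
    have "((\<lambda>t. 0) has_real_derivative 0) (at x)" by simp
    then have "(F has_real_derivative 0) (at x)"
      by (rule has_field_derivative_transform_within_open[where S = "{..<a}"]) (use True F0 in auto)
    then show ?thesis using ab(3)[of x] True by simp
  next
    case False
    then have x: "-1 < x" using ab by simp
    have "(F has_vector_derivative f x) (at x within {-1..x+1})"
      unfolding F_def using x by (intro integral_has_vector_derivative cf) auto
    moreover have "at x within {-1..x+1} = at x"
      by (rule at_within_interior) (use x in auto)
    ultimately show ?thesis by (simp add: has_real_derivative_iff_has_vector_derivative)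
  qed
  have "prim T f T = F T - F 0"
    by (rule prim_FTC[OF D cf]) (use T in auto)
  then have FT: "F T = 0" using z F0[of 0] ab prim_T[of T T f] by simp
  have Fb: "F t = 0" if "t > b" for t
  proof -
    have "\<exists>c. \<forall>x\<in>{b<..}. F x = c"
    proof (rule has_field_derivative_zero_constant)
      fix x assume "x \<in> {b<..}"
      then show "(F has_field_derivative 0) (at x within {b<..})"
        using D[of x] ab(3)[of x] by (auto intro: has_field_derivative_at_within)
    qed simp
    then show ?thesis using FT that ab(2) by force
  qed
  have fd: "pd 1 F t = f t" for t
    using frechet_derivative_real[OF D] by simp
  have "smooth_fun F"
  proof (rule smooth_fun_coinduct[where S = "insert F {f. smooth_fun f}"])
    fix g :: "real \<Rightarrow> real" and c :: real
    assume "g \<in> insert F {f. smooth_fun f}" "c \<in> Basis"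
    then show "pd c g \<in> insert F {f. smooth_fun f}"
      using smooth_fun_pderiv[of g c] time_testsD[OF f] fd by auto
  qed (use D smooth_fun_has_real_derivative in \<open>auto simp: real_differentiable_def\<close>)
  then have "F \<in> time_tests T"
    unfolding time_tests_def using ab F0 Fb by (intro CollectI conjI exI[of _ a] exI[of _ b]) auto
  with that fd show ?thesis by blast
qed

text \<open>Du Bois-Reymond's lemma: \<open>r = u - prim T v\<close> annihilates all derivatives of
  test functions, that is, all test functions of mean zero, and is therefore constant.\<close>

lemma weak_time_derivative_primitive:
  assumes u: "integrable (dt T) u" and v: "integrable (dt T) v" and T: "T > 0"
    and w: "\<And>\<psi>. \<psi> \<in> time_tests T \<Longrightarrow>
      (\<integral>t. u t * pd 1 \<psi> t \<partial>dt T) = - (\<integral>t. v t * \<psi> t \<partial>dt T)"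
  obtains c where "AE t in dt T. u t = c + prim T v t"
proof -
  define r where "r t = u t - prim T v t" for t
  have ip: "integrable (dt T) (prim T v)"
    using prim_bounded[OF v] prim_measurable[OF v]
    by (intro time_integrable_bounded borel_measurable_time_leb) auto
  have r: "integrable (dt T) r" unfolding r_def using u ip by simp
  have 1: "(\<integral>t. r t * pd 1 \<psi> t \<partial>dt T) = 0" if \<psi>: "\<psi> \<in> time_tests T" for \<psi>
  proof -
    let ?d = "pd 1 \<psi>"
    have d: "?d \<in> time_tests T" by (rule time_tests_deriv[OF \<psi>])
    have "\<psi> T = 0" using \<psi> by (auto simp: time_tests_def)
    then have "0 = prim T (\<lambda>s. v s * \<psi> s + prim T v s * ?d s) T"
      using prim_product_rule(1)[OF v time_tests_integrable[OF d], of "prim T v" 0 \<psi> 0 T] time_tests_prim[OF \<psi>] T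
      by simp
    also have "\<dots> = (\<integral>t. v t * \<psi> t \<partial>dt T) + (\<integral>t. prim T v t * ?d t \<partial>dt T)"
      using time_tests_integrable_mult[OF v \<psi>] time_tests_integrable_mult[OF ip d] by (simp add: prim_T)
    finally have "(\<integral>t. prim T v t * ?d t \<partial>dt T) = - (\<integral>t. v t * \<psi> t \<partial>dt T)" by simp
    then show ?thesis
      using w[OF \<psi>] time_tests_integrable_mult[OF u d] time_tests_integrable_mult[OF ip d]
      by (simp add: r_def left_diff_distrib)
  qed
  \<comment> \<open>Any fixed test function of nonzero mean serves to correct the mean of the
    others; this one is positive on the middle third of (0,T).\<close>
  define \<rho> where "\<rho> = bump 1 (T / 3) (2 * T / 3)"
  have \<rho>: "\<rho> \<in> time_tests T" unfolding \<rho>_def using T by (intro bump_time_test) auto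
  define I where "I = (\<integral>t. \<rho> t \<partial>dt T)"
  have I: "I \<noteq> 0"
  proof
    assume "I = 0"
    then have "AE t in dt T. \<rho> t = 0"
      unfolding I_def using integral_nonneg_eq_0_iff_AE[OF time_tests_integrable[OF \<rho>]] bump_bounds(1)[of 1]
      by (auto simp: \<rho>_def)
    then have "AE t in dt T. t \<notin> {T/3<..<2*T/3}"
    proof eventually_elim
      case (elim t)
      show ?case
      proof
        assume "t \<in> {T/3<..<2*T/3}"
        then have "0 < \<rho> t" unfolding \<rho>_def by (intro bump_pos) auto
        with elim show False by simp
      qed
    qed
    then have "AE t in lborel. t \<notin> {T/3<..<2*T/3}"
      unfolding AE_time_leb by eventually_elim (use T in auto)
    then have "emeasure lborel {T/3<..<2*T/3} = 0"
      by (subst (asm) AE_iff_null_sets[symmetric]) (auto simp: null_sets_def)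
    then show False using T by simp
  qed
  \<comment> \<open>The only possible constant: the mean of r weighted by \<rho>.\<close>
  define c where "c = (\<integral>t. r t * \<rho> t \<partial>dt T) / I"
  have "AE t in dt T. r t - c = 0"
  proof (rule time_tests_fundamental)
    show "integrable (dt T) (\<lambda>t. r t - c)" using r by simp
    fix \<psi> assume \<psi>: "\<psi> \<in> time_tests T"
    define J where "J = (\<integral>t. \<psi> t \<partial>dt T)"
    \<comment> \<open>The multiple of \<rho> cancels the mean of \<psi>, so f has a primitive that
      is a test function.\<close>
    define f where "f t = \<psi> t - J / I * \<rho> t" for t
    have "f \<in> time_tests T"
    proof -
      obtain a b where ab: "0 < a" "b < T" "\<And>t. t \<notin> {a..b} \<Longrightarrow> \<psi> t = 0" using \<psi> by (auto simp: time_tests_def)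
      obtain a' b' where ab': "0 < a'" "b' < T" "\<And>t. t \<notin> {a'..b'} \<Longrightarrow> \<rho> t = 0" using \<rho> by (auto simp: time_tests_def)
      have "smooth_fun f" unfolding f_def
        by (intro smooth_fun_diff smooth_fun_cmult time_testsD[OF \<psi>] time_testsD[OF \<rho>])
      then show ?thesis
      proof (rule time_testsI[where a = "min a a'" and b = "max b b'"])
        fix t assume "t \<notin> {min a a'..max b b'}"
        then have "t \<notin> {a..b}" "t \<notin> {a'..b'}" by auto
        then show "f t = 0" using ab(3) ab'(3) by (simp add: f_def)
      qed (use ab ab' in auto)
    qed
    moreover have "(\<integral>t. f t \<partial>dt T) = 0"
      using I time_tests_integrable[OF \<psi>] time_tests_integrable[OF \<rho>] by (simp add: f_def I_def J_def)
    ultimately obtain F where F: "F \<in> time_tests T" "\<And>t. pd 1 F t = f t"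
      using time_tests_primitive T by blast
    have "0 = (\<integral>t. r t * f t \<partial>dt T)"
      using 1[OF F(1)] F(2) by simp
    also have "\<dots> = (\<integral>t. r t * \<psi> t - J / I * (r t * \<rho> t) \<partial>dt T)"
      by (intro Bochner_Integration.integral_cong) (auto simp: f_def algebra_simps)
    also have "\<dots> = (\<integral>t. r t * \<psi> t \<partial>dt T) - J * c"
      using time_tests_integrable_mult[OF r \<psi>] time_tests_integrable_mult[OF r \<rho>] by (simp add: c_def)
    finally show "(\<integral>t. (r t - c) * \<psi> t \<partial>dt T) = 0"
      using time_tests_integrable_mult[OF r \<psi>] time_tests_integrable[OF \<psi>] by (simp add: left_diff_distrib J_def)
  qed
  then have "AE t in dt T. u t = c + prim T v t"
    by eventually_elim (simp add: r_def)
  with that show ?thesis by blast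
qed

section \<open>Fourier analysis on the torus\<close>

subsection \<open>The measure on the fundamental cell\<close>

lemma torus_cell_borel [measurable]: "(torus_cell :: (real^'d) set) \<in> sets borel"
  unfolding torus_cell_def by measurable

lemma space_torus_leb [simp]: "space dx = torus_cell"
  and sets_torus_leb: "sets dx = sets (restrict_space borel torus_cell)"
  by (auto simp: torus_leb_def space_restrict_space intro!: sets_restrict_space_cong)

lemma borel_measurable_torus_leb:
  "f \<in> measurable borel N \<Longrightarrow> f \<in> measurable dx N"
  unfolding torus_leb_def by (intro measurable_restrict_space1) simp

lemma integral_torus_leb:
  "(\<integral>x. f x \<partial>dx) = (\<integral>x. indicator torus_cell x * (f x :: real) \<partial>lborel)"
  unfolding torus_leb_def by (subst integral_restrict_space) auto

lemma emeasure_torus_cell: "emeasure lborel (torus_cell :: (real^'d) set) = 1"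
proof (rule antisym)
  have *: "(\<Prod>b\<in>Basis. ((1 :: real^'d) - 0) \<bullet> b) = 1"
    by (rule prod.neutral) (auto simp: Basis_vec_def inner_axis)
  have sub: "box 0 1 \<subseteq> (torus_cell :: (real^'d) set)" "torus_cell \<subseteq> cbox 0 (1 :: real^'d)"
    by (auto simp: torus_cell_def mem_box_cart less_imp_le)
  have le: "\<And>b. b \<in> Basis \<Longrightarrow> (0 :: real^'d) \<bullet> b \<le> 1 \<bullet> b"
    by (auto simp: Basis_vec_def inner_axis)
  have "emeasure lborel (torus_cell :: (real^'d) set) \<le> emeasure lborel (cbox 0 (1 :: real^'d))"
    by (rule emeasure_mono[OF sub(2)]) simp
  also have "\<dots> = 1" using le * by (subst emeasure_lborel_cbox) auto
  finally show "emeasure lborel (torus_cell :: (real^'d) set) \<le> 1" .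
  have "1 = emeasure lborel (box 0 (1 :: real^'d))"
    using le * by (subst emeasure_lborel_box) auto
  also have "\<dots> \<le> emeasure lborel (torus_cell :: (real^'d) set)"
    by (rule emeasure_mono[OF sub(1)]) simp
  finally show "1 \<le> emeasure lborel (torus_cell :: (real^'d) set)" .
qed

lemma emeasure_torus_leb: "emeasure dx (torus_cell :: (real^'d) set) = 1"
  unfolding torus_leb_def using emeasure_torus_cell by (subst emeasure_restrict_space) auto

lemma measure_torus_leb [simp]: "measure dx (torus_cell :: (real^'d) set) = 1"
  by (simp add: measure_def emeasure_torus_leb)

lemma finite_measure_torus_leb: "finite_measure (dx :: (real^'d) measure)"
  by (rule finite_measureI) (simp add: emeasure_torus_leb)

interpretation torus: finite_measure "dx :: (real^'d) measure"
  by (rule finite_measure_torus_leb)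

lemma torus_bounded_integrable:
  assumes "f \<in> borel_measurable (dx :: (real^'d) measure)" "\<And>x. \<bar>f x\<bar> \<le> (B::real)"
  shows "integrable dx f"
  using assms by (intro torus.integrable_const_bound[where B = B]) auto

lemma Cinf_torus_measurable: "f \<in> Cinf_torus \<Longrightarrow> f \<in> borel_measurable dx"
  by (intro borel_measurable_torus_leb smooth_fun_measurable Cinf_torusD)

lemma Cinf_torus_integrable: "f \<in> Cinf_torus \<Longrightarrow> integrable dx f"
  by (metis Cinf_torus_bounded Cinf_torus_measurable torus_bounded_integrable)

lemma Cinf_torus_L2: "f \<in> Cinf_torus \<Longrightarrow> f \<in> L2 dx"
  using Cinf_torus_integrable[OF Cinf_torus_mult, of f f]
  by (simp add: L2_iff Cinf_torus_measurable power2_eq_square)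

lemma lborel_integral_shift:
  fixes g :: "'e::euclidean_space \<Rightarrow> real"
  assumes "g \<in> borel_measurable borel"
  shows "(\<integral>x. g (x + v) \<partial>lborel) = (\<integral>x. g x \<partial>lborel)"
proof -
  have "(\<integral>x. g x \<partial>lborel) = (\<integral>x. g x \<partial>distr lborel borel ((+) v))"
    by (simp add: lborel_distr_plus)
  also have "\<dots> = (\<integral>x. g (v + x) \<partial>lborel)"
    using assms by (subst integral_distr) auto
  finally show ?thesis by (simp add: add.commute)
qed

text \<open>The shifted cell is the original one with the slab \<open>D\<close> carried to the
  opposite face; periodicity brings the slab back.\<close>

lemma periodic_integral_shift:
  fixes f :: "real^'d \<Rightarrow> real"
  assumes per: "periodic f" and f [measurable]: "f \<in> borel_measurable borel" and B: "\<And>x. \<bar>f x\<bar> \<le> B"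
    and a: "0 \<le> a" "a \<le> 1"
  shows "(\<integral>x. f (x + a *\<^sub>R axis i 1) \<partial>dx) = (\<integral>x. f x \<partial>dx)"
proof -
  let ?v = "a *\<^sub>R axis i (1::real) :: real^'d" and ?e = "axis i (1::real) :: real^'d"
  let ?c = "torus_cell :: (real^'d) set"
  \<comment> \<open>\<open>A\<close> is the part of the cell that the shifted cell still covers,
    \<open>D\<close> the part that reappears translated by one unit.\<close>
  define A where "A = {y \<in> ?c. a \<le> y $ i}"
  define D where "D = {y \<in> ?c. y $ i < a}"
  have [measurable]: "A \<in> sets borel" "D \<in> sets borel"
    unfolding A_def D_def by measurable
  have int: "integrable lborel (\<lambda>x. indicator S x * f x)" if [measurable]: "S \<in> sets borel" and "S \<subseteq> ?c" for S
  proof -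
    have "integrable dx (\<lambda>x. indicator S x * f x)"
      by (rule torus_bounded_integrable[of _ B])
         (use B order_trans[OF abs_ge_zero B] in \<open>auto intro!: borel_measurable_torus_leb simp: indicator_def\<close>)
    then have "integrable lborel (\<lambda>x. indicator torus_cell x *\<^sub>R (indicator S x * f x))"
      unfolding torus_leb_def by (subst (asm) integrable_restrict_space) auto
    moreover have "indicator torus_cell x *\<^sub>R (indicator S x * f x) = indicator S x * f x" for x
      using \<open>S \<subseteq> ?c\<close> by (auto simp: indicator_def)
    ultimately show ?thesis by (simp only:)
  qed
  have vi: "(y - ?v) $ j = (if j = i then y $ i - a else y $ j)" "(y - ?e) $ j = (if j = i then y $ i - 1 else y $ j)" for y j
    by (auto simp: axis_def)
  have ind: "indicator ?c (y - ?v) = indicator A y + (indicator D (y - ?e) :: real)" for y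
  proof -
    have c: "y - ?v \<in> ?c \<longleftrightarrow> (\<forall>j. j \<noteq> i \<longrightarrow> 0 \<le> y $ j \<and> y $ j < 1) \<and> a \<le> y $ i \<and> y $ i < 1 + a"
      unfolding torus_cell_def mem_Collect_eq vi by (auto split: if_splits)
    have dA: "y \<in> A \<longleftrightarrow> (\<forall>j. j \<noteq> i \<longrightarrow> 0 \<le> y $ j \<and> y $ j < 1) \<and> a \<le> y $ i \<and> y $ i < 1"
      unfolding A_def torus_cell_def mem_Collect_eq using a by (metis order_trans)
    have dD: "y - ?e \<in> D \<longleftrightarrow> (\<forall>j. j \<noteq> i \<longrightarrow> 0 \<le> y $ j \<and> y $ j < 1) \<and> 1 \<le> y $ i \<and> y $ i < 1 + a"
      unfolding D_def torus_cell_def mem_Collect_eq vi using a by (auto split: if_splits)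
    show ?thesis using a c dA dD by (auto simp: indicator_def)
  qed
  have "(\<integral>x. f (x + ?v) \<partial>dx) = (\<integral>x. indicator ?c ((x + ?v) - ?v) * f (x + ?v) \<partial>lborel)"
    by (simp add: integral_torus_leb)
  also have "\<dots> = (\<integral>y. indicator ?c (y - ?v) * f y \<partial>lborel)"
    by (rule lborel_integral_shift[where g = "\<lambda>y. indicator ?c (y - ?v) * f y"]) measurable
  also have "\<dots> = (\<integral>y. indicator A y * f y + indicator D (y - ?e) * f ((y - ?e) + ?e) \<partial>lborel)"
    by (simp add: ind distrib_right)
  also have "\<dots> = (\<integral>y. indicator A y * f y + indicator D (y + (- ?e)) * f (y + (- ?e)) \<partial>lborel)"
  proof -
    have "f ((y - ?e) + ?e) = f (y + (- ?e))" for y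
      using per unfolding periodic_def by (metis diff_conv_add_uminus)
    then show ?thesis by simp
  qed
  also have "\<dots> = (\<integral>y. indicator A y * f y \<partial>lborel) + (\<integral>y. indicator D (y + (- ?e)) * f (y + (- ?e)) \<partial>lborel)"
  proof (rule Bochner_Integration.integral_add)
    show "integrable lborel (\<lambda>y. indicator A y * f y)" by (rule int) (auto simp: A_def)
    have "integrable lborel (\<lambda>y. indicator D y * f y)" by (rule int) (auto simp: D_def)
    then have "integrable (distr lborel borel ((+) (- ?e))) (\<lambda>y. indicator D y * f y)"
      by (simp add: lborel_distr_plus)
    then have "integrable lborel (\<lambda>y. indicator D (- ?e + y) * f (- ?e + y))"
      by (subst (asm) integrable_distr_eq) auto
    then show "integrable lborel (\<lambda>y. indicator D (y + (- ?e)) * f (y + (- ?e)))"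
      by (simp add: add.commute)
  qed
  also have "(\<integral>y. indicator D (y + (- ?e)) * f (y + (- ?e)) \<partial>lborel) = (\<integral>y. indicator D y * f y \<partial>lborel)"
    by (rule lborel_integral_shift[where g = "\<lambda>y. indicator D y * f y"]) measurable
  also have "(\<integral>y. indicator A y * f y \<partial>lborel) + (\<integral>y. indicator D y * f y \<partial>lborel)
      = (\<integral>y. indicator A y * f y + indicator D y * f y \<partial>lborel)"
    by (rule Bochner_Integration.integral_add[symmetric]) (auto intro!: int simp: A_def D_def)
  also have "\<dots> = (\<integral>y. indicator ?c y * f y \<partial>lborel)"
    by (intro Bochner_Integration.integral_cong) (auto simp: A_def D_def indicator_def)
  finally show ?thesis by (simp add: integral_torus_leb)
qed

text \<open>Difference quotients have integral zero by shift invariance and are bounded by the mean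
  value theorem, so dominated convergence suffices and no iterated integration over coordinates is
  needed.\<close>

lemma Cinf_torus_integral_pderiv:
  assumes f: "f \<in> Cinf_torus"
  shows "(\<integral>x. pd (axis i 1) f x \<partial>dx) = 0"
proof -
  let ?e = "axis i (1::real)" and ?d = "pd (axis i 1) f"
  obtain B where B: "\<And>x. \<bar>f x\<bar> \<le> B" using Cinf_torus_bounded[OF f] by blast
  have dC: "?d \<in> Cinf_torus" by (rule Cinf_torus_pderiv[OF f])
  obtain D where D: "\<And>x. \<bar>?d x\<bar> \<le> D" using Cinf_torus_bounded[OF dC] by blast
  have fm [measurable]: "f \<in> borel_measurable borel" by (intro smooth_fun_measurable Cinf_torusD f)
  define h where "h n = inverse (real (Suc n))" for n
  have h: "0 < h n" "h n \<le> 1" for n by (auto simp: h_def inverse_eq_divide)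
  define q where "q n x = (f (x + h n *\<^sub>R ?e) - f x) / h n" for n x
  have line: "((\<lambda>s. f (x + s *\<^sub>R ?e)) has_real_derivative ?d (x + s *\<^sub>R ?e)) (at s)" for x s
    by (rule smooth_fun_line_derivative[OF Cinf_torusD(1)[OF f]])
  have q0: "(\<integral>x. q n x \<partial>dx) = 0" for n
  proof -
    have "integrable dx (\<lambda>x. f (x + h n *\<^sub>R ?e))"
      by (rule torus_bounded_integrable[OF _ B], rule borel_measurable_torus_leb) measurable
    then show ?thesis
      unfolding q_def using periodic_integral_shift[OF Cinf_torusD(2)[OF f] fm B, of "h n" i] h[of n]
        Cinf_torus_integrable[OF f] by simp
  qed
  have "(\<lambda>n. \<integral>x. q n x \<partial>dx) \<longlonglongrightarrow> (\<integral>x. ?d x \<partial>dx)"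
  proof (rule integral_dominated_convergence[where w = "\<lambda>x. D"])
    show "AE x in dx. (\<lambda>n. q n x) \<longlonglongrightarrow> ?d x"
    proof (rule AE_I2)
      fix x
      have "((\<lambda>s. (f (x + s *\<^sub>R ?e) - f x) / s) \<longlongrightarrow> ?d x) (at 0)"
        using line[of x 0] by (simp add: has_field_derivative_iff)
      moreover have "filterlim h (at 0) sequentially"
        unfolding filterlim_at h_def using LIMSEQ_inverse_real_of_nat by auto
      ultimately show "(\<lambda>n. q n x) \<longlonglongrightarrow> ?d x"
        unfolding q_def by (rule filterlim_compose)
    qed
    show "AE x in dx. norm (q n x) \<le> D" for n
    proof (rule AE_I2)
      fix x
      obtain z where z: "f (x + h n *\<^sub>R ?e) - f (x + 0 *\<^sub>R ?e) = (h n - 0) * ?d (x + z *\<^sub>R ?e)"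
        using MVT2[of 0 "h n" "\<lambda>s. f (x + s *\<^sub>R ?e)" "\<lambda>s. ?d (x + s *\<^sub>R ?e)"] h[of n] line by blast
      then have "q n x = ?d (x + z *\<^sub>R ?e)" unfolding q_def using h[of n] by simp
      then show "norm (q n x) \<le> D" using D by simp
    qed
    show "?d \<in> borel_measurable dx" by (rule Cinf_torus_measurable[OF dC])
    show "q n \<in> borel_measurable dx" for n
      unfolding q_def[abs_def] by (rule borel_measurable_torus_leb) measurable
  qed simp
  then show ?thesis by (simp add: q0 LIMSEQ_const_iff)
qed

lemma torus_integral_by_parts:
  assumes "f \<in> Cinf_torus" "g \<in> Cinf_torus"
  shows "(\<integral>x. pd (axis i 1) f x * g x \<partial>dx) =
    - (\<integral>x. f x * pd (axis i 1) g x \<partial>dx)"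
proof -
  have "0 = (\<integral>x. f x * pd (axis i 1) g x + pd (axis i 1) f x * g x \<partial>dx)"
    using Cinf_torus_integral_pderiv[OF Cinf_torus_mult[OF assms], of i] assms
    by (simp add: frechet_derivative_smooth_mult Cinf_torusD)
  also have "\<dots> = (\<integral>x. f x * pd (axis i 1) g x \<partial>dx)
      + (\<integral>x. pd (axis i 1) f x * g x \<partial>dx)"
    using assms by (intro Bochner_Integration.integral_add Cinf_torus_integrable Cinf_torus_mult Cinf_torus_pderiv)
  finally show ?thesis by simp
qed

subsection \<open>The Hartley basis\<close>

definition phase :: "int^'d \<Rightarrow> real^'d \<Rightarrow> real" where
  "phase \<xi> x = 2 * pi * (\<Sum>i\<in>UNIV. of_int (\<xi> $ i) * x $ i)"

text \<open>The functions \<open>cos + sin\<close> of the integer phases form a real orthonormal basis indexed by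
  \<open>\<int>\<^sup>d\<close>, in which \<open>\<partial>\<^sub>i\<close> maps the index \<open>\<xi>\<close> to \<open>- \<xi>\<close>.\<close>

definition hartley :: "int^'d \<Rightarrow> real^'d \<Rightarrow> real" where
  "hartley \<xi> x = cos (phase \<xi> x) + sin (phase \<xi> x)"

lemma phase_has_derivative: "(phase \<xi> has_derivative phase \<xi>) (at x)"
proof (rule linear_imp_has_derivative)
  show "linear (phase \<xi>)"
    by (rule linearI) (simp_all add: phase_def algebra_simps sum.distrib sum_distrib_left)
qed

lemma phase_add_index: "phase (\<xi> + \<zeta>) x = phase \<xi> x + phase \<zeta> x"
  and phase_minus_index [simp]: "phase (- \<xi>) x = - phase \<xi> x"
  and phase_zero_index [simp]: "phase 0 x = 0"
  by (simp_all add: phase_def algebra_simps sum.distrib sum_negf)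

lemma phase_axis [simp]: "phase \<xi> (axis i 1) = 2 * pi * of_int (\<xi> $ i)"
  by (simp add: phase_def axis_def if_distrib cong: if_cong)

lemma hartley_has_derivative:
  "(hartley \<xi> has_derivative (\<lambda>h. phase \<xi> h * hartley (- \<xi>) x)) (at x)"
  unfolding hartley_def
  by (auto intro!: derivative_eq_intros phase_has_derivative simp: algebra_simps)

lemma frechet_derivative_hartley:
  "pd (axis i 1) (hartley \<xi>) x = 2 * pi * of_int (\<xi> $ i) * hartley (- \<xi>) x"
  using frechet_derivative_eqI[OF hartley_has_derivative[of \<xi> x], of "axis i 1"] by simp

lemma smooth_fun_hartley: "smooth_fun (hartley \<xi>)"
proof (rule smooth_fun_coinduct[where S = "{\<lambda>x. a * hartley \<xi> x + b * hartley (- \<xi>) x |a b. True}"])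
  show "hartley \<xi> \<in> {\<lambda>x. a * hartley \<xi> x + b * hartley (- \<xi>) x |a b. True}"
    by (rule CollectI, rule exI[of _ 1], rule exI[of _ 0]) simp
  have D: "((\<lambda>x. a * hartley \<xi> x + b * hartley (- \<xi>) x) has_derivative
      (\<lambda>h. a * (phase \<xi> h * hartley (- \<xi>) x) + b * (- phase \<xi> h * hartley \<xi> x))) (at x)" for a b x
    using has_derivative_add[OF has_derivative_mult_right[OF hartley_has_derivative[of \<xi> x], of a]
        has_derivative_mult_right[OF hartley_has_derivative[of "- \<xi>" x], of b]] by simp
  fix g assume "g \<in> {\<lambda>x. a * hartley \<xi> x + b * hartley (- \<xi>) x |a b. True}"
  then obtain a b where g: "g = (\<lambda>x. a * hartley \<xi> x + b * hartley (- \<xi>) x)" by blast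
  show "g differentiable (at x)" for x unfolding g using D by (rule differentiableI)
  fix c
  have "pd c g = (\<lambda>x. (- b * phase \<xi> c) * hartley \<xi> x + (a * phase \<xi> c) * hartley (- \<xi>) x)"
    unfolding g frechet_derivative_eqI[OF D] by (simp add: algebra_simps)
  then show "pd c g \<in> {\<lambda>x. a * hartley \<xi> x + b * hartley (- \<xi>) x |a b. True}"
    by blast
qed

lemma hartley_Cinf [simp]: "hartley \<xi> \<in> Cinf_torus"
proof (rule Cinf_torusI[OF smooth_fun_hartley])
  have "phase \<xi> (x + axis i 1) = phase \<xi> x + (2 * pi) * of_int (\<xi> $ i)" for x i
    using linear_add[OF has_derivative_linear[OF phase_has_derivative[of \<xi>]], of x "axis i 1"] by simp
  then show "periodic (hartley \<xi>)"
    by (simp add: periodic_def hartley_def cos_add sin_add)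
qed

lemma hartley_zero [simp]: "hartley 0 x = 1"
  by (simp add: hartley_def)

text \<open>Product-to-sum formula. It gives orthogonality after integration, and closure of
  trigonometric polynomials under products.\<close>

lemma hartley_mult: "hartley \<xi> x * hartley \<zeta> x =
    (hartley (\<xi> - \<zeta>) x + hartley (- (\<xi> - \<zeta>)) x) / 2 + (hartley (\<xi> + \<zeta>) x - hartley (- (\<xi> + \<zeta>)) x) / 2"
proof -
  have "phase (\<xi> - \<zeta>) x = phase \<xi> x - phase \<zeta> x"
    using phase_add_index[of \<xi> "- \<zeta>" x] by simp
  then show ?thesis
    by (simp only: hartley_def phase_minus_index phase_add_index cos_minus sin_minus cos_add sin_add cos_diff sin_diff)
       (simp add: field_simps)
qed

text \<open>For a nonzero index the function is a nonzero multiple of a partial derivative of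
  \<open>hartley (- \<xi>)\<close>.\<close>

lemma integral_hartley: "(\<integral>x. hartley \<xi> x \<partial>dx) = (if \<xi> = 0 then 1 else 0)"
proof (cases "\<xi> = 0")
  case False
  then obtain i where i: "\<xi> $ i \<noteq> 0" by (auto simp: vec_eq_iff)
  have "0 = (\<integral>x. pd (axis i 1) (hartley (- \<xi>)) x \<partial>dx)"
    by (rule Cinf_torus_integral_pderiv[symmetric]) simp
  also have "\<dots> = (2 * pi * of_int (- \<xi> $ i)) * (\<integral>x. hartley \<xi> x \<partial>dx)"
    by (simp add: frechet_derivative_hartley)
  finally show ?thesis using i False by simp
qed simp

lemma hartley_orthonormal:
  "(\<integral>x. hartley \<xi> x * hartley \<zeta> x \<partial>dx) = (if \<xi> = \<zeta> then 1 else 0)"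
proof -
  have "\<xi> + \<zeta> = 0 \<longleftrightarrow> - \<xi> - \<zeta> = 0" by (simp add: eq_neg_iff_add_eq_0[symmetric] add_eq_0_iff) (metis minus_minus)
  then show ?thesis
    unfolding hartley_mult
    by (simp add: Cinf_torus_integrable integral_hartley)
qed

subsection \<open>Coefficients and partial sums\<close>

definition hat :: "(real^'d \<Rightarrow> real) \<Rightarrow> int^'d \<Rightarrow> real" where
  "hat u \<xi> = (\<integral>x. u x * hartley \<xi> x \<partial>dx)"

definition trig :: "(int^'d \<Rightarrow> real) \<Rightarrow> (int^'d) set \<Rightarrow> real^'d \<Rightarrow> real" where
  "trig a \<Lambda> x = (\<Sum>\<xi>\<in>\<Lambda>. a \<xi> * hartley \<xi> x)"

text \<open>Cubes are finite, exhaust the lattice, and are stable under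
  \<open>\<xi> \<mapsto> - \<xi>\<close>, the index change caused by each derivative.\<close>

definition Lam :: "nat \<Rightarrow> (int^'d) set" where
  "Lam N = {\<xi>. \<forall>i. \<bar>\<xi> $ i\<bar> \<le> int N}"

lemma finite_Lam [simp]: "finite (Lam N)"
proof (rule finite_subset)
  show "Lam N \<subseteq> vec_lambda ` (\<Pi>\<^sub>E i\<in>UNIV. {- int N..int N})"
  proof
    fix \<xi> :: "int^'d" assume "\<xi> \<in> Lam N"
    then have "vec_nth \<xi> \<in> (\<Pi>\<^sub>E i\<in>UNIV. {- int N..int N})"
      by (auto simp: Lam_def abs_le_iff) (meson minus_le_iff)
    then show "\<xi> \<in> vec_lambda ` (\<Pi>\<^sub>E i\<in>UNIV. {- int N..int N})"
      by (metis image_eqI vec_lambda_eta)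
  qed
qed (auto intro!: finite_PiE)

lemma Lam_mono: "M \<le> N \<Longrightarrow> Lam M \<subseteq> Lam N"
  by (auto simp: Lam_def intro: order_trans)

lemma Lam_minus [simp]: "- \<xi> \<in> Lam N \<longleftrightarrow> \<xi> \<in> Lam N"
  by (simp add: Lam_def)

lemma Lam_exhausts: obtains N where "\<xi> \<in> Lam N"
proof
  show "\<xi> \<in> Lam (nat (\<Sum>i\<in>UNIV. \<bar>\<xi> $ i\<bar>))"
    using member_le_sum[of _ UNIV "\<lambda>i. \<bar>\<xi> $ i\<bar>"] by (auto simp: Lam_def sum_nonneg)
qed

lemma eventually_Lam: "\<forall>\<^sub>F N in sequentially. \<xi> \<in> Lam N"
proof -
  obtain N where "\<xi> \<in> Lam N" by (rule Lam_exhausts)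
  then show ?thesis
    using Lam_mono by (intro eventually_sequentiallyI[of N]) blast
qed

lemma sum_Lam_uminus: "(\<Sum>\<xi>\<in>Lam N. f (- \<xi>)) = (\<Sum>\<xi>\<in>Lam N. f \<xi>)"
  by (rule sum.reindex_bij_witness[of _ uminus uminus]) auto

lemma trig_Cinf [simp]: "trig a \<Lambda> \<in> Cinf_torus"
  unfolding trig_def[abs_def] by (intro Cinf_torus_sum Cinf_torus_cmult) simp

lemma L2_hartley_integrable: "u \<in> L2 dx \<Longrightarrow> r \<in> Cinf_torus \<Longrightarrow> integrable dx (\<lambda>x. u x * r x)"
  by (rule L2_mult_integrable[OF _ Cinf_torus_L2])

lemma hat_add: "u \<in> L2 dx \<Longrightarrow> v \<in> L2 dx \<Longrightarrow> hat (\<lambda>x. u x + v x) \<xi> = hat u \<xi> + hat v \<xi>"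
  and hat_diff: "u \<in> L2 dx \<Longrightarrow> v \<in> L2 dx \<Longrightarrow> hat (\<lambda>x. u x - v x) \<xi> = hat u \<xi> - hat v \<xi>"
  by (simp_all add: hat_def distrib_right left_diff_distrib L2_hartley_integrable)

lemma hat_cmult: "hat (\<lambda>x. c * u x) \<xi> = c * hat u \<xi>"
  by (simp add: hat_def mult.assoc)

lemma hat_zero [simp]: "hat (\<lambda>x. 0) \<xi> = 0"
  by (simp add: hat_def)

lemma hat_sum: "(\<And>i. i \<in> I \<Longrightarrow> u i \<in> L2 dx) \<Longrightarrow> hat (\<lambda>x. \<Sum>i\<in>I. u i x) \<xi> = (\<Sum>i\<in>I. hat (u i) \<xi>)"
  by (induction I rule: infinite_finite_induct) (auto simp: hat_add L2_sum)

lemma hat_cong_AE: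
  assumes "u \<in> borel_measurable dx" "v \<in> borel_measurable dx" "AE x in dx. u x = v x"
  shows "hat u \<xi> = hat v \<xi>"
  unfolding hat_def
  using assms by (intro integral_cong_AE) (auto intro!: borel_measurable_times Cinf_torus_measurable[OF hartley_Cinf])

lemma inner_trig:
  assumes "u \<in> L2 dx"
  shows "(\<integral>x. u x * trig a \<Lambda> x \<partial>dx) = (\<Sum>\<xi>\<in>\<Lambda>. hat u \<xi> * a \<xi>)"
proof -
  have "(\<integral>x. u x * trig a \<Lambda> x \<partial>dx) = (\<integral>x. (\<Sum>\<xi>\<in>\<Lambda>. a \<xi> * (u x * hartley \<xi> x)) \<partial>dx)"
    by (simp add: trig_def sum_distrib_left mult_ac)
  also have "\<dots> = (\<Sum>\<xi>\<in>\<Lambda>. \<integral>x. a \<xi> * (u x * hartley \<xi> x) \<partial>dx)"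
    using L2_hartley_integrable[OF assms hartley_Cinf] by (intro Bochner_Integration.integral_sum) auto
  also have "\<dots> = (\<Sum>\<xi>\<in>\<Lambda>. hat u \<xi> * a \<xi>)"
    by (simp add: hat_def mult.commute)
  finally show ?thesis .
qed

lemma hat_hartley: "hat (hartley \<xi>) \<zeta> = (if \<xi> = \<zeta> then 1 else 0)"
  by (simp add: hat_def hartley_orthonormal)

lemma hat_trig:
  assumes "finite \<Lambda>"
  shows "hat (trig a \<Lambda>) \<xi> = (if \<xi> \<in> \<Lambda> then a \<xi> else 0)"
proof -
  have "hat (trig a \<Lambda>) \<xi> = (\<Sum>\<zeta>\<in>\<Lambda>. a \<zeta> * hat (hartley \<zeta>) \<xi>)"
    unfolding trig_def[abs_def] by (subst hat_sum) (auto intro!: Cinf_torus_L2 Cinf_torus_cmult simp: hat_cmult)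
  also have "\<dots> = (\<Sum>\<zeta>\<in>\<Lambda>. if \<zeta> = \<xi> then a \<xi> else 0)"
    by (intro sum.cong) (auto simp: hat_hartley)
  also have "\<dots> = (if \<xi> \<in> \<Lambda> then a \<xi> else 0)" using assms by simp
  finally show ?thesis .
qed

lemma normsq_trig:
  assumes "finite \<Lambda>"
  shows "L2_normsq dx (trig a \<Lambda>) = (\<Sum>\<xi>\<in>\<Lambda>. (a \<xi>)\<^sup>2)"
proof -
  have "L2_normsq dx (trig a \<Lambda>) = (\<integral>x. trig a \<Lambda> x * trig a \<Lambda> x \<partial>dx)"
    by (simp add: L2_normsq_def power2_eq_square)
  also have "\<dots> = (\<Sum>\<xi>\<in>\<Lambda>. hat (trig a \<Lambda>) \<xi> * a \<xi>)"
    by (rule inner_trig) (simp add: Cinf_torus_L2)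
  also have "\<dots> = (\<Sum>\<xi>\<in>\<Lambda>. (a \<xi>)\<^sup>2)"
    by (intro sum.cong) (simp_all add: hat_trig[OF assms] power2_eq_square)
  finally show ?thesis .
qed

lemma normsq_diff_trig_hat:
  assumes u: "u \<in> L2 dx" and "finite \<Lambda>"
  shows "L2_normsq dx (\<lambda>x. u x - trig (hat u) \<Lambda> x) = L2_normsq dx u - (\<Sum>\<xi>\<in>\<Lambda>. (hat u \<xi>)\<^sup>2)"
proof -
  have "L2_normsq dx (\<lambda>x. u x + (-1) * trig (hat u) \<Lambda> x) =
      L2_normsq dx u + 2 * (\<integral>x. u x * ((-1) * trig (hat u) \<Lambda> x) \<partial>dx) + (\<Sum>\<xi>\<in>\<Lambda>. (hat u \<xi>)\<^sup>2)"
    using L2_normsq_cmult[of dx "-1" "trig (hat u) \<Lambda>"] normsq_trig[OF assms(2)]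
    by (subst L2_normsq_add_eq[OF u L2_cmult[OF Cinf_torus_L2[OF trig_Cinf]]]) simp
  also have "(\<integral>x. u x * ((-1) * trig (hat u) \<Lambda> x) \<partial>dx) = - (\<Sum>\<xi>\<in>\<Lambda>. (hat u \<xi>)\<^sup>2)"
    using inner_trig[OF u, of "hat u" \<Lambda>] by (simp add: power2_eq_square)
  finally show ?thesis by simp
qed

lemma Bessel:
  assumes "u \<in> L2 dx" "finite \<Lambda>"
  shows "(\<Sum>\<xi>\<in>\<Lambda>. (hat u \<xi>)\<^sup>2) \<le> L2_normsq dx u"
  using normsq_diff_trig_hat[OF assms] L2_normsq_nonneg[of dx "\<lambda>x. u x - trig (hat u) \<Lambda> x"] by simp

lemma trig_diff:
  assumes "finite \<Lambda>" "\<Lambda>' \<subseteq> \<Lambda>"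
  shows "trig a \<Lambda> x - trig a \<Lambda>' x = trig a (\<Lambda> - \<Lambda>') x"
  unfolding trig_def using assms by (simp add: sum_diff finite_subset)

subsection \<open>Completeness\<close>

text \<open>Stone--Weierstrass is applied to the image of the torus under \<open>x \<mapsto> (exp (2 \<pi> i x\<^sub>j))\<^sub>j\<close>, on which
  polynomials are trigonometric polynomials; the map is injective on the cell with a Borel inverse.\<close>

definition torus_embed :: "real^'d \<Rightarrow> complex^'d" where
  "torus_embed x = (\<chi> i. cis (2 * pi * x $ i))"

inductive_set trig_span :: "(real^'d \<Rightarrow> real) set" where
  base: "(\<lambda>x. c * hartley \<xi> x) \<in> trig_span"
| add: "f \<in> trig_span \<Longrightarrow> g \<in> trig_span \<Longrightarrow> (\<lambda>x. f x + g x) \<in> trig_span"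

lemma trig_span_mult:
  assumes "f \<in> trig_span" "g \<in> trig_span"
  shows "(\<lambda>x. f x * g x) \<in> trig_span"
  using assms(1)
proof induction
  case (base c \<xi>)
  from assms(2) show ?case
  proof induction
    case (base d \<zeta>)
    have "(\<lambda>x. c * hartley \<xi> x * (d * hartley \<zeta> x)) = (\<lambda>x.
        (((c * d / 2) * hartley (\<xi> - \<zeta>) x + (c * d / 2) * hartley (- (\<xi> - \<zeta>)) x) + ((c * d / 2) * hartley (\<xi> + \<zeta>) x + (- c * d / 2) * hartley (- (\<xi> + \<zeta>)) x)))"
    proof
      fix x
      have "c * hartley \<xi> x * (d * hartley \<zeta> x) = (c * d) * (hartley \<xi> x * hartley \<zeta> x)" by simp
      then show "c * hartley \<xi> x * (d * hartley \<zeta> x) =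
        (((c * d / 2) * hartley (\<xi> - \<zeta>) x + (c * d / 2) * hartley (- (\<xi> - \<zeta>)) x) + ((c * d / 2) * hartley (\<xi> + \<zeta>) x + (- c * d / 2) * hartley (- (\<xi> + \<zeta>)) x))"
        unfolding hartley_mult by (simp add: algebra_simps add_divide_distrib diff_divide_distrib)
    qed
    also have "\<dots> \<in> trig_span" by (intro trig_span.intros)
    finally show ?case .
  next
    case (add f g)
    then show ?case using trig_span.add[OF add.IH] by (simp add: distrib_left)
  qed
next
  case (add f g)
  then show ?case using trig_span.add[OF add.IH] by (simp add: distrib_right)
qed

lemma trig_span_const: "(\<lambda>x. c) \<in> trig_span"
  using trig_span.base[of c 0] by simp

lemma trig_span_sum: "(\<And>i. i \<in> I \<Longrightarrow> f i \<in> trig_span) \<Longrightarrow> (\<lambda>x. \<Sum>i\<in>I. f i x) \<in> trig_span"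
  by (induction I rule: infinite_finite_induct) (auto intro: trig_span.add trig_span_const)

text \<open>A linear functional of the embedding is a combination of cosines and sines of the single
  coordinates, which are half the sum and half the difference of \<open>hartley\<close> at plus and
  minus a unit index. Products are covered by \<open>trig_span_mult\<close>.\<close>

lemma trig_span_polynomial:
  assumes "real_polynomial_function (p :: complex^'d \<Rightarrow> real)"
  shows "(\<lambda>x. p (torus_embed x)) \<in> trig_span"
  using assms
proof induction
  case (linear f)
  interpret bounded_linear f by fact
  have h: "phase (axis i 1) x = 2 * pi * x $ i" for i and x :: "real^'d"
    by (simp add: phase_def axis_def if_distrib[of "\<lambda>c. of_int c * _"] cong: if_cong)
  have "f (torus_embed x) = (\<Sum>i\<in>UNIV. ((f (axis i 1) + f (axis i \<i>)) / 2) * hartley (axis i 1) x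
      + ((f (axis i 1) - f (axis i \<i>)) / 2) * hartley (- axis i 1) x)" for x
  proof -
    have "torus_embed x = (\<Sum>i\<in>UNIV. cos (2 * pi * x $ i) *\<^sub>R axis i 1 + sin (2 * pi * x $ i) *\<^sub>R axis i \<i>)"
      unfolding torus_embed_def vec_eq_iff
      by (simp add: axis_def if_distrib sum.If_cases complex_eq_iff sum.distrib cong: if_cong)
    then have "f (torus_embed x) = (\<Sum>i\<in>UNIV. cos (2 * pi * x $ i) * f (axis i 1) + sin (2 * pi * x $ i) * f (axis i \<i>))"
      by (simp add: sum add scaleR)
    also have "\<dots> = (\<Sum>i\<in>UNIV. ((f (axis i 1) + f (axis i \<i>)) / 2) * hartley (axis i 1) x
      + ((f (axis i 1) - f (axis i \<i>)) / 2) * hartley (- axis i 1) x)"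
      by (intro sum.cong) (auto simp: hartley_def h field_simps)
    finally show ?thesis .
  qed
  then show ?case by (simp only:) (intro trig_span_sum trig_span.intros)
qed (auto intro: trig_span_const trig_span.add trig_span_mult)

lemma trig_span_Cinf: "p \<in> trig_span \<Longrightarrow> p \<in> Cinf_torus"
  by (induction rule: trig_span.induct) (auto intro: Cinf_torus_add Cinf_torus_cmult)

lemma torus_embed_continuous: "continuous_on UNIV (torus_embed :: real^'d \<Rightarrow> _)"
  unfolding torus_embed_def[abs_def] cis_conv_exp by (intro continuous_intros)

text \<open>The angle jumps only across the closed half-line of nonnegative reals, and there its
  value is 0.\<close>

lemma Arg2pi_borel: "Arg2pi \<in> borel_measurable borel"
proof -
  have "(\<lambda>z. if z \<in> \<real>\<^sub>\<ge>\<^sub>0 then 0 else Arg2pi z) \<in> borel_measurable borel"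
    by (intro borel_measurable_continuous_on_if)
       (auto intro!: continuous_at_imp_continuous_on continuous_at_Arg2pi borel_closed)
  moreover have "(\<lambda>z. if z \<in> \<real>\<^sub>\<ge>\<^sub>0 then 0 else Arg2pi z) = Arg2pi"
    by (auto simp: fun_eq_iff Arg2pi_eq_0 nonneg_Reals_def complex_nonneg_Reals_iff complex_is_Real_iff)
  ultimately show ?thesis by simp
qed

text \<open>Orthogonality to trigonometric polynomials extends to continuous functions of the
  embedded point, then to closed sets, then to Borel sets, and by the Borel inverse of the embedding
  to all measurable subsets of the cell. The half-open cell is not compact, which is why the
  argument passes through the embedding.\<close>

lemma hat_zero_imp_AE_zero:
  fixes u :: "real^'d \<Rightarrow> real"
  assumes u: "u \<in> L2 dx" and z: "\<And>\<xi>. hat u \<xi> = 0"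
  shows "AE x in dx. u x = 0"
proof -
  have ui: "integrable dx u" by (rule torus.L2_integrable[OF u])
  have [measurable]: "u \<in> borel_measurable dx" using ui by simp
  have E_meas: "torus_embed \<in> measurable dx (borel :: (complex^'d) measure)"
    by (intro borel_measurable_torus_leb borel_measurable_continuous_onI torus_embed_continuous)
  have span0: "(\<integral>x. u x * p x \<partial>dx) = 0" if "p \<in> trig_span" for p
    using that
  proof induction
    case (base c \<xi>)
    then show ?case using z[of \<xi>] by (simp add: hat_def mult.left_commute[of _ c])
  next
    case (add f g)
    then show ?case using L2_hartley_integrable[OF u trig_span_Cinf] by (simp add: distrib_left)
  qed
  have cont0: "(\<integral>x. u x * h (torus_embed x) \<partial>dx) = 0"
    if h: "continuous_on UNIV h" and hb: "\<And>z. \<bar>h z\<bar> \<le> (1::real)" for h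
  proof -
    \<comment> \<open>A compact set containing the image: each of the CARD('d) coordinates has
      modulus one.\<close>
    let ?K = "cball 0 (real CARD('d)) :: (complex^'d) set"
    have inK: "torus_embed x \<in> ?K" for x :: "real^'d"
    proof -
      have "norm (torus_embed x) \<le> (\<Sum>i\<in>UNIV. norm (torus_embed x $ i))"
        unfolding norm_vec_def by (rule L2_set_le_sum) simp
      then show ?thesis by (simp add: torus_embed_def)
    qed
    let ?I = "\<integral>x. u x * h (torus_embed x) \<partial>dx" and ?A = "\<integral>x. \<bar>u x\<bar> \<partial>dx"
    have hm: "(\<lambda>x. h (torus_embed x)) \<in> borel_measurable dx"
      using measurable_compose[OF E_meas borel_measurable_continuous_onI[OF h]] .
    have ih: "integrable dx (\<lambda>x. u x * h (torus_embed x))"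
      by (rule Bochner_Integration.integrable_bound[OF ui])
         (use hm hb in \<open>auto simp: abs_mult intro!: AE_I2 mult_left_le\<close>)
    have bound: "\<bar>?I\<bar> \<le> e * ?A" if e: "e > 0" for e
    proof -
      obtain p where p: "real_polynomial_function p" "\<And>z. z \<in> ?K \<Longrightarrow> \<bar>h z - p z\<bar> < e"
        using Stone_Weierstrass_real_polynomial_function[OF compact_cball continuous_on_subset[OF h subset_UNIV] e] by blast
      have pC: "(\<lambda>x. p (torus_embed x)) \<in> trig_span" by (rule trig_span_polynomial[OF p(1)])
      have ip: "integrable dx (\<lambda>x. u x * p (torus_embed x))"
        by (rule L2_hartley_integrable[OF u trig_span_Cinf[OF pC]])
      have "?I = (\<integral>x. u x * h (torus_embed x) - u x * p (torus_embed x) \<partial>dx)"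
        using ih ip span0[OF pC] by simp
      also have "\<bar>\<dots>\<bar> \<le> (\<integral>x. \<bar>u x * h (torus_embed x) - u x * p (torus_embed x)\<bar> \<partial>dx)"
        using integral_norm_bound by force
      also have "\<dots> \<le> (\<integral>x. e * \<bar>u x\<bar> \<partial>dx)"
      proof (rule integral_mono)
        fix x
        have "\<bar>u x\<bar> * \<bar>h (torus_embed x) - p (torus_embed x)\<bar> \<le> \<bar>u x\<bar> * e"
          using p(2)[OF inK[of x]] by (intro mult_left_mono) auto
        then show "\<bar>u x * h (torus_embed x) - u x * p (torus_embed x)\<bar> \<le> e * \<bar>u x\<bar>"
          by (simp add: abs_mult[symmetric] right_diff_distrib mult.commute)
      qed (use ih ip ui in auto)
      finally show ?thesis by simp
    qed
    have "\<bar>?I\<bar> \<le> 0"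
    proof (rule field_le_epsilon)
      fix e :: real assume e: "0 < e"
      have A: "0 \<le> ?A" by simp
      have "\<bar>?I\<bar> \<le> e / (?A + 1) * ?A" using bound[of "e / (?A + 1)"] e A by simp
      also have "\<dots> \<le> e / (?A + 1) * (?A + 1)" using e A by (intro mult_left_mono) auto
      also have "\<dots> = e" using add_nonneg_pos[OF A, of 1] by simp
      finally show "\<bar>?I\<bar> \<le> 0 + e" by simp
    qed
    then show ?thesis by simp
  qed
  have u0: "(\<integral>x. u x \<partial>dx) = 0" using z[of 0] by (simp add: hat_def)
  have closed0: "(\<integral>x. indicator A (torus_embed x) * u x \<partial>dx) = 0" if A: "closed A" for A :: "(complex^'d) set"
  proof (cases "A = {}")
    case False
    \<comment> \<open>Continuous functions decreasing to the indicator of the closed set.\<close>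
    define h where "h n y = max 0 (1 - real n * infdist y A)" for n and y :: "complex^'d"
    have hc: "continuous_on UNIV (h n)" for n unfolding h_def[abs_def] by (intro continuous_intros)
    have hb: "\<bar>h n y\<bar> \<le> 1" for n y by (simp add: h_def infdist_nonneg)
    have hm: "(\<lambda>x. h n (torus_embed x)) \<in> borel_measurable dx" for n
      using measurable_compose[OF E_meas borel_measurable_continuous_onI[OF hc]] .
    have lim: "(\<lambda>n. h n y) \<longlonglongrightarrow> indicator A y" for y
    proof (cases "y \<in> A")
      case True
      then show ?thesis by (simp add: h_def)
    next
      case f: False
      then have pos: "infdist y A > 0" using infdist_pos_not_in_closed[OF A False] by blast
      obtain M :: nat where M: "1 < real M * infdist y A" using reals_Archimedean3[OF pos] by blast
      have "h n y = 0" if "M \<le> n" for n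
      proof -
        have "real M * infdist y A \<le> real n * infdist y A" using that pos by (intro mult_right_mono) auto
        then show ?thesis using M by (simp add: h_def)
      qed
      then have "\<forall>\<^sub>F n in sequentially. h n y = indicator A y"
        using f by (intro eventually_sequentiallyI[of M]) simp
      then show ?thesis by (rule tendsto_eventually)
    qed
    have "(\<lambda>n. \<integral>x. h n (torus_embed x) * u x \<partial>dx) \<longlonglongrightarrow> (\<integral>x. indicator A (torus_embed x) * u x \<partial>dx)"
    proof (rule integral_dominated_convergence[where w = "\<lambda>x. \<bar>u x\<bar>"])
      show "AE x in dx. (\<lambda>n. h n (torus_embed x) * u x) \<longlonglongrightarrow> indicator A (torus_embed x) * u x"
        by (intro AE_I2 tendsto_mult lim tendsto_const)
      show "AE x in dx. norm (h n (torus_embed x) * u x) \<le> \<bar>u x\<bar>" for n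
        using hb by (intro AE_I2) (simp add: abs_mult mult_left_le_one_le)
      have "(\<lambda>x. indicator A (torus_embed x) :: real) \<in> borel_measurable dx"
        using A by (intro measurable_compose[OF E_meas]) auto
      then show "(\<lambda>x. indicator A (torus_embed x) * u x) \<in> borel_measurable dx" by measurable
      show "(\<lambda>x. h n (torus_embed x) * u x) \<in> borel_measurable dx" for n using hm by measurable
    qed (use ui in auto)
    moreover have "(\<integral>x. h n (torus_embed x) * u x \<partial>dx) = 0" for n
      using cont0[OF hc hb] by (simp add: mult.commute)
    ultimately show ?thesis by (simp add: LIMSEQ_const_iff)
  qed simp
  have borel0: "(\<integral>x. indicator A (torus_embed x) * u x \<partial>dx) = 0" if "A \<in> sets borel" for A :: "(complex^'d) set"
  proof (rule integral_zero_generator[OF ui E_meas, where E = "Collect closed"])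
    show "Int_stable (Collect closed :: (complex^'d) set set)" by (auto simp: Int_stable_def)
    show "sets (borel :: (complex^'d) measure) = sigma_sets UNIV (Collect closed)"
      unfolding borel_eq_closed by simp
  qed (use closed0 u0 that in auto)
  \<comment> \<open>A left inverse of the embedding on the cell; normalising the angle to [0, 2 pi)
    matches the half-open cell.\<close>
  define G where "G y = ((\<chi> i. Arg2pi (y $ i) / (2 * pi)) :: real^'d)" for y :: "complex^'d"
  have G_meas: "G \<in> borel_measurable borel"
  proof (rule iffD2[OF borel_measurable_euclidean_space], rule ballI)
    fix b :: "real^'d" assume "b \<in> Basis"
    then obtain i where b: "b = axis i 1" by (auto simp: Basis_vec_def)
    have "(\<lambda>y :: complex^'d. y $ i) \<in> borel_measurable borel"
      by (intro borel_measurable_continuous_onI continuous_intros)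
    then have "(\<lambda>y :: complex^'d. Arg2pi (y $ i)) \<in> borel_measurable borel"
      by (rule measurable_compose[OF _ Arg2pi_borel])
    then show "(\<lambda>y. G y \<bullet> b) \<in> borel_measurable borel"
      by (simp add: G_def b inner_axis)
  qed
  have GE: "G (torus_embed x) = x" if x: "x \<in> torus_cell" for x
  proof -
    have "Arg2pi (cis (2 * pi * x $ i)) = 2 * pi * x $ i" for i
      by (rule Arg2pi_unique[of 1]) (use x in \<open>auto simp: torus_cell_def cis_conv_exp\<close>)
    then show ?thesis by (simp add: G_def torus_embed_def vec_eq_iff)
  qed
  have "set_lebesgue_integral dx A u = 0" if A: "A \<in> sets dx" for A
  proof -
    obtain B where B: "B \<in> sets borel" "A = torus_cell \<inter> B"
      using A by (auto simp: sets_torus_leb sets_restrict_space)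
    have GB: "G -` B \<in> sets borel" using measurable_sets[OF G_meas B(1)] by simp
    have "set_lebesgue_integral dx A u = (\<integral>x. indicator (G -` B) (torus_embed x) * u x \<partial>dx)"
      unfolding set_lebesgue_integral_def B(2)
      by (rule Bochner_Integration.integral_cong) (auto simp: indicator_def GE)
    then show ?thesis using borel0[OF GB] by simp
  qed
  then show ?thesis by (rule torus.density_zero[OF ui])
qed

subsection \<open>Parseval's identity\<close>

text \<open>Riesz-Fischer: the increments of the bounded sums of squares are exactly the squared
  distances of the partial sums.\<close>

lemma trig_L2_limit:
  assumes K: "\<And>N. (\<Sum>\<xi>\<in>Lam N. (a \<xi>)\<^sup>2) \<le> K"
  obtains v where "v \<in> L2 dx" "\<And>\<xi>. hat v \<xi> = a \<xi>"
    "(\<lambda>N. L2_normsq dx (\<lambda>x. trig a (Lam N) x - v x)) \<longlonglongrightarrow> 0"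
proof -
  obtain v where v: "v \<in> L2 dx" "(\<lambda>N. L2_normsq dx (\<lambda>x. trig a (Lam N) x - v x)) \<longlonglongrightarrow> 0"
  proof (rule torus.L2_complete_mono[where u = "\<lambda>N. trig a (Lam N)" and A = "\<lambda>N. \<Sum>\<xi>\<in>Lam N. (a \<xi>)\<^sup>2", OF _ _ K])
    fix m n :: nat assume "n \<le> m"
    then have sub: "Lam n \<subseteq> (Lam m :: (int^'a) set)" by (rule Lam_mono)
    show "L2_normsq dx (\<lambda>x. trig a (Lam m) x - trig a (Lam n) x) \<le>
        (\<Sum>\<xi>\<in>Lam m. (a \<xi>)\<^sup>2) - (\<Sum>\<xi>\<in>Lam n. (a \<xi>)\<^sup>2)"
      by (simp add: trig_diff[OF finite_Lam sub] normsq_trig sum_diff[OF finite_Lam sub] del: finite_Lam)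
         (simp add: normsq_trig sum_diff sub)
  qed (auto intro: Cinf_torus_L2)
  have "hat v \<xi> = a \<xi>" for \<xi>
  proof -
    have "(\<lambda>N. \<integral>x. trig a (Lam N) x * hartley \<xi> x \<partial>dx) \<longlonglongrightarrow> (\<integral>x. v x * hartley \<xi> x \<partial>dx)"
      by (rule L2_inner_tendsto[OF _ v(1) _ v(2)]) (auto intro: Cinf_torus_L2)
    moreover have "\<forall>\<^sub>F N in sequentially. (\<integral>x. trig a (Lam N) x * hartley \<xi> x \<partial>dx) = a \<xi>"
      using eventually_Lam[of \<xi>]
    proof eventually_elim
      case (elim N)
      then show ?case using hat_trig[OF finite_Lam, of a N \<xi>] by (simp add: hat_def)
    qed
    ultimately show ?thesis
      unfolding hat_def using tendsto_unique[OF _ _ tendsto_eventually] sequentially_bot by blast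
  qed
  with v that show ?thesis by blast
qed

text \<open>The series of \<open>u\<close> converges to some \<open>v\<close> with the same
  coefficients, and completeness identifies \<open>v\<close> with \<open>u\<close>.\<close>

lemma partial_sums_tendsto:
  assumes u: "u \<in> L2 dx"
  shows "(\<lambda>N. L2_normsq dx (\<lambda>x. trig (hat u) (Lam N) x - u x)) \<longlonglongrightarrow> 0"
proof -
  obtain v where v: "v \<in> L2 dx" "\<And>\<xi>. hat v \<xi> = hat u \<xi>"
    "(\<lambda>N. L2_normsq dx (\<lambda>x. trig (hat u) (Lam N) x - v x)) \<longlonglongrightarrow> 0"
    using trig_L2_limit[of "hat u", OF Bessel[OF u finite_Lam]] by blast
  have ae: "AE x in dx. v x - u x = 0"
    by (rule hat_zero_imp_AE_zero) (auto simp: hat_diff u v intro: L2_diff)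
  have "L2_normsq dx (\<lambda>x. trig (hat u) (Lam N) x - u x) = L2_normsq dx (\<lambda>x. trig (hat u) (Lam N) x - v x)" for N
  proof (rule L2_normsq_cong_AE)
    show "AE x in dx. trig (hat u) (Lam N) x - u x = trig (hat u) (Lam N) x - v x"
      using ae by eventually_elim simp
  qed (auto intro!: L2_meas[OF L2_diff[OF Cinf_torus_L2[OF trig_Cinf]]] u v)
  with v(3) show ?thesis by simp
qed

lemma Parseval_inner:
  assumes u: "u \<in> L2 dx" and v: "v \<in> L2 dx"
  shows "(\<lambda>N. \<Sum>\<xi>\<in>Lam N. hat u \<xi> * hat v \<xi>) \<longlonglongrightarrow> (\<integral>x. u x * v x \<partial>dx)"
proof -
  have "(\<lambda>N. \<integral>x. trig (hat u) (Lam N) x * v x \<partial>dx) \<longlonglongrightarrow> (\<integral>x. u x * v x \<partial>dx)"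
    by (rule L2_inner_tendsto[OF _ u v partial_sums_tendsto[OF u]]) (simp add: Cinf_torus_L2)
  moreover have "(\<integral>x. trig (hat u) (Lam N) x * v x \<partial>dx) = (\<Sum>\<xi>\<in>Lam N. hat u \<xi> * hat v \<xi>)" for N
    using inner_trig[OF v, of "hat u" "Lam N"] by (simp add: mult.commute)
  ultimately show ?thesis by simp
qed

lemma Parseval_normsq:
  assumes u: "u \<in> L2 dx"
  shows "(\<lambda>N. \<Sum>\<xi>\<in>Lam N. (hat u \<xi>)\<^sup>2) \<longlonglongrightarrow> L2_normsq dx u"
  using Parseval_inner[OF u u] by (simp add: L2_normsq_def power2_eq_square)

lemma L2_normsq_le_hat:
  assumes u: "u \<in> L2 dx" and K: "\<And>N. (\<Sum>\<xi>\<in>Lam N. (hat u \<xi>)\<^sup>2) \<le> K"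
  shows "L2_normsq dx u \<le> K"
  by (intro LIMSEQ_le_const2[OF Parseval_normsq[OF u]] exI[of _ 0]) (use K in auto)

subsection \<open>Derivatives as multipliers\<close>

text \<open>\<open>D\<^bsup>is\<^esup>\<close> multiplies by \<open>dmult is \<xi>\<close> and moves the index by \<open>flip is\<close>.\<close>

fun dmult :: "'d list \<Rightarrow> int^'d \<Rightarrow> real" where
  "dmult [] \<xi> = 1"
| "dmult (i # is) \<xi> = - (2 * pi * of_int (\<xi> $ i)) * dmult is (- \<xi>)"

definition flip :: "'d list \<Rightarrow> int^'d \<Rightarrow> int^'d" where
  "flip is \<xi> = (if even (length is) then \<xi> else - \<xi>)"

lemma flip_simps [simp]: "flip [] \<xi> = \<xi>" "flip (i # is) \<xi> = - flip is \<xi>" "flip is (flip is \<xi>) = \<xi>"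
  "flip is (- \<xi>) = - flip is \<xi>" "flip is \<xi> \<in> Lam N \<longleftrightarrow> \<xi> \<in> Lam N"
  by (auto simp: flip_def)

lemma dmult_uminus: "dmult is (- \<xi>) = (-1) ^ length is * dmult is \<xi>"
  by (induction "is" arbitrary: \<xi>) auto

lemma dmult_flip: "dmult is (flip is \<xi>) = (-1) ^ length is * dmult is \<xi>"
  by (auto simp: flip_def dmult_uminus)

lemma sum_Lam_flip: "(\<Sum>\<xi>\<in>Lam N. f (flip is \<xi>)) = (\<Sum>\<xi>\<in>Lam N. f \<xi>)"
  by (rule sum.reindex_bij_witness[of _ "flip is" "flip is"]) auto

lemma space_dirs_Cons: "space_dirs (i # is) = axis i 1 # space_dirs is"
  by (simp add: space_dirs_def)

lemma frechet_derivative_cmult: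
  fixes f :: "'a::real_normed_vector \<Rightarrow> real"
  shows
  "f differentiable (at x) \<Longrightarrow> pd b (\<lambda>x. c * f x) x = c * pd b f x"
  using frechet_derivative_eqI[OF has_derivative_mult_right[of f "frechet_derivative f (at x)" "at x" c]]
  by (simp add: frechet_derivative_works[symmetric])

lemma iter_pderiv_hartley:
  "iter_pderiv (space_dirs is) (hartley \<xi>) = (\<lambda>x. dmult is (flip is \<xi>) * hartley (flip is \<xi>) x)"
proof (induction "is")
  case (Cons i "is")
  show ?case
    by (simp add: space_dirs_Cons Cons.IH frechet_derivative_cmult smooth_fun_differentiable smooth_fun_hartley
        frechet_derivative_hartley)
       (simp add: mult_ac)
qed (simp add: space_dirs_def)

lemma hat_pderiv:
  assumes "f \<in> Cinf_torus"
  shows "hat (pd (axis i 1) f) \<xi> = - (2 * pi * of_int (\<xi> $ i)) * hat f (- \<xi>)"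
  unfolding hat_def
  by (subst torus_integral_by_parts[OF assms hartley_Cinf])
     (simp add: frechet_derivative_hartley mult.left_commute[of "f _"])

lemma hat_iter_pderiv:
  assumes "f \<in> Cinf_torus"
  shows "hat (iter_pderiv (space_dirs is) f) \<xi> = dmult is \<xi> * hat f (flip is \<xi>)"
proof (induction "is" arbitrary: \<xi>)
  case (Cons i "is")
  then show ?case
    using hat_pderiv[OF Cinf_torus_iter[OF assms, of "is"], of i \<xi>] by (simp add: space_dirs_Cons)
qed (simp add: space_dirs_def)

text \<open>Testing with the basis functions alone already determines the coefficients of a weak
  derivative.\<close>

lemma weak_deriv_hat:
  assumes "\<And>\<phi>. \<phi> \<in> Cinf_torus \<Longrightarrow>
    (\<integral>x. u x * iter_pderiv (space_dirs is) \<phi> x \<partial>dx) = (-1) ^ length is * (\<integral>x. v x * \<phi> x \<partial>dx)"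
  shows "hat v \<xi> = dmult is \<xi> * hat u (flip is \<xi>)"
proof -
  have "(-1) ^ length is * hat v \<xi> = dmult is (flip is \<xi>) * hat u (flip is \<xi>)"
    using assms[OF hartley_Cinf, of \<xi>]
    by (simp add: hat_def iter_pderiv_hartley mult.left_commute[of "u _"])
  \<comment> \<open>Multiplying by the sign once more makes it a square and removes it.\<close>
  then have "((-1) ^ length is * (-1) ^ length is) * hat v \<xi> = ((-1) ^ length is * (-1) ^ length is) * (dmult is \<xi> * hat u (flip is \<xi>))"
    by (simp only: dmult_flip mult.assoc)
  then show ?thesis by (simp flip: power_add)
qed

text \<open>Parseval's identity against an arbitrary smooth test function, after the index flip has
  been absorbed by the symmetric cube.\<close>

lemma weak_deriv_of_hat:
  assumes u: "u \<in> L2 dx" and v: "v \<in> L2 dx"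
    and h: "\<And>\<xi>. hat v \<xi> = dmult is \<xi> * hat u (flip is \<xi>)" and \<phi>: "\<phi> \<in> Cinf_torus"
  shows "(\<integral>x. u x * iter_pderiv (space_dirs is) \<phi> x \<partial>dx) = (-1) ^ length is * (\<integral>x. v x * \<phi> x \<partial>dx)"
proof (rule LIMSEQ_unique)
  show "(\<lambda>N. \<Sum>\<xi>\<in>Lam N. hat u \<xi> * hat (iter_pderiv (space_dirs is) \<phi>) \<xi>)
      \<longlonglongrightarrow> (\<integral>x. u x * iter_pderiv (space_dirs is) \<phi> x \<partial>dx)"
    by (intro Parseval_inner u Cinf_torus_L2 Cinf_torus_iter \<phi>)
  have "(\<Sum>\<xi>\<in>Lam N. hat u \<xi> * hat (iter_pderiv (space_dirs is) \<phi>) \<xi>) = (-1) ^ length is * (\<Sum>\<xi>\<in>Lam N. hat v \<xi> * hat \<phi> \<xi>)" for N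
  proof -
    have "(\<Sum>\<xi>\<in>Lam N. hat u \<xi> * hat (iter_pderiv (space_dirs is) \<phi>) \<xi>)
        = (\<Sum>\<xi>\<in>Lam N. hat u (flip is \<xi>) * hat (iter_pderiv (space_dirs is) \<phi>) (flip is \<xi>))"
      by (rule sum_Lam_flip[symmetric])
    also have "\<dots> = (\<Sum>\<xi>\<in>Lam N. (-1) ^ length is * (hat v \<xi> * hat \<phi> \<xi>))"
      by (intro sum.cong refl) (simp add: hat_iter_pderiv[OF \<phi>] dmult_flip h)
    finally show ?thesis by (simp add: sum_distrib_left)
  qed
  moreover have "(\<lambda>N. (-1) ^ length is * (\<Sum>\<xi>\<in>Lam N. hat v \<xi> * hat \<phi> \<xi>)) \<longlonglongrightarrow> (-1) ^ length is * (\<integral>x. v x * \<phi> x \<partial>dx)"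
    by (intro tendsto_mult tendsto_const Parseval_inner v Cinf_torus_L2 \<phi>)
  ultimately show "(\<lambda>N. \<Sum>\<xi>\<in>Lam N. hat u \<xi> * hat (iter_pderiv (space_dirs is) \<phi>) \<xi>)
      \<longlonglongrightarrow> (-1) ^ length is * (\<integral>x. v x * \<phi> x \<partial>dx)"
    by simp
qed

subsection \<open>Sobolev weights\<close>

definition freq :: "int^'d \<Rightarrow> real" where
  "freq \<xi> = (\<Sum>i\<in>UNIV. (2 * pi * of_int (\<xi> $ i))\<^sup>2)"

text \<open>This is the sum of the squared multipliers of all derivatives up to order s
  (\<open>sum_dmult_length_le\<close>), so that weighted sums of coefficients reproduce the Sobolev
  norms of the statement exactly and not just up to constants.\<close>

definition weight :: "nat \<Rightarrow> int^'d \<Rightarrow> real" where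
  "weight s \<xi> = (\<Sum>j\<le>s. freq \<xi> ^ j)"

lemma freq_nonneg [simp]: "0 \<le> freq \<xi>"
  by (simp add: freq_def sum_nonneg)

lemma freq_uminus [simp]: "freq (- \<xi>) = freq \<xi>"
  by (simp add: freq_def)

lemma weight_nonneg [simp]: "0 \<le> weight s \<xi>"
  by (simp add: weight_def sum_nonneg)

lemma weight_uminus [simp]: "weight s (- \<xi>) = weight s \<xi>"
  by (simp add: weight_def)

lemma weight_flip [simp]: "weight s (flip is \<xi>) = weight s \<xi>"
  by (simp add: flip_def)

lemma weight_0 [simp]: "weight 0 \<xi> = 1"
  by (simp add: weight_def)

lemma weight_Suc: "weight (Suc s) \<xi> = 1 + freq \<xi> * weight s \<xi>"
  unfolding weight_def by (subst sum.atMost_Suc_shift) (simp add: sum_distrib_left)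

lemma weight_mono: "s \<le> s' \<Longrightarrow> weight s \<xi> \<le> weight s' \<xi>"
  unfolding weight_def by (intro sum_mono2) auto

lemma weight_ge_1: "1 \<le> weight s \<xi>"
  using weight_mono[of 0 s \<xi>] by simp

lemma freq_weight_le: "freq \<xi> * weight s \<xi> \<le> weight (Suc s) \<xi>"
  by (simp add: weight_Suc)

lemma finite_lists_length [simp]: "finite {is :: 'd::finite list. length is = j}"
  using finite_lists_length_eq[of "UNIV :: 'd set" j] by simp

text \<open>Summing products of j squared frequencies over all lists of length j expands the j-th
  power of \<open>freq\<close>.\<close>

lemma sum_dmult_length: "(\<Sum>is | length is = j. (dmult is \<xi>)\<^sup>2) = freq \<xi> ^ j"
proof (induction j arbitrary: \<xi>)
  case 0
  have "{is :: 'a list. length is = 0} = {[]}" by auto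
  then show ?case by simp
next
  case (Suc j)
  have "(\<Sum>is | length is = Suc j. (dmult is \<xi>)\<^sup>2) = (\<Sum>(i, is)\<in>UNIV \<times> {is. length is = j}. (dmult (i # is) \<xi>)\<^sup>2)"
    by (rule sum.reindex_bij_witness[of _ "\<lambda>(i, is). i # is" "\<lambda>is. (hd is, tl is)"])
       (auto simp: length_Suc_conv)
  also have "\<dots> = (\<Sum>i\<in>UNIV. \<Sum>is | length is = j. (2 * pi * of_int (\<xi> $ i))\<^sup>2 * (dmult is (- \<xi>))\<^sup>2)"
    by (simp add: sum.cartesian_product[symmetric] power_mult_distrib)
  also have "\<dots> = (\<Sum>i\<in>UNIV. (2 * pi * of_int (\<xi> $ i))\<^sup>2 * freq \<xi> ^ j)"
    using Suc.IH[of "- \<xi>"] by (simp add: sum_distrib_left[symmetric])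
  finally show ?case by (simp add: freq_def sum_distrib_right)
qed

text \<open>Sobolev norms are handled through their partial sums: membership in H^s becomes a bound
  uniform in N, and every intermediate quantity is a finite sum.\<close>

definition sobsum :: "nat \<Rightarrow> nat \<Rightarrow> (real^'d \<Rightarrow> real) \<Rightarrow> real" where
  "sobsum s N u = (\<Sum>\<xi>\<in>Lam N. weight s \<xi> * (hat u \<xi>)\<^sup>2)"

lemma sobsum_nonneg [simp]: "0 \<le> sobsum s N u"
  by (simp add: sobsum_def sum_nonneg)

lemma sobsum_mono: "s \<le> s' \<Longrightarrow> sobsum s N u \<le> sobsum s' N u"
  unfolding sobsum_def by (intro sum_mono mult_right_mono weight_mono) auto

lemma sobsum_mono_N: "N \<le> N' \<Longrightarrow> sobsum s N u \<le> sobsum s N' u"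
  unfolding sobsum_def using Lam_mono by (intro sum_mono2) auto

lemma sobsum_0: "sobsum 0 N u = (\<Sum>\<xi>\<in>Lam N. (hat u \<xi>)\<^sup>2)"
  by (simp add: sobsum_def)

lemma sobsum_le_normsq: "u \<in> L2 dx \<Longrightarrow> sobsum 0 N u \<le> L2_normsq dx u"
  by (simp add: sobsum_0 Bessel)

lemma normsq_le_sobsum:
  assumes "u \<in> L2 dx" "\<And>N. sobsum s N u \<le> K"
  shows "L2_normsq dx u \<le> K"
  using order_trans[OF sobsum_mono[of 0 s] assms(2)] by (intro L2_normsq_le_hat[OF assms(1)]) (auto simp: sobsum_0)

lemma sobsum_add_le:
  assumes "u \<in> L2 dx" "v \<in> L2 dx"
  shows "sobsum s N (\<lambda>x. u x + v x) \<le> 2 * sobsum s N u + 2 * sobsum s N v"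
proof -
  have *: "(a + b)\<^sup>2 \<le> 2 * a\<^sup>2 + 2 * b\<^sup>2" for a b :: real
    using sum_squares_bound[of a b] by (simp add: power2_sum)
  have "sobsum s N (\<lambda>x. u x + v x) \<le> (\<Sum>\<xi>\<in>Lam N. weight s \<xi> * (2 * (hat u \<xi>)\<^sup>2 + 2 * (hat v \<xi>)\<^sup>2))"
    unfolding sobsum_def using * by (intro sum_mono mult_left_mono) (auto simp: hat_add assms)
  also have "\<dots> = 2 * sobsum s N u + 2 * sobsum s N v"
    by (simp add: sobsum_def sum.distrib sum_distrib_left algebra_simps)
  finally show ?thesis .
qed

lemma sobsum_cmult: "sobsum s N (\<lambda>x. c * u x) = c\<^sup>2 * sobsum s N u"
  by (simp add: sobsum_def hat_cmult power_mult_distrib sum_distrib_left mult.left_commute)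

lemma sobsum_sum_le:
  assumes "finite I" "\<And>i. i \<in> I \<Longrightarrow> u i \<in> L2 dx"
  shows "sobsum s N (\<lambda>x. \<Sum>i\<in>I. u i x) \<le> real (card I) * (\<Sum>i\<in>I. sobsum s N (u i))"
proof -
  have "sobsum s N (\<lambda>x. \<Sum>i\<in>I. u i x) \<le> (\<Sum>\<xi>\<in>Lam N. weight s \<xi> * (real (card I) * (\<Sum>i\<in>I. (hat (u i) \<xi>)\<^sup>2)))"
    unfolding sobsum_def
  proof (intro sum_mono mult_left_mono)
    fix \<xi>
    show "(hat (\<lambda>x. \<Sum>i\<in>I. u i x) \<xi>)\<^sup>2 \<le> real (card I) * (\<Sum>i\<in>I. (hat (u i) \<xi>)\<^sup>2)"
      using sum_squared_le_sum_of_squares[of "\<lambda>i. hat (u i) \<xi>" I] assms by (simp add: hat_sum mult.commute)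
  qed simp
  also have "\<dots> = real (card I) * (\<Sum>i\<in>I. sobsum s N (u i))"
    unfolding sobsum_def sum_distrib_left by (subst sum.swap) (simp add: mult_ac)
  finally show ?thesis .
qed

text \<open>The recursion \<open>weight_Suc\<close> in terms of derivatives; it drives the induction
  on s for products.\<close>

lemma sobsum_Suc_smooth:
  assumes f: "f \<in> Cinf_torus"
  shows "sobsum (Suc s) N f = sobsum 0 N f + (\<Sum>i\<in>UNIV. sobsum s N (pd (axis i 1) f))"
proof -
  have "(\<Sum>i\<in>UNIV. sobsum s N (pd (axis i 1) f))
      = (\<Sum>i\<in>UNIV. \<Sum>\<xi>\<in>Lam N. weight s \<xi> * ((2 * pi * of_int (\<xi> $ i))\<^sup>2 * (hat f (- \<xi>))\<^sup>2))"
    by (simp add: sobsum_def hat_pderiv[OF f] power_mult_distrib)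
  also have "\<dots> = (\<Sum>\<xi>\<in>Lam N. \<Sum>i\<in>UNIV. weight s \<xi> * ((2 * pi * of_int (\<xi> $ i))\<^sup>2 * (hat f (- \<xi>))\<^sup>2))"
    by (rule sum.swap)
  also have "\<dots> = (\<Sum>\<xi>\<in>Lam N. weight s (- \<xi>) * (freq (- \<xi>) * (hat f (- \<xi>))\<^sup>2))"
    by (simp only: sum_distrib_left[symmetric] sum_distrib_right[symmetric] freq_def[symmetric] weight_uminus freq_uminus)
  also have "\<dots> = (\<Sum>\<xi>\<in>Lam N. weight s \<xi> * (freq \<xi> * (hat f \<xi>)\<^sup>2))"
    by (rule sum_Lam_uminus)
  finally show ?thesis
    by (simp add: sobsum_def weight_Suc sum.distrib algebra_simps)
qed

text \<open>Induction on s with r arbitrary, since Leibniz's rule moves a derivative onto r. The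
  hypothesis bounds all truncations of f at once: multiplication mixes frequencies, so a truncation
  of the product is not controlled by the truncation of f at the same size.\<close>

lemma sobsum_mult_smooth:
  fixes r :: "real^'d \<Rightarrow> real"
  assumes "r \<in> Cinf_torus"
  shows "\<exists>C\<ge>0. \<forall>f\<in>Cinf_torus. \<forall>K. (\<forall>M. sobsum s M f \<le> K) \<longrightarrow> (\<forall>N. sobsum s N (\<lambda>x. r x * f x) \<le> C * K)"
  using assms
proof (induction s arbitrary: r)
  case 0
  obtain B where B: "\<And>x. \<bar>r x\<bar> \<le> B" using Cinf_torus_bounded[OF 0] by blast
  show ?case
  proof (intro exI[of _ "B\<^sup>2"] conjI ballI allI impI)
    fix f :: "real^'d \<Rightarrow> real" and K N assume f: "f \<in> Cinf_torus" and K: "\<forall>M. sobsum 0 M f \<le> K"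
    have "sobsum 0 N (\<lambda>x. r x * f x) \<le> L2_normsq dx (\<lambda>x. r x * f x)"
      by (intro sobsum_le_normsq Cinf_torus_L2 Cinf_torus_mult 0 f)
    also have "\<dots> \<le> B\<^sup>2 * L2_normsq dx f"
      by (rule L2_bounded_mult(2)) (use B in \<open>auto intro: Cinf_torus_measurable 0 Cinf_torus_L2 f\<close>)
    also have "\<dots> \<le> B\<^sup>2 * K"
      using K by (intro mult_left_mono normsq_le_sobsum[of _ 0] Cinf_torus_L2 f) auto
    finally show "sobsum 0 N (\<lambda>x. r x * f x) \<le> B\<^sup>2 * K" .
  qed simp
next
  case (Suc s)
  let ?d = "\<lambda>(f :: real^'d \<Rightarrow> real) i x. pd (axis i 1) f x"
  obtain B where B: "\<And>x. \<bar>r x\<bar> \<le> B" using Cinf_torus_bounded[OF Suc.prems] by blast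
  obtain C where C: "C \<ge> 0" "\<And>f K N. f \<in> Cinf_torus \<Longrightarrow> (\<forall>M. sobsum s M f \<le> K) \<Longrightarrow> sobsum s N (\<lambda>x. r x * f x) \<le> C * K"
    using Suc.IH[OF Suc.prems] by blast
  define Q where "Q i C \<longleftrightarrow> C \<ge> 0 \<and> (\<forall>f\<in>Cinf_torus. \<forall>K. (\<forall>M. sobsum s M f \<le> K) \<longrightarrow>
    (\<forall>N. sobsum s N (\<lambda>x. ?d r i x * f x) \<le> C * K))" for i C
  have "\<forall>i. \<exists>C. Q i C"
    unfolding Q_def by (rule allI, rule Suc.IH, rule Cinf_torus_pderiv[OF Suc.prems])
  then obtain D where QD: "\<And>i. Q i (D i)" by metis
  have D: "D i \<ge> 0" "f \<in> Cinf_torus \<Longrightarrow> (\<forall>M. sobsum s M f \<le> K) \<Longrightarrow> sobsum s N (\<lambda>x. ?d r i x * f x) \<le> D i * K" for i f K N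
    using QD[of i] unfolding Q_def by blast+
  show ?case
  proof (intro exI[of _ "B\<^sup>2 + (\<Sum>i\<in>UNIV. 2 * C + 2 * D i)"] conjI ballI allI impI)
    show "0 \<le> B\<^sup>2 + (\<Sum>i\<in>UNIV. 2 * C + 2 * D i)" using C D by (intro add_nonneg_nonneg sum_nonneg) auto
    fix f :: "real^'d \<Rightarrow> real" and K N assume f: "f \<in> Cinf_torus" and K: "\<forall>M. sobsum (Suc s) M f \<le> K"
    have K0: "sobsum 0 M f \<le> K" and Ks: "sobsum s M f \<le> K" for M
      using K order_trans[OF sobsum_mono[of _ "Suc s" M f]] by auto
    have Kd: "sobsum s M (?d f i) \<le> K" for i M
    proof -
      have "sobsum s M (?d f i) \<le> (\<Sum>i\<in>UNIV. sobsum s M (?d f i))"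
        by (rule member_le_sum) auto
      also have "\<dots> \<le> sobsum (Suc s) M f" by (simp add: sobsum_Suc_smooth[OF f])
      finally show ?thesis using K order_trans by blast
    qed
    have rf: "(\<lambda>x. r x * f x) \<in> Cinf_torus" by (rule Cinf_torus_mult[OF Suc.prems f])
    have "sobsum 0 N (\<lambda>x. r x * f x) \<le> L2_normsq dx (\<lambda>x. r x * f x)"
      by (intro sobsum_le_normsq Cinf_torus_L2 rf)
    also have "\<dots> \<le> B\<^sup>2 * L2_normsq dx f"
      by (rule L2_bounded_mult(2)) (use B in \<open>auto intro: Cinf_torus_measurable Suc.prems Cinf_torus_L2 f\<close>)
    also have "\<dots> \<le> B\<^sup>2 * K"
      using K0 by (intro mult_left_mono normsq_le_sobsum[of _ 0] Cinf_torus_L2 f) auto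
    finally have 1: "sobsum 0 N (\<lambda>x. r x * f x) \<le> B\<^sup>2 * K" .
    have 2: "sobsum s N (?d (\<lambda>x. r x * f x) i) \<le> (2 * C + 2 * D i) * K" for i
    proof -
      have "sobsum s N (?d (\<lambda>x. r x * f x) i) = sobsum s N (\<lambda>x. r x * ?d f i x + ?d r i x * f x)"
        using frechet_derivative_smooth_mult[OF Cinf_torusD(1)[OF Suc.prems] Cinf_torusD(1)[OF f]] by simp
      also have "\<dots> \<le> 2 * sobsum s N (\<lambda>x. r x * ?d f i x) + 2 * sobsum s N (\<lambda>x. ?d r i x * f x)"
        by (intro sobsum_add_le Cinf_torus_L2 Cinf_torus_mult Cinf_torus_pderiv Suc.prems f)
      also have "\<dots> \<le> 2 * (C * K) + 2 * (D i * K)"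
        using C(2)[OF Cinf_torus_pderiv[OF f]] D(2)[OF f] Kd Ks by (intro add_mono mult_left_mono) auto
      finally show ?thesis by (simp add: algebra_simps)
    qed
    have "sobsum (Suc s) N (\<lambda>x. r x * f x) \<le> B\<^sup>2 * K + (\<Sum>i\<in>UNIV. (2 * C + 2 * D i) * K)"
      unfolding sobsum_Suc_smooth[OF rf] by (intro add_mono 1 sum_mono 2)
    then show "sobsum (Suc s) N (\<lambda>x. r x * f x) \<le> (B\<^sup>2 + (\<Sum>i\<in>UNIV. 2 * C + 2 * D i)) * K"
      by (simp add: distrib_right sum_distrib_right)
  qed
qed

text \<open>Partial sums of u are smooth and obey the same bound K. For fixed N only finitely many
  coefficients of the product matter, and each of them passes to the limit.\<close>

lemma sobsum_mult:
  assumes r: "r \<in> Cinf_torus"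
  obtains C where "C \<ge> 0"
    "\<And>u K N. u \<in> L2 dx \<Longrightarrow> (\<And>M. sobsum s M u \<le> K) \<Longrightarrow> sobsum s N (\<lambda>x. r x * u x) \<le> C * K"
proof -
  obtain C where C: "C \<ge> 0" "\<And>f K N. f \<in> Cinf_torus \<Longrightarrow> (\<forall>M. sobsum s M f \<le> K) \<Longrightarrow> sobsum s N (\<lambda>x. r x * f x) \<le> C * K"
    using sobsum_mult_smooth[OF r] by blast
  have "sobsum s N (\<lambda>x. r x * u x) \<le> C * K" if u: "u \<in> L2 dx" and K: "\<And>M. sobsum s M u \<le> K" for u K N
  proof -
    let ?p = "\<lambda>M. trig (hat u) (Lam M)"
    have b: "sobsum s M' (?p M) \<le> K" for M M'
    proof -
      have "sobsum s M' (?p M) = (\<Sum>\<xi>\<in>Lam M'. if \<xi> \<in> Lam M then weight s \<xi> * (hat u \<xi>)\<^sup>2 else 0)"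
        unfolding sobsum_def by (intro sum.cong) (auto simp: hat_trig)
      also have "\<dots> = (\<Sum>\<xi>\<in>Lam M' \<inter> Lam M. weight s \<xi> * (hat u \<xi>)\<^sup>2)"
        by (simp add: sum.inter_restrict)
      also have "\<dots> \<le> sobsum s M u"
        unfolding sobsum_def by (intro sum_mono2) auto
      finally show ?thesis using K order_trans by blast
    qed
    have lim: "(\<lambda>M. hat (\<lambda>x. r x * ?p M x) \<xi>) \<longlonglongrightarrow> hat (\<lambda>x. r x * u x) \<xi>" for \<xi>
    proof -
      have "(\<lambda>M. \<integral>x. ?p M x * (r x * hartley \<xi> x) \<partial>dx) \<longlonglongrightarrow> (\<integral>x. u x * (r x * hartley \<xi> x) \<partial>dx)"
        by (rule L2_inner_tendsto[OF _ u _ partial_sums_tendsto[OF u]])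
           (auto intro!: Cinf_torus_L2 Cinf_torus_mult r)
      then show ?thesis by (simp add: hat_def mult_ac)
    qed
    have "(\<lambda>M. sobsum s N (\<lambda>x. r x * ?p M x)) \<longlonglongrightarrow> sobsum s N (\<lambda>x. r x * u x)"
      unfolding sobsum_def by (intro tendsto_intros lim)
    moreover have "sobsum s N (\<lambda>x. r x * ?p M x) \<le> C * K" for M
      using C(2)[OF trig_Cinf] b by blast
    ultimately show ?thesis
      by (intro LIMSEQ_le_const2[of _ _ "C * K"]) auto
  qed
  with C(1) that show ?thesis by blast
qed

lemma sum_dmult_length_le: "(\<Sum>j\<le>s. \<Sum>is | length is = j. (dmult is \<xi>)\<^sup>2) = weight s \<xi>"
  by (simp add: sum_dmult_length weight_def)

lemma sobsum_eq_sum_derivs: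
  assumes v: "\<And>is \<xi>. length is \<le> s \<Longrightarrow> hat (v is) \<xi> = dmult is \<xi> * hat u (flip is \<xi>)"
  shows "(\<Sum>j\<le>s. \<Sum>is | length is = j. sobsum 0 N (v is)) = sobsum s N u"
proof -
  have 1: "sobsum 0 N (v is) = (\<Sum>\<xi>\<in>Lam N. (dmult is \<xi>)\<^sup>2 * (hat u \<xi>)\<^sup>2)" if "length is \<le> s" for "is"
  proof -
    have "sobsum 0 N (v is) = (\<Sum>\<xi>\<in>Lam N. (dmult is (flip is \<xi>))\<^sup>2 * (hat u (flip is \<xi>))\<^sup>2)"
      unfolding sobsum_0 by (intro sum.cong refl) (simp add: v[OF that] power_mult_distrib dmult_flip power_mult[symmetric])
    then show ?thesis using sum_Lam_flip[of "\<lambda>\<xi>. (dmult is \<xi>)\<^sup>2 * (hat u \<xi>)\<^sup>2" "is" N] by simp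
  qed
  have "(\<Sum>j\<le>s. \<Sum>is | length is = j. sobsum 0 N (v is))
      = (\<Sum>j\<le>s. \<Sum>is | length is = j. \<Sum>\<xi>\<in>Lam N. (dmult is \<xi>)\<^sup>2 * (hat u \<xi>)\<^sup>2)"
    by (intro sum.cong refl) (auto intro!: 1)
  also have "\<dots> = (\<Sum>j\<le>s. \<Sum>\<xi>\<in>Lam N. \<Sum>is | length is = j. (dmult is \<xi>)\<^sup>2 * (hat u \<xi>)\<^sup>2)"
    by (intro sum.cong refl sum.swap)
  also have "\<dots> = (\<Sum>\<xi>\<in>Lam N. \<Sum>j\<le>s. \<Sum>is | length is = j. (dmult is \<xi>)\<^sup>2 * (hat u \<xi>)\<^sup>2)"
    by (rule sum.swap)
  also have "\<dots> = sobsum s N u"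
    unfolding sobsum_def by (simp only: sum_distrib_right[symmetric] sum_dmult_length_le)
  finally show ?thesis .
qed

lemma sobsum_tendsto:
  assumes v: "\<And>is. length is \<le> s \<Longrightarrow> v is \<in> L2 dx"
    "\<And>is \<xi>. length is \<le> s \<Longrightarrow> hat (v is) \<xi> = dmult is \<xi> * hat u (flip is \<xi>)"
  shows "(\<lambda>N. sobsum s N u) \<longlonglongrightarrow> (\<Sum>j\<le>s. \<Sum>is | length is = j. L2_normsq dx (v is))"
proof -
  have eq: "sobsum s N u = (\<Sum>j\<le>s. \<Sum>is | length is = j. sobsum 0 N (v is))" for N
    by (rule sobsum_eq_sum_derivs[symmetric]) (rule v(2))
  show ?thesis
    unfolding eq sobsum_0 by (intro tendsto_sum Parseval_normsq v(1)) auto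
qed

lemma incseq_sobsum: "incseq (\<lambda>N. sobsum s N u)"
  by (simp add: incseq_def sobsum_mono_N)

section \<open>Functions on the space-time cylinder\<close>

subsection \<open>Product structure and weights\<close>

text \<open>The sigma-algebras agree because the identity map is measurable in both directions; the
  measures agree on rectangles. Everything later that slices in time rests on this.\<close>

lemma cyl_leb_pair: "dtx T = dt T \<Otimes>\<^sub>M (dx :: (real^'d) measure)"
proof (rule pair_measure_eqI[symmetric])
  let ?\<Omega> = "{0<..<T} \<times> (torus_cell :: (real^'d) set)"
  let ?M = "dt T" and ?N = "dx :: (real^'d) measure"
  have \<Omega>: "?\<Omega> \<in> sets borel"
    by (intro borel_Times) auto
  have sc: "sets (dtx T) = sets (restrict_space (borel :: (real \<times> (real^'d)) measure) ?\<Omega>)"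
    unfolding cyl_leb_def by (intro sets_restrict_space_cong) simp
  have spc: "space (dtx T) = ?\<Omega>" by (simp add: cyl_leb_def space_restrict_space)
  show "sets (?M \<Otimes>\<^sub>M ?N) = sets (dtx T)"
  proof
    have "(\<lambda>z. (fst z, snd z)) \<in> measurable (dtx T) (?M \<Otimes>\<^sub>M ?N)"
    proof (rule measurable_Pair)
      let ?C = "dtx T :: (real \<times> (real^'d)) measure"
      have f: "fst \<in> measurable ?C (borel :: real measure)" "snd \<in> measurable ?C (borel :: (real^'d) measure)"
        unfolding cyl_leb_def by (intro measurable_restrict_space1; simp add: borel_measurable_continuous_onI continuous_on_fst continuous_on_snd)+
      show "(\<lambda>z. fst z) \<in> measurable ?C ?M"
        unfolding time_leb_def using f(1) by (intro measurable_restrict_space2) (auto simp: spc)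
      show "(\<lambda>z. snd z) \<in> measurable ?C ?N"
        unfolding torus_leb_def using f(2) by (intro measurable_restrict_space2) (auto simp: spc)
    qed
    then have m: "(\<lambda>z. z) \<in> measurable (dtx T) (?M \<Otimes>\<^sub>M ?N)" by simp
    show "sets (?M \<Otimes>\<^sub>M ?N) \<subseteq> sets (dtx T)"
    proof
      fix A assume A: "A \<in> sets (?M \<Otimes>\<^sub>M ?N)"
      have "A \<subseteq> ?\<Omega>" using sets.sets_into_space[OF A] by (simp add: space_pair_measure)
      then show "A \<in> sets (dtx T)"
        using measurable_sets[OF m A] by (simp add: spc Int_absorb2)
    qed
    have i: "(\<lambda>x. x) \<in> measurable ?M borel" "(\<lambda>x. x) \<in> measurable ?N borel"
      by (auto intro!: borel_measurable_time_leb borel_measurable_torus_leb)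
    have "(\<lambda>z. (fst z, snd z)) \<in> measurable (?M \<Otimes>\<^sub>M ?N) (borel \<Otimes>\<^sub>M borel)"
      by (intro measurable_Pair measurable_compose[OF measurable_fst i(1)] measurable_compose[OF measurable_snd i(2)])
    then have m: "(\<lambda>z. z) \<in> measurable (?M \<Otimes>\<^sub>M ?N) borel" by (simp add: borel_prod)
    show "sets (dtx T) \<subseteq> sets (?M \<Otimes>\<^sub>M ?N)"
    proof
      fix A :: "(real \<times> (real^'d)) set" assume "A \<in> sets (dtx T)"
      then obtain B where "B \<in> sets borel" "A = ?\<Omega> \<inter> B" by (auto simp: sc sets_restrict_space)
      then show "A \<in> sets (?M \<Otimes>\<^sub>M ?N)"
        using measurable_sets[OF m] by (simp add: space_pair_measure Int_commute)
    qed
  qed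
  fix A B assume A: "A \<in> sets ?M" and B: "B \<in> sets ?N"
  have A': "A \<in> sets borel" "A \<subseteq> {0<..<T}" using A by (auto simp: sets_time_leb sets_restrict_space)
  have B': "B \<in> sets borel" "B \<subseteq> torus_cell" using B by (auto simp: sets_torus_leb sets_restrict_space)
  have "emeasure (dtx T) (A \<times> B) = emeasure lborel (A \<times> B)"
    unfolding cyl_leb_def using A' B' \<Omega> by (subst emeasure_restrict_space) auto
  also have "\<dots> = emeasure lborel A * emeasure lborel B"
    unfolding lborel_prod[symmetric] using A' B' by (subst lborel.emeasure_pair_measure_Times) auto
  also have "emeasure lborel A = emeasure ?M A"
    unfolding time_leb_def using A' by (subst emeasure_restrict_space) auto
  also have "emeasure lborel B = emeasure ?N B"
    unfolding torus_leb_def using B' by (subst emeasure_restrict_space) auto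
  finally show "emeasure ?M A * emeasure ?N B = emeasure (dtx T) (A \<times> B)" by simp
qed (auto intro: time.sigma_finite_measure_axioms torus.sigma_finite_measure_axioms)

interpretation cyl: pair_sigma_finite "dt T" "dx :: (real^'d) measure" for T
  by standard

lemma space_cyl_leb [simp]: "space (dtx T) = {0<..<T} \<times> torus_cell"
  by (simp add: cyl_leb_pair space_pair_measure)

lemma finite_measure_cyl_leb: "finite_measure (dtx T :: (real \<times> (real^'d)) measure)"
proof (rule finite_measureI)
  have "emeasure (dtx T) (space (dtx T :: (real \<times> (real^'d)) measure)) =
      emeasure (dt T) (space (dt T)) * emeasure dx (space (dx :: (real^'d) measure))"
    unfolding cyl_leb_pair space_pair_measure
    by (rule torus.emeasure_pair_measure_Times[OF sets.top sets.top])
  then show "emeasure (dtx T) (space (dtx T :: (real \<times> (real^'d)) measure)) \<noteq> \<infinity>"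
    using time.emeasure_finite[of T "space (dt T)"] emeasure_torus_leb by (simp add: ennreal_mult_eq_top_iff)
qed

interpretation cylm: finite_measure "dtx T :: (real \<times> (real^'d)) measure" for T
  by (rule finite_measure_cyl_leb)

lemma density_bounded_weight:
  fixes \<rho> :: "'a \<Rightarrow> real"
  assumes \<rho> [measurable]: "\<rho> \<in> borel_measurable M" and lo: "0 < lo" "\<And>x. lo \<le> \<rho> x" and hi: "\<And>x. \<rho> x \<le> hi"
  shows "L2 (density M (\<lambda>x. ennreal (\<rho> x))) = L2 M" (is ?A)
    and "u \<in> L2 M \<Longrightarrow> lo * L2_normsq M u \<le> L2_normsq (density M (\<lambda>x. ennreal (\<rho> x))) u"
    and "u \<in> L2 M \<Longrightarrow> L2_normsq (density M (\<lambda>x. ennreal (\<rho> x))) u \<le> hi * L2_normsq M u"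
    and "(AE x in density M (\<lambda>x. ennreal (\<rho> x)). P x) \<longleftrightarrow> (AE x in M. P x)"
proof -
  have pos: "0 < \<rho> x" for x using lo by (rule less_le_trans)
  let ?D = "density M (\<lambda>x. ennreal (\<rho> x))"
  have ie: "integrable ?D f \<longleftrightarrow> integrable M (\<lambda>x. \<rho> x * f x)" if "f \<in> borel_measurable M" for f :: "'a \<Rightarrow> real"
    using pos that by (subst integrable_density) (auto simp: less_imp_le)
  have i2: "integrable M (\<lambda>x. \<rho> x * f x) \<longleftrightarrow> integrable M f" if [measurable]: "f \<in> borel_measurable M" for f :: "'a \<Rightarrow> real"
  proof
    assume "integrable M (\<lambda>x. \<rho> x * f x)"
    then have "integrable M (\<lambda>x. inverse lo * (\<rho> x * f x))" by simp
    then show "integrable M f"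
    proof (rule Bochner_Integration.integrable_bound)
      show "AE x in M. norm (f x) \<le> norm (inverse lo * (\<rho> x * f x))"
      proof (rule AE_I2)
        fix x
        have "lo * \<bar>f x\<bar> \<le> \<rho> x * \<bar>f x\<bar>" using lo by (intro mult_right_mono) auto
        then show "norm (f x) \<le> norm (inverse lo * (\<rho> x * f x))"
          using lo(1) pos[of x] by (simp add: abs_mult field_simps)
      qed
    qed simp
  next
    assume "integrable M f"
    then have "integrable M (\<lambda>x. hi * f x)" by simp
    then show "integrable M (\<lambda>x. \<rho> x * f x)"
    proof (rule Bochner_Integration.integrable_bound)
      show "AE x in M. norm (\<rho> x * f x) \<le> norm (hi * f x)"
        using hi pos by (intro AE_I2) (auto simp: abs_mult intro!: mult_right_mono intro: order_trans[OF _ abs_ge_self] simp: abs_of_pos)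
    qed simp
  qed
  show ?A
    unfolding L2_def using ie i2 by auto
  have n: "L2_normsq ?D u = (\<integral>x. \<rho> x * (u x)\<^sup>2 \<partial>M)" if "u \<in> L2 M"
    unfolding L2_normsq_def using pos that by (subst integral_density) (auto simp: less_imp_le L2_iff)
  have i3: "integrable M (\<lambda>x. \<rho> x * (u x)\<^sup>2)" "integrable M (\<lambda>x. (u x)\<^sup>2)" if "u \<in> L2 M"
    using that i2[of "\<lambda>x. (u x)\<^sup>2"] by (auto simp: L2_iff)
  show "lo * L2_normsq M u \<le> L2_normsq ?D u" if u: "u \<in> L2 M"
  proof -
    have "(\<integral>x. lo * (u x)\<^sup>2 \<partial>M) \<le> (\<integral>x. \<rho> x * (u x)\<^sup>2 \<partial>M)"
      using i3[OF u] lo by (intro integral_mono) (auto intro: mult_right_mono)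
    then show ?thesis unfolding n[OF u] by (simp add: L2_normsq_def)
  qed
  show "L2_normsq ?D u \<le> hi * L2_normsq M u" if u: "u \<in> L2 M"
  proof -
    have "(\<integral>x. \<rho> x * (u x)\<^sup>2 \<partial>M) \<le> (\<integral>x. hi * (u x)\<^sup>2 \<partial>M)"
      using i3[OF u] hi by (intro integral_mono) (auto intro: mult_right_mono)
    then show ?thesis unfolding n[OF u] by (simp add: L2_normsq_def)
  qed
  show "(AE x in ?D. P x) \<longleftrightarrow> (AE x in M. P x)"
    using pos by (subst AE_density) auto
qed

lemma weight_bounds:
  assumes "U \<in> Cinf_torus"
  obtains lo hi where "0 < lo" "\<And>x. lo \<le> exp (- U x)" "\<And>x. exp (- U x) \<le> hi"
proof -
  obtain B where B: "\<And>x. \<bar>U x\<bar> \<le> B" using Cinf_torus_bounded[OF assms] by blast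
  have "exp (- B) \<le> exp (- U x) \<and> exp (- U x) \<le> exp B" for x
    using B[of x] by (auto simp: abs_le_iff)
  then show ?thesis using that[of "exp (- B)" "exp B"] by auto
qed

text \<open>One pair of bounds of the weight serves the torus and all cylinders, so a single
  \<open>lo\<close> and \<open>hi\<close> enter the final constant.\<close>

lemma eta_equiv:
  fixes U :: "real^'d \<Rightarrow> real"
  assumes U: "U \<in> Cinf_torus"
  shows L2_eta: "L2 (eta U) = L2 dx"
    and L2_cyl_eta: "L2 (cyl_eta T U) = L2 (dtx T)"
    and AE_eta: "(AE x in eta U. P x) \<longleftrightarrow> (AE x in dx. P x)"
    and AE_cyl_eta: "(AE z in cyl_eta T U. Q z) \<longleftrightarrow> (AE z in dtx T. Q z)"
    and normsq_eta_bounds: "\<exists>lo hi. 0 < lo \<and> 0 < hi \<and> (\<forall>u\<in>L2 dx. lo * L2_normsq dx u \<le> L2_normsq (eta U) u \<and>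
      L2_normsq (eta U) u \<le> hi * L2_normsq dx u) \<and>
      (\<forall>T. \<forall>u\<in>L2 (dtx T). lo * L2_normsq (dtx T) u \<le> L2_normsq (cyl_eta T U) u \<and>
      L2_normsq (cyl_eta T U) u \<le> hi * L2_normsq (dtx T) u)"
proof -
  obtain lo hi where b: "0 < lo" "\<And>x. lo \<le> exp (- U x)" "\<And>x. exp (- U x) \<le> hi"
    using weight_bounds[OF U] by blast
  have m: "(\<lambda>x. exp (- U x)) \<in> borel_measurable dx"
    by (intro borel_measurable_torus_leb measurable_compose[OF smooth_fun_measurable[OF Cinf_torusD(1)[OF U]]]) auto
  have m': "(\<lambda>z :: real \<times> (real^'d). exp (- U (snd z))) \<in> borel_measurable (dtx T)" for T
    unfolding cyl_leb_pair by (rule measurable_compose[OF measurable_snd m])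
  have e: "eta U = density dx (\<lambda>x. ennreal (exp (- U x)))" by (simp add: eta_def)
  have ce: "cyl_eta T U = density (dtx T) (\<lambda>z. ennreal (exp (- U (snd z))))" for T
    by (simp add: cyl_eta_def case_prod_unfold)
  note A = density_bounded_weight[OF m b, folded e]
  have b': "\<And>z :: real \<times> (real^'d). lo \<le> exp (- U (snd z))" "\<And>z :: real \<times> (real^'d). exp (- U (snd z)) \<le> hi"
    using b by auto
  note B = density_bounded_weight[OF m' b(1) b', folded ce]
  show "L2 (eta U) = L2 dx" "L2 (cyl_eta T U) = L2 (dtx T)"
    "(AE x in eta U. P x) \<longleftrightarrow> (AE x in dx. P x)" "(AE z in cyl_eta T U. Q z) \<longleftrightarrow> (AE z in dtx T. Q z)"
    using A B by auto
  have "0 < hi" using less_le_trans[OF b(1) order_trans[OF b(2) b(3)]] .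
  then show "\<exists>lo hi. 0 < lo \<and> 0 < hi \<and> (\<forall>u\<in>L2 dx. lo * L2_normsq dx u \<le> L2_normsq (eta U) u \<and>
      L2_normsq (eta U) u \<le> hi * L2_normsq dx u) \<and>
      (\<forall>T. \<forall>u\<in>L2 (dtx T). lo * L2_normsq (dtx T) u \<le> L2_normsq (cyl_eta T U) u \<and>
      L2_normsq (cyl_eta T U) u \<le> hi * L2_normsq (dtx T) u)"
    using A B b(1) by (intro exI[of _ lo] exI[of _ hi]) auto
qed

subsection \<open>Time slices\<close>

lemma cyl_section_measurable:
  "u \<in> borel_measurable (dtx T) \<Longrightarrow> 0 < t \<Longrightarrow> t < T \<Longrightarrow> slice u t \<in> borel_measurable dx"
  unfolding cyl_leb_pair by (rule measurable_compose[OF measurable_Pair1']) auto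

lemma cyl_integral_inner:
  assumes u: "u \<in> L2 (dtx T)" and v: "v \<in> L2 (dtx T)"
  shows "(\<integral>z. u z * v z \<partial>dtx T) = (\<integral>t. (\<integral>x. u (t, x) * v (t, x) \<partial>dx) \<partial>dt T)"
    and "integrable (dt T) (\<lambda>t. \<integral>x. u (t, x) * v (t, x) \<partial>dx)"
proof -
  have i: "integrable (dt T \<Otimes>\<^sub>M dx) (\<lambda>z. u z * v z)"
    using L2_mult_integrable[OF u v] by (simp add: cyl_leb_pair)
  show "(\<integral>z. u z * v z \<partial>dtx T) = (\<integral>t. (\<integral>x. u (t, x) * v (t, x) \<partial>dx) \<partial>dt T)"
    using cyl.integral_fst'[OF i] by (simp add: cyl_leb_pair)
  show "integrable (dt T) (\<lambda>t. \<integral>x. u (t, x) * v (t, x) \<partial>dx)"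
    using cyl.integrable_fst'[OF i] by simp
qed

lemma cyl_normsq:
  assumes u: "u \<in> L2 (dtx T)"
  shows "L2_normsq (dtx T) u = (\<integral>t. L2_normsq dx (slice u t) \<partial>dt T)"
    and "integrable (dt T) (\<lambda>t. L2_normsq dx (slice u t))"
  using cyl_integral_inner[OF u u] by (simp_all add: L2_normsq_def power2_eq_square)

lemma cyl_section_L2:
  assumes u: "u \<in> L2 (dtx T)"
  shows "AE t in dt T. slice u t \<in> L2 dx"
proof -
  have i: "integrable (dt T \<Otimes>\<^sub>M dx) (\<lambda>z. (u z)\<^sup>2)"
    using L2_sq_integrable[OF u] by (simp add: cyl_leb_pair)
  from cyl.AE_integrable_fst'[OF i] AE_space show ?thesis
  proof eventually_elim
    case (elim t)
    then show ?case using cyl_section_measurable[OF L2_meas[OF u], of t] by (auto simp: L2_iff)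
  qed
qed

lemma L2_cylI:
  assumes u: "u \<in> borel_measurable (dtx T)" and s: "AE t in dt T. slice u t \<in> L2 dx \<and> L2_normsq dx (slice u t) \<le> k t"
    and k: "integrable (dt T) k"
  shows "u \<in> L2 (dtx T)"
proof (rule L2_I_nn[OF u])
  have [measurable]: "u \<in> borel_measurable (dt T \<Otimes>\<^sub>M dx)" using u by (simp add: cyl_leb_pair)
  have "(\<integral>\<^sup>+z. ennreal ((u z)\<^sup>2) \<partial>dtx T) = (\<integral>\<^sup>+t. \<integral>\<^sup>+x. ennreal ((u (t, x))\<^sup>2) \<partial>dx \<partial>dt T)"
    unfolding cyl_leb_pair by (rule torus.nn_integral_fst[symmetric]) measurable
  also have "\<dots> \<le> (\<integral>\<^sup>+t. ennreal (k t) \<partial>dt T)"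
  proof (rule nn_integral_mono_AE, use s in eventually_elim)
    case (elim t)
    then show ?case using L2_normsq_eq_nn[of "\<lambda>x. u (t, x)" dx] by (metis ennreal_leI)
  qed
  also have "\<dots> < \<infinity>"
  proof -
    have "(\<integral>\<^sup>+t. ennreal (k t) \<partial>dt T) \<le> (\<integral>\<^sup>+t. ennreal (norm (k t)) \<partial>dt T)"
      by (intro nn_integral_mono ennreal_leI) simp
    also have "\<dots> < \<infinity>" using k unfolding integrable_iff_bounded by simp
    finally show ?thesis .
  qed
  finally show "(\<integral>\<^sup>+z. ennreal ((u z)\<^sup>2) \<partial>dtx T) < \<infinity>" .
qed

lemma cyl_hat_measurable:
  fixes u :: "'d::finite st_fun"
  assumes "u \<in> borel_measurable (dtx T)" "r \<in> borel_measurable dx"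
  shows "(\<lambda>t. \<integral>x. u (t, x) * r x \<partial>dx) \<in> borel_measurable (dt T)"
proof -
  have [measurable]: "u \<in> borel_measurable (dt T \<Otimes>\<^sub>M dx)" "r \<in> borel_measurable dx"
    using assms by (simp_all add: cyl_leb_pair)
  show ?thesis by measurable
qed

lemma cyl_inner_L2:
  assumes u: "u \<in> L2 (dtx T)" and r: "r \<in> Cinf_torus"
  shows "(\<lambda>t. \<integral>x. u (t, x) * r x \<partial>dx) \<in> L2 (dt T)"
proof -
  let ?f = "\<lambda>t. \<integral>x. u (t, x) * r x \<partial>dx"
  have m: "?f \<in> borel_measurable (dt T)"
    by (rule cyl_hat_measurable[OF L2_meas[OF u] Cinf_torus_measurable[OF r]])
  have "integrable (dt T) (\<lambda>t. (?f t)\<^sup>2)"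
  proof (rule Bochner_Integration.integrable_bound)
    show "integrable (dt T) (\<lambda>t. L2_normsq dx (slice u t) * L2_normsq dx r)"
      using cyl_normsq(2)[OF u] by simp
    show "AE t in dt T. norm ((?f t)\<^sup>2) \<le> norm (L2_normsq dx (slice u t) * L2_normsq dx r)"
      using cyl_section_L2[OF u] by eventually_elim (use L2_Cauchy_Schwarz[OF _ Cinf_torus_L2[OF r]] in auto)
  qed (use m in measurable)
  then show ?thesis using m by (simp add: L2_iff)
qed

lemma cyl_hat_L2: "u \<in> L2 (dtx T) \<Longrightarrow> (\<lambda>t. hat (slice u t) \<xi>) \<in> L2 (dt T)"
  unfolding hat_def by (rule cyl_inner_L2) auto

lemma cyl_hat_integrable: "u \<in> L2 (dtx T) \<Longrightarrow> integrable (dt T) (\<lambda>t. hat (slice u t) \<xi>)"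
  by (rule time.L2_integrable[OF cyl_hat_L2])

lemma AE_cyl_iterated:
  "AE z in dtx T. P z \<Longrightarrow> AE t in dt T. AE x in dx. P (t, x)"
  unfolding cyl_leb_pair by (rule cyl.AE_pair)

lemma AE_cyl_eqI:
  assumes "u \<in> borel_measurable (dtx T)" "v \<in> borel_measurable (dtx T)"
    and "AE t in dt T. AE x in dx. u (t, x) = (v (t, x) :: real)"
  shows "AE z in dtx T. u z = v z"
  unfolding cyl_leb_pair
proof (rule cyl.AE_pair_measure)
  have [measurable]: "u \<in> borel_measurable (dt T \<Otimes>\<^sub>M dx)" "v \<in> borel_measurable (dt T \<Otimes>\<^sub>M dx)"
    using assms by (simp_all add: cyl_leb_pair)
  show "{z \<in> space (dt T \<Otimes>\<^sub>M dx). u z = v z} \<in> sets (dt T \<Otimes>\<^sub>M dx)"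
    by measurable
qed (use assms in simp)

text \<open>The lattice is countable, so the exceptional times of all modes form one null set, and
  completeness applies on each remaining slice.\<close>

lemma cyl_eq_of_hat:
  assumes u: "u \<in> L2 (dtx T)" and v: "v \<in> L2 (dtx T)"
    and h: "\<And>\<xi>. AE t in dt T. hat (slice u t) \<xi> = hat (slice v t) \<xi>"
  shows "AE z in dtx T. u z = v z"
proof (rule AE_cyl_eqI[OF L2_meas[OF u] L2_meas[OF v]])
  have "AE t in dt T. \<forall>\<xi>. hat (slice u t) \<xi> = hat (slice v t) \<xi>"
    using h by (simp add: AE_all_countable)
  with cyl_section_L2[OF u] cyl_section_L2[OF v]
  show "AE t in dt T. AE x in dx. u (t, x) = v (t, x)"
  proof eventually_elim
    case (elim t)
    have "AE x in dx. u (t, x) - v (t, x) = 0"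
      by (rule hat_zero_imp_AE_zero) (use elim in \<open>auto simp: hat_diff intro: L2_diff\<close>)
    then show ?case by eventually_elim simp
  qed
qed

lemma tensor_measurable:
  assumes "a \<in> borel_measurable (dt T)" "r \<in> borel_measurable dx"
  shows "(\<lambda>(t, x). a t * r x :: real) \<in> borel_measurable (dtx T)"
proof -
  have [measurable]: "a \<in> borel_measurable (dt T)" "r \<in> borel_measurable dx" using assms .
  show ?thesis unfolding cyl_leb_pair by measurable
qed

lemma tensor_L2:
  assumes a: "a \<in> L2 (dt T)" and r: "r \<in> Cinf_torus"
  shows "(\<lambda>(t, x). a t * r x) \<in> L2 (dtx T)"
proof (rule L2_cylI[where k = "\<lambda>t. L2_normsq dx r * (a t)\<^sup>2"])
  show "(\<lambda>(t, x). a t * r x) \<in> borel_measurable (dtx T)"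
    by (intro tensor_measurable L2_meas[OF a] Cinf_torus_measurable[OF r])
  show "integrable (dt T) (\<lambda>t. L2_normsq dx r * (a t)\<^sup>2)" using a by (simp add: L2_iff)
qed (auto intro!: AE_I2 L2_cmult[OF Cinf_torus_L2[OF r]] simp: L2_normsq_cmult)

text \<open>Riesz-Fischer carried out in L2 of the cylinder and not slice by slice, so that the
  limit is jointly measurable from the start.\<close>

lemma cyl_synthesis:
  fixes a :: "int^'d \<Rightarrow> real \<Rightarrow> real"
  assumes a: "\<And>\<xi>. a \<xi> \<in> L2 (dt T)" and K: "\<And>N. (\<integral>t. (\<Sum>\<xi>\<in>Lam N. (a \<xi> t)\<^sup>2) \<partial>dt T) \<le> K"
  obtains v where "v \<in> L2 (dtx T)" "\<And>\<xi>. AE t in dt T. hat (slice v t) \<xi> = a \<xi> t"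
proof -
  define S where "S N = (\<lambda>z. \<Sum>\<xi>\<in>Lam N. (\<lambda>(t, x). a \<xi> t * hartley \<xi> x) z)" for N
  have S_sec: "(slice (S N) t) = trig (\<lambda>\<xi>. a \<xi> t) (Lam N)" for N t
    by (simp add: S_def trig_def fun_eq_iff)
  have S_val: "S N (t, x) = trig (\<lambda>\<xi>. a \<xi> t) (Lam N) x" for N t x
    by (simp add: S_def trig_def)
  have S_L2: "S N \<in> L2 (dtx T)" for N
    unfolding S_def by (intro L2_sum tensor_L2 a) simp
  have ia: "integrable (dt T) (\<lambda>t. (a \<xi> t)\<^sup>2)" for \<xi> using a by (simp add: L2_iff)
  have d: "L2_normsq (dtx T) (\<lambda>z. S m z - S n z) \<le>
      (\<integral>t. (\<Sum>\<xi>\<in>Lam m. (a \<xi> t)\<^sup>2) \<partial>dt T) - (\<integral>t. (\<Sum>\<xi>\<in>Lam n. (a \<xi> t)\<^sup>2) \<partial>dt T)" if "n \<le> m" for m n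
  proof -
    have sub: "Lam n \<subseteq> (Lam m :: (int^'d) set)" by (rule Lam_mono[OF that])
    have "L2_normsq (dtx T) (\<lambda>z. S m z - S n z) =
        (\<integral>t. L2_normsq dx (\<lambda>x. S m (t, x) - S n (t, x)) \<partial>dt T)"
      by (rule cyl_normsq(1)[OF L2_diff[OF S_L2 S_L2]])
    also have "\<dots> = (\<integral>t. (\<Sum>\<xi>\<in>Lam m. (a \<xi> t)\<^sup>2) - (\<Sum>\<xi>\<in>Lam n. (a \<xi> t)\<^sup>2) \<partial>dt T)"
    proof (rule Bochner_Integration.integral_cong[OF refl])
      fix t
      have "(\<lambda>x. S m (t, x) - S n (t, x)) = trig (\<lambda>\<xi>. a \<xi> t) (Lam m - Lam n)"
        by (simp add: S_val trig_diff[OF finite_Lam sub])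
      then show "L2_normsq dx (\<lambda>x. S m (t, x) - S n (t, x)) = (\<Sum>\<xi>\<in>Lam m. (a \<xi> t)\<^sup>2) - (\<Sum>\<xi>\<in>Lam n. (a \<xi> t)\<^sup>2)"
        using sub by (simp add: normsq_trig sum_diff)
    qed
    finally show ?thesis using ia by simp
  qed
  obtain v where v: "v \<in> L2 (dtx T)" "(\<lambda>n. L2_normsq (dtx T) (\<lambda>z. S n z - v z)) \<longlonglongrightarrow> 0"
  proof (rule cylm.L2_complete_mono[where A = "\<lambda>n. \<integral>t. (\<Sum>\<xi>\<in>Lam n. (a \<xi> t)\<^sup>2) \<partial>dt T", OF S_L2 d K])
    fix v assume "v \<in> L2 (dtx T)" "(\<lambda>n. L2_normsq (dtx T) (\<lambda>z. S n z - v z)) \<longlonglongrightarrow> 0"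
    then show thesis by (rule that)
  qed
  have "AE t in dt T. hat (slice v t) \<xi> = a \<xi> t" for \<xi>
  proof -
    obtain N where N: "\<xi> \<in> Lam N" by (rule Lam_exhausts)
    let ?w = "\<lambda>t. a \<xi> t - hat (slice v t) \<xi>"
    have w: "?w \<in> L2 (dt T)" by (intro L2_diff a cyl_hat_L2 v)
    \<comment> \<open>Bessel's inequality for one mode, integrated in time; the mode of
      \<open>S n\<close> is already the prescribed one.\<close>
    have "L2_normsq (dt T) ?w \<le> L2_normsq (dtx T) (\<lambda>z. S n z - v z)" if "N \<le> n" for n
    proof -
      have Sv: "(\<lambda>z. S n z - v z) \<in> L2 (dtx T)" by (rule L2_diff[OF S_L2 v(1)])
      have "L2_normsq (dt T) ?w \<le> (\<integral>t. L2_normsq dx (\<lambda>x. S n (t, x) - v (t, x)) \<partial>dt T)"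
        unfolding L2_normsq_def[of "dt T"]
      proof (rule integral_mono_AE)
        show "AE t in dt T. (?w t)\<^sup>2 \<le> L2_normsq dx (\<lambda>x. S n (t, x) - v (t, x))"
          using cyl_section_L2[OF v(1)] cyl_section_L2[OF Sv]
        proof eventually_elim
          case (elim t)
          have "hat (\<lambda>x. S n (t, x) - v (t, x)) \<xi> = ?w t"
            using elim N Lam_mono[OF that] by (subst hat_diff) (auto simp: S_sec hat_trig Cinf_torus_L2)
          then show ?case using Bessel[OF elim(2), of "{\<xi>}"] by simp
        qed
      qed (use w cyl_normsq(2)[OF Sv] in \<open>auto simp: L2_iff\<close>)
      then show ?thesis using cyl_normsq(1)[OF Sv] by simp
    qed
    then have "L2_normsq (dt T) ?w \<le> 0"
      by (intro LIMSEQ_le_const[OF v(2)] exI[of _ N]) auto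
    then have "L2_normsq (dt T) ?w = 0" using L2_normsq_nonneg by (intro antisym) auto
    from L2_normsq_zero_AE[OF w this] show ?thesis by eventually_elim simp
  qed
  with v(1) that show ?thesis by blast
qed

subsection \<open>Test functions on the cylinder\<close>

lemma cyl_testsI:
  assumes "smooth_fun \<phi>" "\<And>t. periodic (slice \<phi> t)" "0 < a" "b < T" "\<And>t x. t \<notin> {a..b} \<Longrightarrow> \<phi> (t, x) = 0"
  shows "\<phi> \<in> cyl_tests T"
  unfolding cyl_tests_def using assms by blast

lemma cyl_testsE:
  assumes "\<phi> \<in> cyl_tests T"
  obtains a b where "smooth_fun \<phi>" "\<And>t. periodic (slice \<phi> t)" "0 < a" "b < T"
    "\<And>t x. t \<notin> {a..b} \<Longrightarrow> \<phi> (t, x) = 0"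
  using assms unfolding cyl_tests_def by blast

lemma cyl_tests_smooth: "\<phi> \<in> cyl_tests T \<Longrightarrow> smooth_fun \<phi>"
  by (simp add: cyl_tests_def)

lemma cyl_test_pderiv:
  fixes \<phi> :: "'d::finite st_fun"
  assumes \<phi>: "\<phi> \<in> cyl_tests T" and c: "c \<in> Basis"
  shows "pd c \<phi> \<in> cyl_tests T"
proof -
  obtain a b where ab: "smooth_fun \<phi>" "\<And>t. periodic (slice \<phi> t)" "0 < a" "b < T"
    "\<And>t x. t \<notin> {a..b} \<Longrightarrow> \<phi> (t, x) = 0" by (rule cyl_testsE[OF \<phi>]) (rule that)
  show ?thesis
  proof (rule cyl_testsI[OF smooth_fun_pderiv[OF ab(1) c] _ ab(3,4)])
    show "periodic (\<lambda>x. pd c \<phi> (t, x))" for t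
      unfolding periodic_def
    proof (intro allI)
      fix x :: "real^'d" and i
      have "\<phi> (z + (0, axis i 1)) = \<phi> z" for z
        using ab(2)[of "fst z"] unfolding periodic_def by (cases z) simp
      from frechet_derivative_shift[OF this smooth_fun_differentiable[OF ab(1)], of "(t, x)"]
      show "pd c \<phi> (t, x + axis i 1) = pd c \<phi> (t, x)" by simp
    qed
    fix t and x :: "real^'d" assume t: "t \<notin> {a..b}"
    have "open (fst -` (- {a..b}) :: (real \<times> (real^'d)) set)"
      by (intro open_vimage continuous_intros)
    then have "(\<phi> has_derivative (\<lambda>h. 0)) (at (t, x))"
      by (rule has_derivative_transform_within_open[of "\<lambda>z. 0" "\<lambda>h. 0", rotated]) (use t ab(5) in auto)
    then show "pd c \<phi> (t, x) = 0" by (rule frechet_derivative_eqI)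
  qed
qed

lemma cyl_test_iter:
  "\<phi> \<in> cyl_tests T \<Longrightarrow> set bs \<subseteq> Basis \<Longrightarrow> iter_pderiv bs \<phi> \<in> cyl_tests T"
  by (induction bs) (auto intro: cyl_test_pderiv)

lemma time_dir_Basis [simp]: "(1, 0) \<in> (Basis :: (real \<times> (real^'d)) set)"
  and space_dir_Basis [simp]: "(0, axis i 1) \<in> (Basis :: (real \<times> (real^'d)) set)"
  by (auto simp: Basis_prod_def)

lemma set_cyl_dirs: "set (cyl_dirs i is) \<subseteq> (Basis :: (real \<times> (real^'d)) set)"
  by (auto simp: cyl_dirs_def space_dirs_def Basis_prod_def)

lemma length_cyl_dirs [simp]: "length (cyl_dirs i is) = i + length is"
  by (simp add: cyl_dirs_def space_dirs_def)

lemma cyl_dirs_append: "cyl_dirs (i + j) is = cyl_dirs i [] @ cyl_dirs j is"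
  by (simp add: cyl_dirs_def space_dirs_def replicate_add)

lemma cyl_test_dirs: "\<phi> \<in> cyl_tests T \<Longrightarrow> iter_pderiv (cyl_dirs i is) \<phi> \<in> cyl_tests T"
  by (rule cyl_test_iter[OF _ set_cyl_dirs])

lemma cyl_tests_mult:
  assumes "\<phi> \<in> cyl_tests T" "r \<in> Cinf_torus"
  shows "(\<lambda>z. r (snd z) * \<phi> z) \<in> cyl_tests T"
proof -
  obtain a b where ab: "smooth_fun \<phi>" "\<And>t. periodic (slice \<phi> t)" "0 < a" "b < T"
    "\<And>t x. t \<notin> {a..b} \<Longrightarrow> \<phi> (t, x) = 0" by (rule cyl_testsE[OF assms(1)]) (rule that)
  show ?thesis
  proof (rule cyl_testsI[OF _ _ ab(3,4)])
    show "smooth_fun (\<lambda>z. r (snd z) * \<phi> z)"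
      by (intro smooth_fun_mult smooth_fun_compose_snd(1) Cinf_torusD(1) assms ab(1))
    show "periodic (\<lambda>x. r (snd (t, x)) * \<phi> (t, x))" for t
      using ab(2)[of t] Cinf_torusD(2)[OF assms(2)] by (simp add: periodic_def)
  qed (use ab in auto)
qed

lemma tensor_test:
  assumes "\<psi> \<in> time_tests T" "r \<in> Cinf_torus"
  shows "(\<lambda>z. \<psi> (fst z) * r (snd z)) \<in> cyl_tests T"
proof -
  obtain a b where ab: "0 < a" "b < T" "\<And>t. t \<notin> {a..b} \<Longrightarrow> \<psi> t = 0"
    using assms(1) by (auto simp: time_tests_def)
  show ?thesis
  proof (rule cyl_testsI[OF _ _ ab(1,2)])
    show "smooth_fun (\<lambda>z. \<psi> (fst z) * r (snd z))"
      by (intro smooth_fun_mult smooth_fun_compose_snd(1) smooth_fun_compose_fst(1) Cinf_torusD(1) time_testsD[OF assms(1)] assms(2))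
    show "periodic (\<lambda>x. \<psi> (fst (t, x)) * r (snd (t, x)))" for t
      using Cinf_torusD(2)[OF assms(2)] by (simp add: periodic_def)
  qed (use ab in auto)
qed

lemma cyl_tests_L2:
  fixes \<phi> :: "'d::finite st_fun"
  assumes "\<phi> \<in> cyl_tests T"
  shows "\<phi> \<in> L2 (dtx T)"
proof -
  have c: "continuous_on S \<phi>" for S by (rule smooth_fun_continuous[OF cyl_tests_smooth[OF assms]])
  have m: "\<phi> \<in> borel_measurable (dtx T)"
    unfolding cyl_leb_def by (intro measurable_restrict_space1) (simp add: borel_measurable_continuous_onI c)
  have "compact (\<phi> ` ({0..T} \<times> cbox 0 1))"
    by (intro compact_continuous_image c compact_Times compact_Icc compact_cbox)
  then obtain B where B: "\<And>z. z \<in> {0..T} \<times> cbox 0 1 \<Longrightarrow> \<bar>\<phi> z\<bar> \<le> B"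
    using compact_imp_bounded bounded_iff by (metis imageI real_norm_def)
  have "integrable (dtx T) (\<lambda>z. (\<phi> z)\<^sup>2)"
  proof (rule cylm.integrable_const_bound[where B = "B\<^sup>2"])
    show "AE z in dtx T. norm ((\<phi> z)\<^sup>2) \<le> B\<^sup>2"
    proof (rule AE_I2)
      fix z :: "real \<times> (real^'d)" assume "z \<in> space (dtx T)"
      then have "z \<in> {0..T} \<times> cbox 0 1"
        by (auto simp: torus_cell_def mem_box_cart less_imp_le)
      from power_mono[OF B[OF this], of 2] show "norm ((\<phi> z)\<^sup>2) \<le> B\<^sup>2" by simp
    qed
  qed (use m in measurable)
  then show ?thesis using m by (simp add: L2_iff)
qed

lemma cyl_test_slice: "\<phi> \<in> cyl_tests T \<Longrightarrow> slice \<phi> t \<in> Cinf_torus"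
  by (auto elim!: cyl_testsE intro!: Cinf_torusI smooth_fun_slice(1))

lemma iter_pderiv_slice:
  fixes \<phi> :: "'d::finite st_fun"
  assumes "smooth_fun \<phi>"
  shows "iter_pderiv (cyl_dirs 0 is) \<phi> (t, x) = iter_pderiv (space_dirs is) (slice \<phi> t) x"
proof (induction "is" arbitrary: x)
  case (Cons i "is")
  have "smooth_fun (iter_pderiv (cyl_dirs 0 is) \<phi>)"
    by (rule smooth_fun_iter_pderiv[OF assms set_cyl_dirs])
  from smooth_fun_slice(2)[OF this, of t x "axis i 1"] Cons
  show ?case by (simp add: cyl_dirs_def space_dirs_def)
qed (simp add: cyl_dirs_def space_dirs_def)

lemma cyl_dirs_time [simp]: "cyl_dirs (Suc 0) [] = [(1, 0)]" "cyl_dirs 0 [] = []"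
  by (simp_all add: cyl_dirs_def space_dirs_def)

lemma frechet_derivative_tensor_time:
  assumes "smooth_fun \<psi>" "smooth_fun r"
  shows "pd (1, 0) (\<lambda>z :: real \<times> 'b::euclidean_space. \<psi> (fst z) * r (snd z)) z =
    pd 1 \<psi> (fst z) * r (snd z)"
proof -
  have "pd 0 r (snd z) = 0"
    by (rule linear_0[OF linear_frechet_derivative[OF smooth_fun_differentiable[OF assms(2)]]])
  then show ?thesis
    using frechet_derivative_smooth_mult[OF smooth_fun_compose_fst(1)[OF assms(1)] smooth_fun_compose_snd(1)[OF assms(2)], of z "(1, 0)"]
    by (simp add: smooth_fun_compose_fst(2)[OF assms(1)] smooth_fun_compose_snd(2)[OF assms(2)])
qed

lemma iter_pderiv_cmult:
  assumes "r \<in> Cinf_torus"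
  shows "iter_pderiv (space_dirs is) (\<lambda>x. c * r x) = (\<lambda>x. c * iter_pderiv (space_dirs is) r x)"
proof (induction "is")
  case (Cons i "is")
  then show ?case
    using Cinf_torusD(1)[OF Cinf_torus_iter[OF assms, of "is"]]
    by (simp add: space_dirs_Cons frechet_derivative_cmult smooth_fun_differentiable)
qed (simp add: space_dirs_def)

lemma time_derivative_slice:
  assumes "smooth_fun \<phi>"
  shows "((\<lambda>t. \<phi> (t, x)) has_real_derivative pd (1, 0) \<phi> (t, x)) (at t)"
  using smooth_fun_line_derivative[OF assms, of "(0, x)" "(1, 0)" t] by simp

text \<open>Supplies the second factor for \<open>prim_product_rule\<close>; the explicit initial
  value 0 reflects that test functions vanish near t = 0.\<close>

lemma hat_test_prim:
  fixes \<phi> :: "'d::finite st_fun"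
  assumes \<phi>: "\<phi> \<in> cyl_tests T" and t: "t \<in> {0..T}"
  shows "hat (slice \<phi> t) \<xi> = 0 + prim T (\<lambda>s. hat (\<lambda>x. pd (1, 0) \<phi> (s, x)) \<xi>) t"
proof -
  let ?d = "pd (1, 0) \<phi>"
  have d: "?d \<in> cyl_tests T" by (rule cyl_test_pderiv[OF \<phi>]) simp
  have z0: "\<phi> (0, x) = 0" for x using \<phi> by (elim cyl_testsE) auto
  have eq: "\<phi> (t, x) = prim T (\<lambda>s. ?d (s, x)) t" for x
  proof -
    have "continuous_on UNIV (\<lambda>s. ?d (s, x))"
      by (rule continuous_on_compose2[OF smooth_fun_continuous[OF cyl_tests_smooth[OF d], of UNIV]])
         (auto intro!: continuous_intros)
    then have "prim T (\<lambda>s. ?d (s, x)) t = \<phi> (t, x) - \<phi> (0, x)"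
      using t by (intro prim_FTC time_derivative_slice cyl_tests_smooth[OF \<phi>]) auto
    then show ?thesis using z0 by simp
  qed
  let ?F = "\<lambda>(s, x). indicator {..t} s * (?d (s, x) * hartley \<xi> x)"
  have dL: "?d \<in> L2 (dtx T)" by (rule cyl_tests_L2[OF d])
  have hL: "(\<lambda>(s, x). 1 * hartley \<xi> x) \<in> L2 (dtx T)" by (rule tensor_L2) auto
  have i: "integrable (dtx T) (\<lambda>z. ?d z * (\<lambda>(s, x). 1 * hartley \<xi> x) z)"
    by (rule L2_mult_integrable[OF dL hL])
  have m: "?F \<in> borel_measurable (dt T \<Otimes>\<^sub>M dx)"
  proof -
    have [measurable]: "?d \<in> borel_measurable (dt T \<Otimes>\<^sub>M dx)"
      using L2_meas[OF dL] by (simp add: cyl_leb_pair)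
    have [measurable]: "hartley \<xi> \<in> borel_measurable dx" by (rule Cinf_torus_measurable) simp
    show ?thesis by measurable
  qed
  have iF: "integrable (dt T \<Otimes>\<^sub>M dx) ?F"
    by (rule Bochner_Integration.integrable_bound[OF i[unfolded cyl_leb_pair] m])
       (auto intro!: AE_I2 simp: indicator_def)
  have "hat (slice \<phi> t) \<xi> = (\<integral>x. (\<integral>s. ?F (s, x) \<partial>dt T) \<partial>dx)"
    unfolding hat_def
  proof (rule Bochner_Integration.integral_cong[OF refl])
    fix x
    have "(\<integral>s. ?F (s, x) \<partial>dt T) = (\<integral>s. hartley \<xi> x * (indicator {..t} s * ?d (s, x)) \<partial>dt T)"
      by (simp add: mult_ac)
    then show "\<phi> (t, x) * hartley \<xi> x = (\<integral>s. ?F (s, x) \<partial>dt T)"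
      unfolding eq by (simp add: prim_def)
  qed
  also have "\<dots> = (\<integral>s. (\<integral>x. ?F (s, x) \<partial>dx) \<partial>dt T)"
    using cyl.Fubini_integral[of T "\<lambda>s x. ?F (s, x)"] iF by simp
  also have "\<dots> = prim T (\<lambda>s. hat (slice ?d s) \<xi>) t"
    unfolding prim_def hat_def by simp
  finally show ?thesis by simp
qed

subsection \<open>Weak derivatives on the cylinder\<close>

text \<open>\<open>is_Dtx\<close> with the weight removed from the L2 condition, harmless because
  the weight is bounded both ways; the test integrals were unweighted from the start.\<close>

definition wderiv :: "real \<Rightarrow> nat \<Rightarrow> 'd list \<Rightarrow> 'd::finite st_fun \<Rightarrow> 'd::finite st_fun \<Rightarrow> bool" where
  "wderiv T i is u v \<longleftrightarrow> v \<in> L2 (dtx T) \<and>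
     (\<forall>\<phi>\<in>cyl_tests T. (\<integral>z. u z * iter_pderiv (cyl_dirs i is) \<phi> z \<partial>dtx T) =
        (-1) ^ (i + length is) * (\<integral>z. v z * \<phi> z \<partial>dtx T))"

lemma is_Dtx_iff: "U \<in> Cinf_torus \<Longrightarrow> is_Dtx T U i is u v \<longleftrightarrow> wderiv T i is u v"
  by (simp add: is_Dtx_def is_weak_deriv_def wderiv_def L2_cyl_eta)

lemma is_Dx_iff: "U \<in> Cinf_torus \<Longrightarrow> is_Dx U is u v \<longleftrightarrow> v \<in> L2 dx \<and>
    (\<forall>\<phi>\<in>Cinf_torus. (\<integral>x. u x * iter_pderiv (space_dirs is) \<phi> x \<partial>dx) = (-1) ^ length is * (\<integral>x. v x * \<phi> x \<partial>dx))"
  by (simp add: is_Dx_def is_weak_deriv_def L2_eta space_dirs_def)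

lemma wderiv_L2: "wderiv T i is u v \<Longrightarrow> v \<in> L2 (dtx T)"
  by (simp add: wderiv_def)

lemma wderivD: "wderiv T i is u v \<Longrightarrow> \<phi> \<in> cyl_tests T \<Longrightarrow>
    (\<integral>z. u z * iter_pderiv (cyl_dirs i is) \<phi> z \<partial>dtx T) = (-1) ^ (i + length is) * (\<integral>z. v z * \<phi> z \<partial>dtx T)"
  by (simp add: wderiv_def)

lemma wderiv_refl: "u \<in> L2 (dtx T) \<Longrightarrow> wderiv T 0 [] u u"
  by (simp add: wderiv_def)

text \<open>\<open>cyl_dirs\<close> places time derivatives outermost, so a pure time derivative can
  be split off without commuting any derivatives.\<close>

lemma wderiv_compose:
  assumes "wderiv T i [] u v" "wderiv T j is v w"
  shows "wderiv T (i + j) is u w"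
  unfolding wderiv_def
proof (intro conjI ballI)
  show "w \<in> L2 (dtx T)" by (rule wderiv_L2[OF assms(2)])
  fix \<phi> :: "real \<times> (real^'a) \<Rightarrow> real" assume \<phi>: "\<phi> \<in> cyl_tests T"
  show "(\<integral>z. u z * iter_pderiv (cyl_dirs (i + j) is) \<phi> z \<partial>dtx T) =
      (-1) ^ (i + j + length is) * (\<integral>z. w z * \<phi> z \<partial>dtx T)"
    using wderivD[OF assms(1) cyl_test_dirs[OF \<phi>, of j "is"]] wderivD[OF assms(2) \<phi>]
    by (simp add: cyl_dirs_append iter_pderiv_append power_add)
qed

text \<open>Reads a mixed derivative of \<open>u\<close> as a derivative of the time derivative
  \<open>v\<close>; in this way the time derivatives of the forcing inherit space
  regularity.\<close>

lemma wderiv_decompose: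
  assumes "wderiv T (i + j) is u w" "wderiv T i [] u v"
  shows "wderiv T j is v w"
  unfolding wderiv_def
proof (intro conjI ballI)
  show "w \<in> L2 (dtx T)" by (rule wderiv_L2[OF assms(1)])
  fix \<phi> :: "real \<times> (real^'a) \<Rightarrow> real" assume \<phi>: "\<phi> \<in> cyl_tests T"
  have "(-1) ^ i * (\<integral>z. v z * iter_pderiv (cyl_dirs j is) \<phi> z \<partial>dtx T) = (-1) ^ (i + j + length is) * (\<integral>z. w z * \<phi> z \<partial>dtx T)"
    using wderivD[OF assms(2) cyl_test_dirs[OF \<phi>, of j "is"]] wderivD[OF assms(1) \<phi>]
    by (simp add: cyl_dirs_append iter_pderiv_append)
  then have "((-1) ^ i * (-1) ^ i) * (\<integral>z. v z * iter_pderiv (cyl_dirs j is) \<phi> z \<partial>dtx T)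
      = ((-1) ^ i * (-1) ^ i) * ((-1) ^ (j + length is) * (\<integral>z. w z * \<phi> z \<partial>dtx T))"
    by (simp add: power_add mult.assoc)
  then show "(\<integral>z. v z * iter_pderiv (cyl_dirs j is) \<phi> z \<partial>dtx T) = (-1) ^ (j + length is) * (\<integral>z. w z * \<phi> z \<partial>dtx T)"
    by (simp flip: power_add)
qed

lemma wderiv_add:
  assumes "wderiv T i is u v" "wderiv T i is u' v'" "u \<in> L2 (dtx T)" "u' \<in> L2 (dtx T)"
  shows "wderiv T i is (\<lambda>z. u z + u' z) (\<lambda>z. v z + v' z)"
  unfolding wderiv_def
proof (intro conjI ballI)
  note L = wderiv_L2[OF assms(1)] wderiv_L2[OF assms(2)]
  show "(\<lambda>z. v z + v' z) \<in> L2 (dtx T)" by (rule L2_add[OF L])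
  fix \<phi> :: "real \<times> (real^'a) \<Rightarrow> real" assume \<phi>: "\<phi> \<in> cyl_tests T"
  note t = cyl_tests_L2[OF cyl_test_dirs[OF \<phi>, of i "is"]] cyl_tests_L2[OF \<phi>]
  show "(\<integral>z. (u z + u' z) * iter_pderiv (cyl_dirs i is) \<phi> z \<partial>dtx T) =
      (-1) ^ (i + length is) * (\<integral>z. (v z + v' z) * \<phi> z \<partial>dtx T)"
    using L2_mult_integrable[OF assms(3) t(1)] L2_mult_integrable[OF assms(4) t(1)]
      L2_mult_integrable[OF L(1) t(2)] L2_mult_integrable[OF L(2) t(2)]
      wderivD[OF assms(1) \<phi>] wderivD[OF assms(2) \<phi>]
    by (simp add: distrib_left distrib_right)
qed

lemma wderiv_cmult:
  assumes "wderiv T i is u v"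
  shows "wderiv T i is (\<lambda>z. c * u z) (\<lambda>z. c * v z)"
  using assms by (auto simp: wderiv_def mult.assoc mult.left_commute intro: L2_cmult)

lemma wderiv_zero: "wderiv T i is (\<lambda>z. 0) (\<lambda>z. 0)"
  by (simp add: wderiv_def)

lemma wderiv_sum:
  "(\<And>l. l \<in> I \<Longrightarrow> wderiv T i is (u l) (v l)) \<Longrightarrow> (\<And>l. l \<in> I \<Longrightarrow> u l \<in> L2 (dtx T)) \<Longrightarrow>
    wderiv T i is (\<lambda>z. \<Sum>l\<in>I. u l z) (\<lambda>z. \<Sum>l\<in>I. v l z)"
proof (induction I rule: infinite_finite_induct)
  case (insert l I)
  have "wderiv T i is (\<lambda>z. u l z + (\<Sum>l\<in>I. u l z)) (\<lambda>z. v l z + (\<Sum>l\<in>I. v l z))"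
    by (rule wderiv_add) (use insert in \<open>auto intro: L2_sum\<close>)
  then show ?case using insert by simp
qed (simp_all add: wderiv_zero)

text \<open>Since r does not depend on time it can be moved into the test function.\<close>

lemma wderiv_smooth_mult_time:
  assumes "wderiv T (Suc 0) [] u v" "r \<in> Cinf_torus"
  shows "wderiv T (Suc 0) [] (\<lambda>z. r (snd z) * u z) (\<lambda>z. r (snd z) * v z)"
  unfolding wderiv_def
proof (intro conjI ballI)
  obtain B where B: "\<And>x. \<bar>r x\<bar> \<le> B" using Cinf_torus_bounded[OF assms(2)] by blast
  have "(\<lambda>z :: real \<times> (real^'a). r (snd z)) \<in> borel_measurable (dtx T)"
    unfolding cyl_leb_pair by (rule measurable_compose[OF measurable_snd Cinf_torus_measurable[OF assms(2)]])
  then show "(\<lambda>z. r (snd z) * v z) \<in> L2 (dtx T)"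
    using B by (rule L2_bounded_mult(1)[OF _ _ wderiv_L2[OF assms(1)]])
  fix \<phi> :: "real \<times> (real^'a) \<Rightarrow> real" assume \<phi>: "\<phi> \<in> cyl_tests T"
  have 0: "pd 0 r x = 0" for x
    by (rule linear_0[OF linear_frechet_derivative[OF smooth_fun_differentiable[OF Cinf_torusD(1)[OF assms(2)]]]])
  have "pd (1, 0) (\<lambda>z. r (snd z) * \<phi> z) z = r (snd z) * pd (1, 0) \<phi> z" for z
    using frechet_derivative_smooth_mult[OF smooth_fun_compose_snd(1)[OF Cinf_torusD(1)[OF assms(2)]] cyl_tests_smooth[OF \<phi>], of z "(1, 0)"]
    by (simp add: smooth_fun_compose_snd(2)[OF Cinf_torusD(1)[OF assms(2)]] 0)
  then show "(\<integral>z. r (snd z) * u z * iter_pderiv (cyl_dirs (Suc 0) []) \<phi> z \<partial>dtx T) =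
      (-1) ^ (Suc 0 + length []) * (\<integral>z. r (snd z) * v z * \<phi> z \<partial>dtx T)"
    using wderivD[OF assms(1) cyl_tests_mult[OF \<phi> assms(2)]] by (simp add: mult_ac)
qed

text \<open>Time and space derivatives of test functions commute, hence so do those of \<open>u\<close>.\<close>

lemma wderiv_swap:
  assumes "wderiv T (Suc 0) [] u u'" "wderiv T 0 [l] u v" "wderiv T 0 [l] u' v'"
  shows "wderiv T (Suc 0) [] v v'"
  unfolding wderiv_def
proof (intro conjI ballI)
  show "v' \<in> L2 (dtx T)" by (rule wderiv_L2[OF assms(3)])
  fix \<phi> :: "real \<times> (real^'a) \<Rightarrow> real" assume \<phi>: "\<phi> \<in> cyl_tests T"
  let ?t = "\<lambda>\<phi> z. pd (1, 0) \<phi> z" and ?l = "\<lambda>\<phi> z. pd (0, axis l 1) \<phi> z"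
  have dl: "cyl_dirs 0 [l] = [(0, axis l 1)]" by (simp add: cyl_dirs_def space_dirs_def)
  have "(\<integral>z. v z * ?t \<phi> z \<partial>dtx T) = - (\<integral>z. u z * ?l (?t \<phi>) z \<partial>dtx T)"
    using wderivD[OF assms(2) cyl_test_pderiv[OF \<phi> time_dir_Basis]] by (simp add: dl)
  also have "?l (?t \<phi>) = ?t (?l \<phi>)"
    using mixed_derivatives_commute[OF cyl_tests_smooth[OF \<phi>] time_dir_Basis space_dir_Basis] by blast
  also have "- (\<integral>z. u z * ?t (?l \<phi>) z \<partial>dtx T) = (\<integral>z. u' z * ?l \<phi> z \<partial>dtx T)"
    using wderivD[OF assms(1) cyl_test_pderiv[OF \<phi> space_dir_Basis]] by simp
  also have "\<dots> = - (\<integral>z. v' z * \<phi> z \<partial>dtx T)"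
    using wderivD[OF assms(3) \<phi>] by (simp add: dl)
  finally show "(\<integral>z. v z * iter_pderiv (cyl_dirs (Suc 0) []) \<phi> z \<partial>dtx T) =
      (-1) ^ (Suc 0 + length []) * (\<integral>z. v' z * \<phi> z \<partial>dtx T)" by simp
qed

lemma cyl_inner_tensor:
  assumes u: "u \<in> L2 (dtx T)" and \<psi>: "\<psi> \<in> time_tests T" and r: "r \<in> Cinf_torus"
  shows "(\<integral>z. u z * (\<psi> (fst z) * r (snd z)) \<partial>dtx T) = (\<integral>t. (\<integral>x. u (t, x) * r x \<partial>dx) * \<psi> t \<partial>dt T)"
proof -
  have "(\<integral>z. u z * (\<psi> (fst z) * r (snd z)) \<partial>dtx T) =
      (\<integral>t. (\<integral>x. u (t, x) * (\<psi> (fst (t, x)) * r (snd (t, x))) \<partial>dx) \<partial>dt T)"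
    by (rule cyl_integral_inner(1)[OF u cyl_tests_L2[OF tensor_test[OF \<psi> r]]])
  also have "\<dots> = (\<integral>t. (\<integral>x. \<psi> t * (u (t, x) * r x) \<partial>dx) \<partial>dt T)"
    by (simp add: mult_ac)
  finally show ?thesis by (simp add: mult.commute)
qed

text \<open>Product test functions reduce the claim to the scalar lemma in time.\<close>

lemma wderiv_time_primitive:
  assumes u: "u \<in> L2 (dtx T)" and w: "wderiv T (Suc 0) [] u v" and r: "r \<in> Cinf_torus" and T: "T > 0"
  obtains c where "AE t in dt T. (\<integral>x. u (t, x) * r x \<partial>dx) =
    c + prim T (\<lambda>s. \<integral>x. v (s, x) * r x \<partial>dx) t"
proof (rule weak_time_derivative_primitive[OF _ _ T])
  show "integrable (dt T) (\<lambda>t. \<integral>x. u (t, x) * r x \<partial>dx)"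
    "integrable (dt T) (\<lambda>t. \<integral>x. v (t, x) * r x \<partial>dx)"
    by (intro time.L2_integrable cyl_inner_L2 u r wderiv_L2[OF w])+
  fix \<psi> assume \<psi>: "\<psi> \<in> time_tests T"
  show "(\<integral>t. (\<integral>x. u (t, x) * r x \<partial>dx) * pd 1 \<psi> t \<partial>dt T) =
      - (\<integral>t. (\<integral>x. v (t, x) * r x \<partial>dx) * \<psi> t \<partial>dt T)"
    using wderivD[OF w tensor_test[OF \<psi> r]] cyl_inner_tensor[OF u time_tests_deriv[OF \<psi>] r]
      cyl_inner_tensor[OF wderiv_L2[OF w] \<psi> r]
    by (simp add: frechet_derivative_tensor_time[OF time_testsD[OF \<psi>] Cinf_torusD(1)[OF r]])
qed (rule that)

text \<open>For each mode the product rule gives integration by parts, where the constant is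
  harmless because test functions vanish at both ends. Parseval's identity under the time integral
  then reassembles the modes.\<close>

lemma wderiv_of_primitive:
  fixes u v :: "'d::finite st_fun"
  assumes u: "u \<in> L2 (dtx T)" and v: "v \<in> L2 (dtx T)" and T: "T > 0"
    and h: "\<And>\<xi>. \<exists>c. AE t in dt T. hat (slice u t) \<xi> = c + prim T (\<lambda>s. hat (slice v s) \<xi>) t"
  shows "wderiv T (Suc 0) [] u v"
  unfolding wderiv_def
proof (intro conjI ballI)
  show "v \<in> L2 (dtx T)" by (rule v)
  fix \<phi> :: "'d::finite st_fun" assume \<phi>: "\<phi> \<in> cyl_tests T"
  let ?d = "pd (1, 0) \<phi>"
  have d: "?d \<in> cyl_tests T" by (rule cyl_test_pderiv[OF \<phi>]) simp
  have mode: "(\<integral>t. hat (slice u t) \<xi> * hat (slice ?d t) \<xi> \<partial>dt T) =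
      - (\<integral>t. hat (slice v t) \<xi> * hat (slice \<phi> t) \<xi> \<partial>dt T)" for \<xi>
  proof -
    obtain c where c: "AE t in dt T. hat (slice u t) \<xi> = c + prim T (\<lambda>s. hat (slice v s) \<xi>) t"
      using h by blast
    let ?h = "\<lambda>t. hat (slice v t) \<xi>" and ?q = "\<lambda>t. hat (slice ?d t) \<xi>" and ?z = "\<lambda>t. hat (slice \<phi> t) \<xi>"
    let ?y = "\<lambda>t. c + prim T ?h t"
    have ih: "integrable (dt T) ?h" by (rule cyl_hat_integrable[OF v])
    have iq: "integrable (dt T) ?q" by (rule cyl_hat_integrable[OF cyl_tests_L2[OF d]])
    have zT: "?z T = 0" using \<phi> by (elim cyl_testsE) auto
    have "?y T * ?z T = c * 0 + prim T (\<lambda>s. ?h s * ?z s + ?y s * ?q s) T"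
      by (rule prim_product_rule(1)[OF ih iq _ hat_test_prim[OF \<phi>]]) (use T in auto)
    then have "(\<integral>s. ?h s * ?z s + ?y s * ?q s \<partial>dt T) = 0" using zT by (simp add: prim_T)
    moreover have i1: "integrable (dt T) (\<lambda>s. ?h s * ?z s)"
      by (intro L2_mult_integrable cyl_hat_L2 v cyl_tests_L2[OF \<phi>])
    moreover have i2: "integrable (dt T) (\<lambda>s. ?y s * ?q s)"
    proof -
      have m: "?y \<in> borel_measurable (dt T)"
        by (intro borel_measurable_time_leb borel_measurable_add prim_measurable[OF ih]) simp
      have "\<bar>?y s\<bar> \<le> \<bar>c\<bar> + (\<integral>s. \<bar>?h s\<bar> \<partial>dt T)" for s
        using abs_triangle_ineq[of c "prim T ?h s"] prim_bounded[OF ih, of s] by linarith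
      from time_integrable_mult_bounded[OF iq m this] show ?thesis .
    qed
    ultimately have "(\<integral>s. ?y s * ?q s \<partial>dt T) = - (\<integral>s. ?h s * ?z s \<partial>dt T)" by simp
    moreover have "(\<integral>s. hat (slice u s) \<xi> * ?q s \<partial>dt T) = (\<integral>s. ?y s * ?q s \<partial>dt T)"
    proof (rule integral_cong_AE)
      show "AE s in dt T. hat (slice u s) \<xi> * ?q s = ?y s * ?q s"
        using c by eventually_elim simp
      show "(\<lambda>s. hat (slice u s) \<xi> * ?q s) \<in> borel_measurable (dt T)"
        using cyl_hat_integrable[OF u, of \<xi>] iq by auto
    qed (use i2 in simp)
    ultimately show ?thesis by simp
  qed
  have lim: "(\<lambda>N. \<integral>t. (\<Sum>\<xi>\<in>Lam N. hat (slice f t) \<xi> * hat (slice \<theta> t) \<xi>) \<partial>dt T)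
      \<longlonglongrightarrow> (\<integral>z. f z * \<theta> z \<partial>dtx T)"
    if f: "f \<in> L2 (dtx T)" and \<theta>: "\<theta> \<in> cyl_tests T" for f \<theta> :: "'d::finite st_fun"
    unfolding cyl_integral_inner(1)[OF f cyl_tests_L2[OF \<theta>]]
  proof (rule integral_dominated_convergence[where w = "\<lambda>t. L2_normsq dx (slice f t) + L2_normsq dx (slice \<theta> t)"])
    have \<theta>t: "slice \<theta> t \<in> L2 dx" for t by (intro Cinf_torus_L2 cyl_test_slice[OF \<theta>])
    show "AE t in dt T. (\<lambda>N. \<Sum>\<xi>\<in>Lam N. hat (slice f t) \<xi> * hat (slice \<theta> t) \<xi>)
        \<longlonglongrightarrow> (\<integral>x. f (t, x) * \<theta> (t, x) \<partial>dx)"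
      using cyl_section_L2[OF f] by eventually_elim (intro Parseval_inner \<theta>t)
    show "AE t in dt T. norm (\<Sum>\<xi>\<in>Lam N. hat (slice f t) \<xi> * hat (slice \<theta> t) \<xi>)
        \<le> L2_normsq dx (slice f t) + L2_normsq dx (slice \<theta> t)" for N
      using cyl_section_L2[OF f]
    proof eventually_elim
      case (elim t)
      have "\<bar>a * b\<bar> \<le> a\<^sup>2 + b\<^sup>2" for a b :: real
      proof -
        have "2 * (\<bar>a\<bar> * \<bar>b\<bar>) \<le> a\<^sup>2 + b\<^sup>2"
          using sum_squares_bound[of "\<bar>a\<bar>" "\<bar>b\<bar>"] by simp
        moreover have "0 \<le> \<bar>a\<bar> * \<bar>b\<bar>" by simp
        ultimately show ?thesis unfolding abs_mult by linarith
      qed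
      then have "norm (\<Sum>\<xi>\<in>Lam N. hat (slice f t) \<xi> * hat (slice \<theta> t) \<xi>)
          \<le> (\<Sum>\<xi>\<in>Lam N. (hat (slice f t) \<xi>)\<^sup>2 + (hat (slice \<theta> t) \<xi>)\<^sup>2)"
        by (intro sum_norm_le) simp
      also have "\<dots> \<le> L2_normsq dx (slice f t) + L2_normsq dx (slice \<theta> t)"
        unfolding sum.distrib by (intro add_mono Bessel elim \<theta>t finite_Lam)
      finally show ?case .
    qed
    show "(\<lambda>t. \<integral>x. f (t, x) * \<theta> (t, x) \<partial>dx) \<in> borel_measurable (dt T)"
      using cyl_integral_inner(2)[OF f cyl_tests_L2[OF \<theta>]] by simp
    show "(\<lambda>t. \<Sum>\<xi>\<in>Lam N. hat (slice f t) \<xi> * hat (slice \<theta> t) \<xi>) \<in> borel_measurable (dt T)" for N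
      using cyl_hat_integrable[OF f] cyl_hat_integrable[OF cyl_tests_L2[OF \<theta>]]
      by (intro borel_measurable_sum borel_measurable_times borel_measurable_integrable)
  qed (use cyl_normsq(2)[OF f] cyl_normsq(2)[OF cyl_tests_L2[OF \<theta>]] in auto)
  have i: "integrable (dt T) (\<lambda>t. hat (slice f t) \<xi> * hat (slice \<theta> t) \<xi>)"
    if "f \<in> L2 (dtx T)" "\<theta> \<in> cyl_tests T" for f \<theta> :: "'d::finite st_fun" and \<xi>
    by (intro L2_mult_integrable cyl_hat_L2 cyl_tests_L2 that)
  have "(\<lambda>N. \<integral>t. (\<Sum>\<xi>\<in>Lam N. hat (slice u t) \<xi> * hat (slice ?d t) \<xi>) \<partial>dt T)
      = (\<lambda>N. - (\<integral>t. (\<Sum>\<xi>\<in>Lam N. hat (slice v t) \<xi> * hat (slice \<phi> t) \<xi>) \<partial>dt T))"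
    by (simp add: Bochner_Integration.integral_sum i[OF u d] i[OF v \<phi>] mode sum_negf)
  then have "(\<integral>z. u z * ?d z \<partial>dtx T) = - (\<integral>z. v z * \<phi> z \<partial>dtx T)"
    using LIMSEQ_unique[OF lim[OF u d]] tendsto_minus[OF lim[OF v \<phi>]] by simp
  then show "(\<integral>z. u z * iter_pderiv (cyl_dirs (Suc 0) []) \<phi> z \<partial>dtx T) =
      (-1) ^ (Suc 0 + length []) * (\<integral>z. v z * \<phi> z \<partial>dtx T)" by simp
qed

text \<open>Tested with \<open>\<psi>(t)\<close> times a basis function in x, the definition becomes
  a scalar identity for all \<psi>, to which the fundamental lemma in time applies.\<close>

lemma wderiv_space_hat:
  assumes u: "u \<in> L2 (dtx T)" and w: "wderiv T 0 is u v"
  shows "AE t in dt T. hat (slice v t) \<xi> = dmult is \<xi> * hat (slice u t) (flip is \<xi>)"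
proof -
  let ?g = "\<lambda>t. hat (slice v t) \<xi> - dmult is \<xi> * hat (slice u t) (flip is \<xi>)"
  note v = wderiv_L2[OF w]
  have "AE t in dt T. ?g t = 0"
  proof (rule time_tests_fundamental)
    show "integrable (dt T) ?g" using cyl_hat_integrable[OF u] cyl_hat_integrable[OF v] by simp
    fix \<psi> assume \<psi>: "\<psi> \<in> time_tests T"
    have D: "iter_pderiv (cyl_dirs 0 is) (\<lambda>z. \<psi> (fst z) * hartley \<xi> (snd z)) =
        (\<lambda>z. dmult is (flip is \<xi>) * (\<psi> (fst z) * hartley (flip is \<xi>) (snd z)))"
    proof
      fix z
      show "iter_pderiv (cyl_dirs 0 is) (\<lambda>z. \<psi> (fst z) * hartley \<xi> (snd z)) z =
          dmult is (flip is \<xi>) * (\<psi> (fst z) * hartley (flip is \<xi>) (snd z))"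
        using iter_pderiv_slice[OF cyl_tests_smooth[OF tensor_test[OF \<psi> hartley_Cinf[of \<xi>]]], of "is" "fst z" "snd z"]
        by (simp add: iter_pderiv_cmult iter_pderiv_hartley)
    qed
    have "dmult is (flip is \<xi>) * (\<integral>t. hat (slice u t) (flip is \<xi>) * \<psi> t \<partial>dt T) =
        (-1) ^ length is * (\<integral>t. hat (slice v t) \<xi> * \<psi> t \<partial>dt T)"
      using wderivD[OF w tensor_test[OF \<psi> hartley_Cinf[of \<xi>]]] cyl_inner_tensor[OF u \<psi> hartley_Cinf[of "flip is \<xi>"]]
        cyl_inner_tensor[OF v \<psi> hartley_Cinf[of \<xi>]]
      by (simp add: D hat_def mult.left_commute[of "u _"])
    then have "((-1) ^ length is * (-1) ^ length is) * (dmult is \<xi> * (\<integral>t. hat (slice u t) (flip is \<xi>) * \<psi> t \<partial>dt T)) =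
        ((-1) ^ length is * (-1) ^ length is) * (\<integral>t. hat (slice v t) \<xi> * \<psi> t \<partial>dt T)"
      by (simp only: dmult_flip mult.assoc)
    then have "dmult is \<xi> * (\<integral>t. hat (slice u t) (flip is \<xi>) * \<psi> t \<partial>dt T) = (\<integral>t. hat (slice v t) \<xi> * \<psi> t \<partial>dt T)"
      by (simp flip: power_add)
    then show "(\<integral>t. ?g t * \<psi> t \<partial>dt T) = 0"
      using time_tests_integrable_mult[OF cyl_hat_integrable[OF u, of "flip is \<xi>"] \<psi>] time_tests_integrable_mult[OF cyl_hat_integrable[OF v, of \<xi>] \<psi>]
      by (simp add: left_diff_distrib mult.assoc)
  qed
  then show ?thesis by eventually_elim simp
qed

lemma wderiv_space_of_hat:
  assumes u: "u \<in> L2 (dtx T)" and v: "v \<in> L2 (dtx T)"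
    and h: "\<And>\<xi>. AE t in dt T. hat (slice v t) \<xi> = dmult is \<xi> * hat (slice u t) (flip is \<xi>)"
  shows "wderiv T 0 is u v"
  unfolding wderiv_def
proof (intro conjI ballI)
  show "v \<in> L2 (dtx T)" by (rule v)
  fix \<phi> :: "real \<times> (real^'a) \<Rightarrow> real" assume \<phi>: "\<phi> \<in> cyl_tests T"
  have d: "iter_pderiv (cyl_dirs 0 is) \<phi> \<in> cyl_tests T" by (rule cyl_test_dirs[OF \<phi>])
  have ae: "AE t in dt T. \<forall>\<xi>. hat (slice v t) \<xi> = dmult is \<xi> * hat (slice u t) (flip is \<xi>)"
    using h by (simp add: AE_all_countable)
  have "(\<integral>t. \<integral>x. u (t, x) * iter_pderiv (cyl_dirs 0 is) \<phi> (t, x) \<partial>dx \<partial>dt T) =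
      (\<integral>t. (-1) ^ length is * (\<integral>x. v (t, x) * \<phi> (t, x) \<partial>dx) \<partial>dt T)"
  proof (rule integral_cong_AE)
    show "AE t in dt T. (\<integral>x. u (t, x) * iter_pderiv (cyl_dirs 0 is) \<phi> (t, x) \<partial>dx) =
        (-1) ^ length is * (\<integral>x. v (t, x) * \<phi> (t, x) \<partial>dx)"
      using ae cyl_section_L2[OF u] cyl_section_L2[OF v]
    proof eventually_elim
      case (elim t)
      then show ?case
        using weak_deriv_of_hat[OF elim(2,3) _ cyl_test_slice[OF \<phi>, of t], of "is"]
        by (simp add: iter_pderiv_slice[OF cyl_tests_smooth[OF \<phi>]])
    qed
    show "(\<lambda>t. \<integral>x. u (t, x) * iter_pderiv (cyl_dirs 0 is) \<phi> (t, x) \<partial>dx) \<in> borel_measurable (dt T)"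
      using cyl_integral_inner(2)[OF u cyl_tests_L2[OF d]] by simp
    show "(\<lambda>t. (-1) ^ length is * (\<integral>x. v (t, x) * \<phi> (t, x) \<partial>dx)) \<in> borel_measurable (dt T)"
      using cyl_integral_inner(2)[OF v cyl_tests_L2[OF \<phi>]] by simp
  qed
  then show "(\<integral>z. u z * iter_pderiv (cyl_dirs 0 is) \<phi> z \<partial>dtx T) = (-1) ^ (0 + length is) * (\<integral>z. v z * \<phi> z \<partial>dtx T)"
    by (simp add: cyl_integral_inner(1)[OF u cyl_tests_L2[OF d]] cyl_integral_inner(1)[OF v cyl_tests_L2[OF \<phi>]])
qed

text \<open>Two derivatives of the same function have equal test integrals, which says that one is a
  weak derivative of order zero of the other; their coefficients then agree.\<close>

lemma wderiv_unique:
  assumes "wderiv T i is u v" "wderiv T i is u w"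
  shows "AE z in dtx T. v z = w z"
proof -
  note L = wderiv_L2[OF assms(1)] wderiv_L2[OF assms(2)]
  have "(\<integral>z. v z * \<phi> z \<partial>dtx T) = (\<integral>z. w z * \<phi> z \<partial>dtx T)" if "\<phi> \<in> cyl_tests T" for \<phi>
    using wderivD[OF assms(1) that] wderivD[OF assms(2) that] by simp
  then have "wderiv T 0 [] v w" using L by (simp add: wderiv_def)
  from wderiv_space_hat[OF L(1) this]
  have "AE z in dtx T. w z = v z" by (intro cyl_eq_of_hat L) simp
  then show ?thesis by eventually_elim simp
qed

lemma Dx_unique:
  assumes U: "U \<in> Cinf_torus" and v: "is_Dx U is u v" and w: "is_Dx U is u w"
  shows "AE x in dx. v x = w x"
proof -
  have L: "v \<in> L2 dx" "w \<in> L2 dx" using v w by (simp_all add: is_Dx_iff[OF U])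
  have "hat v \<xi> = dmult is \<xi> * hat u (flip is \<xi>)" "hat w \<xi> = dmult is \<xi> * hat u (flip is \<xi>)" for \<xi>
    using v w by (auto simp: is_Dx_iff[OF U] intro!: weak_deriv_hat)
  then have "AE x in dx. v x - w x = 0"
    by (intro hat_zero_imp_AE_zero L2_diff L) (simp add: hat_diff L)
  then show ?thesis by eventually_elim simp
qed

lemma is_Dx_Dx: "is_Dx U is u v \<Longrightarrow> is_Dx U is u (Dx U is u)"
  unfolding Dx_def by (rule someI[where P = "is_Dx U is u"])

lemma is_Dtx_Dtx: "is_Dtx T U i is u v \<Longrightarrow> is_Dtx T U i is u (Dtx T U i is u)"
  unfolding Dtx_def by (rule someI[where P = "is_Dtx T U i is u"])

lemma is_Dx_hat:
  assumes "U \<in> Cinf_torus" "is_Dx U is u v"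
  shows "hat v \<xi> = dmult is \<xi> * hat u (flip is \<xi>)"
  using assms by (intro weak_deriv_hat) (simp add: is_Dx_iff)

lemma is_Dx_of_hat:
  assumes "U \<in> Cinf_torus" "u \<in> L2 dx" "v \<in> L2 dx" "\<And>\<xi>. hat v \<xi> = dmult is \<xi> * hat u (flip is \<xi>)"
  shows "is_Dx U is u v"
  using assms by (simp add: is_Dx_iff weak_deriv_of_hat)

section \<open>The Galerkin scheme\<close>

text \<open>The system reads \<open>\<partial>\<^sub>t c\<^sub>j + \<Sum>\<^sub>i \<Sum>\<^sub>l (B\<^sub>i + B\<^sub>i\<^sup>T)\<^sub>j\<^sub>l \<partial>\<^sub>i c\<^sub>l + \<Sum>\<^sub>l R\<^sub>j\<^sub>l c\<^sub>l = f\<^sub>j\<close> with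
  \<open>R = A - \<Sum>\<^sub>i (\<partial>\<^sub>i U) B\<^sub>i\<close>. All constants are explicit in \<open>Bd\<close> and \<open>Cm\<close>, so that they do not depend on the
  matrices themselves.\<close>

locale moment_system =
  fixes U :: "real^'d \<Rightarrow> real" and T :: real and n :: nat
    and A :: "nat \<Rightarrow> nat \<Rightarrow> real" and B :: "'d \<Rightarrow> nat \<Rightarrow> nat \<Rightarrow> real" and Bd Cm :: real and q :: nat
  assumes U: "U \<in> Cinf_torus" and T: "T > 0"
    and A_bd: "\<And>j l. j \<in> {1..n} \<Longrightarrow> l \<in> {1..n} \<Longrightarrow> \<bar>A j l\<bar> \<le> Bd"
    and B_bd: "\<And>i j l. j \<in> {1..n} \<Longrightarrow> l \<in> {1..n} \<Longrightarrow> \<bar>B i j l\<bar> \<le> Bd"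
    and Bd: "0 \<le> Bd" and Cm: "0 \<le> Cm"
    and dU_mult: "\<And>i s u K N. s \<le> q \<Longrightarrow> u \<in> L2 dx \<Longrightarrow> (\<And>M. sobsum s M u \<le> K) \<Longrightarrow>
      sobsum s N (\<lambda>x. pd (axis i 1) U x * u x) \<le> Cm * K"
begin

definition Sm :: "'d \<Rightarrow> nat \<Rightarrow> nat \<Rightarrow> real" where
  "Sm i j l = B i j l + B i l j"

definition Rm :: "nat \<Rightarrow> nat \<Rightarrow> real^'d \<Rightarrow> real" where
  "Rm j l x = A j l - (\<Sum>i\<in>UNIV. B i j l * pd (axis i 1) U x)"

definition RR :: "(nat \<Rightarrow> real^'d \<Rightarrow> real) \<Rightarrow> nat \<Rightarrow> real^'d \<Rightarrow> real" where
  "RR w j x = (\<Sum>l=1..n. Rm j l x * w l x)"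

text \<open>The coefficient at \<xi> of minus the transport term: the minus sign cancels the one in
  \<open>hat_pderiv\<close>.\<close>

definition Sk :: "(int^'d \<Rightarrow> nat \<Rightarrow> real) \<Rightarrow> int^'d \<Rightarrow> nat \<Rightarrow> real" where
  "Sk a \<xi> j = (\<Sum>i\<in>UNIV. \<Sum>l=1..n. Sm i j l * (2 * pi * of_int (\<xi> $ i)) * a (- \<xi>) l)"

text \<open>\<open>2 * Bd\<^sup>2\<close> comes from the matrix A, the other summand from the
  CARD('d) products with derivatives of U. Of the three factors n, one is Cauchy-Schwarz for the sum
  over l, one that sum itself, one the sum over components.\<close>

definition CR :: real where
  "CR = real n ^ 3 * (2 * Bd\<^sup>2 + 2 * (real CARD('d))\<^sup>2 * Bd\<^sup>2 * Cm)"

lemma CR_nonneg: "0 \<le> CR"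
  using Cm by (simp add: CR_def)

lemma Sm_sym: "Sm i j l = Sm i l j"
  by (simp add: Sm_def)

lemma Rm_Cinf: "Rm j l \<in> Cinf_torus"
  unfolding Rm_def[abs_def]
  by (intro Cinf_torus_diff Cinf_torus_const Cinf_torus_sum Cinf_torus_cmult Cinf_torus_pderiv U)

lemma smooth_mult_L2: "r \<in> Cinf_torus \<Longrightarrow> u \<in> L2 dx \<Longrightarrow> (\<lambda>x. r x * u x) \<in> L2 dx"
  by (metis Cinf_torus_bounded Cinf_torus_measurable L2_bounded_mult(1))

lemma RR_L2: "(\<And>l. l \<in> {1..n} \<Longrightarrow> w l \<in> L2 dx) \<Longrightarrow> RR w j \<in> L2 dx"
  unfolding RR_def[abs_def] by (intro L2_sum smooth_mult_L2 Rm_Cinf) auto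

lemma hat_RR:
  assumes "\<And>l. l \<in> {1..n} \<Longrightarrow> w l \<in> L2 dx"
  shows "hat (RR w j) \<xi> = (\<Sum>l=1..n. \<integral>x. w l x * (Rm j l x * hartley \<xi> x) \<partial>dx)"
proof -
  have "hat (RR w j) \<xi> = (\<Sum>l=1..n. hat (\<lambda>x. Rm j l x * w l x) \<xi>)"
    unfolding RR_def[abs_def] by (rule hat_sum) (intro smooth_mult_L2 Rm_Cinf assms)
  then show ?thesis by (simp add: hat_def mult_ac)
qed

lemma hat_RR_diff:
  assumes "\<And>l. l \<in> {1..n} \<Longrightarrow> w l \<in> L2 dx" "\<And>l. l \<in> {1..n} \<Longrightarrow> v l \<in> L2 dx"
  shows "hat (RR (\<lambda>l x. w l x - v l x) j) \<xi> = hat (RR w j) \<xi> - hat (RR v j) \<xi>"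
proof -
  have "RR (\<lambda>l x. w l x - v l x) j = (\<lambda>x. RR w j x - RR v j x)"
    by (simp add: RR_def fun_eq_iff right_diff_distrib sum_subtractf)
  then show ?thesis using RR_L2[of w j, OF assms(1)] RR_L2[of v j, OF assms(2)] by (simp add: hat_diff)
qed

lemma hat_RR_trig:
  assumes "finite \<Lambda>"
  shows "hat (RR (\<lambda>l. trig (a l) \<Lambda>) j) \<xi> = (\<Sum>l=1..n. \<Sum>\<zeta>\<in>\<Lambda>. a l \<zeta> * hat (\<lambda>x. Rm j l x * hartley \<zeta> x) \<xi>)"
proof -
  have 1: "(\<lambda>x. Rm j l x * trig (a l) \<Lambda> x) = (\<lambda>x. \<Sum>\<zeta>\<in>\<Lambda>. a l \<zeta> * (Rm j l x * hartley \<zeta> x))" for l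
    by (simp add: trig_def sum_distrib_left mult_ac fun_eq_iff)
  have L: "(\<lambda>x. a l \<zeta> * (Rm j l x * hartley \<zeta> x)) \<in> L2 dx" for l \<zeta>
    by (intro L2_cmult smooth_mult_L2 Rm_Cinf Cinf_torus_L2[OF hartley_Cinf])
  have "hat (RR (\<lambda>l. trig (a l) \<Lambda>) j) \<xi> = (\<Sum>l=1..n. hat (\<lambda>x. Rm j l x * trig (a l) \<Lambda> x) \<xi>)"
    unfolding RR_def[abs_def] by (rule hat_sum) (intro smooth_mult_L2 Rm_Cinf Cinf_torus_L2[OF trig_Cinf])
  also have "\<dots> = (\<Sum>l=1..n. \<Sum>\<zeta>\<in>\<Lambda>. a l \<zeta> * hat (\<lambda>x. Rm j l x * hartley \<zeta> x) \<xi>)"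
    unfolding 1 by (simp add: hat_sum L hat_cmult)
  finally show ?thesis .
qed

lemma RR_sobsum:
  assumes s: "s \<le> q" and w: "\<And>l. l \<in> {1..n} \<Longrightarrow> w l \<in> L2 dx"
    and K: "\<And>M. (\<Sum>l=1..n. sobsum s M (w l)) \<le> K"
  shows "(\<Sum>j=1..n. sobsum s N (RR w j)) \<le> CR * K"
proof -
  let ?d = "\<lambda>i x. pd (axis i 1) U x"
  let ?D = "real CARD('d)"
  have Kl: "sobsum s M (w l) \<le> K" if "l \<in> {1..n}" for l M
    using order_trans[OF member_le_sum[of l "{1..n}" "\<lambda>l. sobsum s M (w l)"] K] that by auto
  have c: "sobsum s N (\<lambda>x. Rm j l x * w l x) \<le> (2 * Bd\<^sup>2 + 2 * ?D\<^sup>2 * Bd\<^sup>2 * Cm) * K"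
    if j: "j \<in> {1..n}" and l: "l \<in> {1..n}" for j l
  proof -
    have dL: "(\<lambda>x. ?d i x * w l x) \<in> L2 dx" for i
      by (intro smooth_mult_L2 Cinf_torus_pderiv U w l)
    have "(\<lambda>x. Rm j l x * w l x) = (\<lambda>x. A j l * w l x + (\<Sum>i\<in>UNIV. (- B i j l) * (?d i x * w l x)))"
      by (simp add: Rm_def fun_eq_iff left_diff_distrib sum_distrib_right sum_negf mult.assoc)
    then have "sobsum s N (\<lambda>x. Rm j l x * w l x) \<le> 2 * sobsum s N (\<lambda>x. A j l * w l x)
        + 2 * sobsum s N (\<lambda>x. \<Sum>i\<in>UNIV. (- B i j l) * (?d i x * w l x))"
      using w[OF l] dL by (simp only:) (intro sobsum_add_le L2_cmult L2_sum)
    also have "sobsum s N (\<lambda>x. A j l * w l x) \<le> Bd\<^sup>2 * K"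
      unfolding sobsum_cmult using power_mono[OF A_bd[OF j l], of 2] Kl[OF l] by (intro mult_mono) auto
    also have "sobsum s N (\<lambda>x. \<Sum>i\<in>UNIV. (- B i j l) * (?d i x * w l x))
        \<le> ?D * (\<Sum>i\<in>UNIV. sobsum s N (\<lambda>x. (- B i j l) * (?d i x * w l x)))"
      using dL by (intro sobsum_sum_le L2_cmult) auto
    also have "(\<Sum>i\<in>UNIV. sobsum s N (\<lambda>x. (- B i j l) * (?d i x * w l x))) \<le> (\<Sum>i\<in>(UNIV :: 'd set). Bd\<^sup>2 * (Cm * K))"
      unfolding sobsum_cmult using power_mono[OF B_bd[OF j l], of _ 2] dU_mult[OF s w[OF l] Kl[OF l]]
      by (intro sum_mono mult_mono) auto
    finally have "sobsum s N (\<lambda>x. Rm j l x * w l x) \<le> 2 * (Bd\<^sup>2 * K) + 2 * (?D * (\<Sum>i\<in>(UNIV :: 'd set). Bd\<^sup>2 * (Cm * K)))"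
      by (simp add: mult_left_mono)
    also have "\<dots> = (2 * Bd\<^sup>2 + 2 * ?D\<^sup>2 * Bd\<^sup>2 * Cm) * K"
      by (simp add: algebra_simps power2_eq_square)
    finally show ?thesis .
  qed
  have "(\<Sum>j=1..n. sobsum s N (RR w j)) \<le> (\<Sum>j=1..n. real n * (\<Sum>l=1..n. (2 * Bd\<^sup>2 + 2 * ?D\<^sup>2 * Bd\<^sup>2 * Cm) * K))"
  proof (rule sum_mono)
    fix j assume j: "j \<in> {1..n}"
    have "sobsum s N (RR w j) \<le> real (card {1..n}) * (\<Sum>l=1..n. sobsum s N (\<lambda>x. Rm j l x * w l x))"
      unfolding RR_def[abs_def] by (intro sobsum_sum_le smooth_mult_L2 Rm_Cinf w) auto
    also have "\<dots> \<le> real (card {1..n}) * (\<Sum>l=1..n. (2 * Bd\<^sup>2 + 2 * ?D\<^sup>2 * Bd\<^sup>2 * Cm) * K)"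
      using c[OF j] by (intro mult_left_mono sum_mono) auto
    finally show "sobsum s N (RR w j) \<le> real n * (\<Sum>l=1..n. (2 * Bd\<^sup>2 + 2 * ?D\<^sup>2 * Bd\<^sup>2 * Cm) * K)" by simp
  qed
  also have "\<dots> = CR * K" by (simp add: CR_def power3_eq_cube algebra_simps)
  finally show ?thesis .
qed

section \<open>The transport term and energy estimates for systems of modes\<close>

lemma Sk_diff: "Sk (\<lambda>\<xi> l. a \<xi> l - b \<xi> l) \<xi> j = Sk a \<xi> j - Sk b \<xi> j"
  by (simp add: Sk_def right_diff_distrib sum_subtractf)

lemma Sk_tendsto:
  "(\<And>\<xi> l. l \<in> {1..n} \<Longrightarrow> (\<lambda>m. a m \<xi> l) \<longlonglongrightarrow> b \<xi> l) \<Longrightarrow> (\<lambda>m. Sk (a m) \<xi> j) \<longlonglongrightarrow> Sk b \<xi> j"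
  unfolding Sk_def by (intro tendsto_sum tendsto_mult tendsto_const) auto

lemma Sk_bound:
  assumes "\<And>l. l \<in> {1..n} \<Longrightarrow> \<bar>a (- \<xi>) l\<bar> \<le> Y"
  shows "\<bar>Sk a \<xi> j\<bar> \<le> (\<Sum>i\<in>UNIV. \<Sum>l=1..n. \<bar>Sm i j l * (2 * pi * of_int (\<xi> $ i))\<bar> * Y)"
proof -
  have *: "\<bar>x * b\<bar> \<le> \<bar>x\<bar> * Y" if "\<bar>b\<bar> \<le> Y" for x b :: real
    using that by (simp add: abs_mult mult_left_mono)
  show ?thesis
    unfolding Sk_def by (intro order_trans[OF sum_abs] sum_mono * assms)
qed

definition esum :: "(int^'d \<Rightarrow> real) \<Rightarrow> (int^'d) set \<Rightarrow> (int^'d \<Rightarrow> nat \<Rightarrow> real) \<Rightarrow> real" where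
  "esum V \<Lambda> a = (\<Sum>\<xi>\<in>\<Lambda>. \<Sum>j=1..n. V \<xi> * (a \<xi> j)\<^sup>2)"

text \<open>Reindexing by \<open>\<xi> \<mapsto> - \<xi>\<close> exchanges the two factors; the
  matrices are symmetric and the frequency is odd, so the sum equals its own negative. This uses
  that the index set is symmetric and the weight even.\<close>

lemma skew_sum_zero:
  assumes sym: "\<And>\<xi>. \<xi> \<in> \<Lambda> \<Longrightarrow> - \<xi> \<in> \<Lambda>" and V: "\<And>\<xi>. V (- \<xi>) = V \<xi>"
  shows "(\<Sum>\<xi>\<in>\<Lambda>. \<Sum>j=1..n. V \<xi> * (a \<xi> j * Sk a \<xi> j)) = 0"
proof -
  define Q where "Q \<xi> = (\<Sum>i\<in>UNIV. \<Sum>j=1..n. \<Sum>l=1..n. (2 * pi * of_int (\<xi> $ i)) * (Sm i j l * (a \<xi> j * a (- \<xi>) l)))" for \<xi>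
  have eq: "(\<Sum>j=1..n. V \<xi> * (a \<xi> j * Sk a \<xi> j)) = V \<xi> * Q \<xi>" for \<xi>
  proof -
    have "(\<Sum>j=1..n. a \<xi> j * Sk a \<xi> j) = Q \<xi>"
      unfolding Q_def Sk_def sum_distrib_left by (subst sum.swap) (simp add: mult_ac)
    then show ?thesis by (simp add: sum_distrib_left[symmetric])
  qed
  have odd: "Q (- \<xi>) = - Q \<xi>" for \<xi>
  proof -
    have "Q (- \<xi>) = (\<Sum>i\<in>UNIV. \<Sum>l=1..n. \<Sum>j=1..n. (2 * pi * of_int ((- \<xi>) $ i)) * (Sm i j l * (a (- \<xi>) j * a (- (- \<xi>)) l)))"
      unfolding Q_def by (intro sum.cong refl sum.swap)
    also have "\<dots> = - Q \<xi>"
      unfolding Q_def sum_negf[symmetric] by (intro sum.cong refl) (simp add: Sm_sym mult_ac)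
    finally show ?thesis .
  qed
  have "(\<Sum>\<xi>\<in>\<Lambda>. V \<xi> * Q \<xi>) = (\<Sum>\<xi>\<in>\<Lambda>. V (- \<xi>) * Q (- \<xi>))"
    by (rule sum.reindex_bij_witness[of _ uminus uminus]) (auto simp: sym)
  then show ?thesis unfolding eq by (simp add: V odd sum_negf)
qed

text \<open>The product rule for the square of each mode, summed with weights. The transport part
  cancels by \<open>skew_sum_zero\<close>, so its unbounded frequencies never enter the right-hand
  side.\<close>

lemma energy_identity:
  assumes fin: "finite \<Lambda>" and sym: "\<And>\<xi>. \<xi> \<in> \<Lambda> \<Longrightarrow> - \<xi> \<in> \<Lambda>" and V: "\<And>\<xi>. V (- \<xi>) = V \<xi>"
    and ym: "\<And>\<xi> j. \<xi> \<in> \<Lambda> \<Longrightarrow> j \<in> {1..n} \<Longrightarrow> y \<xi> j \<in> borel_measurable (dt T)"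
    and yb: "\<And>\<xi> j t. \<xi> \<in> \<Lambda> \<Longrightarrow> j \<in> {1..n} \<Longrightarrow> 0 < t \<Longrightarrow> t < T \<Longrightarrow> \<bar>y \<xi> j t\<bar> \<le> Y"
    and h: "\<And>\<xi> j. \<xi> \<in> \<Lambda> \<Longrightarrow> j \<in> {1..n} \<Longrightarrow> integrable (dt T) (h \<xi> j)"
    and eq: "\<And>\<xi> j t. \<xi> \<in> \<Lambda> \<Longrightarrow> j \<in> {1..n} \<Longrightarrow> t \<in> {0..T} \<Longrightarrow>
      y \<xi> j t = y0 \<xi> j + prim T (\<lambda>s. Sk (\<lambda>\<zeta> l. y \<zeta> l s) \<xi> j + h \<xi> j s) t"
    and t: "t \<in> {0..T}"
  shows "esum V \<Lambda> (\<lambda>\<xi> j. y \<xi> j t) = esum V \<Lambda> y0 + prim T (\<lambda>s. 2 * (\<Sum>\<xi>\<in>\<Lambda>. \<Sum>j=1..n. V \<xi> * (y \<xi> j s * h \<xi> j s))) t"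
    and "integrable (dt T) (\<lambda>s. 2 * (\<Sum>\<xi>\<in>\<Lambda>. \<Sum>j=1..n. V \<xi> * (y \<xi> j s * h \<xi> j s)))"
proof -
  let ?q = "\<lambda>\<xi> j s. Sk (\<lambda>\<zeta> l. y \<zeta> l s) \<xi> j + h \<xi> j s"
  have Skm: "(\<lambda>s. Sk (\<lambda>\<zeta> l. y \<zeta> l s) \<xi> j) \<in> borel_measurable (dt T)" if "\<xi> \<in> \<Lambda>" for \<xi> j
    unfolding Sk_def by (intro borel_measurable_sum borel_measurable_times borel_measurable_const ym sym that)
  have Ski: "integrable (dt T) (\<lambda>s. Sk (\<lambda>\<zeta> l. y \<zeta> l s) \<xi> j)" if "\<xi> \<in> \<Lambda>" for \<xi> j
    by (rule time_integrable_bounded[OF Skm[OF that] Sk_bound]) (use yb sym that in auto)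
  have qi: "integrable (dt T) (?q \<xi> j)" if "\<xi> \<in> \<Lambda>" "j \<in> {1..n}" for \<xi> j
    using Ski h that by simp
  have P: "(y \<xi> j t)\<^sup>2 = (y0 \<xi> j)\<^sup>2 + prim T (\<lambda>s. ?q \<xi> j s * y \<xi> j s + y \<xi> j s * ?q \<xi> j s) t"
    and Pi: "integrable (dt T) (\<lambda>s. ?q \<xi> j s * y \<xi> j s + y \<xi> j s * ?q \<xi> j s)"
    if "\<xi> \<in> \<Lambda>" "j \<in> {1..n}" for \<xi> j
    using prim_product_rule[OF qi[OF that] qi[OF that] eq[OF that] eq[OF that] t] by (simp_all add: power2_eq_square)
  have Pv: "V \<xi> * (y \<xi> j t)\<^sup>2 = V \<xi> * (y0 \<xi> j)\<^sup>2 + prim T (\<lambda>s. V \<xi> * (?q \<xi> j s * y \<xi> j s + y \<xi> j s * ?q \<xi> j s)) t"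
    if "\<xi> \<in> \<Lambda>" "j \<in> {1..n}" for \<xi> j
    unfolding prim_cmult P[OF that] by (rule distrib_left)
  have yh: "integrable (dt T) (\<lambda>s. y \<xi> j s * h \<xi> j s)" if "\<xi> \<in> \<Lambda>" "j \<in> {1..n}" for \<xi> j
    by (rule time_integrable_mult_bounded[OF h[OF that] ym[OF that] yb[OF that]])
  show "integrable (dt T) (\<lambda>s. 2 * (\<Sum>\<xi>\<in>\<Lambda>. \<Sum>j=1..n. V \<xi> * (y \<xi> j s * h \<xi> j s)))"
    by (intro Bochner_Integration.integrable_sum integrable_mult_right yh)
  have "esum V \<Lambda> (\<lambda>\<xi> j. y \<xi> j t) = esum V \<Lambda> y0 +
      (\<Sum>\<xi>\<in>\<Lambda>. \<Sum>j=1..n. prim T (\<lambda>s. V \<xi> * (?q \<xi> j s * y \<xi> j s + y \<xi> j s * ?q \<xi> j s)) t)"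
    unfolding esum_def sum.distrib[symmetric] by (intro sum.cong refl Pv)
  also have "(\<Sum>\<xi>\<in>\<Lambda>. \<Sum>j=1..n. prim T (\<lambda>s. V \<xi> * (?q \<xi> j s * y \<xi> j s + y \<xi> j s * ?q \<xi> j s)) t)
      = prim T (\<lambda>s. \<Sum>\<xi>\<in>\<Lambda>. \<Sum>j=1..n. V \<xi> * (?q \<xi> j s * y \<xi> j s + y \<xi> j s * ?q \<xi> j s)) t"
    using Pi by (subst prim_sum) (auto intro!: sum.cong prim_sum[symmetric] Bochner_Integration.integrable_sum integrable_mult_right)
  also have "\<dots> = prim T (\<lambda>s. 2 * (\<Sum>\<xi>\<in>\<Lambda>. \<Sum>j=1..n. V \<xi> * (y \<xi> j s * h \<xi> j s))) t"
  proof (rule prim_cong)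
    fix s
    have "(\<Sum>\<xi>\<in>\<Lambda>. \<Sum>j=1..n. V \<xi> * (?q \<xi> j s * y \<xi> j s + y \<xi> j s * ?q \<xi> j s)) =
        (\<Sum>\<xi>\<in>\<Lambda>. \<Sum>j=1..n. 2 * (V \<xi> * (y \<xi> j s * Sk (\<lambda>\<zeta> l. y \<zeta> l s) \<xi> j)) + 2 * (V \<xi> * (y \<xi> j s * h \<xi> j s)))"
      by (intro sum.cong refl) (simp add: algebra_simps)
    also have "\<dots> = 2 * (\<Sum>\<xi>\<in>\<Lambda>. \<Sum>j=1..n. V \<xi> * (y \<xi> j s * Sk (\<lambda>\<zeta> l. y \<zeta> l s) \<xi> j)) + 2 * (\<Sum>\<xi>\<in>\<Lambda>. \<Sum>j=1..n. V \<xi> * (y \<xi> j s * h \<xi> j s))"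
      by (simp add: sum.distrib sum_distrib_left)
    finally show "(\<Sum>\<xi>\<in>\<Lambda>. \<Sum>j=1..n. V \<xi> * (?q \<xi> j s * y \<xi> j s + y \<xi> j s * ?q \<xi> j s)) = 2 * (\<Sum>\<xi>\<in>\<Lambda>. \<Sum>j=1..n. V \<xi> * (y \<xi> j s * h \<xi> j s))"
      using skew_sum_zero[where V = V and \<Lambda> = \<Lambda> and a = "\<lambda>\<xi> j. y \<xi> j s", OF sym V] by simp
  qed
  finally show "esum V \<Lambda> (\<lambda>\<xi> j. y \<xi> j t) = esum V \<Lambda> y0 + prim T (\<lambda>s. 2 * (\<Sum>\<xi>\<in>\<Lambda>. \<Sum>j=1..n. V \<xi> * (y \<xi> j s * h \<xi> j s))) t" .
qed

text \<open>The forcing is split into a part \<open>r\<close> controlled by the energy itself, which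
  feeds Gronwall's lemma, and a part \<open>g\<close> with a given integrable majorant. The bound
  does not depend on the index set, nor on \<open>Y\<close>, which only serves
  integrability.\<close>

lemma energy_bound:
  assumes fin: "finite \<Lambda>" and sym: "\<And>\<xi>. \<xi> \<in> \<Lambda> \<Longrightarrow> - \<xi> \<in> \<Lambda>" and V: "\<And>\<xi>. V (- \<xi>) = V \<xi>" "\<And>\<xi>. 0 \<le> V \<xi>"
    and ym: "\<And>\<xi> j. \<xi> \<in> \<Lambda> \<Longrightarrow> j \<in> {1..n} \<Longrightarrow> y \<xi> j \<in> borel_measurable (dt T)"
    and yb: "\<And>\<xi> j t. \<xi> \<in> \<Lambda> \<Longrightarrow> j \<in> {1..n} \<Longrightarrow> 0 < t \<Longrightarrow> t < T \<Longrightarrow> \<bar>y \<xi> j t\<bar> \<le> Y"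
    and r: "\<And>\<xi> j. \<xi> \<in> \<Lambda> \<Longrightarrow> j \<in> {1..n} \<Longrightarrow> integrable (dt T) (r \<xi> j)"
    and g: "\<And>\<xi> j. \<xi> \<in> \<Lambda> \<Longrightarrow> j \<in> {1..n} \<Longrightarrow> integrable (dt T) (g \<xi> j)"
    and eq: "\<And>\<xi> j t. \<xi> \<in> \<Lambda> \<Longrightarrow> j \<in> {1..n} \<Longrightarrow> t \<in> {0..T} \<Longrightarrow>
      y \<xi> j t = y0 \<xi> j + prim T (\<lambda>s. Sk (\<lambda>\<zeta> l. y \<zeta> l s) \<xi> j + (g \<xi> j s - r \<xi> j s)) t"
    and rb: "\<And>s. 0 < s \<Longrightarrow> s < T \<Longrightarrow> esum V \<Lambda> (\<lambda>\<xi> j. r \<xi> j s) \<le> CR * esum V \<Lambda> (\<lambda>\<xi> j. y \<xi> j s)"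
    and gb: "AE s in dt T. esum V \<Lambda> (\<lambda>\<xi> j. g \<xi> j s) \<le> \<kappa> s" and \<kappa>: "integrable (dt T) \<kappa>"
    and K0: "esum V \<Lambda> y0 \<le> K0" and K1: "(\<integral>s. \<kappa> s \<partial>dt T) \<le> K1"
    and t: "t \<in> {0..T}"
  shows "esum V \<Lambda> (\<lambda>\<xi> j. y \<xi> j t) \<le> (K0 + K1) * exp ((2 + CR) * T)"
proof -
  let ?E = "\<lambda>s. esum V \<Lambda> (\<lambda>\<xi> j. y \<xi> j s)"
  let ?h = "\<lambda>\<xi> j s. g \<xi> j s - r \<xi> j s"
  let ?P = "\<lambda>s. 2 * (\<Sum>\<xi>\<in>\<Lambda>. \<Sum>j=1..n. V \<xi> * (y \<xi> j s * ?h \<xi> j s))"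
  have hi: "integrable (dt T) (?h \<xi> j)" if "\<xi> \<in> \<Lambda>" "j \<in> {1..n}" for \<xi> j using g r that by simp
  have EI: "?E t = esum V \<Lambda> y0 + prim T ?P t" "integrable (dt T) ?P" if t: "t \<in> {0..T}" for t
    by (rule energy_identity[where y = y and h = ?h and ?y0.0 = y0 and V = V and \<Lambda> = \<Lambda>, OF fin sym V(1) ym yb hi eq t]; assumption)+
  have Ei: "integrable (dt T) ?E"
    unfolding esum_def
  proof (intro Bochner_Integration.integrable_sum integrable_mult_right)
    fix \<xi> j assume *: "\<xi> \<in> \<Lambda>" "j \<in> {1..n}"
    show "integrable (dt T) (\<lambda>s. (y \<xi> j s)\<^sup>2)"
    proof (rule time_integrable_bounded[where B = "Y\<^sup>2"])
      show "(\<lambda>s. (y \<xi> j s)\<^sup>2) \<in> borel_measurable (dt T)" using ym[OF *] by measurable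
      fix s assume "0 < s" "s < T"
      from power_mono[OF yb[OF * this], of 2] show "\<bar>(y \<xi> j s)\<^sup>2\<bar> \<le> Y\<^sup>2" by simp
    qed
  qed
  have k0: "AE s in dt T. 0 \<le> \<kappa> s"
    using gb by eventually_elim (rule order_trans[rotated], assumption, auto simp: esum_def V intro!: sum_nonneg)
  have le: "?E t \<le> (K0 + K1) + (2 + CR) * prim T ?E t" if t: "t \<in> {0..T}" for t
  proof -
    have "prim T ?P t \<le> prim T (\<lambda>s. (2 + CR) * ?E s + \<kappa> s) t"
    proof (rule prim_mono_AE)
      show "integrable (dt T) ?P" by (rule EI(2)[OF t])
      show "integrable (dt T) (\<lambda>s. (2 + CR) * ?E s + \<kappa> s)" using Ei \<kappa> by simp
      show "AE s in dt T. ?P s \<le> (2 + CR) * ?E s + \<kappa> s"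
        using gb AE_space
      proof eventually_elim
        case (elim s)
        then have s: "0 < s" "s < T" by auto
        \<comment> \<open>Origin of the rate \<open>2 + CR\<close>: two squares of y, and one of r,
          which costs CR.\<close>
        have 1: "2 * (a * (b - c)) \<le> 2 * a\<^sup>2 + b\<^sup>2 + c\<^sup>2" for a b c :: real
          using sum_squares_bound[of a b] sum_squares_bound[of "-a" c] by (simp add: algebra_simps)
        have "?P s = (\<Sum>\<xi>\<in>\<Lambda>. \<Sum>j=1..n. V \<xi> * (2 * (y \<xi> j s * ?h \<xi> j s)))"
          by (simp add: sum_distrib_left mult_ac)
        also have "\<dots> \<le> (\<Sum>\<xi>\<in>\<Lambda>. \<Sum>j=1..n. V \<xi> * (2 * (y \<xi> j s)\<^sup>2 + (g \<xi> j s)\<^sup>2 + (r \<xi> j s)\<^sup>2))"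
          by (intro sum_mono mult_left_mono 1 V)
        also have "\<dots> = 2 * ?E s + esum V \<Lambda> (\<lambda>\<xi> j. g \<xi> j s) + esum V \<Lambda> (\<lambda>\<xi> j. r \<xi> j s)"
          by (simp add: esum_def distrib_left sum.distrib sum_distrib_left mult_ac)
        also have "\<dots> \<le> 2 * ?E s + \<kappa> s + CR * ?E s"
          using elim rb[OF s] by simp
        finally show ?case by (simp add: algebra_simps)
      qed
    qed
    also have "\<dots> = (2 + CR) * prim T ?E t + prim T \<kappa> t"
      using Ei \<kappa> by (simp add: prim_add prim_cmult)
    \<comment> \<open>The majorant is nonnegative almost everywhere because it dominates a sum of
      squares, so its primitive grows up to T.\<close>
    also have "prim T \<kappa> t \<le> K1"
    proof -
      have "prim T \<kappa> t \<le> prim T \<kappa> T"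
        unfolding prim_def
      proof (rule integral_mono_AE)
        show "AE s in dt T. indicator {..t} s * \<kappa> s \<le> indicator {..T} s * \<kappa> s"
          using k0 by eventually_elim (use t in \<open>auto simp: indicator_def\<close>)
      qed (intro prim_integrable \<kappa>)+
      then show ?thesis using K1 by (simp add: prim_T)
    qed
    finally show ?thesis using EI(1)[OF t] K0 by simp
  qed
  have C: "2 + CR > 0" using CR_nonneg by simp
  have nn: "0 \<le> K0 + K1"
  proof -
    have "0 \<le> ?E 0" by (auto simp: esum_def V intro!: sum_nonneg)
    also have "\<dots> \<le> K0 + K1" using le[of 0] T by (simp add: prim_0)
    finally show ?thesis .
  qed
  have "?E t \<le> (K0 + K1) * exp ((2 + CR) * t)"
    by (rule Gronwall_prim[OF Ei C le t])
  also have "\<dots> \<le> (K0 + K1) * exp ((2 + CR) * T)"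
    using t C nn by (intro mult_left_mono) auto
  finally show ?thesis .
qed

end

lemma sobsum_trig_le: "sobsum s M (trig a (Lam N)) \<le> (\<Sum>\<xi>\<in>Lam N. weight s \<xi> * (a \<xi>)\<^sup>2)"
proof -
  have "sobsum s M (trig a (Lam N)) = (\<Sum>\<xi>\<in>Lam M. if \<xi> \<in> Lam N then weight s \<xi> * (a \<xi>)\<^sup>2 else 0)"
    unfolding sobsum_def by (intro sum.cong) (auto simp: hat_trig)
  also have "\<dots> = (\<Sum>\<xi>\<in>Lam M \<inter> Lam N. weight s \<xi> * (a \<xi>)\<^sup>2)"
    by (simp add: sum.inter_restrict)
  also have "\<dots> \<le> (\<Sum>\<xi>\<in>Lam N. weight s \<xi> * (a \<xi>)\<^sup>2)"
    by (intro sum_mono2) auto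
  finally show ?thesis .
qed

text \<open>Some coordinate of \<xi> is at least N + 1 in modulus, and 2 pi exceeds 1. This is the
  source of the convergence rate of the Galerkin scheme.\<close>

lemma weight_outside_Lam:
  fixes \<xi> :: "int^'d"
  assumes "\<xi> \<notin> Lam N" "1 \<le> s"
  shows "(real N + 1)\<^sup>2 \<le> weight s \<xi>"
proof -
  obtain i where "\<not> \<bar>\<xi> $ i\<bar> \<le> int N" using assms(1) unfolding Lam_def by blast
  then have i: "\<bar>\<xi> $ i\<bar> \<ge> int N + 1" by simp
  have "real N + 1 \<le> of_int \<bar>\<xi> $ i\<bar>" using i by (metis of_int_add of_int_of_nat_eq of_int_1 of_int_le_iff)
  also have "\<dots> \<le> 2 * pi * of_int \<bar>\<xi> $ i\<bar>"
  proof -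
    have "1 * real_of_int \<bar>\<xi> $ i\<bar> \<le> (2 * pi) * of_int \<bar>\<xi> $ i\<bar>"
      using pi_gt3 by (intro mult_right_mono) auto
    then show ?thesis by simp
  qed
  finally have "(real N + 1)\<^sup>2 \<le> (2 * pi * of_int \<bar>\<xi> $ i\<bar>)\<^sup>2" by (intro power_mono) auto
  also have "\<dots> = (2 * pi * of_int (\<xi> $ i))\<^sup>2" by (simp add: power_mult_distrib)
  also have "\<dots> \<le> freq \<xi>"
    unfolding freq_def by (rule member_le_sum[where f = "\<lambda>i. (2 * pi * of_int (\<xi> $ i))\<^sup>2"]) auto
  also have "\<dots> \<le> weight 1 \<xi>" by (simp add: weight_def)
  also have "\<dots> \<le> weight s \<xi>" by (rule weight_mono[OF assms(2)])
  finally show ?thesis .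
qed

lemma trig_coeff_diff: "trig a \<Lambda> x - trig b \<Lambda> x = trig (\<lambda>\<xi>. a \<xi> - b \<xi>) \<Lambda> x"
  by (simp add: trig_def left_diff_distrib sum_subtractf)

lemma trig_enlarge:
  assumes "finite \<Lambda>'" "\<Lambda> \<subseteq> \<Lambda>'" "\<And>\<xi>. \<xi> \<notin> \<Lambda> \<Longrightarrow> a \<xi> = 0"
  shows "trig a \<Lambda> = trig a \<Lambda>'"
  unfolding trig_def[abs_def] by (intro ext sum.mono_neutral_left) (use assms in auto)

lemma sobsum_time_integrable:
  assumes "u \<in> L2 (dtx T)"
  shows "integrable (dt T) (\<lambda>t. sobsum s N (slice u t))"
  unfolding sobsum_def
  by (intro Bochner_Integration.integrable_sum integrable_mult_right L2_sq_integrable cyl_hat_L2 assms)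

abbreviation sobsums where
  "sobsums n s N u \<equiv> \<lambda>t. \<Sum>j=1..n. sobsum s N (slice (u j) t)"

section \<open>The truncated systems: solvability, uniform bounds and rate of convergence\<close>

context moment_system
begin

abbreviation trigs :: "(int^'d \<Rightarrow> nat \<Rightarrow> real \<Rightarrow> real) \<Rightarrow> real \<Rightarrow> (int^'d) set \<Rightarrow> nat \<Rightarrow> real^'d \<Rightarrow> real" where
  "trigs y s \<Lambda> \<equiv> \<lambda>l. trig (\<lambda>\<zeta>. y \<zeta> l s) \<Lambda>"

abbreviation grhs where
  "grhs F \<Lambda> y \<xi> j \<equiv> \<lambda>s. Sk (\<lambda>\<zeta> l. y \<zeta> l s) \<xi> j + (hat (slice (F j) s) \<xi> - hat (RR (trigs y s \<Lambda>) j) \<xi>)"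

abbreviation rhs where
  "rhs F c \<xi> j \<equiv> \<lambda>s. Sk (\<lambda>\<zeta> l. hat (slice (c l) s) \<zeta>) \<xi> j + (hat (slice (F j) s) \<xi> - hat (RR (\<lambda>l. slice (c l) s) j) \<xi>)"

text \<open>The unknowns are coefficients, extended by zero off the cube so that solutions of
  different size can be compared on the larger one. The lower-order term acts on the truncated
  function and only its modes in the cube are kept.\<close>

definition galerkin :: "(nat \<Rightarrow> 'd::finite st_fun) \<Rightarrow> (nat \<Rightarrow> real^'d \<Rightarrow> real) \<Rightarrow> nat \<Rightarrow> (int^'d \<Rightarrow> nat \<Rightarrow> real \<Rightarrow> real) \<Rightarrow> bool" where
  "galerkin F G N y \<longleftrightarrow> (\<forall>\<xi> j. y \<xi> j \<in> borel_measurable borel) \<and> (\<exists>Y. \<forall>\<xi> j. \<forall>t\<in>{0..T}. \<bar>y \<xi> j t\<bar> \<le> Y) \<and>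
    (\<forall>\<xi> j t. \<xi> \<notin> Lam N \<longrightarrow> y \<xi> j t = 0) \<and>
    (\<forall>\<xi>\<in>Lam N. \<forall>j\<in>{1..n}. \<forall>t\<in>{0..T}. y \<xi> j t = hat (G j) \<xi> + prim T (grhs F (Lam N) y \<xi> j) t)"

text \<open>On a fixed cube this is a finite linear system, constant in time, with unknowns indexed
  by frequency and component. The forcing enters through its primitive, which is bounded and
  continuous.\<close>

lemma galerkin_exists:
  assumes F: "\<And>j. j \<in> {1..n} \<Longrightarrow> F j \<in> L2 (dtx T)"
  shows "\<exists>y. galerkin F G N y"
proof -
  let ?F = "\<lambda>j \<xi> s. hat (slice (F j) s) \<xi>"
  have Fi: "integrable (dt T) (?F j \<xi>)" if "j \<in> {1..n}" for j \<xi>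
    by (rule cyl_hat_integrable[OF F[OF that]])
  define I :: "((int^'d) \<times> nat) set" where "I = Lam N \<times> {1..n}"
  \<comment> \<open>Transport couples \<xi> with \<open>- \<xi>\<close> only; the lower-order term
    couples every pair of frequencies.\<close>
  define M where "M = (\<lambda>(\<xi>, j) (\<zeta>, l). (if \<zeta> = - \<xi> then \<Sum>i\<in>UNIV. Sm i j l * (2 * pi * of_int (\<xi> $ i)) else 0)
    - hat (\<lambda>x. Rm j l x * hartley \<zeta> x) \<xi>)"
  define G' where "G' = (\<lambda>(\<xi>, j) t. hat (G j) \<xi> + prim T (?F j \<xi>) t)"
  define b where "b = (\<lambda>(\<xi>, j). \<bar>hat (G j) \<xi>\<bar> + (\<integral>s. \<bar>?F j \<xi> s\<bar> \<partial>dt T))"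
  have finI: "finite I" by (simp add: I_def)
  have b0: "0 \<le> b p" for p by (cases p) (simp add: b_def)
  have G'b: "\<bar>G' p t\<bar> \<le> sum b I" if pI: "p \<in> I" for p t
  proof -
    obtain \<xi> j where p: "p = (\<xi>, j)" "j \<in> {1..n}" using pI by (cases p) (auto simp: I_def)
    have "\<bar>G' p t\<bar> \<le> b p"
      using prim_bounded[OF Fi[OF p(2)], of \<xi> t] abs_triangle_ineq[of "hat (G j) \<xi>" "prim T (?F j \<xi>) t"]
      by (simp add: G'_def b_def p(1))
    also have "\<dots> \<le> sum b I" by (rule member_le_sum[OF pI b0 finI])
    finally show ?thesis .
  qed
  have G'm: "G' p \<in> borel_measurable borel" if pI: "p \<in> I" for p
  proof -
    obtain \<xi> j where p: "p = (\<xi>, j)" "j \<in> {1..n}" using pI by (cases p) (auto simp: I_def)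
    have [measurable]: "prim T (?F j \<xi>) \<in> borel_measurable borel" by (rule prim_measurable[OF Fi[OF p(2)]])
    show ?thesis unfolding G'_def p(1) prod.case by measurable
  qed
  obtain z Z where z: "\<And>p. z p \<in> borel_measurable borel" "\<And>p t. p \<in> I \<Longrightarrow> t \<in> {0..T} \<Longrightarrow> \<bar>z p t\<bar> \<le> Z"
    "\<And>p t. p \<in> I \<Longrightarrow> t \<in> {0..T} \<Longrightarrow> z p t = G' p t + prim T (\<lambda>s. \<Sum>p'\<in>I. M p p' * z p' s) t"
    using linear_system_exists[of I G' "sum b I" T M, OF finI G'm G'b] by blast
  define y where "y \<xi> j t = (if (\<xi>, j) \<in> I then z (\<xi>, j) t else 0)" for \<xi> j t
  have y_meas: "y \<xi> j \<in> borel_measurable borel" for \<xi> j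
    using z(1)[of "(\<xi>, j)"] by (cases "(\<xi>, j) \<in> I") (simp_all add: y_def[abs_def])
  have y_bd: "\<bar>y \<xi> j t\<bar> \<le> \<bar>Z\<bar>" if "t \<in> {0..T}" for \<xi> j t
    using z(2)[of "(\<xi>, j)" t] that by (auto simp: y_def)
  have sumM: "(\<Sum>p'\<in>I. M (\<xi>, j) p' * z p' s) =
      Sk (\<lambda>\<zeta> l. y \<zeta> l s) \<xi> j - hat (RR (trigs y s (Lam N)) j) \<xi>" if \<xi>: "\<xi> \<in> Lam N" for \<xi> j s
  proof -
    have "(\<Sum>p'\<in>I. M (\<xi>, j) p' * z p' s) = (\<Sum>(\<zeta>, l)\<in>I. M (\<xi>, j) (\<zeta>, l) * y \<zeta> l s)"
      by (intro sum.cong) (auto simp: y_def)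
    also have "\<dots> = (\<Sum>\<zeta>\<in>Lam N. \<Sum>l=1..n. M (\<xi>, j) (\<zeta>, l) * y \<zeta> l s)"
      unfolding I_def by (rule sum.cartesian_product[symmetric])
    also have "\<dots> = (\<Sum>l=1..n. \<Sum>\<zeta>\<in>Lam N. M (\<xi>, j) (\<zeta>, l) * y \<zeta> l s)"
      by (rule sum.swap)
    also have "\<dots> = (\<Sum>l=1..n. (\<Sum>i\<in>UNIV. Sm i j l * (2 * pi * of_int (\<xi> $ i))) * y (- \<xi>) l s
        - (\<Sum>\<zeta>\<in>Lam N. y \<zeta> l s * hat (\<lambda>x. Rm j l x * hartley \<zeta> x) \<xi>))"
    proof (rule sum.cong[OF refl])
      fix l
      let ?c = "\<Sum>i\<in>UNIV. Sm i j l * (2 * pi * of_int (\<xi> $ i))"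
      have "(\<Sum>\<zeta>\<in>Lam N. M (\<xi>, j) (\<zeta>, l) * y \<zeta> l s) =
          (\<Sum>\<zeta>\<in>Lam N. (if \<zeta> = - \<xi> then ?c * y (- \<xi>) l s else 0) - y \<zeta> l s * hat (\<lambda>x. Rm j l x * hartley \<zeta> x) \<xi>)"
        by (intro sum.cong) (auto simp: M_def left_diff_distrib)
      then show "(\<Sum>\<zeta>\<in>Lam N. M (\<xi>, j) (\<zeta>, l) * y \<zeta> l s) = ?c * y (- \<xi>) l s
          - (\<Sum>\<zeta>\<in>Lam N. y \<zeta> l s * hat (\<lambda>x. Rm j l x * hartley \<zeta> x) \<xi>)"
        using \<xi> by (simp add: sum_subtractf)
    qed
    also have "\<dots> = Sk (\<lambda>\<zeta> l. y \<zeta> l s) \<xi> j - hat (RR (trigs y s (Lam N)) j) \<xi>"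
    proof -
      have "Sk (\<lambda>\<zeta> l. y \<zeta> l s) \<xi> j = (\<Sum>l=1..n. (\<Sum>i\<in>UNIV. Sm i j l * (2 * pi * of_int (\<xi> $ i))) * y (- \<xi>) l s)"
        unfolding Sk_def sum_distrib_right by (rule sum.swap)
      then show ?thesis unfolding hat_RR_trig[OF finite_Lam] sum_subtractf by simp
    qed
    finally show ?thesis .
  qed
  have "y \<xi> j t = hat (G j) \<xi> + prim T (grhs F (Lam N) y \<xi> j) t"
    if \<xi>: "\<xi> \<in> Lam N" and j: "j \<in> {1..n}" and t: "t \<in> {0..T}" for \<xi> j t
  proof -
    have p: "(\<xi>, j) \<in> I" using \<xi> j by (simp add: I_def)
    have i: "integrable (dt T) (\<lambda>s. \<Sum>p'\<in>I. M (\<xi>, j) p' * z p' s)"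
    proof (intro Bochner_Integration.integrable_sum integrable_mult_right)
      fix p' assume "p' \<in> I"
      show "integrable (dt T) (z p')"
        by (rule time_integrable_bounded[OF borel_measurable_time_leb[OF z(1)] z(2)[OF \<open>p' \<in> I\<close>]]) auto
    qed
    have "y \<xi> j t = hat (G j) \<xi> + (prim T (?F j \<xi>) t + prim T (\<lambda>s. \<Sum>p'\<in>I. M (\<xi>, j) p' * z p' s) t)"
      using z(3)[OF p t] p by (simp add: y_def G'_def)
    also have "prim T (?F j \<xi>) t + prim T (\<lambda>s. \<Sum>p'\<in>I. M (\<xi>, j) p' * z p' s) t =
        prim T (\<lambda>s. ?F j \<xi> s + (\<Sum>p'\<in>I. M (\<xi>, j) p' * z p' s)) t"
      by (rule prim_add[OF Fi[OF j] i, symmetric])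
    also have "\<dots> = prim T (grhs F (Lam N) y \<xi> j) t"
      by (rule prim_cong) (simp add: sumM[OF \<xi>])
    finally show ?thesis .
  qed
  moreover have "y \<xi> j t = 0" if "\<xi> \<notin> Lam N" for \<xi> j t using that by (simp add: y_def I_def)
  ultimately have "galerkin F G N y"
    unfolding galerkin_def using y_meas y_bd by blast
  then show ?thesis by (rule exI[of _ y])
qed

lemma galerkinD:
  assumes "galerkin F G N y"
  shows "y \<xi> j \<in> borel_measurable borel" "\<xi> \<notin> Lam N \<Longrightarrow> y \<xi> j t = 0"
    "\<exists>Y. \<forall>\<xi> j. \<forall>t\<in>{0..T}. \<bar>y \<xi> j t\<bar> \<le> Y"
    "\<xi> \<in> Lam N \<Longrightarrow> j \<in> {1..n} \<Longrightarrow> t \<in> {0..T} \<Longrightarrow> y \<xi> j t = hat (G j) \<xi> + prim T (grhs F (Lam N) y \<xi> j) t"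
  using assms unfolding galerkin_def by blast+

lemma galerkin_integrable:
  assumes g: "galerkin F G N y"
  shows "integrable (dt T) (\<lambda>s. Sk (\<lambda>\<zeta> l. y \<zeta> l s) \<xi> j)"
    and "integrable (dt T) (\<lambda>s. hat (RR (trigs y s (Lam N)) j) \<xi>)"
proof -
  obtain Y where Y: "\<And>\<xi> j t. t \<in> {0..T} \<Longrightarrow> \<bar>y \<xi> j t\<bar> \<le> Y" using galerkinD(3)[OF g] by blast
  have yi: "integrable (dt T) (y \<xi> j)" for \<xi> j
    by (rule time_integrable_bounded[OF borel_measurable_time_leb[OF galerkinD(1)[OF g]] Y]) auto
  show "integrable (dt T) (\<lambda>s. Sk (\<lambda>\<zeta> l. y \<zeta> l s) \<xi> j)"
    unfolding Sk_def by (intro Bochner_Integration.integrable_sum integrable_mult_right yi)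
  show "integrable (dt T) (\<lambda>s. hat (RR (trigs y s (Lam N)) j) \<xi>)"
    unfolding hat_RR_trig[OF finite_Lam] by (intro Bochner_Integration.integrable_sum integrable_mult_left yi)
qed

lemma galerkin_continuous:
  assumes g: "galerkin F G N y" and F: "\<And>j. j \<in> {1..n} \<Longrightarrow> F j \<in> L2 (dtx T)" and j: "j \<in> {1..n}"
  shows "continuous_on {0..T} (y \<xi> j)"
proof (cases "\<xi> \<in> Lam N")
  case True
  let ?h = "grhs F (Lam N) y \<xi> j"
  have "integrable (dt T) ?h"
    using galerkin_integrable[OF g] cyl_hat_integrable[OF F[OF j]] by auto
  then have "continuous_on {0..T} (\<lambda>t. hat (G j) \<xi> + prim T ?h t)"
    by (intro continuous_intros continuous_on_subset[OF continuous_prim]) auto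
  then show ?thesis
    by (rule continuous_on_eq) (simp add: galerkinD(4)[OF g True j])
next
  case False
  then show ?thesis using galerkinD(2)[OF g False] by (simp add: continuous_on_def)
qed

lemma esum_swap: "esum V \<Lambda> a = (\<Sum>j=1..n. \<Sum>\<xi>\<in>\<Lambda>. V \<xi> * (a \<xi> j)\<^sup>2)"
  unfolding esum_def by (rule sum.swap)

lemma esum_sobsum: "esum (weight s) (Lam N) (\<lambda>\<xi> j. hat (u j) \<xi>) = (\<Sum>j=1..n. sobsum s N (u j))"
  unfolding esum_swap sobsum_def ..

lemma RR_trig_esum:
  assumes "s \<le> q"
  shows "(\<Sum>j=1..n. sobsum s M (RR (\<lambda>l. trig (\<lambda>\<zeta>. a \<zeta> l) (Lam N)) j)) \<le> CR * esum (weight s) (Lam N) a"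
proof (rule RR_sobsum[OF assms])
  show "trig (\<lambda>\<zeta>. a \<zeta> l) (Lam N) \<in> L2 dx" for l by (rule Cinf_torus_L2[OF trig_Cinf])
  show "(\<Sum>l=1..n. sobsum s M (trig (\<lambda>\<zeta>. a \<zeta> l) (Lam N))) \<le> esum (weight s) (Lam N) a" for M
    unfolding esum_swap by (intro sum_mono sobsum_trig_le)
qed

text \<open>The energy bound with the Sobolev weight; the right-hand side depends on N only through
  bounds for the data.\<close>

lemma galerkin_sobolev:
  assumes g: "galerkin F G N y" and s: "s \<le> q"
    and F: "\<And>j. j \<in> {1..n} \<Longrightarrow> F j \<in> L2 (dtx T)"
    and KG: "(\<Sum>j=1..n. sobsum s N (G j)) \<le> KG"
    and KF: "(\<integral>t. (sobsums n s N F t) \<partial>dt T) \<le> KF"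
    and t: "t \<in> {0..T}"
  shows "esum (weight s) (Lam N) (\<lambda>\<xi> j. y \<xi> j t) \<le> (KG + KF) * exp ((2 + CR) * T)"
proof -
  obtain Y where Y: "\<And>\<xi> j t. t \<in> {0..T} \<Longrightarrow> \<bar>y \<xi> j t\<bar> \<le> Y" using galerkinD(3)[OF g] by blast
  show ?thesis
  proof (rule energy_bound[where y = y and Y = Y and ?y0.0 = "\<lambda>\<xi> j. hat (G j) \<xi>" and g = "\<lambda>\<xi> j s. hat (slice (F j) s) \<xi>"
        and r = "\<lambda>\<xi> j s. hat (RR (trigs y s (Lam N)) j) \<xi>"
        and \<kappa> = "sobsums n s N F"])
    show "esum (weight s) (Lam N) (\<lambda>\<xi> j. hat (RR (trigs y s' (Lam N)) j) \<xi>)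
        \<le> CR * esum (weight s) (Lam N) (\<lambda>\<xi> j. y \<xi> j s')" for s'
      unfolding esum_sobsum by (rule RR_trig_esum[OF s])
    show "AE s' in dt T. esum (weight s) (Lam N) (\<lambda>\<xi> j. hat (slice (F j) s') \<xi>) \<le> (sobsums n s N F s')"
      unfolding esum_sobsum by simp
    show "integrable (dt T) (sobsums n s N F)"
      by (intro Bochner_Integration.integrable_sum sobsum_time_integrable F)
    show "esum (weight s) (Lam N) (\<lambda>\<xi> j. hat (G j) \<xi>) \<le> KG" unfolding esum_sobsum by (rule KG)
    show "integrable (dt T) (\<lambda>s. hat (slice (F j) s) \<xi>)" if "j \<in> {1..n}" for j \<xi>
      by (rule cyl_hat_integrable[OF F[OF that]])
    show "y \<xi> j \<in> borel_measurable (dt T)" for \<xi> j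
      by (rule borel_measurable_time_leb[OF galerkinD(1)[OF g]])
    show "\<bar>y \<xi> j t\<bar> \<le> Y" if "0 < t" "t < T" for \<xi> j t
      by (rule Y) (use that in auto)
    show "y \<xi> j t = hat (G j) \<xi> + prim T (grhs F (Lam N) y \<xi> j) t"
      if "\<xi> \<in> Lam N" "j \<in> {1..n}" "t \<in> {0..T}" for \<xi> j t
      by (rule galerkinD(4)[OF g that])
  qed (use KF t galerkin_integrable(2)[OF g] in auto)
qed

text \<open>The difference of two Galerkin solutions solves the larger system with initial data and
  forcing supported outside the smaller cube. There the plain square is at most
  \<open>1 / (real N + 1)\<^sup>2\<close> times the weighted one, and the weighted norms are bounded
  by the data and by \<open>galerkin_sobolev\<close>. The energy bound is applied with weight
  1.\<close>

lemma galerkin_cauchy: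
  assumes g: "galerkin F G N y" and g': "galerkin F G M y'" and NM: "N \<le> M" and q: "1 \<le> q"
    and F: "\<And>j. j \<in> {1..n} \<Longrightarrow> F j \<in> L2 (dtx T)"
    and KG: "\<And>N. (\<Sum>j=1..n. sobsum q N (G j)) \<le> KG"
    and KF: "\<And>N. (\<integral>t. (sobsums n q N F t) \<partial>dt T) \<le> KF"
    and t: "t \<in> {0..T}"
  shows "esum (\<lambda>_. 1) (Lam M) (\<lambda>\<xi> j. y' \<xi> j t - y \<xi> j t) \<le>
    ((KG + 2 * (KF + CR * ((KG + KF) * exp ((2 + CR) * T)) * T)) * exp ((2 + CR) * T)) / (real N + 1)\<^sup>2"
proof -
  define K1 where "K1 = (KG + KF) * exp ((2 + CR) * T)"
  define \<nu> where "\<nu> = 1 / (real N + 1)\<^sup>2"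
  have \<nu>: "0 \<le> \<nu>" by (simp add: \<nu>_def)
  obtain Y where Y: "\<And>\<xi> j t. t \<in> {0..T} \<Longrightarrow> \<bar>y \<xi> j t\<bar> \<le> Y" using galerkinD(3)[OF g] by blast
  obtain Y' where Y': "\<And>\<xi> j t. t \<in> {0..T} \<Longrightarrow> \<bar>y' \<xi> j t\<bar> \<le> Y'" using galerkinD(3)[OF g'] by blast
  let ?F = "\<lambda>j \<xi> s. hat (slice (F j) s) \<xi>"
  let ?p = "\<lambda>s l. trig (\<lambda>\<zeta>. y \<zeta> l s) (Lam N)"
  let ?z = "\<lambda>\<xi> j t. y' \<xi> j t - y \<xi> j t"
  let ?r = "\<lambda>\<xi> j s. hat (RR (trigs ?z s (Lam M)) j) \<xi>"
  \<comment> \<open>Inside the smaller cube both equations hold and the forcing cancels. Outside it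
    the smaller system has no equation, so the forcing and the lower-order term of the smaller
    solution remain.\<close>
  let ?g = "\<lambda>\<xi> j s. if \<xi> \<in> Lam N then 0 else ?F j \<xi> s - hat (RR (?p s) j) \<xi>"
  let ?w = "\<lambda>\<xi> j. if \<xi> \<in> Lam N then 0 else hat (G j) \<xi>"
  have sub: "Lam N \<subseteq> (Lam M :: (int^'d) set)" by (rule Lam_mono[OF NM])
  have p_eq: "?p s l = trig (\<lambda>\<zeta>. y \<zeta> l s) (Lam M)" for s l
    by (rule trig_enlarge[OF finite_Lam sub]) (rule galerkinD(2)[OF g])
  have r_eq: "?r \<xi> j s = hat (RR (trigs y' s (Lam M)) j) \<xi> - hat (RR (?p s) j) \<xi>" for \<xi> j s
  proof -
    have "(trigs ?z s (Lam M)) = (\<lambda>l x. trig (\<lambda>\<zeta>. y' \<zeta> l s) (Lam M) x - ?p s l x)"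
      unfolding p_eq trig_coeff_diff ..
    then show ?thesis by (simp add: hat_RR_diff Cinf_torus_L2)
  qed
  have ri: "integrable (dt T) (?r \<xi> j)" for \<xi> j
    unfolding r_eq using galerkin_integrable(2)[OF g] galerkin_integrable(2)[OF g'] by simp
  have gi: "integrable (dt T) (?g \<xi> j)" if "j \<in> {1..n}" for \<xi> j
    using galerkin_integrable(2)[OF g] cyl_hat_integrable[OF F[OF that]] by (cases "\<xi> \<in> Lam N") simp_all
  have Fi: "integrable (dt T) (?F j \<xi>)" if "j \<in> {1..n}" for j \<xi>
    by (rule cyl_hat_integrable[OF F[OF that]])
  have eq: "?z \<xi> j t = ?w \<xi> j + prim T (\<lambda>s. Sk (\<lambda>\<zeta> l. ?z \<zeta> l s) \<xi> j + (?g \<xi> j s - ?r \<xi> j s)) t"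
    if \<xi>: "\<xi> \<in> Lam M" and j: "j \<in> {1..n}" and t: "t \<in> {0..T}" for \<xi> j t
  proof (cases "\<xi> \<in> Lam N")
    case True
    have i1: "integrable (dt T) (grhs F (Lam M) y' \<xi> j)"
      using galerkin_integrable[OF g'] Fi[OF j] by simp
    have i2: "integrable (dt T) (\<lambda>s. Sk (\<lambda>\<zeta> l. y \<zeta> l s) \<xi> j + (?F j \<xi> s - hat (RR (?p s) j) \<xi>))"
      using galerkin_integrable[OF g] Fi[OF j] by simp
    have "?z \<xi> j t = prim T (\<lambda>s. (grhs F (Lam M) y' \<xi> j s)
        - (Sk (\<lambda>\<zeta> l. y \<zeta> l s) \<xi> j + (?F j \<xi> s - hat (RR (?p s) j) \<xi>))) t"
      unfolding prim_diff[OF i1 i2] using galerkinD(4)[OF g True j t] galerkinD(4)[OF g' \<xi> j t] by simp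
    also have "\<dots> = prim T (\<lambda>s. Sk (\<lambda>\<zeta> l. ?z \<zeta> l s) \<xi> j + (?g \<xi> j s - ?r \<xi> j s)) t"
      by (rule prim_cong) (use True in \<open>simp add: r_eq Sk_diff\<close>)
    finally show ?thesis using True by simp
  next
    case False
    have y0: "y \<xi> j s = 0" for s by (rule galerkinD(2)[OF g False])
    have Sk0: "Sk (\<lambda>\<zeta> l. y \<zeta> l s) \<xi> j = 0" for s
      unfolding Sk_def using galerkinD(2)[OF g, of "- \<xi>"] False by (intro sum.neutral ballI) simp
    have "?z \<xi> j t = hat (G j) \<xi> + prim T (grhs F (Lam M) y' \<xi> j) t"
      using galerkinD(4)[OF g' \<xi> j t] y0 by simp
    also have "\<dots> = ?w \<xi> j + prim T (\<lambda>s. Sk (\<lambda>\<zeta> l. ?z \<zeta> l s) \<xi> j + (?g \<xi> j s - ?r \<xi> j s)) t"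
      using False by (auto intro!: prim_cong simp: r_eq Sk_diff Sk0)
    finally show ?thesis .
  qed
  \<comment> \<open>One Sobolev derivative is traded for the factor \<nu>.\<close>
  have small: "x\<^sup>2 \<le> \<nu> * (weight s \<xi> * x\<^sup>2)" if "\<xi> \<notin> Lam N" "1 \<le> s" for \<xi> :: "int^'d" and x :: real and s
  proof -
    have "(real N + 1)\<^sup>2 * x\<^sup>2 \<le> weight s \<xi> * x\<^sup>2" using weight_outside_Lam[OF that] by (intro mult_right_mono) auto
    then have "\<nu> * ((real N + 1)\<^sup>2 * x\<^sup>2) \<le> \<nu> * (weight s \<xi> * x\<^sup>2)" using \<nu> by (rule mult_left_mono)
    moreover have "\<nu> * ((real N + 1)\<^sup>2 * x\<^sup>2) = x\<^sup>2" by (simp add: \<nu>_def)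
    ultimately show ?thesis by simp
  qed
  have pK: "esum (weight q) (Lam N) (\<lambda>\<xi> j. y \<xi> j s) \<le> K1" if "s \<in> {0..T}" for s
    unfolding K1_def by (rule galerkin_sobolev[OF g order.refl F KG KF that])
  have "esum (\<lambda>_. 1) (Lam M) (\<lambda>\<xi> j. ?z \<xi> j t) \<le> (\<nu> * KG + \<nu> * (2 * (KF + CR * K1 * T))) * exp ((2 + CR) * T)"
  proof (rule energy_bound[where y = ?z and Y = "Y' + Y" and ?y0.0 = ?w and g = ?g and r = ?r
        and \<kappa> = "\<lambda>t. \<nu> * (2 * ((sobsums n q M F t) + CR * K1))"])
    show "?z \<xi> j \<in> borel_measurable (dt T)" for \<xi> j
      by (intro borel_measurable_time_leb borel_measurable_diff galerkinD(1)[OF g] galerkinD(1)[OF g'])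
    show "\<bar>?z \<xi> j t\<bar> \<le> Y' + Y" if "0 < t" "t < T" for \<xi> j t
      using Y[of t \<xi> j] Y'[of t \<xi> j] that by (auto simp: abs_le_iff)
    show "esum (\<lambda>_. 1) (Lam M) (\<lambda>\<xi> j. ?r \<xi> j s) \<le> CR * esum (\<lambda>_. 1) (Lam M) (\<lambda>\<xi> j. ?z \<xi> j s)" for s
      using RR_trig_esum[of 0 M "\<lambda>\<zeta> l. ?z \<zeta> l s" M] esum_sobsum[of 0 M "RR (trigs ?z s (Lam M))"]
      by (simp add: esum_def)
    show "integrable (dt T) (\<lambda>t. \<nu> * (2 * ((sobsums n q M F t) + CR * K1)))"
      by (intro integrable_mult_right Bochner_Integration.integrable_add Bochner_Integration.integrable_sum sobsum_time_integrable F) auto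
    show "(\<integral>t. \<nu> * (2 * ((sobsums n q M F t) + CR * K1)) \<partial>dt T) \<le> \<nu> * (2 * (KF + CR * K1 * T))"
    proof -
      have i: "integrable (dt T) (sobsums n q M F)"
        by (intro Bochner_Integration.integrable_sum sobsum_time_integrable F)
      have eq: "(\<integral>t. (sobsums n q M F t) + CR * K1 \<partial>dt T) =
          (\<integral>t. (sobsums n q M F t) \<partial>dt T) + CR * K1 * T"
        using i T measure_time_leb[of T] by (simp add: mult.commute)
      show ?thesis
        unfolding integral_mult_right_zero eq using KF[of M] \<nu> by (intro mult_left_mono) auto
    qed
    show "AE s in dt T. esum (\<lambda>_. 1) (Lam M) (\<lambda>\<xi> j. ?g \<xi> j s) \<le> \<nu> * (2 * ((sobsums n q M F s) + CR * K1))"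
    proof (rule AE_I2)
      fix s assume "s \<in> space (dt T)"
      then have s: "s \<in> {0..T}" by auto
      have ab: "(a - b)\<^sup>2 \<le> 2 * a\<^sup>2 + 2 * b\<^sup>2" for a b :: real
        using zero_le_power2[of "a + b"] by (simp add: power2_sum power2_diff)
      have "(?g \<xi> j s)\<^sup>2 \<le> \<nu> * (2 * (weight q \<xi> * (?F j \<xi> s)\<^sup>2) + 2 * (weight q \<xi> * (hat (RR (?p s) j) \<xi>)\<^sup>2))" for \<xi> j
      proof (cases "\<xi> \<in> Lam N")
        case True
        then show ?thesis using \<nu> by simp
      next
        case False
        have "(?F j \<xi> s - hat (RR (?p s) j) \<xi>)\<^sup>2 \<le> 2 * (?F j \<xi> s)\<^sup>2 + 2 * (hat (RR (?p s) j) \<xi>)\<^sup>2"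
          by (rule ab)
        also have "\<dots> \<le> 2 * (\<nu> * (weight q \<xi> * (?F j \<xi> s)\<^sup>2)) + 2 * (\<nu> * (weight q \<xi> * (hat (RR (?p s) j) \<xi>)\<^sup>2))"
          by (intro add_mono mult_left_mono small False q) auto
        finally show ?thesis using False by (simp add: algebra_simps)
      qed
      then have "esum (\<lambda>_. 1) (Lam M) (\<lambda>\<xi> j. ?g \<xi> j s) \<le>
          (\<Sum>\<xi>\<in>Lam M. \<Sum>j=1..n. \<nu> * (2 * (weight q \<xi> * (?F j \<xi> s)\<^sup>2) + 2 * (weight q \<xi> * (hat (RR (?p s) j) \<xi>)\<^sup>2)))"
        unfolding esum_def mult_1 by (intro sum_mono)
      also have "\<dots> = \<nu> * (2 * (esum (weight q) (Lam M) (\<lambda>\<xi> j. ?F j \<xi> s) + esum (weight q) (Lam M) (\<lambda>\<xi> j. hat (RR (?p s) j) \<xi>)))"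
        by (simp add: esum_def sum.distrib sum_distrib_left distrib_left)
      also have "\<dots> \<le> \<nu> * (2 * ((sobsums n q M F s) + CR * K1))"
      proof -
        have "esum (weight q) (Lam M) (\<lambda>\<xi> j. hat (RR (?p s) j) \<xi>) \<le> CR * esum (weight q) (Lam N) (\<lambda>\<xi> j. y \<xi> j s)"
          unfolding esum_sobsum by (rule RR_trig_esum) simp
        also have "\<dots> \<le> CR * K1" by (rule mult_left_mono[OF pK[OF s] CR_nonneg])
        finally show ?thesis unfolding esum_sobsum using \<nu> by (intro mult_left_mono add_mono) auto
      qed
      finally show "esum (\<lambda>_. 1) (Lam M) (\<lambda>\<xi> j. ?g \<xi> j s) \<le> \<nu> * (2 * ((sobsums n q M F s) + CR * K1))" .
    qed
    show "esum (\<lambda>_. 1) (Lam M) ?w \<le> \<nu> * KG"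
    proof -
      have "(?w \<xi> j)\<^sup>2 \<le> \<nu> * (weight q \<xi> * (hat (G j) \<xi>)\<^sup>2)" for \<xi> j
        using small[OF _ q, of \<xi>] \<nu> by simp
      then have "esum (\<lambda>_. 1) (Lam M) ?w \<le> (\<Sum>\<xi>\<in>Lam M. \<Sum>j=1..n. \<nu> * (weight q \<xi> * (hat (G j) \<xi>)\<^sup>2))"
        unfolding esum_def mult_1 by (intro sum_mono)
      also have "\<dots> = \<nu> * esum (weight q) (Lam M) (\<lambda>\<xi> j. hat (G j) \<xi>)"
        by (simp add: esum_def sum_distrib_left)
      also have "\<dots> \<le> \<nu> * KG" unfolding esum_sobsum by (rule mult_left_mono[OF KG \<nu>])
      finally show ?thesis .
    qed
  qed (use ri gi eq t in auto)
  then show ?thesis by (simp add: K1_def \<nu>_def field_simps)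
qed

end

section \<open>Passage to the limit in the Galerkin scheme\<close>

context moment_system
begin

text \<open>Truncation at powers of two turns the quadratic rate into 4^-k, as
  \<open>L2_fast_limit\<close> requires at each fixed time. Since the limit is an explicit pointwise
  one, the same function has all slices in L2 and is measurable on the cylinder.\<close>

theorem solution_exists:
  fixes F :: "nat \<Rightarrow> 'd::finite st_fun" and G :: "nat \<Rightarrow> real^'d \<Rightarrow> real"
  assumes q: "1 \<le> q"
    and F: "\<And>j. j \<in> {1..n} \<Longrightarrow> F j \<in> L2 (dtx T)"
    and KG: "\<And>N. (\<Sum>j=1..n. sobsum q N (G j)) \<le> KG"
    and KF: "\<And>N. (\<integral>t. (sobsums n q N F t) \<partial>dt T) \<le> KF"
  obtains c where "\<And>j. j \<in> {1..n} \<Longrightarrow> c j \<in> L2 (dtx T)"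
    and "\<And>j t. j \<in> {1..n} \<Longrightarrow> t \<in> {0..T} \<Longrightarrow> slice (c j) t \<in> L2 dx"
    and "\<And>j \<xi> t. j \<in> {1..n} \<Longrightarrow> t \<in> {0..T} \<Longrightarrow> hat (slice (c j) t) \<xi> = hat (G j) \<xi> +
      prim T (rhs F c \<xi> j) t"
    and "\<And>N t. t \<in> {0..T} \<Longrightarrow> (sobsums n q N c t) \<le> (KG + KF) * exp ((2 + CR) * T)"
    and "\<And>j s. j \<in> {1..n} \<Longrightarrow> s \<in> {0..T} \<Longrightarrow>
      ((\<lambda>t. L2_normsq dx (\<lambda>x. c j (t, x) - c j (s, x))) \<longlongrightarrow> 0) (at s within {0..T})"
proof -
  \<comment> \<open>\<open>K1\<close> bounds the Sobolev energy of every truncated solution at every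
    time; \<open>Kc\<close> is the constant of \<open>galerkin_cauchy\<close> without the tail
    factor.\<close>
  define K1 where "K1 = (KG + KF) * exp ((2 + CR) * T)"
  define Kc where "Kc = (KG + 2 * (KF + CR * K1 * T)) * exp ((2 + CR) * T)"
  have "\<forall>k. \<exists>y. galerkin F G (2 ^ k) y" by (intro allI galerkin_exists F)
  then obtain y where y: "\<And>k. galerkin F G (2 ^ k) (y k)" by metis
  let ?\<Lambda> = "\<lambda>k. Lam (2 ^ k) :: (int^'d) set"
  define p where "p k j t = trig (\<lambda>\<xi>. y k \<xi> j t) (?\<Lambda> k)" for k j t
  define c where "c j = (\<lambda>(t, x). lim (\<lambda>k. p k j t x))" for j
  have yK: "esum (weight q) (?\<Lambda> k) (\<lambda>\<xi> j. y k \<xi> j t) \<le> K1" if "t \<in> {0..T}" for k t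
    unfolding K1_def by (rule galerkin_sobolev[OF y order.refl F KG KF that])
  have rate: "1 / (real (2 ^ k) + 1)\<^sup>2 \<le> 1 / 4 ^ k" for k
  proof -
    have "(4::real) ^ k = (2 ^ k)\<^sup>2" by (simp add: power2_eq_square power_mult_distrib[symmetric])
    also have "\<dots> \<le> (real (2 ^ k) + 1)\<^sup>2" by (intro power_mono) auto
    finally show ?thesis by (intro frac_le) auto
  qed
  have KG0: "0 \<le> KG" using order_trans[OF _ KG] by (simp add: sum_nonneg)
  have KF0: "0 \<le> KF"
  proof -
    have "0 \<le> (\<integral>t. (sobsums n q 0 F t) \<partial>dt T)"
      by (intro Bochner_Integration.integral_nonneg sum_nonneg) auto
    then show ?thesis using KF[of 0] by simp
  qed
  have K10: "0 \<le> K1" using KG0 KF0 by (simp add: K1_def)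
  have Kc0: "0 \<le> Kc" using KG0 KF0 K10 CR_nonneg T by (simp add: Kc_def)
  have cauchy: "esum (\<lambda>_. 1) (?\<Lambda> m) (\<lambda>\<xi> j. y m \<xi> j t - y k \<xi> j t) \<le> Kc / 4 ^ k" if "k \<le> m" "t \<in> {0..T}" for k m t
  proof -
    have "(2::nat) ^ k \<le> 2 ^ m" using that(1) by (intro power_increasing) auto
    then have "esum (\<lambda>_. 1) (?\<Lambda> m) (\<lambda>\<xi> j. y m \<xi> j t - y k \<xi> j t) \<le> Kc / (real (2 ^ k) + 1)\<^sup>2"
      unfolding Kc_def K1_def by (rule galerkin_cauchy[OF y y _ q F KG KF that(2)])
    also have "\<dots> \<le> Kc / 4 ^ k" using mult_left_mono[OF rate[of k] Kc0] by simp
    finally show ?thesis .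
  qed
  have hat_p: "hat (p k j t) \<xi> = y k \<xi> j t" for k j t \<xi>
    unfolding p_def hat_trig[OF finite_Lam] using galerkinD(2)[OF y] by auto
  have p_L2: "p k j t \<in> L2 dx" for k j t
    unfolding p_def by (rule Cinf_torus_L2[OF trig_Cinf])
  have comp_le: "(\<Sum>\<xi>\<in>\<Lambda>. (a \<xi> j)\<^sup>2) \<le> esum (\<lambda>_. 1) \<Lambda> a" if "j \<in> {1..n}" for \<Lambda> :: "(int^'d) set" and a j
    unfolding esum_swap mult_1 using that by (intro member_le_sum) (auto intro: sum_nonneg)
  have p_step: "L2_normsq dx (\<lambda>x. p (Suc k) j t x - p k j t x) \<le> Kc / 4 ^ k"
    if j: "j \<in> {1..n}" and t: "t \<in> {0..T}" for k j t
  proof -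
    have "?\<Lambda> k \<subseteq> ?\<Lambda> (Suc k)" by (intro Lam_mono power_increasing) auto
    then have "p k j t = trig (\<lambda>\<xi>. y k \<xi> j t) (?\<Lambda> (Suc k))"
      unfolding p_def by (rule trig_enlarge[OF finite_Lam]) (rule galerkinD(2)[OF y])
    then have "(\<lambda>x. p (Suc k) j t x - p k j t x) = trig (\<lambda>\<xi>. y (Suc k) \<xi> j t - y k \<xi> j t) (?\<Lambda> (Suc k))"
      by (simp only: p_def[of "Suc k"] trig_coeff_diff)
    then have "L2_normsq dx (\<lambda>x. p (Suc k) j t x - p k j t x) = (\<Sum>\<xi>\<in>?\<Lambda> (Suc k). (y (Suc k) \<xi> j t - y k \<xi> j t)\<^sup>2)"
      by (simp only: normsq_trig[OF finite_Lam])
    also have "\<dots> \<le> Kc / 4 ^ k"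
      by (rule order_trans[OF comp_le[OF j] cauchy[OF _ t]]) simp
    finally show ?thesis .
  qed
  have c_lim: "slice (c j) t \<in> L2 dx"
    "(\<lambda>k. L2_normsq dx (\<lambda>x. p k j t x - c j (t, x))) \<longlonglongrightarrow> 0"
    if "j \<in> {1..n}" "t \<in> {0..T}" for j t
    using torus.L2_fast_limit[of "\<lambda>k. p k j t" Kc, OF p_L2 p_step[OF that]] by (simp_all add: c_def)
  have hat_c: "(\<lambda>k. y k \<xi> j t) \<longlonglongrightarrow> hat (slice (c j) t) \<xi>" if "j \<in> {1..n}" "t \<in> {0..T}" for \<xi> j t
    using L2_inner_tendsto[OF p_L2 c_lim(1)[OF that] Cinf_torus_L2[OF hartley_Cinf[of \<xi>]] c_lim(2)[OF that]]
    unfolding hat_def[symmetric] hat_p .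
  have c_sob: "(sobsums n q N c t) \<le> K1" if t: "t \<in> {0..T}" for N t
  proof (rule LIMSEQ_le_const2)
    show "(\<lambda>k. \<Sum>j=1..n. sobsum q N (p k j t)) \<longlonglongrightarrow> (sobsums n q N c t)"
      unfolding sobsum_def hat_p by (intro tendsto_sum tendsto_mult tendsto_const tendsto_power hat_c t)
    show "\<exists>M. \<forall>k\<ge>M. (\<Sum>j=1..n. sobsum q N (p k j t)) \<le> K1"
    proof (intro exI allI impI)
      fix k
      have "(\<Sum>j=1..n. sobsum q N (p k j t)) \<le> esum (weight q) (?\<Lambda> k) (\<lambda>\<xi> j. y k \<xi> j t)"
        unfolding esum_swap p_def by (intro sum_mono sobsum_trig_le)
      then show "(\<Sum>j=1..n. sobsum q N (p k j t)) \<le> K1" using yK[OF t] by (rule order_trans)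
    qed
  qed
  \<comment> \<open>The rate for the limit itself, uniform in t. For fixed N only finitely many
    coefficients are compared, so m can be sent to infinity before N.\<close>
  have dist: "L2_normsq dx (\<lambda>x. c j (t, x) - p k j t x) \<le> Kc / 4 ^ k" if j: "j \<in> {1..n}" and t: "t \<in> {0..T}" for j t k
  proof (rule L2_normsq_le_hat)
    show "(\<lambda>x. c j (t, x) - p k j t x) \<in> L2 dx" by (intro L2_diff c_lim(1) j t p_L2)
    fix N
    have "hat (\<lambda>x. c j (t, x) - p k j t x) \<xi> = hat (slice (c j) t) \<xi> - y k \<xi> j t" for \<xi>
      using hat_diff[OF c_lim(1)[OF j t] p_L2] by (simp add: hat_p)
    moreover have "(\<Sum>\<xi>\<in>Lam N. (hat (slice (c j) t) \<xi> - y k \<xi> j t)\<^sup>2) \<le> Kc / 4 ^ k"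
    proof (rule LIMSEQ_le_const2)
      show "(\<lambda>m. \<Sum>\<xi>\<in>Lam N. (y m \<xi> j t - y k \<xi> j t)\<^sup>2) \<longlonglongrightarrow> (\<Sum>\<xi>\<in>Lam N. (hat (slice (c j) t) \<xi> - y k \<xi> j t)\<^sup>2)"
        by (intro tendsto_sum tendsto_power tendsto_diff tendsto_const hat_c j t)
      show "\<exists>M. \<forall>m\<ge>M. (\<Sum>\<xi>\<in>Lam N. (y m \<xi> j t - y k \<xi> j t)\<^sup>2) \<le> Kc / 4 ^ k"
      proof (intro exI allI impI)
        fix m assume m: "max k N \<le> m"
        have "N \<le> 2 ^ m" using m less_exp[of m] by linarith
        then have "(\<Sum>\<xi>\<in>Lam N. (y m \<xi> j t - y k \<xi> j t)\<^sup>2) \<le> (\<Sum>\<xi>\<in>?\<Lambda> m. (y m \<xi> j t - y k \<xi> j t)\<^sup>2)"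
          by (intro sum_mono2 Lam_mono) auto
        also have "\<dots> \<le> Kc / 4 ^ k"
          by (rule order_trans[OF comp_le[OF j] cauchy[OF _ t]]) (use m in simp)
        finally show "(\<Sum>\<xi>\<in>Lam N. (y m \<xi> j t - y k \<xi> j t)\<^sup>2) \<le> Kc / 4 ^ k" .
      qed
    qed
    ultimately show "(\<Sum>\<xi>\<in>Lam N. (hat (\<lambda>x. c j (t, x) - p k j t x) \<xi>)\<^sup>2) \<le> Kc / 4 ^ k" by simp
  qed
  have c_meas: "c j \<in> borel_measurable (dtx T)" for j
  proof -
    have "(\<lambda>z. p k j (fst z) (snd z)) \<in> borel_measurable (dtx T)" for k
    proof -
      have "(\<lambda>z. \<Sum>\<xi>\<in>?\<Lambda> k. (\<lambda>(t, x). y k \<xi> j t * hartley \<xi> x) z) \<in> borel_measurable (dtx T)"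
        by (intro borel_measurable_sum tensor_measurable borel_measurable_time_leb galerkinD(1)[OF y]
            Cinf_torus_measurable hartley_Cinf)
      then show ?thesis by (simp add: p_def trig_def case_prod_unfold)
    qed
    then have "(\<lambda>z. lim (\<lambda>k. p k j (fst z) (snd z))) \<in> borel_measurable (dtx T)"
      by (intro borel_measurable_lim_metric)
    then show ?thesis by (simp add: c_def case_prod_unfold)
  qed
  have c_norm: "L2_normsq dx (slice (c j) t) \<le> K1" if j: "j \<in> {1..n}" and t: "t \<in> {0..T}" for j t
  proof (rule normsq_le_sobsum[OF c_lim(1)[OF j t]])
    fix N
    have "sobsum q N (slice (c j) t) \<le> (sobsums n q N c t)"
      using j by (intro member_le_sum) auto
    then show "sobsum q N (slice (c j) t) \<le> K1" using c_sob[OF t] by (rule order_trans)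
  qed
  have c_L2: "c j \<in> L2 (dtx T)" if j: "j \<in> {1..n}" for j
    by (rule L2_cylI[OF c_meas, where k = "\<lambda>t. K1"]) (use c_lim(1)[OF j] c_norm[OF j] in \<open>auto intro!: AE_I2\<close>)
  have modes: "hat (slice (c j) t) \<xi> = hat (G j) \<xi> +
      prim T (rhs F c \<xi> j) t"
    if j: "j \<in> {1..n}" and t: "t \<in> {0..T}" for j \<xi> t
  proof (rule LIMSEQ_unique[OF hat_c[OF that]])
    let ?h = "\<lambda>k s. Sk (\<lambda>\<zeta> l. y k \<zeta> l s) \<xi> j + (hat (slice (F j) s) \<xi> - hat (RR (\<lambda>l. p k l s) j) \<xi>)"
    let ?H = "rhs F c \<xi> j"
    obtain N where N: "\<xi> \<in> Lam N" by (rule Lam_exhausts)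
    have ev: "\<forall>\<^sub>F k in sequentially. y k \<xi> j t = hat (G j) \<xi> + prim T (?h k) t"
    proof (rule eventually_sequentiallyI[of N])
      fix k assume "N \<le> k"
      then have "N \<le> 2 ^ k" using less_exp[of k] by linarith
      then have "\<xi> \<in> ?\<Lambda> k" using N Lam_mono by blast
      from galerkinD(4)[OF y this j t] show "y k \<xi> j t = hat (G j) \<xi> + prim T (?h k) t" unfolding p_def .
    qed
    have hi: "integrable (dt T) (?h k)" for k
      unfolding p_def using galerkin_integrable[OF y] cyl_hat_integrable[OF F[OF j]] by simp
    have lim_h: "(\<lambda>k. ?h k s) \<longlonglongrightarrow> ?H s" if s: "s \<in> {0..T}" for s
    proof (intro tendsto_intros Sk_tendsto hat_c s)
      have "(\<lambda>k. \<Sum>l=1..n. \<integral>x. p k l s x * (Rm j l x * hartley \<xi> x) \<partial>dx)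
          \<longlonglongrightarrow> (\<Sum>l=1..n. \<integral>x. c l (s, x) * (Rm j l x * hartley \<xi> x) \<partial>dx)"
        by (intro tendsto_sum L2_inner_tendsto p_L2 c_lim s Cinf_torus_L2 Cinf_torus_mult Rm_Cinf hartley_Cinf)
      then show "(\<lambda>k. hat (RR (\<lambda>l. p k l s) j) \<xi>) \<longlonglongrightarrow> hat (RR (\<lambda>l. slice (c l) s) j) \<xi>"
        using c_lim(1)[OF _ s] by (simp only: hat_RR p_L2)
    qed
    \<comment> \<open>Weights are at least 1, so the energy bounds each single coefficient; this
      provides the majorant for passing to the limit under the time integral.\<close>
    have yb: "\<bar>y k \<zeta> l s\<bar> \<le> sqrt K1" if l: "l \<in> {1..n}" and s: "s \<in> {0..T}" for k \<zeta> l s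
    proof -
      have "(y k \<zeta> l s)\<^sup>2 \<le> K1"
      proof (cases "\<zeta> \<in> ?\<Lambda> k")
        case True
        have "(y k \<zeta> l s)\<^sup>2 \<le> weight q \<zeta> * (y k \<zeta> l s)\<^sup>2"
          using mult_right_mono[OF weight_ge_1[of q \<zeta>], of "(y k \<zeta> l s)\<^sup>2"] by simp
        also have "\<dots> \<le> (\<Sum>\<zeta>\<in>?\<Lambda> k. weight q \<zeta> * (y k \<zeta> l s)\<^sup>2)"
          by (rule member_le_sum[OF True, where f = "\<lambda>\<zeta>. weight q \<zeta> * (y k \<zeta> l s)\<^sup>2"]) auto
        also have "\<dots> \<le> (\<Sum>l=1..n. \<Sum>\<zeta>\<in>?\<Lambda> k. weight q \<zeta> * (y k \<zeta> l s)\<^sup>2)"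
          by (rule member_le_sum[OF l, where f = "\<lambda>l. \<Sum>\<zeta>\<in>?\<Lambda> k. weight q \<zeta> * (y k \<zeta> l s)\<^sup>2"]) (auto intro: sum_nonneg)
        also have "\<dots> \<le> K1" using yK[OF s, of k] unfolding esum_swap .
        finally show ?thesis .
      next
        case False
        then show ?thesis using galerkinD(2)[OF y False] K10 by simp
      qed
      then show ?thesis using real_le_rsqrt[of "\<bar>y k \<zeta> l s\<bar>" K1] by simp
    qed
    define Y where "Y = (\<Sum>i\<in>UNIV. \<Sum>l=1..n. \<bar>Sm i j l * (2 * pi * of_int (\<xi> $ i))\<bar> * sqrt K1)"
    have Skb: "\<bar>Sk (\<lambda>\<zeta> l. y k \<zeta> l s) \<xi> j\<bar> \<le> Y" if "s \<in> {0..T}" for k s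
      unfolding Y_def by (rule Sk_bound) (rule yb[OF _ that])
    have RRb: "\<bar>hat (RR (\<lambda>l. p k l s) j) \<xi>\<bar> \<le> sqrt (CR * K1)" if s: "s \<in> {0..T}" for k s
    proof (rule real_le_rsqrt)
      have "\<bar>hat (RR (\<lambda>l. p k l s) j) \<xi>\<bar>\<^sup>2 \<le> weight q \<xi> * (hat (RR (\<lambda>l. p k l s) j) \<xi>)\<^sup>2"
        using mult_right_mono[OF weight_ge_1[of q \<xi>], of "(hat (RR (\<lambda>l. p k l s) j) \<xi>)\<^sup>2"] by simp
      also have "\<dots> \<le> sobsum q N (RR (\<lambda>l. p k l s) j)"
        unfolding sobsum_def
        by (rule member_le_sum[OF N, where f = "\<lambda>\<xi>. weight q \<xi> * (hat (RR (\<lambda>l. p k l s) j) \<xi>)\<^sup>2"]) auto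
      also have "\<dots> \<le> (\<Sum>j=1..n. sobsum q N (RR (\<lambda>l. p k l s) j))"
        using j by (intro member_le_sum) auto
      also have "\<dots> \<le> CR * esum (weight q) (?\<Lambda> k) (\<lambda>\<zeta> l. y k \<zeta> l s)"
        unfolding p_def by (rule RR_trig_esum) simp
      also have "\<dots> \<le> CR * K1" by (rule mult_left_mono[OF yK[OF s] CR_nonneg])
      finally show "\<bar>hat (RR (\<lambda>l. p k l s) j) \<xi>\<bar>\<^sup>2 \<le> CR * K1" .
    qed
    have "(\<lambda>k. prim T (?h k) t) \<longlonglongrightarrow> prim T ?H t"
      unfolding prim_def
    proof (rule integral_dominated_convergence[where w = "\<lambda>s. Y + sqrt (CR * K1) + \<bar>hat (slice (F j) s) \<xi>\<bar>"])
      show "AE s in dt T. (\<lambda>k. indicator {..t} s * ?h k s) \<longlonglongrightarrow> indicator {..t} s * ?H s"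
        by (intro AE_I2 tendsto_mult tendsto_const lim_h) auto
      have m: "(\<lambda>s. indicator {..t} s * ?h k s) \<in> borel_measurable (dt T)" for k
        using prim_integrable[OF hi] by blast
      then show "(\<lambda>s. indicator {..t} s * ?h k s) \<in> borel_measurable (dt T)" for k .
      show "(\<lambda>s. indicator {..t} s * ?H s) \<in> borel_measurable (dt T)"
        by (rule borel_measurable_LIMSEQ_real[where u = "\<lambda>k s. indicator {..t} s * ?h k s", OF _ m]) (intro tendsto_mult tendsto_const lim_h, auto)
      show "integrable (dt T) (\<lambda>s. Y + sqrt (CR * K1) + \<bar>hat (slice (F j) s) \<xi>\<bar>)"
        using cyl_hat_integrable[OF F[OF j]] by simp
      show "AE s in dt T. norm (indicator {..t} s * ?h k s) \<le> Y + sqrt (CR * K1) + \<bar>hat (slice (F j) s) \<xi>\<bar>" for k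
      proof (rule AE_I2)
        fix s assume "s \<in> space (dt T)"
        then have s: "s \<in> {0..T}" by auto
        have "\<bar>?h k s\<bar> \<le> Y + sqrt (CR * K1) + \<bar>hat (slice (F j) s) \<xi>\<bar>"
          using Skb[OF s, of k] RRb[OF s, of k] by linarith
        moreover have "norm (indicator {..t} s * ?h k s) \<le> \<bar>?h k s\<bar>" by (simp add: indicator_def)
        ultimately show "norm (indicator {..t} s * ?h k s) \<le> Y + sqrt (CR * K1) + \<bar>hat (slice (F j) s) \<xi>\<bar>"
          by linarith
      qed
    qed
    then have "(\<lambda>k. hat (G j) \<xi> + prim T (?h k) t) \<longlonglongrightarrow> hat (G j) \<xi> + prim T ?H t"
      by (intro tendsto_intros)
    then show "(\<lambda>k. y k \<xi> j t) \<longlonglongrightarrow> hat (G j) \<xi> + prim T ?H t"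
      by (rule Lim_transform_eventually) (use ev in \<open>simp add: eq_commute\<close>)
  qed
  have cont: "((\<lambda>t. L2_normsq dx (\<lambda>x. c j (t, x) - c j (s, x))) \<longlongrightarrow> 0) (at s within {0..T})"
    if j: "j \<in> {1..n}" and s: "s \<in> {0..T}" for j s
  proof (rule tendstoI)
    fix e :: real assume e: "0 < e"
    \<comment> \<open>Two applications of \<open>L2_normsq_add_le\<close> give the error at t the
      factor 2, the error at s the factor 4, and the increment of the k-th approximation the factor
      4.\<close>
    have "(\<lambda>k. 6 * Kc * (1 / 4) ^ k) \<longlonglongrightarrow> 6 * Kc * 0" by (intro tendsto_intros LIMSEQ_power_zero) auto
    then have "\<forall>\<^sub>F k in sequentially. 6 * Kc * (1 / 4) ^ k < e / 2" using e by (intro order_tendstoD) auto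
    then obtain k where k: "6 * (Kc / 4 ^ k) < e / 2"
      using eventually_happens by (force simp: power_divide)
    let ?D = "\<lambda>t. \<Sum>\<xi>\<in>?\<Lambda> k. (y k \<xi> j t - y k \<xi> j s)\<^sup>2"
    have "((\<lambda>t. 4 * ?D t) \<longlongrightarrow> 4 * (\<Sum>\<xi>\<in>?\<Lambda> k. (y k \<xi> j s - y k \<xi> j s)\<^sup>2)) (at s within {0..T})"
      using galerkin_continuous[OF y F j] s by (intro tendsto_intros) (auto simp: continuous_on_def)
    then have "\<forall>\<^sub>F t in at s within {0..T}. 4 * ?D t < e / 2" using e by (intro order_tendstoD) auto
    moreover have "\<forall>\<^sub>F t in at s within {0..T}. t \<in> {0..T}" by (simp add: eventually_at_filter)
    ultimately show "\<forall>\<^sub>F t in at s within {0..T}. dist (L2_normsq dx (\<lambda>x. c j (t, x) - c j (s, x))) 0 < e"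
    proof eventually_elim
      case (elim t)
      note t = elim(2)
      have D: "L2_normsq dx (\<lambda>x. p k j t x - p k j s x) = ?D t"
        unfolding p_def trig_coeff_diff by (rule normsq_trig[OF finite_Lam, where a = "\<lambda>\<xi>. y k \<xi> j t - y k \<xi> j s"])
      have "L2_normsq dx (\<lambda>x. c j (t, x) - c j (s, x)) \<le>
          2 * L2_normsq dx (\<lambda>x. c j (t, x) - p k j t x) + 2 * L2_normsq dx (\<lambda>x. p k j t x - c j (s, x))"
        using L2_normsq_add_le[OF L2_diff[OF c_lim(1)[OF j t] p_L2[of k j t]] L2_diff[OF p_L2[of k j t] c_lim(1)[OF j s]]] by simp
      moreover have "L2_normsq dx (\<lambda>x. p k j t x - c j (s, x)) \<le>
          2 * L2_normsq dx (\<lambda>x. p k j t x - p k j s x) + 2 * L2_normsq dx (\<lambda>x. p k j s x - c j (s, x))"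
        using L2_normsq_add_le[OF L2_diff[OF p_L2[of k j t] p_L2[of k j s]] L2_diff[OF p_L2[of k j s] c_lim(1)[OF j s]]] by simp
      ultimately have "L2_normsq dx (\<lambda>x. c j (t, x) - c j (s, x)) \<le> 6 * (Kc / 4 ^ k) + 4 * ?D t"
        using dist[OF j t, of k] dist[OF j s, of k] D
          L2_normsq_minus_commute[of dx "p k j s" "\<lambda>x. c j (s, x)"] by linarith
      also have "\<dots> < e" using k elim(1) by simp
      finally show ?case by (simp add: dist_real_def)
    qed
  qed
  show ?thesis
    by (rule that[of c, OF c_L2 c_lim(1) modes c_sob[unfolded K1_def] cont])
qed

end

section \<open>Regularity in space and time\<close>

lemma dmult_le_weight:
  assumes "length is \<le> s"
  shows "(dmult is \<xi>)\<^sup>2 \<le> weight s \<xi>"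
proof -
  have "(dmult is \<xi>)\<^sup>2 \<le> (\<Sum>is' | length is' = length is. (dmult is' \<xi>)\<^sup>2)"
    by (rule member_le_sum[where f = "\<lambda>is. (dmult is \<xi>)\<^sup>2"]) auto
  also have "\<dots> \<le> (\<Sum>j\<le>s. \<Sum>is | length is = j. (dmult is \<xi>)\<^sup>2)"
    by (rule member_le_sum[where f = "\<lambda>j. \<Sum>is | length is = j. (dmult is \<xi>)\<^sup>2"]) (use assms in \<open>auto intro: sum_nonneg\<close>)
  finally show ?thesis by (simp add: sum_dmult_length_le)
qed

definition wderivs_upto :: "real \<Rightarrow> nat \<Rightarrow> 'd::finite st_fun \<Rightarrow> ('d list \<Rightarrow> 'd::finite st_fun) \<Rightarrow> bool" where
  "wderivs_upto T s u V \<longleftrightarrow> (\<forall>is. length is \<le> s \<longrightarrow> wderiv T 0 is u (V is))"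

lemma wderivs_upto_AE:
  assumes u: "u \<in> L2 (dtx T)" and V: "wderivs_upto T s u V"
  shows "AE t in dt T. \<forall>is. length is \<le> s \<longrightarrow> slice (V is) t \<in> L2 dx \<and>
    (\<forall>\<xi>. hat (slice (V is) t) \<xi> = dmult is \<xi> * hat (slice u t) (flip is \<xi>))"
proof -
  have "AE t in dt T. length is \<le> s \<longrightarrow> slice (V is) t \<in> L2 dx \<and>
    (\<forall>\<xi>. hat (slice (V is) t) \<xi> = dmult is \<xi> * hat (slice u t) (flip is \<xi>))" for "is"
  proof (cases "length is \<le> s")
    case True
    then have w: "wderiv T 0 is u (V is)" using V by (simp add: wderivs_upto_def)
    have "AE t in dt T. \<forall>\<xi>. hat (slice (V is) t) \<xi> = dmult is \<xi> * hat (slice u t) (flip is \<xi>)"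
      using wderiv_space_hat[OF u w] by (simp add: AE_all_countable)
    with cyl_section_L2[OF wderiv_L2[OF w]] show ?thesis by eventually_elim simp
  qed simp
  then show ?thesis by (simp add: AE_all_countable)
qed

definition deriv_norms :: "nat \<Rightarrow> ('d::finite list \<Rightarrow> 'd::finite st_fun) \<Rightarrow> real \<Rightarrow> real" where
  "deriv_norms s V t = (\<Sum>j\<le>s. \<Sum>is | length is = j. L2_normsq dx (slice (V is) t))"

abbreviation dnorm where
  "dnorm T s V \<equiv> \<Sum>k\<le>s. \<Sum>is | length is = k. L2_normsq (dtx T) (V is)"

abbreviation dnorms where
  "dnorms T q D \<equiv> \<Sum>i\<le>q. dnorm T (q - i) (D i)"

lemma deriv_norms_integrable:
  assumes V: "wderivs_upto T s u V"
  shows "integrable (dt T) (deriv_norms s V)"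
    and "(\<integral>t. deriv_norms s V t \<partial>dt T) = dnorm T s V"
proof -
  have w: "V is \<in> L2 (dtx T)" if "length is \<le> s" for "is"
  proof -
    have "wderiv T 0 is u (V is)" using V that by (simp add: wderivs_upto_def)
    then show ?thesis by (rule wderiv_L2)
  qed
  have i: "integrable (dt T) (\<lambda>t. \<Sum>is | length is = j. L2_normsq dx (slice (V is) t))" if "j \<le> s" for j
    using that by (intro Bochner_Integration.integrable_sum cyl_normsq(2) w) auto
  show "integrable (dt T) (deriv_norms s V)"
    unfolding deriv_norms_def[abs_def] by (intro Bochner_Integration.integrable_sum i) auto
  have "(\<integral>t. deriv_norms s V t \<partial>dt T) = (\<Sum>j\<le>s. \<integral>t. (\<Sum>is | length is = j. L2_normsq dx (slice (V is) t)) \<partial>dt T)"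
    unfolding deriv_norms_def by (intro Bochner_Integration.integral_sum i) auto
  also have "\<dots> = dnorm T s V"
  proof (intro sum.cong refl)
    fix j assume "j \<in> {..s}"
    then have "(\<integral>t. (\<Sum>is | length is = j. L2_normsq dx (slice (V is) t)) \<partial>dt T) =
        (\<Sum>is | length is = j. \<integral>t. L2_normsq dx (slice (V is) t) \<partial>dt T)"
      by (intro Bochner_Integration.integral_sum cyl_normsq(2) w) auto
    also have "\<dots> = (\<Sum>is | length is = j. L2_normsq (dtx T) (V is))"
      using \<open>j \<in> {..s}\<close> by (intro sum.cong refl) (auto intro!: cyl_normsq(1)[symmetric] w)
    finally show "(\<integral>t. (\<Sum>is | length is = j. L2_normsq dx (slice (V is) t)) \<partial>dt T) =
        (\<Sum>is | length is = j. L2_normsq (dtx T) (V is))" .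
  qed
  finally show "(\<integral>t. deriv_norms s V t \<partial>dt T) = dnorm T s V" .
qed

lemma sobsum_tendsto_deriv_norms:
  assumes u: "u \<in> L2 (dtx T)" and V: "wderivs_upto T s u V"
  shows "AE t in dt T. (\<lambda>N. sobsum s N (slice u t)) \<longlonglongrightarrow> deriv_norms s V t"
  using wderivs_upto_AE[OF u V]
  by eventually_elim (unfold deriv_norms_def, rule sobsum_tendsto, auto)

lemma sobsum_le_deriv_norms:
  assumes u: "u \<in> L2 (dtx T)" and V: "wderivs_upto T s u V"
  shows "AE t in dt T. \<forall>N. sobsum s N (slice u t) \<le> deriv_norms s V t"
  using sobsum_tendsto_deriv_norms[OF u V]
proof eventually_elim
  case (elim t)
  show ?case by (intro allI incseq_le[OF incseq_sobsum elim])
qed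

lemma sobsum_integral_le:
  assumes u: "u \<in> L2 (dtx T)" and V: "wderivs_upto T s u V"
  shows "(\<integral>t. sobsum s N (slice u t) \<partial>dt T) \<le> dnorm T s V"
  unfolding deriv_norms_integrable(2)[OF V, symmetric]
proof (rule integral_mono_AE[OF sobsum_time_integrable[OF u] deriv_norms_integrable(1)[OF V]])
  show "AE t in dt T. sobsum s N (slice u t) \<le> deriv_norms s V t"
    using sobsum_le_deriv_norms[OF u V] by eventually_elim blast
qed

text \<open>Weighted coefficients that are square-summable in the time mean are synthesised into
  weak derivatives. The truncated norms increase to the full ones, so the bound K survives in the
  limit by dominated convergence.\<close>

lemma wderivs_upto_exists:
  fixes u :: "nat \<Rightarrow> 'd::finite st_fun"
  assumes u: "\<And>j. j \<in> {1..n} \<Longrightarrow> u j \<in> L2 (dtx T)"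
    and K: "\<And>N. (\<integral>t. (sobsums n s N u t) \<partial>dt T) \<le> K"
  obtains V where "\<And>j. j \<in> {1..n} \<Longrightarrow> wderivs_upto T s (u j) (V j)"
    "(\<integral>t. (\<Sum>j=1..n. deriv_norms s (V j) t) \<partial>dt T) \<le> K"
proof -
  have ex: "\<exists>v. length is \<le> s \<longrightarrow> wderiv T 0 is (u j) v" if j: "j \<in> {1..n}" for j and "is" :: "'d list"
  proof (cases "length is \<le> s")
    case True
    let ?a = "\<lambda>\<xi> t. dmult is \<xi> * hat (slice (u j) t) (flip is \<xi>)"
    have "(\<integral>t. (\<Sum>\<xi>\<in>Lam N. (?a \<xi> t)\<^sup>2) \<partial>dt T) \<le> K" for N
    proof -
      have "(\<integral>t. (\<Sum>\<xi>\<in>Lam N. (?a \<xi> t)\<^sup>2) \<partial>dt T) \<le> (\<integral>t. (sobsums n s N u t) \<partial>dt T)"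
      proof (rule integral_mono)
        show "integrable (dt T) (\<lambda>t. \<Sum>\<xi>\<in>Lam N. (?a \<xi> t)\<^sup>2)"
          by (intro Bochner_Integration.integrable_sum L2_sq_integrable L2_cmult cyl_hat_L2 u j)
        show "integrable (dt T) (sobsums n s N u)"
          by (intro Bochner_Integration.integrable_sum sobsum_time_integrable u)
        fix t
        have "(\<Sum>\<xi>\<in>Lam N. (?a \<xi> t)\<^sup>2) \<le> (\<Sum>\<xi>\<in>Lam N. weight s (flip is \<xi>) * (hat (slice (u j) t) (flip is \<xi>))\<^sup>2)"
          unfolding power_mult_distrib weight_flip by (intro sum_mono mult_right_mono dmult_le_weight True) auto
        also have "\<dots> = sobsum s N (slice (u j) t)" unfolding sobsum_def by (rule sum_Lam_flip)
        also have "\<dots> \<le> (sobsums n s N u t)"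
          by (rule member_le_sum[OF j, where f = "\<lambda>j. sobsum s N (slice (u j) t)"]) auto
        finally show "(\<Sum>\<xi>\<in>Lam N. (?a \<xi> t)\<^sup>2) \<le> (sobsums n s N u t)" .
      qed
      then show ?thesis using K[of N] by (rule order_trans)
    qed
    then obtain v where "v \<in> L2 (dtx T)" "\<And>\<xi>. AE t in dt T. hat (slice v t) \<xi> = ?a \<xi> t"
      using cyl_synthesis[of ?a T K, OF L2_cmult[OF cyl_hat_L2[OF u[OF j]]]] by blast
    then have "wderiv T 0 is (u j) v" by (rule wderiv_space_of_hat[OF u[OF j]])
    then show ?thesis by blast
  qed blast
  define V where "V j is = (SOME v. length is \<le> s \<longrightarrow> wderiv T 0 is (u j) v)" for j "is"
  have V: "wderivs_upto T s (u j) (V j)" if "j \<in> {1..n}" for j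
    unfolding wderivs_upto_def V_def
  proof (rule allI)
    fix "is" :: "'d list"
    show "length is \<le> s \<longrightarrow> wderiv T 0 is (u j) (SOME v. length is \<le> s \<longrightarrow> wderiv T 0 is (u j) v)"
      by (rule someI_ex[OF ex[OF that, of "is"]])
  qed
  have "(\<lambda>N. \<integral>t. (sobsums n s N u t) \<partial>dt T) \<longlonglongrightarrow> (\<integral>t. (\<Sum>j=1..n. deriv_norms s (V j) t) \<partial>dt T)"
  proof (rule integral_dominated_convergence[where w = "\<lambda>t. \<Sum>j=1..n. deriv_norms s (V j) t"])
    have "AE t in dt T. \<forall>j\<in>{1..n}. (\<lambda>N. sobsum s N (slice (u j) t)) \<longlonglongrightarrow> deriv_norms s (V j) t"
      by (intro AE_finite_allI sobsum_tendsto_deriv_norms[OF u V] finite_atLeastAtMost) auto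
    then show "AE t in dt T. (\<lambda>N. sobsums n s N u t) \<longlonglongrightarrow> (\<Sum>j=1..n. deriv_norms s (V j) t)"
      by eventually_elim (intro tendsto_sum, blast)
    have "AE t in dt T. \<forall>j\<in>{1..n}. \<forall>N. sobsum s N (slice (u j) t) \<le> deriv_norms s (V j) t"
      proof (intro AE_finite_allI finite_atLeastAtMost)
      fix j assume j: "j \<in> {1..n}"
      show "AE t in dt T. \<forall>N. sobsum s N (slice (u j) t) \<le> deriv_norms s (V j) t"
        by (rule sobsum_le_deriv_norms[OF u[OF j] V[OF j]])
    qed
    then show "AE t in dt T. norm (sobsums n s N u t) \<le> (\<Sum>j=1..n. deriv_norms s (V j) t)" for N
      by eventually_elim (auto intro!: sum_mono simp: abs_of_nonneg sum_nonneg)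
    show "(sobsums n s N u) \<in> borel_measurable (dt T)" for N
      by (intro borel_measurable_sum borel_measurable_integrable sobsum_time_integrable u)
    show "integrable (dt T) (\<lambda>t. \<Sum>j=1..n. deriv_norms s (V j) t)"
      by (intro Bochner_Integration.integrable_sum deriv_norms_integrable(1)[OF V])
    then show "(\<lambda>t. \<Sum>j=1..n. deriv_norms s (V j) t) \<in> borel_measurable (dt T)" by simp
  qed
  then have "(\<integral>t. (\<Sum>j=1..n. deriv_norms s (V j) t) \<partial>dt T) \<le> K"
    by (rule LIMSEQ_le_const2) (use K in blast)
  with V that show ?thesis by blast
qed

definition dV :: "real \<Rightarrow> 'd \<Rightarrow> 'd::finite st_fun \<Rightarrow> 'd::finite st_fun" where
  "dV T i u = (SOME v. wderiv T 0 [i] u v)"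

lemma wderiv_dV: "wderiv T 0 [i] u v \<Longrightarrow> wderiv T 0 [i] u (dV T i u)"
  unfolding dV_def by (rule someI[where P = "wderiv T 0 [i] u"])

section \<open>The time derivative obtained from the equation\<close>

context moment_system
begin

text \<open>Solving the equation for the time derivative: \<open>nxt f u = f - \<Sum>\<^sub>i S\<^sub>i \<partial>\<^sub>i u - R u\<close>.\<close>

definition nxt :: "(nat \<Rightarrow> 'd::finite st_fun) \<Rightarrow> (nat \<Rightarrow> 'd::finite st_fun) \<Rightarrow> nat \<Rightarrow> 'd::finite st_fun" where
  "nxt f u j z = f j z + ((\<Sum>i\<in>UNIV. \<Sum>l=1..n. (- Sm i j l) * dV T i (u l) z) + (\<Sum>l=1..n. (-1) * (Rm j l (snd z) * u l z)))"

lemma Rm_mult_L2_cyl: "u \<in> L2 (dtx T) \<Longrightarrow> (\<lambda>z. Rm j l (snd z) * u z) \<in> L2 (dtx T)"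
proof -
  assume u: "u \<in> L2 (dtx T)"
  obtain K where K: "\<And>x. \<bar>Rm j l x\<bar> \<le> K" using Cinf_torus_bounded[OF Rm_Cinf] by blast
  have "(\<lambda>z :: real \<times> (real^'d). Rm j l (snd z)) \<in> borel_measurable (dtx T)"
    unfolding cyl_leb_pair by (rule measurable_compose[OF measurable_snd Cinf_torus_measurable[OF Rm_Cinf]])
  then show ?thesis using K by (rule L2_bounded_mult(1)[OF _ _ u])
qed

lemma nxt_L2:
  fixes f u :: "nat \<Rightarrow> 'd::finite st_fun"
  assumes f: "\<And>j. j \<in> {1..n} \<Longrightarrow> f j \<in> L2 (dtx T)" and u: "\<And>j. j \<in> {1..n} \<Longrightarrow> u j \<in> L2 (dtx T)"
    and d: "\<And>i j. j \<in> {1..n} \<Longrightarrow> wderiv T 0 [i] (u j) (dV T i (u j))" and j: "j \<in> {1..n}"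
  shows "nxt f u j \<in> L2 (dtx T)"
  unfolding nxt_def[abs_def]
  by (intro L2_add L2_sum L2_cmult Rm_mult_L2_cyl f u j wderiv_L2[OF d])

text \<open>The property of a good time: all slices involved lie in L2, and the selected space
  derivatives have the expected coefficients there. Almost every time is good.\<close>

definition nxt_sec :: "(nat \<Rightarrow> 'd::finite st_fun) \<Rightarrow> (nat \<Rightarrow> 'd::finite st_fun) \<Rightarrow> real \<Rightarrow> bool" where
  "nxt_sec f u t \<longleftrightarrow> (\<forall>j\<in>{1..n}. slice (f j) t \<in> L2 dx \<and> slice (u j) t \<in> L2 dx \<and>
    (\<forall>i\<in>UNIV. slice (dV T i (u j)) t \<in> L2 dx \<and>
      (\<forall>\<xi>. hat (slice (dV T i (u j)) t) \<xi> = - (2 * pi * of_int (\<xi> $ i)) * hat (slice (u j) t) (- \<xi>))))"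

lemma nxt_sections:
  fixes f u :: "nat \<Rightarrow> 'd::finite st_fun"
  assumes f: "\<And>j. j \<in> {1..n} \<Longrightarrow> f j \<in> L2 (dtx T)" and u: "\<And>j. j \<in> {1..n} \<Longrightarrow> u j \<in> L2 (dtx T)"
    and d: "\<And>i j. j \<in> {1..n} \<Longrightarrow> wderiv T 0 [i] (u j) (dV T i (u j))"
  shows "AE t in dt T. nxt_sec f u t"
  unfolding nxt_sec_def
proof (intro AE_finite_allI)
  fix j assume j: "j \<in> {1..n}"
  have "AE t in dt T. \<forall>i\<in>UNIV. slice (dV T i (u j)) t \<in> L2 dx \<and>
      (\<forall>\<xi>. hat (slice (dV T i (u j)) t) \<xi> = - (2 * pi * of_int (\<xi> $ i)) * hat (slice (u j) t) (- \<xi>))"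
  proof (intro AE_finite_allI)
    fix i :: 'd
    have "AE t in dt T. \<forall>\<xi>. hat (slice (dV T i (u j)) t) \<xi> = - (2 * pi * of_int (\<xi> $ i)) * hat (slice (u j) t) (- \<xi>)"
      using wderiv_space_hat[OF u[OF j] d[OF j, of i]] by (simp add: AE_all_countable)
    with cyl_section_L2[OF wderiv_L2[OF d[OF j, of i]]]
    show "AE t in dt T. slice (dV T i (u j)) t \<in> L2 dx \<and>
      (\<forall>\<xi>. hat (slice (dV T i (u j)) t) \<xi> = - (2 * pi * of_int (\<xi> $ i)) * hat (slice (u j) t) (- \<xi>))"
      by eventually_elim simp
  qed simp
  with cyl_section_L2[OF f[OF j]] cyl_section_L2[OF u[OF j]]
  show "AE t in dt T. slice (f j) t \<in> L2 dx \<and> slice (u j) t \<in> L2 dx \<and>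
    (\<forall>i\<in>UNIV. slice (dV T i (u j)) t \<in> L2 dx \<and>
      (\<forall>\<xi>. hat (slice (dV T i (u j)) t) \<xi> = - (2 * pi * of_int (\<xi> $ i)) * hat (slice (u j) t) (- \<xi>)))"
    by eventually_elim simp
qed simp

lemma hat_transport:
  assumes "\<And>i l. l \<in> {1..n} \<Longrightarrow> v i l \<in> L2 dx"
    and "\<And>i l. l \<in> {1..n} \<Longrightarrow> hat (v i l) \<xi> = - (2 * pi * of_int (\<xi> $ i)) * a (- \<xi>) l"
  shows "hat (\<lambda>x. \<Sum>i\<in>UNIV. \<Sum>l=1..n. (- Sm i j l) * v i l x) \<xi> = Sk a \<xi> j"
proof -
  have "hat (\<lambda>x. \<Sum>i\<in>UNIV. \<Sum>l=1..n. (- Sm i j l) * v i l x) \<xi> = (\<Sum>i\<in>UNIV. \<Sum>l=1..n. (- Sm i j l) * hat (v i l) \<xi>)"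
  proof -
    have L: "(\<lambda>x. \<Sum>l=1..n. (- Sm i j l) * v i l x) \<in> L2 dx" for i
      by (intro L2_sum L2_cmult assms(1))
    have "hat (\<lambda>x. \<Sum>i\<in>UNIV. \<Sum>l=1..n. (- Sm i j l) * v i l x) \<xi> =
        (\<Sum>i\<in>UNIV. hat (\<lambda>x. \<Sum>l=1..n. (- Sm i j l) * v i l x) \<xi>)"
      by (rule hat_sum) (rule L)
    also have "\<dots> = (\<Sum>i\<in>UNIV. \<Sum>l=1..n. hat (\<lambda>x. (- Sm i j l) * v i l x) \<xi>)"
      by (intro sum.cong refl hat_sum L2_cmult assms(1))
    finally show ?thesis unfolding hat_cmult .
  qed
  also have "\<dots> = Sk a \<xi> j" unfolding Sk_def by (intro sum.cong refl) (simp add: assms(2))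
  finally show ?thesis .
qed

lemma hat_nxt:
  fixes f u :: "nat \<Rightarrow> 'd::finite st_fun"
  assumes f: "\<And>j. j \<in> {1..n} \<Longrightarrow> f j \<in> L2 (dtx T)" and u: "\<And>j. j \<in> {1..n} \<Longrightarrow> u j \<in> L2 (dtx T)"
    and d: "\<And>i j. j \<in> {1..n} \<Longrightarrow> wderiv T 0 [i] (u j) (dV T i (u j))" and j: "j \<in> {1..n}"
  shows "AE t in dt T. hat (slice (nxt f u j) t) \<xi> =
    rhs f u \<xi> j t"
proof -
  have "AE t in dt T. nxt_sec f u t" by (rule nxt_sections[OF f u d])
  then show ?thesis
    unfolding nxt_sec_def
proof eventually_elim
  case (elim t)
  let ?S = "\<lambda>x. \<Sum>i\<in>UNIV. \<Sum>l=1..n. (- Sm i j l) * dV T i (u l) (t, x)"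
  have L: "?S \<in> L2 dx" using elim by (intro L2_sum L2_cmult) blast
  have R: "RR (\<lambda>l. slice (u l) t) j \<in> L2 dx" using elim by (intro RR_L2) blast
  have f: "slice (f j) t \<in> L2 dx" using elim j by blast
  have eq: "(slice (nxt f u j) t) = (\<lambda>x. f j (t, x) + (?S x + (-1) * RR (\<lambda>l. slice (u l) t) j x))"
    by (simp add: nxt_def RR_def fun_eq_iff sum_negf)
  have "hat (slice (nxt f u j) t) \<xi> = hat (slice (f j) t) \<xi> + (hat ?S \<xi> + (-1) * hat (RR (\<lambda>l. slice (u l) t) j) \<xi>)"
    unfolding eq hat_add[OF f L2_add[OF L L2_cmult[OF R]]] hat_add[OF L L2_cmult[OF R]] hat_cmult ..
  moreover have "hat ?S \<xi> = Sk (\<lambda>\<zeta> l. hat (slice (u l) t) \<zeta>) \<xi> j"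
    by (rule hat_transport) (use elim in blast)+
  ultimately show ?case by simp
qed
qed

text \<open>\<open>4 * Bd\<^sup>2\<close> bounds the squared entries of \<open>Sm\<close>; CARD('d)
  and one n come from Cauchy-Schwarz over directions and components, the other n from summing over
  j.\<close>

definition CS :: real where
  "CS = 4 * Bd\<^sup>2 * real n * (real CARD('d) * real n)"

lemma Sm_sq: "j \<in> {1..n} \<Longrightarrow> l \<in> {1..n} \<Longrightarrow> (Sm i j l)\<^sup>2 \<le> 4 * Bd\<^sup>2"
proof -
  assume *: "j \<in> {1..n}" "l \<in> {1..n}"
  have "\<bar>Sm i j l\<bar> \<le> 2 * Bd" using B_bd[OF *, of i] B_bd[OF *(2,1), of i] by (simp add: Sm_def)
  from power_mono[OF this, of 2] show ?thesis by (simp add: power_mult_distrib)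
qed

text \<open>The transport term costs one space derivative, the lower-order term none. The factors 2
  and 4 come from splitting the three summands by two applications of
  \<open>sobsum_add_le\<close>.\<close>

lemma nxt_sobsum:
  fixes f u :: "nat \<Rightarrow> 'd::finite st_fun"
  assumes f: "\<And>j. j \<in> {1..n} \<Longrightarrow> f j \<in> L2 (dtx T)" and u: "\<And>j. j \<in> {1..n} \<Longrightarrow> u j \<in> L2 (dtx T)"
    and d: "\<And>i j. j \<in> {1..n} \<Longrightarrow> wderiv T 0 [i] (u j) (dV T i (u j))" and s: "Suc s \<le> q"
    and Kf: "\<And>N. (\<integral>t. (sobsums n s N f t) \<partial>dt T) \<le> Kf"
    and Ku: "\<And>N. (\<integral>t. (sobsums n (Suc s) N u t) \<partial>dt T) \<le> Ku"
  shows "(\<integral>t. (sobsums n s N (nxt f u) t) \<partial>dt T) \<le> 2 * Kf + 4 * (CS + CR) * Ku"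
proof -
  have "AE t in dt T. nxt_sec f u t" by (rule nxt_sections[OF f u d])
  note nxt_sec = this[unfolded nxt_sec_def]
  obtain V where V: "\<And>j. j \<in> {1..n} \<Longrightarrow> wderivs_upto T (Suc s) (u j) (V j)"
    "(\<integral>t. (\<Sum>j=1..n. deriv_norms (Suc s) (V j) t) \<partial>dt T) \<le> Ku"
    using wderivs_upto_exists[OF u Ku] by blast
  let ?\<kappa> = "\<lambda>t. \<Sum>j=1..n. deriv_norms (Suc s) (V j) t"
  have \<kappa>i: "integrable (dt T) ?\<kappa>"
    by (intro Bochner_Integration.integrable_sum deriv_norms_integrable(1)[OF V(1)])
  have \<kappa>: "AE t in dt T. \<forall>j\<in>{1..n}. \<forall>N. sobsum (Suc s) N (slice (u j) t) \<le> deriv_norms (Suc s) (V j) t"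
    proof (intro AE_finite_allI finite_atLeastAtMost)
    fix j assume j: "j \<in> {1..n}"
    show "AE t in dt T. \<forall>N. sobsum (Suc s) N (slice (u j) t) \<le> deriv_norms (Suc s) (V j) t"
      by (rule sobsum_le_deriv_norms[OF u[OF j] V(1)[OF j]])
  qed
  have fi: "integrable (dt T) (sobsums n s N f)"
    by (intro Bochner_Integration.integrable_sum sobsum_time_integrable f)
  have "(\<integral>t. (sobsums n s N (nxt f u) t) \<partial>dt T) \<le>
      (\<integral>t. 2 * (sobsums n s N f t) + 4 * (CS + CR) * ?\<kappa> t \<partial>dt T)"
  proof (rule integral_mono_AE)
    show "integrable (dt T) (\<lambda>t. sobsums n s N (nxt f u) t)"
      by (intro Bochner_Integration.integrable_sum sobsum_time_integrable nxt_L2 f u d)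
    show "integrable (dt T) (\<lambda>t. 2 * (sobsums n s N f t) + 4 * (CS + CR) * ?\<kappa> t)"
      using fi \<kappa>i by simp
    show "AE t in dt T. (sobsums n s N (nxt f u) t) \<le>
        2 * (sobsums n s N f t) + 4 * (CS + CR) * ?\<kappa> t"
      using nxt_sec \<kappa>
    proof eventually_elim
      case (elim t)
      let ?S = "\<lambda>j x. \<Sum>i\<in>UNIV. \<Sum>l=1..n. (- Sm i j l) * dV T i (u l) (t, x)"
      let ?R = "\<lambda>j. RR (\<lambda>l. slice (u l) t) j"
      have uL: "slice (u l) t \<in> L2 dx" and dL: "slice (dV T i (u l)) t \<in> L2 dx" if "l \<in> {1..n}" for i l
        using elim(1) that by auto
      have L: "?S j \<in> L2 dx" for j using dL by (intro L2_sum L2_cmult)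
      have R: "?R j \<in> L2 dx" for j using uL by (intro RR_L2)
      have sum_u: "(sobsums n (Suc s) M u t) \<le> ?\<kappa> t" for M
        using elim(2) by (intro sum_mono) auto
      \<comment> \<open>Over all directions the squared multipliers add up to \<open>freq\<close>,
        which the next Sobolev weight absorbs.\<close>
      have dV_sum: "(\<Sum>i\<in>UNIV. sobsum s N (slice (dV T i (u l)) t)) \<le> sobsum (Suc s) N (slice (u l) t)" if l: "l \<in> {1..n}" for l
      proof -
        have h: "hat (slice (dV T i (u l)) t) \<xi> = - (2 * pi * of_int (\<xi> $ i)) * hat (slice (u l) t) (- \<xi>)" for i \<xi>
          using elim(1) l by auto
        have "(\<Sum>i\<in>UNIV. sobsum s N (slice (dV T i (u l)) t)) =
            (\<Sum>\<xi>\<in>Lam N. \<Sum>i\<in>UNIV. weight s \<xi> * ((2 * pi * of_int (\<xi> $ i))\<^sup>2 * (hat (slice (u l) t) (- \<xi>))\<^sup>2))"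
          unfolding sobsum_def h by (subst sum.swap) (simp add: power_mult_distrib)
        also have "\<dots> = (\<Sum>\<xi>\<in>Lam N. (freq (- \<xi>) * weight s (- \<xi>)) * (hat (slice (u l) t) (- \<xi>))\<^sup>2)"
          unfolding freq_uminus weight_uminus freq_def
          by (intro sum.cong refl) (simp add: sum_distrib_left sum_distrib_right mult_ac)
        also have "\<dots> = (\<Sum>\<xi>\<in>Lam N. (freq \<xi> * weight s \<xi>) * (hat (slice (u l) t) \<xi>)\<^sup>2)"
          by (rule sum_Lam_uminus)
        also have "\<dots> \<le> sobsum (Suc s) N (slice (u l) t)"
          unfolding sobsum_def by (intro sum_mono mult_right_mono freq_weight_le) auto
        finally show ?thesis .
      qed
      have S: "(\<Sum>j=1..n. sobsum s N (?S j)) \<le> CS * ?\<kappa> t"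
      proof -
        have "sobsum s N (?S j) \<le> (real CARD('d) * real n) * (4 * Bd\<^sup>2 * ?\<kappa> t)" if j: "j \<in> {1..n}" for j
        proof -
          have "sobsum s N (?S j) \<le> real CARD('d) * (\<Sum>i\<in>UNIV. sobsum s N (\<lambda>x. \<Sum>l=1..n. (- Sm i j l) * dV T i (u l) (t, x)))"
            by (rule sobsum_sum_le, simp, intro L2_sum L2_cmult dL)
          also have "\<dots> \<le> real CARD('d) * (\<Sum>i\<in>UNIV. real n * (\<Sum>l=1..n. 4 * Bd\<^sup>2 * sobsum s N (slice (dV T i (u l)) t)))"
          proof (intro mult_left_mono sum_mono)
            fix i
            have "sobsum s N (\<lambda>x. \<Sum>l=1..n. (- Sm i j l) * dV T i (u l) (t, x)) \<le>
                real (card {1..n}) * (\<Sum>l=1..n. sobsum s N (\<lambda>x. (- Sm i j l) * dV T i (u l) (t, x)))"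
              by (rule sobsum_sum_le, simp, intro L2_cmult dL)
            also have "\<dots> \<le> real (card {1..n}) * (\<Sum>l=1..n. 4 * Bd\<^sup>2 * sobsum s N (slice (dV T i (u l)) t))"
              unfolding sobsum_cmult power2_minus by (intro mult_left_mono sum_mono mult_right_mono Sm_sq j) auto
            finally show "sobsum s N (\<lambda>x. \<Sum>l=1..n. (- Sm i j l) * dV T i (u l) (t, x)) \<le>
                real n * (\<Sum>l=1..n. 4 * Bd\<^sup>2 * sobsum s N (slice (dV T i (u l)) t))" by simp
          qed simp
          also have "\<dots> = (real CARD('d) * real n) * (4 * Bd\<^sup>2 * (\<Sum>l=1..n. \<Sum>i\<in>UNIV. sobsum s N (slice (dV T i (u l)) t)))"
            unfolding sum_distrib_left[symmetric] by (subst sum.swap) simp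
          also have "\<dots> \<le> (real CARD('d) * real n) * (4 * Bd\<^sup>2 * (sobsums n (Suc s) N u t))"
            by (intro mult_left_mono sum_mono dV_sum) auto
          also have "\<dots> \<le> (real CARD('d) * real n) * (4 * Bd\<^sup>2 * ?\<kappa> t)"
            by (intro mult_left_mono sum_u) auto
          finally show ?thesis .
        qed
        then have "(\<Sum>j=1..n. sobsum s N (?S j)) \<le> (\<Sum>j=1..n. (real CARD('d) * real n) * (4 * Bd\<^sup>2 * ?\<kappa> t))"
          by (rule sum_mono)
        also have "\<dots> = CS * ?\<kappa> t" by (simp add: CS_def algebra_simps)
        finally show ?thesis .
      qed
      have RRb: "(\<Sum>j=1..n. sobsum s N (?R j)) \<le> CR * ?\<kappa> t"
      proof (rule RR_sobsum)
        show "(sobsums n s M u t) \<le> ?\<kappa> t" for M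
          by (rule order_trans[OF sum_mono[OF sobsum_mono] sum_u]) simp
      qed (use s uL in auto)
      have "sobsum s N (slice (nxt f u j) t) \<le> 2 * sobsum s N (slice (f j) t) + (4 * sobsum s N (?S j) + 4 * sobsum s N (?R j))"
        if j: "j \<in> {1..n}" for j
      proof -
        have fL: "slice (f j) t \<in> L2 dx" using elim(1) j by auto
        have "(slice (nxt f u j) t) = (\<lambda>x. f j (t, x) + (?S j x + (-1) * ?R j x))"
          by (simp add: nxt_def RR_def fun_eq_iff sum_negf)
        then have "sobsum s N (slice (nxt f u j) t) \<le> 2 * sobsum s N (slice (f j) t) + 2 * sobsum s N (\<lambda>x. ?S j x + (-1) * ?R j x)"
          using sobsum_add_le[OF fL L2_add[OF L[of j] L2_cmult[OF R[of j], of "-1"]]] by simp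
        moreover have "sobsum s N (\<lambda>x. ?S j x + (-1) * ?R j x) \<le> 2 * sobsum s N (?S j) + 2 * sobsum s N (?R j)"
          using sobsum_add_le[OF L[of j] L2_cmult[OF R[of j], of "-1"], of s N] unfolding sobsum_cmult by simp
        ultimately show ?thesis by linarith
      qed
      then have "(sobsums n s N (nxt f u) t) \<le>
          (\<Sum>j=1..n. 2 * sobsum s N (slice (f j) t) + (4 * sobsum s N (?S j) + 4 * sobsum s N (?R j)))"
        by (rule sum_mono)
      also have "\<dots> = 2 * (sobsums n s N f t) + (4 * (\<Sum>j=1..n. sobsum s N (?S j)) + 4 * (\<Sum>j=1..n. sobsum s N (?R j)))"
        by (simp only: sum.distrib sum_distrib_left)
      also have "\<dots> \<le> 2 * (sobsums n s N f t) + 4 * (CS + CR) * ?\<kappa> t"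
        using S RRb by (simp add: algebra_simps)
      finally show ?case .
    qed
  qed
  also have "\<dots> = 2 * (\<integral>t. (sobsums n s N f t) \<partial>dt T) + 4 * (CS + CR) * (\<integral>t. ?\<kappa> t \<partial>dt T)"
    using fi \<kappa>i by simp
  also have "\<dots> \<le> 2 * Kf + 4 * (CS + CR) * Ku"
  proof -
    have "0 \<le> CS" by (simp add: CS_def)
    then show ?thesis using Kf V(2) CR_nonneg by (intro add_mono mult_left_mono) auto
  qed
  finally show ?thesis .
qed

text \<open>The coefficients of the system do not depend on time, so differentiating in time
  commutes with \<open>nxt\<close>; space derivatives are exchanged with it by
  \<open>wderiv_swap\<close>.\<close>

lemma nxt_time_derivative:
  fixes f u :: "nat \<Rightarrow> 'd::finite st_fun"
  assumes f: "\<And>j. j \<in> {1..n} \<Longrightarrow> f j \<in> L2 (dtx T)" and u: "\<And>j. j \<in> {1..n} \<Longrightarrow> u j \<in> L2 (dtx T)"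
    and d: "\<And>i j. j \<in> {1..n} \<Longrightarrow> wderiv T 0 [i] (u j) (dV T i (u j))"
    and d': "\<And>i j. j \<in> {1..n} \<Longrightarrow> wderiv T 0 [i] (u' j) (dV T i (u' j))"
    and ff': "\<And>j. j \<in> {1..n} \<Longrightarrow> wderiv T (Suc 0) [] (f j) (f' j)"
    and uu': "\<And>j. j \<in> {1..n} \<Longrightarrow> wderiv T (Suc 0) [] (u j) (u' j)" and j: "j \<in> {1..n}"
  shows "wderiv T (Suc 0) [] (nxt f u j) (nxt f' u' j)"
  unfolding nxt_def[abs_def]
  by (intro wderiv_add wderiv_sum wderiv_cmult wderiv_smooth_mult_time Rm_Cinf ff' uu' j
      wderiv_swap[OF uu' d d'] L2_add L2_sum L2_cmult Rm_mult_L2_cyl f u wderiv_L2[OF d])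

end

lemma sum_pairs_le:
  fixes f :: "nat \<Rightarrow> nat \<Rightarrow> real"
  shows "(\<Sum>(i, j) | i + j \<le> q. f i j) = (\<Sum>i\<le>q. \<Sum>j\<le>q - i. f i j)"
proof -
  have "{(i, j). i + j \<le> q} = Sigma {..q} (\<lambda>i. {..q - i})" by auto
  then show ?thesis by (simp add: sum.Sigma)
qed

lemma sobsum_integral_sum_le:
  assumes L: "\<And>j. j \<in> {1..n} \<Longrightarrow> u j \<in> L2 (dtx T)"
    and V: "\<And>j. j \<in> {1..n} \<Longrightarrow> wderivs_upto T s (u j) (DF j i)" and is_le: "i + s \<le> q"
  shows "(\<integral>t. (sobsums n s N u t) \<partial>dt T) \<le>
    (\<Sum>j=1..n. dnorms T q (DF j))"
proof -
  have "(\<integral>t. (sobsums n s N u t) \<partial>dt T) =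
      (\<Sum>j=1..n. \<integral>t. sobsum s N (slice (u j) t) \<partial>dt T)"
    by (intro Bochner_Integration.integral_sum sobsum_time_integrable L)
  also have "\<dots> \<le> (\<Sum>j=1..n. dnorms T q (DF j))"
  proof (intro sum_mono)
    fix j assume j: "j \<in> {1..n}"
    have "(\<integral>t. sobsum s N (slice (u j) t) \<partial>dt T) \<le>
        dnorm T s (DF j i)"
      by (rule sobsum_integral_le[OF L[OF j] V[OF j]])
    also have "\<dots> \<le> (dnorm T (q - i) (DF j i))"
      by (rule sum_mono2) (use is_le in \<open>auto intro!: sum_nonneg\<close>)
    also have "\<dots> \<le> dnorms T q (DF j)"
      by (rule member_le_sum[where f = "\<lambda>i. dnorm T (q - i) (DF j i)"])
         (use is_le in \<open>auto intro!: sum_nonneg\<close>)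
    finally show "(\<integral>t. sobsum s N (slice (u j) t) \<partial>dt T) \<le>
      dnorms T q (DF j)" .
  qed
  finally show ?thesis .
qed

context moment_system
begin

text \<open>The constant for the i-th time derivative in L2(0,T; H^(q - i)), obtained by iterating
  \<open>nxt_sobsum\<close>. The factor T at the start comes from integrating the bound that holds
  at every time.\<close>

definition Pc :: "nat \<Rightarrow> real" where
  "Pc i = ((\<lambda>p. 2 + 4 * (CS + CR) * p) ^^ i) (T * exp ((2 + CR) * T))"

lemma Pc_simps [simp]: "Pc 0 = T * exp ((2 + CR) * T)" "Pc (Suc i) = 2 + 4 * (CS + CR) * Pc i"
  by (simp_all add: Pc_def)

lemma Sk_integrable:
  "(\<And>j. j \<in> {1..n} \<Longrightarrow> u j \<in> L2 (dtx T)) \<Longrightarrow>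
    integrable (dt T) (\<lambda>s. Sk (\<lambda>\<zeta> l. hat (slice (u l) s) \<zeta>) \<xi> j)"
  unfolding Sk_def
  by (intro Bochner_Integration.integrable_sum integrable_mult_right cyl_hat_integrable) auto

lemma rhs_integrable:
  fixes u :: "nat \<Rightarrow> 'd::finite st_fun"
  assumes f: "f \<in> L2 (dtx T)" and u: "\<And>j. j \<in> {1..n} \<Longrightarrow> u j \<in> L2 (dtx T)"
  shows "integrable (dt T) (\<lambda>s. hat (slice f s) \<xi> - hat (RR (\<lambda>l. slice (u l) s) j) \<xi>)"
proof -
  have "(\<lambda>z. \<Sum>l=1..n. Rm j l (snd z) * u l z) \<in> L2 (dtx T)"
    by (intro L2_sum Rm_mult_L2_cyl u)
  from cyl_hat_integrable[OF this, of \<xi>] cyl_hat_integrable[OF f, of \<xi>]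
  show "integrable (dt T) (\<lambda>s. hat (slice f s) \<xi> - hat (RR (\<lambda>l. slice (u l) s) j) \<xi>)"
    by (simp add: RR_def[abs_def])
qed

end

text \<open>Isolates what the regularity argument uses of a solution: its mode equation in
  integrated form at every time and a Sobolev bound uniform in time.\<close>

locale regular_data = moment_system U T n A B Bd Cm q
  for U :: "real^'d \<Rightarrow> real" and T n A B Bd Cm q +
  fixes F :: "nat \<Rightarrow> 'd::finite st_fun" and DF :: "nat \<Rightarrow> nat \<Rightarrow> 'd list \<Rightarrow> 'd::finite st_fun"
    and G :: "nat \<Rightarrow> real^'d \<Rightarrow> real" and c :: "nat \<Rightarrow> 'd::finite st_fun" and KG KF :: real
  assumes q1: "1 \<le> q" and KG: "0 \<le> KG"
    and F: "\<And>j. j \<in> {1..n} \<Longrightarrow> F j \<in> L2 (dtx T)"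
    and DF: "\<And>j i is. j \<in> {1..n} \<Longrightarrow> i + length is \<le> q \<Longrightarrow> wderiv T i is (F j) (DF j i is)"
    and KF: "(\<Sum>j=1..n. dnorms T q (DF j)) \<le> KF"
    and c: "\<And>j. j \<in> {1..n} \<Longrightarrow> c j \<in> L2 (dtx T)"
    and c_mode: "\<And>j \<xi> t. j \<in> {1..n} \<Longrightarrow> t \<in> {0..T} \<Longrightarrow> hat (slice (c j) t) \<xi> = hat (G j) \<xi> +
      prim T (rhs F c \<xi> j) t"
    and c_bound: "\<And>N t. t \<in> {0..T} \<Longrightarrow> (sobsums n q N c t) \<le> (KG + KF) * exp ((2 + CR) * T)"
begin

text \<open>By the equation, the time derivatives of \<open>c\<close> are \<open>Cs 1, Cs 2, \<dots>\<close>.\<close>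

definition Fs :: "nat \<Rightarrow> nat \<Rightarrow> 'd::finite st_fun" where
  "Fs i j = DF j i []"

fun Cs :: "nat \<Rightarrow> nat \<Rightarrow> 'd::finite st_fun" where
  "Cs 0 = c"
| "Cs (Suc i) = nxt (Fs i) (Cs i)"

lemma Fs_L2: "j \<in> {1..n} \<Longrightarrow> i \<le> q \<Longrightarrow> Fs i j \<in> L2 (dtx T)"
  unfolding Fs_def by (rule wderiv_L2[OF DF]) auto

lemma Fs_upto:
  assumes "j \<in> {1..n}" "i + s \<le> q"
  shows "wderivs_upto T s (Fs i j) (DF j i)"
  unfolding wderivs_upto_def
proof (intro allI impI)
  fix "is" :: "'d list" assume l: "length is \<le> s"
  have "wderiv T (i + 0) is (F j) (DF j i is)" using assms l by (simp add: DF)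
  then show "wderiv T 0 is (Fs i j) (DF j i is)"
    unfolding Fs_def by (rule wderiv_decompose) (use assms in \<open>simp add: DF\<close>)
qed

lemma Fs_time: "j \<in> {1..n} \<Longrightarrow> Suc i \<le> q \<Longrightarrow> wderiv T (Suc 0) [] (Fs i j) (Fs (Suc i) j)"
  unfolding Fs_def using DF[of j "i + Suc 0" "[]"] by (intro wderiv_decompose[OF _ DF]) auto

lemma Fs_bound:
  assumes "i + s \<le> q"
  shows "(\<integral>t. (sobsums n s N (Fs i) t) \<partial>dt T) \<le> KF"
  by (rule order_trans[OF sobsum_integral_sum_le[OF Fs_L2 Fs_upto assms] KF]) (use assms in auto)

lemma dV_of_bound:
  fixes u :: "nat \<Rightarrow> 'd::finite st_fun"
  assumes u: "\<And>j. j \<in> {1..n} \<Longrightarrow> u j \<in> L2 (dtx T)"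
    and K: "\<And>N. (\<integral>t. (sobsums n (Suc s) N u t) \<partial>dt T) \<le> K" and j: "j \<in> {1..n}"
  shows "wderiv T 0 [i] (u j) (dV T i (u j))"
proof -
  obtain V where "\<And>j. j \<in> {1..n} \<Longrightarrow> wderivs_upto T (Suc s) (u j) (V j)"
    using wderivs_upto_exists[OF u K] by blast
  then have "wderiv T 0 [i] (u j) (V j [i])" using j by (simp add: wderivs_upto_def)
  then show ?thesis by (rule wderiv_dV)
qed

lemma Cs_bound_0: "(\<integral>t. (sobsums n q N c t) \<partial>dt T) \<le> Pc 0 * (KG + KF)"
proof -
  have "(\<integral>t. (sobsums n q N c t) \<partial>dt T) \<le> (\<integral>t. (KG + KF) * exp ((2 + CR) * T) \<partial>dt T)"
  proof (rule integral_mono)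
    show "integrable (dt T) (sobsums n q N c)"
      by (intro Bochner_Integration.integrable_sum sobsum_time_integrable c)
    show "(sobsums n q N c t) \<le> (KG + KF) * exp ((2 + CR) * T)" if "t \<in> space (dt T)" for t
      using that by (intro c_bound) auto
  qed simp
  also have "\<dots> = Pc 0 * (KG + KF)" using T by (simp add: measure_time_leb)
  finally show ?thesis .
qed

text \<open>The available order q - i drops by one with each \<open>nxt\<close>. Since
  \<open>Suc (q - Suc i) = q - i\<close>, the bound of stage i is exactly the input that
  \<open>nxt_sobsum\<close> consumes, and \<open>KF\<close> is absorbed into
  \<open>KG + KF\<close>.\<close>

lemma Cs_bound:
  "i \<le> q \<Longrightarrow> (\<forall>j\<in>{1..n}. Cs i j \<in> L2 (dtx T)) \<and>
    (\<forall>N. (\<integral>t. (sobsums n (q - i) N (Cs i) t) \<partial>dt T) \<le> Pc i * (KG + KF))"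
proof (induction i)
  case 0
  show ?case using c Cs_bound_0 by simp
next
  case (Suc i)
  then have u: "\<And>j. j \<in> {1..n} \<Longrightarrow> Cs i j \<in> L2 (dtx T)"
    and K: "\<And>N. (\<integral>t. (sobsums n (Suc (q - Suc i)) N (Cs i) t) \<partial>dt T) \<le> Pc i * (KG + KF)"
    by (auto simp: Suc_diff_Suc)
  have f: "\<And>j. j \<in> {1..n} \<Longrightarrow> Fs i j \<in> L2 (dtx T)" using Suc.prems by (intro Fs_L2) auto
  have d: "\<And>i' j. j \<in> {1..n} \<Longrightarrow> wderiv T 0 [i'] (Cs i j) (dV T i' (Cs i j))" by (rule dV_of_bound[OF u K])
  have s: "Suc (q - Suc i) \<le> q" using Suc.prems by simp
  have Kf: "\<And>N. (\<integral>t. (sobsums n (q - Suc i) N (Fs i) t) \<partial>dt T) \<le> KF"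
    using Suc.prems by (intro Fs_bound) auto
  have "\<forall>j\<in>{1..n}. nxt (Fs i) (Cs i) j \<in> L2 (dtx T)" by (intro ballI nxt_L2 f u d)
  moreover have "(\<integral>t. (sobsums n (q - Suc i) N (nxt (Fs i) (Cs i)) t) \<partial>dt T) \<le> Pc (Suc i) * (KG + KF)" for N
    using nxt_sobsum[OF f u d s Kf K, of N] KG by (simp add: algebra_simps)
  ultimately show ?case by simp
qed

lemma Cs_L2: "i \<le> q \<Longrightarrow> j \<in> {1..n} \<Longrightarrow> Cs i j \<in> L2 (dtx T)"
  using Cs_bound by blast

lemma Cs_dV: "Suc i \<le> q \<Longrightarrow> j \<in> {1..n} \<Longrightarrow> wderiv T 0 [l] (Cs i j) (dV T l (Cs i j))"
  using Cs_bound[of i] by (intro dV_of_bound[where s = "q - Suc i"]) (auto simp: Suc_diff_Suc)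

text \<open>The integrated mode equation exhibits each coefficient of c as a primitive of the
  coefficient of \<open>nxt\<close>, so \<open>wderiv_of_primitive\<close> applies with the initial
  coefficient as constant.\<close>

lemma Cs_time_0:
  assumes j: "j \<in> {1..n}"
  shows "wderiv T (Suc 0) [] (c j) (Cs (Suc 0) j)"
proof (rule wderiv_of_primitive[OF c[OF j] _ T])
  show "Cs (Suc 0) j \<in> L2 (dtx T)" using q1 j by (intro Cs_L2) auto
  fix \<xi> :: "int^'d"
  have d: "\<And>l j. j \<in> {1..n} \<Longrightarrow> wderiv T 0 [l] (c j) (dV T l (c j))" using Cs_dV[of 0] q1 by simp
  have f: "\<And>j. j \<in> {1..n} \<Longrightarrow> Fs 0 j \<in> L2 (dtx T)" by (intro Fs_L2) auto
  \<comment> \<open>The family \<open>Fs\<close> starts with a selected derivative of order zero,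
    which equals F only almost everywhere.\<close>
  have FF: "AE s in dt T. hat (slice (Fs 0 j) s) \<xi> = hat (slice (F j) s) \<xi>"
    using wderiv_space_hat[OF F[OF j], of "[]" "Fs 0 j" \<xi>] DF[OF j, of 0 "[]"] by (simp add: Fs_def)
  have "AE s in dt T. hat (slice (nxt (Fs 0) c j) s) \<xi> =
    Sk (\<lambda>\<zeta> l. hat (slice (c l) s) \<zeta>) \<xi> j + (hat (slice (Fs 0 j) s) \<xi> - hat (RR (\<lambda>l. slice (c l) s) j) \<xi>)"
    by (rule hat_nxt[OF f c d j])
  with FF have eq: "AE s in dt T. rhs F c \<xi> j s =
      hat (slice (Cs (Suc 0) j) s) \<xi>"
    by eventually_elim simp
  have m: "(\<lambda>s. hat (slice (Cs (Suc 0) j) s) \<xi>) \<in> borel_measurable (dt T)"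
    using q1 j by (intro borel_measurable_integrable cyl_hat_integrable Cs_L2) auto
  have m': "(rhs F c \<xi> j)
      \<in> borel_measurable (dt T)"
    by (intro borel_measurable_integrable Bochner_Integration.integrable_add Sk_integrable rhs_integrable c F j)
  have "hat (slice (c j) t) \<xi> = hat (G j) \<xi> + prim T (\<lambda>s. hat (slice (Cs (Suc 0) j) s) \<xi>) t" if "t \<in> {0..T}" for t
    unfolding c_mode[OF j that] prim_cong_AE[OF m' m eq] ..
  then show "\<exists>a. AE t in dt T. hat (slice (c j) t) \<xi> = a + prim T (\<lambda>s. hat (slice (Cs (Suc 0) j) s) \<xi>) t"
    by (intro exI[of _ "hat (G j) \<xi>"] AE_I2) auto
qed

text \<open>Differentiating the recursion in time and using the induction hypothesis for the inner
  function; only the first step needed the equation itself.\<close>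

lemma Cs_time:
  "Suc i \<le> q \<Longrightarrow> j \<in> {1..n} \<Longrightarrow> wderiv T (Suc 0) [] (Cs i j) (Cs (Suc i) j)"
proof (induction i arbitrary: j)
  case 0
  then show ?case using Cs_time_0 by simp
next
  case (Suc i)
  show ?case
    unfolding Cs.simps(2)[of i] Cs.simps(2)[of "Suc i"]
  proof (rule nxt_time_derivative)
    show "wderiv T (Suc 0) [] (Cs i j) (nxt (Fs i) (Cs i) j)" if "j \<in> {1..n}" for j
      using Suc.IH[of j] Suc.prems that by simp
    show "wderiv T 0 [l] (nxt (Fs i) (Cs i) j) (dV T l (nxt (Fs i) (Cs i) j))" if "j \<in> {1..n}" for j l
      using Cs_dV[of "Suc i" j l] Suc.prems that by simp
  qed (use Suc.prems in \<open>auto intro: Fs_L2 Cs_L2 Cs_dV Fs_time\<close>)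
qed

lemma Cs_time_derivative: "i \<le> q \<Longrightarrow> j \<in> {1..n} \<Longrightarrow> wderiv T i [] (c j) (Cs i j)"
proof (induction i)
  case 0
  then show ?case using wderiv_refl[OF c] by simp
next
  case (Suc i)
  then show ?case using wderiv_compose[of T i "c j" "Cs i j" "Suc 0" "[]"] Cs_time[of i j] by simp
qed

lemma regularity_order:
  assumes i: "i \<le> q"
  obtains V where "\<And>j is. j \<in> {1..n} \<Longrightarrow> i + length is \<le> q \<Longrightarrow> wderiv T i is (c j) (V j is)"
    "(\<Sum>j=1..n. dnorm T (q - i) (V j)) \<le> Pc i * (KG + KF)"
proof -
  obtain V where V: "\<And>j. j \<in> {1..n} \<Longrightarrow> wderivs_upto T (q - i) (Cs i j) (V j)"
    "(\<integral>t. (\<Sum>j=1..n. deriv_norms (q - i) (V j) t) \<partial>dt T) \<le> Pc i * (KG + KF)"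
    using wderivs_upto_exists[of n "Cs i" T "q - i" "Pc i * (KG + KF)"] Cs_bound[OF i] by blast
  have "wderiv T i is (c j) (V j is)" if j: "j \<in> {1..n}" and l: "i + length is \<le> q" for j "is"
  proof -
    have "wderiv T 0 is (Cs i j) (V j is)" using V(1)[OF j] l by (simp add: wderivs_upto_def)
    from wderiv_compose[OF Cs_time_derivative[OF i j] this] show ?thesis by simp
  qed
  moreover have "(\<Sum>j=1..n. dnorm T (q - i) (V j)) =
      (\<Sum>j=1..n. \<integral>t. deriv_norms (q - i) (V j) t \<partial>dt T)"
    by (intro sum.cong refl) (rule deriv_norms_integrable(2)[OF V(1), symmetric])
  moreover have "\<dots> = (\<integral>t. (\<Sum>j=1..n. deriv_norms (q - i) (V j) t) \<partial>dt T)"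
    by (intro Bochner_Integration.integral_sum[symmetric]) (rule deriv_norms_integrable(1)[OF V(1)])
  ultimately show ?thesis using that[of V] V(2) by simp
qed

text \<open>Stated for any choice of weak derivatives because the norms of the statement come with
  their own selection; almost-everywhere uniqueness makes the choices interchangeable.\<close>

lemma regularity:
  assumes D: "\<And>j i is. j \<in> {1..n} \<Longrightarrow> i + length is \<le> q \<Longrightarrow> wderiv T i is (c j) (D j i is)"
  shows "(\<Sum>j=1..n. dnorms T q (D j)) \<le> (\<Sum>i\<le>q. Pc i) * (KG + KF)"
proof -
  have "(\<Sum>j=1..n. dnorm T (q - i) (D j i)) \<le> Pc i * (KG + KF)" if i: "i \<le> q" for i
  proof -
    obtain V where V: "\<And>j is. j \<in> {1..n} \<Longrightarrow> i + length is \<le> q \<Longrightarrow> wderiv T i is (c j) (V j is)"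
      "(\<Sum>j=1..n. dnorm T (q - i) (V j)) \<le> Pc i * (KG + KF)"
      by (rule regularity_order[OF i]) blast
    have "(\<Sum>j=1..n. dnorm T (q - i) (D j i)) =
        (\<Sum>j=1..n. dnorm T (q - i) (V j))"
    proof (intro sum.cong refl)
      fix j k "is" assume *: "j \<in> {1..n}" "k \<in> {..q - i}" "is \<in> {is :: 'd list. length is = k}"
      then have l: "i + length is \<le> q" using i by auto
      note w = D[OF *(1) l] V(1)[OF *(1) l]
      show "L2_normsq (dtx T) (D j i is) = L2_normsq (dtx T) (V j is)"
        by (rule L2_normsq_cong_AE[OF _ _ wderiv_unique[OF w]]) (auto intro: L2_meas wderiv_L2[OF w(1)] wderiv_L2[OF w(2)])
    qed
    then show ?thesis using V(2) by simp
  qed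
  then have "(\<Sum>i\<le>q. \<Sum>j=1..n. dnorm T (q - i) (D j i)) \<le> (\<Sum>i\<le>q. Pc i * (KG + KF))"
    by (intro sum_mono) auto
  then show ?thesis by (subst sum.swap) (simp add: sum_distrib_right)
qed

lemma c_wderivs:
  assumes "j \<in> {1..n}" "i + length is \<le> q"
  shows "\<exists>v. wderiv T i is (c j) v"
proof -
  have i: "i \<le> q" using assms by simp
  show ?thesis by (rule regularity_order[OF i]) (use assms in blast)
qed

end

section \<open>Uniqueness\<close>

lemma Cinf_torus_Heta:
  assumes U: "U \<in> Cinf_torus" and f: "f \<in> Cinf_torus"
  shows "f \<in> Heta U k"
proof -
  have "is_Dx U is f (iter_pderiv (space_dirs is) f)" for "is"
    by (intro is_Dx_of_hat U Cinf_torus_L2[OF f] Cinf_torus_L2[OF Cinf_torus_iter[OF f]] hat_iter_pderiv f)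
  then show ?thesis using Cinf_torus_L2[OF f] by (auto simp: Heta_def L2_eta[OF U])
qed

text \<open>An almost-everywhere statement on the open interval says nothing at time 0 itself, but
  every right neighbourhood of 0 has positive measure.\<close>

lemma AE_zero_initial:
  assumes T: "T > 0" and D: "(D \<longlongrightarrow> D 0) (at 0 within {0..T})" and z: "AE t in dt T. D t = 0"
  shows "D 0 = (0 :: real)"
proof (rule ccontr)
  assume "D 0 \<noteq> 0"
  then have "\<forall>\<^sub>F t in at 0 within {0..T}. D t \<noteq> 0" using D by (rule tendsto_imp_eventually_ne[rotated])
  then obtain d where d: "d > 0" "\<And>t. t \<in> {0..T} \<Longrightarrow> t \<noteq> 0 \<Longrightarrow> dist t 0 < d \<Longrightarrow> D t \<noteq> 0"
    unfolding eventually_at by blast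
  let ?e = "min d T"
  have "AE t in lborel. t \<notin> {0<..<?e}"
    using z[unfolded AE_time_leb] by eventually_elim (use d(2) in \<open>auto simp: dist_real_def\<close>)
  then have "emeasure lborel {0<..<?e} = 0"
    by (subst (asm) AE_iff_measurable[where N = "{0<..<?e}"]) auto
  then show False using d(1) T by (simp add: ennreal_eq_0_iff)
qed

lemma hat_sq_le: "u \<in> L2 dx \<Longrightarrow> (hat u \<xi>)\<^sup>2 \<le> L2_normsq dx u"
  using Bessel[of u "{\<xi>}"] by simp

text \<open>The weak time derivative leaves one constant per mode undetermined; the continuous
  representative in the initial condition identifies it as the coefficient of g.\<close>

lemma initial_mode:
  assumes U: "U \<in> Cinf_torus" and T: "T > 0" and u: "u \<in> L2 (dtx T)" and v: "wderiv T (Suc 0) [] u v"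
    and i: "has_initial_value T U u g" and g: "g \<in> L2 dx"
  shows "AE t in dt T. hat (slice u t) \<xi> = hat g \<xi> + prim T (\<lambda>s. hat (slice v s) \<xi>) t"
proof -
  let ?p = "prim T (\<lambda>s. hat (slice v s) \<xi>)"
  obtain a where a: "AE t in dt T. hat (slice u t) \<xi> = a + ?p t"
    using wderiv_time_primitive[OF u v hartley_Cinf T, of \<xi>] unfolding hat_def by blast
  obtain w where w: "\<And>t. t \<in> {0..T} \<Longrightarrow> w t \<in> L2 dx"
    "((\<lambda>t. L2_normsq (eta U) (\<lambda>x. w t x - w 0 x)) \<longlongrightarrow> 0) (at 0 within {0..T})"
    "AE t in dt T. AE x in dx. w t x = u (t, x)" "AE x in dx. w 0 x = g x"
    using i T unfolding has_initial_value_def L2_eta[OF U] AE_eta[OF U] by force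
  obtain lo where lo: "lo > 0" "\<And>u. u \<in> L2 dx \<Longrightarrow> lo * L2_normsq dx u \<le> L2_normsq (eta U) u"
    using normsq_eta_bounds[OF U] by blast
  have w0: "w 0 \<in> L2 dx" using w(1) T by simp
  \<comment> \<open>Zero at almost every time and continuous at 0, hence zero there as well.\<close>
  let ?D = "\<lambda>t. hat (w t) \<xi> - (a + ?p t)"
  have "AE t in dt T. ?D t = 0"
    using a w(3) cyl_section_L2[OF u] AE_space
  proof eventually_elim
    case (elim t)
    then have "hat (w t) \<xi> = hat (slice u t) \<xi>"
      by (intro hat_cong_AE L2_meas w(1)) auto
    then show ?case using elim(1) by simp
  qed
  moreover have "(?D \<longlongrightarrow> ?D 0) (at 0 within {0..T})"
  proof -
    have "((\<lambda>t. hat (w t) \<xi> - hat (w 0) \<xi>) \<longlongrightarrow> 0) (at 0 within {0..T})"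
    proof (rule Lim_null_comparison)
      show "\<forall>\<^sub>F t in at 0 within {0..T}. norm (hat (w t) \<xi> - hat (w 0) \<xi>) \<le> sqrt (L2_normsq (eta U) (\<lambda>x. w t x - w 0 x) / lo)"
        unfolding eventually_at_filter
      proof (intro always_eventually allI impI)
        fix t assume t: "t \<in> {0..T}"
        have d: "(\<lambda>x. w t x - w 0 x) \<in> L2 dx" by (intro L2_diff w(1) t w0)
        have "(hat (w t) \<xi> - hat (w 0) \<xi>)\<^sup>2 \<le> L2_normsq dx (\<lambda>x. w t x - w 0 x)"
          using hat_sq_le[OF d, of \<xi>] by (simp add: hat_diff[OF w(1)[OF t] w0])
        also have "\<dots> \<le> L2_normsq (eta U) (\<lambda>x. w t x - w 0 x) / lo"
          using lo(2)[OF d] lo(1) by (simp add: pos_le_divide_eq mult.commute)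
        finally show "norm (hat (w t) \<xi> - hat (w 0) \<xi>) \<le> sqrt (L2_normsq (eta U) (\<lambda>x. w t x - w 0 x) / lo)"
          by (simp add: real_le_rsqrt)
      qed
      show "((\<lambda>t. sqrt (L2_normsq (eta U) (\<lambda>x. w t x - w 0 x) / lo)) \<longlongrightarrow> 0) (at 0 within {0..T})"
        using tendsto_real_sqrt[OF tendsto_divide[OF w(2) tendsto_const[of lo]]] lo(1) by simp
    qed
    moreover have "(?p \<longlongrightarrow> ?p 0) (at 0 within {0..T})"
      using continuous_prim[OF cyl_hat_integrable[OF wderiv_L2[OF v]], of \<xi>]
      by (auto simp: continuous_on_eq_continuous_at isCont_def intro: tendsto_within_subset)
    ultimately show ?thesis
      by (intro tendsto_diff tendsto_add tendsto_const) (simp_all add: LIM_zero_iff)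
  qed
  ultimately have "hat (w 0) \<xi> - (a + ?p 0) = 0" using AE_zero_initial[OF T, of ?D] by blast
  then have "a = hat g \<xi>"
    using hat_cong_AE[OF L2_meas[OF w0] L2_meas[OF g] w(4), of \<xi>] by (simp add: prim_0)
  then show ?thesis using a by simp
qed

context moment_system
begin

text \<open>The energy of finitely many modes does not close, since the lower-order term involves
  all of them. Each truncated energy is therefore bounded by the primitive of the full L2 norm, and
  only then is N sent to infinity.\<close>

lemma modes_unique:
  fixes z :: "nat \<Rightarrow> 'd::finite st_fun"
  assumes z: "\<And>j. j \<in> {1..n} \<Longrightarrow> z j \<in> L2 (dtx T)"
    and mode: "\<And>j \<xi>. j \<in> {1..n} \<Longrightarrow> AE t in dt T. hat (slice (z j) t) \<xi> =
      prim T (\<lambda>s. Sk (\<lambda>\<zeta> l. hat (slice (z l) s) \<zeta>) \<xi> j + (0 - hat (RR (\<lambda>l. slice (z l) s) j) \<xi>)) t"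
    and j: "j \<in> {1..n}"
  shows "AE y in dtx T. z j y = 0"
proof -
  define h where "h \<xi> j s = 0 - hat (RR (\<lambda>l. slice (z l) s) j) \<xi>" for \<xi> j s
  \<comment> \<open>Representatives of the coefficients that satisfy the equation at every time, as
    \<open>energy_identity\<close> demands.\<close>
  define y where "y \<xi> j = prim T (\<lambda>s. Sk (\<lambda>\<zeta> l. hat (slice (z l) s) \<zeta>) \<xi> j + h \<xi> j s)" for \<xi> j
  define \<phi> where "\<phi> s = (\<Sum>j=1..n. L2_normsq dx (slice (z j) s))" for s
  have hi: "integrable (dt T) (h \<xi> j)" for \<xi> j
    using rhs_integrable[of "\<lambda>z. 0" z \<xi> j, OF _ z] unfolding h_def by (simp add: hat_zero L2_zero)
  have yi: "integrable (dt T) (\<lambda>s. Sk (\<lambda>\<zeta> l. hat (slice (z l) s) \<zeta>) \<xi> j + h \<xi> j s)" for \<xi> j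
    by (intro Bochner_Integration.integrable_add Sk_integrable z hi)
  have ae: "AE s in dt T. \<forall>j\<in>{1..n}. slice (z j) s \<in> L2 dx \<and> (\<forall>\<xi>. hat (slice (z j) s) \<xi> = y \<xi> j s)"
  proof (intro AE_finite_allI finite_atLeastAtMost)
    fix j assume j: "j \<in> {1..n}"
    have "AE s in dt T. \<forall>\<xi>. hat (slice (z j) s) \<xi> = y \<xi> j s"
      using mode[OF j] unfolding y_def h_def by (simp add: AE_all_countable)
    with cyl_section_L2[OF z[OF j]]
    show "AE s in dt T. slice (z j) s \<in> L2 dx \<and> (\<forall>\<xi>. hat (slice (z j) s) \<xi> = y \<xi> j s)"
      by eventually_elim simp
  qed
  have ym: "y \<xi> j \<in> borel_measurable (dt T)" for \<xi> j
    unfolding y_def by (rule borel_measurable_time_leb[OF prim_measurable[OF yi]])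
  define Yb where "Yb \<xi> j = (\<integral>s. \<bar>Sk (\<lambda>\<zeta> l. hat (slice (z l) s) \<zeta>) \<xi> j + h \<xi> j s\<bar> \<partial>dt T)" for \<xi> j
  have yb: "\<bar>y \<xi> j t\<bar> \<le> Yb \<xi> j" for \<xi> j t unfolding y_def Yb_def by (rule prim_bounded[OF yi])
  have Yb0: "0 \<le> Yb \<xi> j" for \<xi> j unfolding Yb_def by (rule Bochner_Integration.integral_nonneg) simp
  have Ski: "integrable (dt T) (\<lambda>s. Sk (\<lambda>\<zeta> l. y \<zeta> l s) \<xi> j)" for \<xi> j
    unfolding Sk_def
    by (intro Bochner_Integration.integrable_sum integrable_mult_right time_integrable_bounded[OF ym yb])
  have y_eq: "y \<xi> j t = 0 + prim T (\<lambda>s. Sk (\<lambda>\<zeta> l. y \<zeta> l s) \<xi> j + h \<xi> j s) t" for \<xi> j t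
  proof -
    have "prim T (\<lambda>s. Sk (\<lambda>\<zeta> l. hat (slice (z l) s) \<zeta>) \<xi> j + h \<xi> j s) t = prim T (\<lambda>s. Sk (\<lambda>\<zeta> l. y \<zeta> l s) \<xi> j + h \<xi> j s) t"
    proof (rule prim_cong_AE)
      show "(\<lambda>s. Sk (\<lambda>\<zeta> l. hat (slice (z l) s) \<zeta>) \<xi> j + h \<xi> j s) \<in> borel_measurable (dt T)"
        by (rule borel_measurable_integrable[OF yi])
      show "(\<lambda>s. Sk (\<lambda>\<zeta> l. y \<zeta> l s) \<xi> j + h \<xi> j s) \<in> borel_measurable (dt T)"
        by (intro borel_measurable_integrable Bochner_Integration.integrable_add Ski hi)
      show "AE s in dt T. Sk (\<lambda>\<zeta> l. hat (slice (z l) s) \<zeta>) \<xi> j + h \<xi> j s = Sk (\<lambda>\<zeta> l. y \<zeta> l s) \<xi> j + h \<xi> j s"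
        using ae by eventually_elim (simp add: Sk_def)
    qed
    then show ?thesis by (simp add: y_def)
  qed
  have \<phi>i: "integrable (dt T) \<phi>"
    unfolding \<phi>_def by (intro Bochner_Integration.integrable_sum cyl_normsq(2) z)
  have energy: "esum (\<lambda>_. 1) (Lam N) (\<lambda>\<xi> j. y \<xi> j t) \<le> (1 + CR) * prim T \<phi> t" if t: "t \<in> {0..T}" for N t
  proof -
    let ?h = "\<lambda>s. 2 * (\<Sum>\<xi>\<in>Lam N. \<Sum>j=1..n. 1 * (y \<xi> j s * h \<xi> j s))"
    let ?Y = "\<Sum>\<xi>\<in>Lam N. \<Sum>j=1..n. Yb \<xi> j"
    have Y: "\<bar>y \<xi> j t\<bar> \<le> ?Y" if "\<xi> \<in> Lam N" "j \<in> {1..n}" for \<xi> j t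
    proof -
      have "Yb \<xi> j \<le> (\<Sum>j=1..n. Yb \<xi> j)" by (rule member_le_sum[OF that(2), where f = "Yb \<xi>"]) (auto intro: Yb0)
      also have "\<dots> \<le> ?Y" by (rule member_le_sum[OF that(1), where f = "\<lambda>\<xi>. \<Sum>j=1..n. Yb \<xi> j"]) (auto intro: sum_nonneg Yb0)
      finally show ?thesis using yb[of \<xi> j t] by linarith
    qed
    note e = energy_identity[of "Lam N" "\<lambda>_. 1" y ?Y h "\<lambda>_ _. 0", OF finite_Lam _ refl ym Y hi y_eq t, simplified Lam_minus]
    have "esum (\<lambda>_. 1) (Lam N) (\<lambda>\<xi> j. y \<xi> j t) = prim T ?h t"
      using e(1) by (simp add: esum_def Lam_minus)
    also have "\<dots> \<le> prim T (\<lambda>s. (1 + CR) * \<phi> s) t"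
    proof (rule prim_mono_AE)
      show "integrable (dt T) ?h" using e(2) by (simp add: Lam_minus)
      show "integrable (dt T) (\<lambda>s. (1 + CR) * \<phi> s)" using \<phi>i by simp
      show "AE s in dt T. ?h s \<le> (1 + CR) * \<phi> s"
        using ae
      proof eventually_elim
        case (elim s)
        have zs: "slice (z l) s \<in> L2 dx" if "l \<in> {1..n}" for l using elim that by blast
        have "?h s = (\<Sum>\<xi>\<in>Lam N. \<Sum>j=1..n. 2 * (y \<xi> j s * h \<xi> j s))" by (simp add: sum_distrib_left)
        also have "\<dots> \<le> (\<Sum>\<xi>\<in>Lam N. \<Sum>j=1..n. (y \<xi> j s)\<^sup>2 + (h \<xi> j s)\<^sup>2)"
          by (intro sum_mono) (use sum_squares_bound in \<open>simp add: mult.assoc\<close>)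
        also have "\<dots> = (\<Sum>j=1..n. \<Sum>\<xi>\<in>Lam N. (y \<xi> j s)\<^sup>2) + (\<Sum>j=1..n. \<Sum>\<xi>\<in>Lam N. (h \<xi> j s)\<^sup>2)"
          by (subst sum.swap) (simp only: sum.distrib)
        also have "(\<Sum>j=1..n. \<Sum>\<xi>\<in>Lam N. (y \<xi> j s)\<^sup>2) = (sobsums n 0 N z s)"
          using elim by (intro sum.cong refl) (simp add: sobsum_0)
        also have "(\<Sum>j=1..n. \<Sum>\<xi>\<in>Lam N. (h \<xi> j s)\<^sup>2) = (\<Sum>j=1..n. sobsum 0 N (RR (\<lambda>l. slice (z l) s) j))"
          by (simp add: sobsum_0 h_def)
        also have "\<dots> \<le> CR * \<phi> s"
          unfolding \<phi>_def by (intro RR_sobsum zs sum_mono sobsum_le_normsq) auto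
        also have "(sobsums n 0 N z s) \<le> \<phi> s"
          unfolding \<phi>_def by (intro zs sum_mono sobsum_le_normsq)
        finally show ?case by (simp add: algebra_simps)
      qed
    qed
    finally show ?thesis by (simp add: prim_cmult)
  qed
  have \<phi>_le: "AE t in dt T. \<phi> t \<le> (1 + CR) * prim T \<phi> t"
    using ae AE_space
  proof eventually_elim
    case (elim t)
    have "(\<lambda>N. \<Sum>j=1..n. \<Sum>\<xi>\<in>Lam N. (hat (slice (z j) t) \<xi>)\<^sup>2) \<longlonglongrightarrow> \<phi> t"
      unfolding \<phi>_def by (intro tendsto_sum Parseval_normsq) (use elim in blast)
    moreover have "(\<Sum>j=1..n. \<Sum>\<xi>\<in>Lam N. (hat (slice (z j) t) \<xi>)\<^sup>2) \<le> (1 + CR) * prim T \<phi> t" for N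
    proof -
      have "(\<Sum>j=1..n. \<Sum>\<xi>\<in>Lam N. (hat (slice (z j) t) \<xi>)\<^sup>2) = (\<Sum>j=1..n. \<Sum>\<xi>\<in>Lam N. (y \<xi> j t)\<^sup>2)"
        using elim(1) by (intro sum.cong refl) simp
      also have "\<dots> = esum (\<lambda>_. 1) (Lam N) (\<lambda>\<xi> j. y \<xi> j t)" unfolding esum_def by (subst sum.swap) simp
      finally show ?thesis using energy[of t N] elim(2) by simp
    qed
    ultimately show ?case by (intro LIMSEQ_le_const2) auto
  qed
  \<comment> \<open>The inequality for \<phi> holds only almost everywhere. Its primitive satisfies
    one at every time, so Gronwall's lemma is applied to the primitive.\<close>
  let ?Q = "prim T \<phi>"
  have Qi: "integrable (dt T) ?Q"
    by (rule time_integrable_bounded[OF borel_measurable_time_leb[OF prim_measurable[OF \<phi>i]] prim_bounded[OF \<phi>i]])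
  have Q0: "?Q t \<le> 0" if "t \<in> {0..T}" for t
  proof -
    have "?Q t \<le> 0 + (1 + CR) * prim T ?Q t" for t
      using prim_mono_AE[OF \<phi>i integrable_mult_right[OF Qi] \<phi>_le, of t] by (simp add: prim_cmult)
    with Gronwall_prim[OF Qi _ _ that, of "1 + CR" 0] CR_nonneg show ?thesis by simp
  qed
  have zero: "AE t in dt T. \<forall>j\<in>{1..n}. L2_normsq dx (slice (z j) t) = 0"
    using \<phi>_le AE_space
  proof eventually_elim
    case (elim t)
    have "(1 + CR) * ?Q t \<le> 0" using Q0[of t] elim(2) CR_nonneg by (simp add: mult_nonneg_nonpos)
    then have "(\<Sum>j=1..n. L2_normsq dx (slice (z j) t)) = 0"
      using elim(1) sum_nonneg[of "{1..n}" "\<lambda>j. L2_normsq dx (slice (z j) t)"] by (simp add: \<phi>_def)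
    then show ?case by (subst (asm) sum_nonneg_eq_0_iff) auto
  qed
  have "L2_normsq (dtx T) (z j) = (\<integral>t. 0 \<partial>dt T)"
    unfolding cyl_normsq(1)[OF z[OF j]]
    by (rule integral_cong_AE) (use zero j in \<open>auto intro: borel_measurable_integrable[OF cyl_normsq(2)[OF z[OF j]]]\<close>)
  then show ?thesis by (intro L2_normsq_zero_AE z j) simp
qed

end

section \<open>Weak solutions\<close>

lemma Heta_iff:
  assumes U: "U \<in> Cinf_torus"
  shows "u \<in> Heta U k \<longleftrightarrow> u \<in> L2 dx \<and> (\<forall>is. length is \<le> k \<longrightarrow> is_Dx U is u (Dx U is u))"
  using is_Dx_Dx unfolding Heta_def L2_eta[OF U] by blast

lemma Htx_iff:
  assumes U: "U \<in> Cinf_torus"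
  shows "u \<in> Htx T U k \<longleftrightarrow> u \<in> L2 (dtx T) \<and>
    (\<forall>i is. i + length is \<le> k \<longrightarrow> wderiv T i is u (Dtx T U i is u))"
  using is_Dtx_Dtx unfolding Htx_def L2_cyl_eta[OF U] is_Dtx_iff[OF U, symmetric] by blast

lemma wderiv_Dtx:
  assumes "U \<in> Cinf_torus" "wderiv T i is u v"
  shows "wderiv T i is u (Dtx T U i is u)"
  using is_Dtx_Dtx[of T U i "is" u v] assms by (simp add: is_Dtx_iff)

lemma Dx_L2: "U \<in> Cinf_torus \<Longrightarrow> is_Dx U is u v \<Longrightarrow> v \<in> L2 dx"
  by (simp add: is_Dx_iff)

lemma sobsum_le_Heta:
  assumes U: "U \<in> Cinf_torus" and g: "g \<in> Heta U s"
  shows "sobsum s N g \<le> (\<Sum>j\<le>s. \<Sum>is | length is = j. L2_normsq dx (Dx U is g))"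
proof -
  have D: "is_Dx U is g (Dx U is g)" if "length is \<le> s" for "is" using g that by (simp add: Heta_iff[OF U])
  show ?thesis
    by (rule incseq_le[OF incseq_sobsum sobsum_tendsto]) (use Dx_L2[OF U D] is_Dx_hat[OF U D] in auto)
qed

text \<open>The norm of a slice uses derivatives selected separately at each time. Monotonicity of
  the integral compares it with the measurable function built from \<open>V\<close>.\<close>

lemma L2_HetaI:
  assumes U: "U \<in> Cinf_torus" and u: "u \<in> L2 (dtx T)" and V: "wderivs_upto T k u V"
  shows "u \<in> L2_Heta T U k"
proof -
  obtain hi where hi: "0 < hi" "\<And>u. u \<in> L2 dx \<Longrightarrow> L2_normsq (eta U) u \<le> hi * L2_normsq dx u"
    using normsq_eta_bounds[OF U] by blast
  have ae: "AE t in dt T. slice u t \<in> L2 dx \<and>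
      (\<forall>is. length is \<le> k \<longrightarrow> is_Dx U is (slice u t) (slice (V is) t))"
    using wderivs_upto_AE[OF u V] cyl_section_L2[OF u] by eventually_elim (auto intro: is_Dx_of_hat[OF U])
  have "AE t in dt T. slice u t \<in> Heta U k"
    using ae by eventually_elim (auto simp: Heta_def L2_eta[OF U])
  moreover have "(\<integral>\<^sup>+t. ennreal (Heta_normsq U k (slice u t)) \<partial>dt T) \<le> (\<integral>\<^sup>+t. ennreal (hi * deriv_norms k V t) \<partial>dt T)"
  proof (rule nn_integral_mono_AE)
    show "AE t in dt T. ennreal (Heta_normsq U k (slice u t)) \<le> ennreal (hi * deriv_norms k V t)"
      using ae
    proof eventually_elim
      case (elim t)
      have "L2_normsq (eta U) (Dx U is (slice u t)) \<le> hi * L2_normsq dx (slice (V is) t)" if "length is \<le> k" for "is"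
      proof -
        have d: "is_Dx U is (slice u t) (slice (V is) t)" using elim that by blast
        note D = is_Dx_Dx[OF d]
        have "L2_normsq dx (Dx U is (slice u t)) = L2_normsq dx (slice (V is) t)"
          by (rule L2_normsq_cong_AE[OF L2_meas[OF Dx_L2[OF U D]] L2_meas[OF Dx_L2[OF U d]] Dx_unique[OF U D d]])
        then show ?thesis using hi(2)[OF Dx_L2[OF U D]] by simp
      qed
      then have "Heta_normsq U k (slice u t) \<le> hi * deriv_norms k V t"
        unfolding Heta_normsq_def deriv_norms_def sum_distrib_left by (intro sum_mono) auto
      then show ?case by (rule ennreal_leI)
    qed
  qed
  moreover have "(\<integral>\<^sup>+t. ennreal (hi * deriv_norms k V t) \<partial>dt T) < \<infinity>"
  proof -
    have "0 \<le> hi * deriv_norms k V t" for t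
      unfolding deriv_norms_def using hi(1) by (auto intro!: mult_nonneg_nonneg sum_nonneg)
    then show ?thesis
      using deriv_norms_integrable(1)[OF V] by (subst nn_integral_eq_integral) auto
  qed
  ultimately show ?thesis using u unfolding L2_Heta_def L2_cyl_eta[OF U] by auto
qed

text \<open>Testing with a basis function in one component yields coefficients of functions
  multiplied by \<open>exp (- U)\<close>. Completeness turns their equality into equality almost
  everywhere, and the nonvanishing weight can be divided out.\<close>

lemma test_equation_hat:
  assumes U: "U \<in> Cinf_torus" and X: "\<And>j. j \<in> {1..n} \<Longrightarrow> (\<lambda>x. X x j) \<in> L2 dx"
    and Y: "\<And>j. j \<in> {1..n} \<Longrightarrow> (\<lambda>x. Y x j) \<in> L2 dx"
    and eq: "\<And>\<phi>. in_comps n \<phi> (Heta U 1) \<Longrightarrow> inner_L2 U n X \<phi> = inner_L2 U n Y \<phi>" and j: "j \<in> {1..n}"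
  shows "hat (\<lambda>x. X x j) \<xi> = hat (\<lambda>x. Y x j) \<xi>"
proof -
  obtain hi where hi: "\<And>x. exp (- U x) \<le> hi" by (rule weight_bounds[OF U]) (rule that)
  have [measurable]: "U \<in> borel_measurable dx" by (rule Cinf_torus_measurable[OF U])
  have W: "(\<lambda>x. exp (- U x) * Z x) \<in> L2 dx" if "Z \<in> L2 dx" for Z
    by (rule L2_bounded_mult(1)[where B = hi, OF _ _ that]) (use hi in auto)
  have inner: "inner_L2 U n Z (\<lambda>x i. if i = j then hartley \<zeta> x else 0) = hat (\<lambda>x. exp (- U x) * Z x j) \<zeta>"
    if Z: "\<And>j. j \<in> {1..n} \<Longrightarrow> (\<lambda>x. Z x j) \<in> L2 dx" for Z \<zeta>
  proof -
    have [measurable]: "(\<lambda>x. Z x j) \<in> borel_measurable dx" by (rule L2_meas[OF Z[OF j]])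
    have [measurable]: "hartley \<zeta> \<in> borel_measurable dx" by (rule Cinf_torus_measurable) simp
    have "inner_L2 U n Z (\<lambda>x i. if i = j then hartley \<zeta> x else 0) = (\<integral>x. Z x j * hartley \<zeta> x \<partial>eta U)"
      unfolding inner_L2_def using j by (simp add: if_distrib[where f = "\<lambda>y. _ * y"] sum.delta del: One_nat_def cong: if_cong)
    also have "\<dots> = hat (\<lambda>x. exp (- U x) * Z x j) \<zeta>"
      unfolding eta_def hat_def by (subst integral_density) (auto simp: mult.assoc)
    finally show ?thesis .
  qed
  have "hat (\<lambda>x. exp (- U x) * X x j - exp (- U x) * Y x j) \<zeta> = 0" for \<zeta>
  proof -
    have "in_comps n (\<lambda>x i. if i = j then hartley \<zeta> x else 0) (Heta U 1)"
      unfolding in_comps_def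
    proof
      fix i
      show "(\<lambda>x. if i = j then hartley \<zeta> x else 0) \<in> Heta U 1"
        by (cases "i = j") (simp_all add: Cinf_torus_Heta[OF U] Cinf_torus_const)
    qed
    note eq = eq[OF this]
    have "hat (\<lambda>x. exp (- U x) * X x j) \<zeta> = inner_L2 U n X (\<lambda>x i. if i = j then hartley \<zeta> x else 0)"
      by (rule inner[symmetric]) (rule X)
    also have "\<dots> = hat (\<lambda>x. exp (- U x) * Y x j) \<zeta>"
      unfolding eq by (rule inner) (rule Y)
    finally show ?thesis using hat_diff[OF W[OF X[OF j]] W[OF Y[OF j]], of \<zeta>] by simp
  qed
  then have "AE x in dx. exp (- U x) * X x j - exp (- U x) * Y x j = 0"
    by (intro hat_zero_imp_AE_zero L2_diff W X Y j)
  then have "AE x in dx. X x j = Y x j" by eventually_elim (simp flip: right_diff_distrib)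
  then show ?thesis by (intro hat_cong_AE L2_meas X Y j)
qed

section \<open>The Hermite moment operator and its weak solutions in Fourier modes\<close>

locale hermite_system = moment_system U T n "matA \<alpha>" "matB \<alpha>" Bd Cm q
  for U :: "real^'d \<Rightarrow> real" and T n and \<alpha> :: "nat \<Rightarrow> 'd \<Rightarrow> nat" and Bd Cm q
begin

text \<open>The derivative part of the adjoint joins the transpose term to form the symmetric
  matrices; its multiplication part goes into \<open>RR\<close>. The signs are arranged as in
  \<open>hat_transport\<close>.\<close>

lemma Hop_eq:
  "Hop U n \<alpha> w x j = (-1) * (\<Sum>i\<in>UNIV. \<Sum>l=1..n. (- Sm i j l) * Dx U [i] (\<lambda>y. w y l) x) + RR (\<lambda>l x. w x l) j x"
proof -
  let ?D = "\<lambda>i l. Dx U [i] (\<lambda>y. w y l) x" and ?u = "\<lambda>i. pd (axis i 1) U x"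
  have "RR (\<lambda>l x. w x l) j x = (\<Sum>l=1..n. matA \<alpha> j l * w x l) - (\<Sum>l=1..n. \<Sum>i\<in>UNIV. matB \<alpha> i j l * ?u i * w x l)"
    unfolding RR_def Rm_def by (simp add: left_diff_distrib sum_subtractf sum_distrib_right)
  also have "(\<Sum>l=1..n. \<Sum>i\<in>UNIV. matB \<alpha> i j l * ?u i * w x l) = (\<Sum>i\<in>UNIV. \<Sum>l=1..n. matB \<alpha> i j l * ?u i * w x l)"
    by (rule sum.swap)
  finally show ?thesis
    unfolding Hop_def mat_vec_def mat_transpose_def grad_comps_def adj_grad_comps_def Sm_def
    by (simp add: algebra_simps sum.distrib sum_subtractf sum_negf)
qed

lemma
  assumes w: "\<And>l. l \<in> {1..n} \<Longrightarrow> w l \<in> L2 dx"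
    and D: "\<And>i l. l \<in> {1..n} \<Longrightarrow> is_Dx U [i] (w l) (Dx U [i] (w l))"
  shows Hop_L2: "(\<lambda>x. Hop U n \<alpha> (\<lambda>y l. w l y) x j) \<in> L2 dx"
    and hat_Hop: "hat (\<lambda>x. Hop U n \<alpha> (\<lambda>y l. w l y) x j) \<xi> = - Sk (\<lambda>\<zeta> l. hat (w l) \<zeta>) \<xi> j + hat (RR w j) \<xi>"
proof -
  let ?S = "\<lambda>x. \<Sum>i\<in>UNIV. \<Sum>l=1..n. (- Sm i j l) * Dx U [i] (w l) x"
  have S: "(\<lambda>x. (-1) * ?S x) \<in> L2 dx" by (intro L2_sum L2_cmult Dx_L2[OF U D])
  have R: "RR w j \<in> L2 dx" by (rule RR_L2[OF w])
  show "(\<lambda>x. Hop U n \<alpha> (\<lambda>y l. w l y) x j) \<in> L2 dx" unfolding Hop_eq by (rule L2_add[OF S R])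
  have "hat ?S \<xi> = Sk (\<lambda>\<zeta> l. hat (w l) \<zeta>) \<xi> j"
    by (rule hat_transport) (use Dx_L2[OF U D] is_Dx_hat[OF U D] in auto)
  then show "hat (\<lambda>x. Hop U n \<alpha> (\<lambda>y l. w l y) x j) \<xi> = - Sk (\<lambda>\<zeta> l. hat (w l) \<zeta>) \<xi> j + hat (RR w j) \<xi>"
    unfolding Hop_eq hat_add[OF S R] hat_cmult by simp
qed

lemma weak_solution_L2:
  "weak_solution T U n \<alpha> F G (\<lambda>z j. c j z) \<Longrightarrow> j \<in> {1..n} \<Longrightarrow> c j \<in> L2 (dtx T)"
  by (auto simp: weak_solution_def in_comps_def L2_Heta_def L2_cyl_eta[OF U])

text \<open>Relies only on the regularity in the definition of a weak solution, so it covers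
  arbitrary competitors in the uniqueness proof.\<close>

lemma weak_solution_modes:
  assumes c: "weak_solution T U n \<alpha> (\<lambda>z j. F j z) (\<lambda>x j. G j x) (\<lambda>z j. c j z)"
    and F: "\<And>j. j \<in> {1..n} \<Longrightarrow> F j \<in> L2 (dtx T)" and G: "\<And>j. j \<in> {1..n} \<Longrightarrow> G j \<in> L2 dx" and j: "j \<in> {1..n}"
  shows "AE t in dt T. hat (slice (c j) t) \<xi> = hat (G j) \<xi> +
      prim T (rhs F c \<xi> j) t"
proof -
  note L = weak_solution_L2[OF c]
  have c1: "\<And>j. j \<in> {1..n} \<Longrightarrow> c j \<in> L2_Heta T U 1" and c2: "\<And>j. j \<in> {1..n} \<Longrightarrow> \<exists>v. is_Dtx T U 1 [] (c j) v"
    and c3: "\<And>j. j \<in> {1..n} \<Longrightarrow> has_initial_value T U (c j) (G j)"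
    and c4: "AE t in dt T. \<forall>\<phi>. in_comps n \<phi> (Heta U 1) \<longrightarrow>
        inner_L2 U n (\<lambda>x j. Dtx T U 1 [] (c j) (t, x) + Hop U n \<alpha> (\<lambda>y l. c l (t, y)) x j) \<phi>
        = inner_L2 U n (\<lambda>x j. F j (t, x)) \<phi>"
    using c unfolding weak_solution_def in_comps_def by auto
  let ?v = "\<lambda>j. Dtx T U 1 [] (c j)"
  have v: "wderiv T (Suc 0) [] (c j) (?v j)" if "j \<in> {1..n}" for j
    using c2[OF that] wderiv_Dtx[OF U] by (auto simp: is_Dtx_iff[OF U])
  have "AE t in dt T. \<forall>j\<in>{1..n}. slice (c j) t \<in> Heta U 1 \<and> slice (?v j) t \<in> L2 dx \<and> slice (F j) t \<in> L2 dx"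
  proof (intro AE_finite_allI finite_atLeastAtMost)
    fix j assume j: "j \<in> {1..n}"
    have "AE t in dt T. slice (c j) t \<in> Heta U 1" using c1[OF j] by (simp add: L2_Heta_def)
    with cyl_section_L2[OF wderiv_L2[OF v[OF j]]] cyl_section_L2[OF F[OF j]]
    show "AE t in dt T. slice (c j) t \<in> Heta U 1 \<and> slice (?v j) t \<in> L2 dx \<and> slice (F j) t \<in> L2 dx"
      by eventually_elim simp
  qed
  with c4 have eq: "AE t in dt T. hat (slice (?v j) t) \<xi> =
      rhs F c \<xi> j t"
  proof eventually_elim
    case (elim t)
    let ?w = "\<lambda>l. slice (c l) t"
    have w: "?w l \<in> L2 dx" "is_Dx U [i] (?w l) (Dx U [i] (?w l))" if "l \<in> {1..n}" for l i
      using elim(2) that by (auto simp: Heta_iff[OF U])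
    have V: "slice (?v j) t \<in> L2 dx" and Ft: "slice (F j) t \<in> L2 dx" if "j \<in> {1..n}" for j
      using elim(2) that by auto
    note H = Hop_L2[of ?w, OF w]
    have "hat (\<lambda>x. ?v j (t, x) + Hop U n \<alpha> (\<lambda>y l. ?w l y) x j) \<xi> = hat (slice (F j) t) \<xi>"
      by (rule test_equation_hat[where n = n and X = "\<lambda>x j. ?v j (t, x) + Hop U n \<alpha> (\<lambda>y l. ?w l y) x j" and Y = "\<lambda>x j. F j (t, x)", OF U])
         (assumption | intro L2_add V H Ft elim(1)[rule_format] j)+
    moreover have "hat (\<lambda>x. ?v j (t, x) + Hop U n \<alpha> (\<lambda>y l. ?w l y) x j) \<xi> =
        hat (slice (?v j) t) \<xi> + hat (\<lambda>x. Hop U n \<alpha> (\<lambda>y l. ?w l y) x j) \<xi>"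
      by (rule hat_add[OF V[OF j] H])
    ultimately show ?case using hat_Hop[of ?w j \<xi>, OF w] by simp
  qed
  have "prim T (\<lambda>s. hat (slice (?v j) s) \<xi>) t =
      prim T (rhs F c \<xi> j) t" for t
    by (rule prim_cong_AE[OF _ _ eq]; intro borel_measurable_integrable Bochner_Integration.integrable_add Sk_integrable
        rhs_integrable L F j cyl_hat_integrable wderiv_L2[OF v])
  then show "AE t in dt T. hat (slice (c j) t) \<xi> = hat (G j) \<xi> +
      prim T (rhs F c \<xi> j) t"
    using initial_mode[OF U T L[OF j] v[OF j] c3[OF j] G[OF j], of \<xi>] by simp
qed

text \<open>Subtracting the mode equations removes forcing and initial value; what is left is the
  homogeneous equation of \<open>modes_unique\<close>.\<close>

lemma weak_solution_unique:
  assumes c: "weak_solution T U n \<alpha> (\<lambda>z j. F j z) (\<lambda>x j. G j x) (\<lambda>z j. c j z)"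
    and c': "weak_solution T U n \<alpha> (\<lambda>z j. F j z) (\<lambda>x j. G j x) (\<lambda>z j. c' j z)"
    and F: "\<And>j. j \<in> {1..n} \<Longrightarrow> F j \<in> L2 (dtx T)" and G: "\<And>j. j \<in> {1..n} \<Longrightarrow> G j \<in> L2 dx" and j: "j \<in> {1..n}"
  shows "AE y in dtx T. c' j y = c j y"
proof -
  note L = weak_solution_L2[OF c] and L' = weak_solution_L2[OF c']
  have "AE y in dtx T. c' j y - c j y = 0"
  proof (rule modes_unique[OF _ _ j])
    show "(\<lambda>z. c' j z - c j z) \<in> L2 (dtx T)" if "j \<in> {1..n}" for j by (intro L2_diff L L' that)
    fix j \<xi> assume j: "j \<in> {1..n}"
    let ?r = "\<lambda>c s. rhs F c \<xi> j s"
    let ?d = "\<lambda>s. Sk (\<lambda>\<zeta> l. hat (\<lambda>x. c' l (s, x) - c l (s, x)) \<zeta>) \<xi> j + (0 - hat (RR (\<lambda>l x. c' l (s, x) - c l (s, x)) j) \<xi>)"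
    have i: "integrable (dt T) (?r c)" "integrable (dt T) (?r c')"
      by (intro Bochner_Integration.integrable_add Sk_integrable rhs_integrable L L' F j; assumption)+
    have sec: "AE s in dt T. \<forall>l\<in>{1..n}. slice (c l) s \<in> L2 dx \<and> slice (c' l) s \<in> L2 dx"
    proof (intro AE_finite_allI finite_atLeastAtMost)
      fix l assume l: "l \<in> {1..n}"
      show "AE s in dt T. slice (c l) s \<in> L2 dx \<and> slice (c' l) s \<in> L2 dx"
        using cyl_section_L2[OF L[OF l]] cyl_section_L2[OF L'[OF l]] by eventually_elim simp
    qed
    then have eq: "AE s in dt T. ?r c' s - ?r c s = ?d s"
    proof eventually_elim
      case (elim s)
      have "Sk (\<lambda>\<zeta> l. hat (\<lambda>x. c' l (s, x) - c l (s, x)) \<zeta>) \<xi> j =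
          Sk (\<lambda>\<zeta> l. hat (slice (c' l) s) \<zeta> - hat (slice (c l) s) \<zeta>) \<xi> j"
        unfolding Sk_def by (intro sum.cong refl) (use elim in \<open>simp add: hat_diff\<close>)
      moreover have "hat (RR (\<lambda>l x. c' l (s, x) - c l (s, x)) j) \<xi> = hat (RR (\<lambda>l. slice (c' l) s) j) \<xi> - hat (RR (\<lambda>l. slice (c l) s) j) \<xi>"
        by (rule hat_RR_diff) (use elim in auto)
      ultimately show ?case by (simp add: Sk_diff)
    qed
    have z: "(\<lambda>z. c' j z - c j z) \<in> L2 (dtx T)" if "j \<in> {1..n}" for j by (intro L2_diff L L' that)
    have di: "integrable (dt T) ?d"
      using rhs_integrable[of "\<lambda>z. 0" "\<lambda>j z. c' j z - c j z" \<xi> j, OF _ z]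
        Sk_integrable[of "\<lambda>j z. c' j z - c j z" \<xi> j, OF z] by (simp add: hat_zero L2_zero)
    have p: "prim T ?d t = prim T (?r c') t - prim T (?r c) t" for t
      using prim_cong_AE[OF borel_measurable_integrable[OF Bochner_Integration.integrable_diff[OF i(2,1)]] borel_measurable_integrable[OF di] eq, of t]
        prim_diff[OF i(2,1), of t] by simp
    have m: "AE t in dt T. hat (slice (c j) t) \<xi> = hat (G j) \<xi> + prim T (?r c) t"
      by (rule weak_solution_modes[OF c F G j])
    have m': "AE t in dt T. hat (slice (c' j) t) \<xi> = hat (G j) \<xi> + prim T (?r c') t"
      by (rule weak_solution_modes[OF c' F G j])
    show "AE t in dt T. hat (\<lambda>x. c' j (t, x) - c j (t, x)) \<xi> = prim T ?d t"
      using m m' sec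
    proof eventually_elim
      case (elim t)
      have "hat (\<lambda>x. c' j (t, x) - c j (t, x)) \<xi> = hat (slice (c' j) t) \<xi> - hat (slice (c j) t) \<xi>"
        using elim(3) j by (intro hat_diff) auto
      then show ?case unfolding p elim(1,2) by simp
    qed
  qed
  then show ?thesis by eventually_elim simp
qed

end

section \<open>Existence and the regularity estimate\<close>

locale hermite_data = hermite_system U T n \<alpha> Bd Cm q +
  regular_data U T n "matA \<alpha>" "matB \<alpha>" Bd Cm q F DF G c KG KF
  for U :: "real^'d \<Rightarrow> real" and T n and \<alpha> :: "nat \<Rightarrow> 'd \<Rightarrow> nat" and Bd Cm q F DF G c KG KF +
  assumes G: "\<And>j. j \<in> {1..n} \<Longrightarrow> G j \<in> L2 dx"
    and c_sec: "\<And>j t. j \<in> {1..n} \<Longrightarrow> t \<in> {0..T} \<Longrightarrow> slice (c j) t \<in> L2 dx"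
    and c_cont: "\<And>j s. j \<in> {1..n} \<Longrightarrow> s \<in> {0..T} \<Longrightarrow>
      ((\<lambda>t. L2_normsq dx (\<lambda>x. c j (t, x) - c j (s, x))) \<longlongrightarrow> 0) (at s within {0..T})"
begin

text \<open>The constructed solution has slices at every time and is itself the continuous
  representative.\<close>

lemma c_initial:
  assumes j: "j \<in> {1..n}"
  shows "has_initial_value T U (c j) (G j)"
  unfolding has_initial_value_def AE_eta[OF U] L2_eta[OF U]
proof (intro exI[of _ "\<lambda>t x. c j (t, x)"] conjI ballI)
  obtain hi where hi: "\<And>u. u \<in> L2 dx \<Longrightarrow> L2_normsq (eta U) u \<le> hi * L2_normsq dx u"
    using normsq_eta_bounds[OF U] by blast
  fix s assume s: "s \<in> {0..T}"
  show "((\<lambda>t. L2_normsq (eta U) (\<lambda>x. c j (t, x) - c j (s, x))) \<longlongrightarrow> 0) (at s within {0..T})"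
  proof (rule Lim_null_comparison)
    show "\<forall>\<^sub>F t in at s within {0..T}. norm (L2_normsq (eta U) (\<lambda>x. c j (t, x) - c j (s, x))) \<le>
        hi * L2_normsq dx (\<lambda>x. c j (t, x) - c j (s, x))"
      unfolding eventually_at_filter
    proof (intro always_eventually allI impI)
      fix t assume t: "t \<in> {0..T}"
      show "norm (L2_normsq (eta U) (\<lambda>x. c j (t, x) - c j (s, x))) \<le> hi * L2_normsq dx (\<lambda>x. c j (t, x) - c j (s, x))"
        using hi[OF L2_diff[OF c_sec[OF j t] c_sec[OF j s]]] by simp
    qed
    show "((\<lambda>t. hi * L2_normsq dx (\<lambda>x. c j (t, x) - c j (s, x))) \<longlongrightarrow> 0) (at s within {0..T})"
      using tendsto_mult_left[OF c_cont[OF j s], of hi] by simp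
  qed
next
  have T0: "0 \<in> {0..T}" using T by simp
  note c0 = c_sec[OF j T0]
  have "AE x in dx. c j (0, x) - G j x = 0"
    by (intro hat_zero_imp_AE_zero L2_diff c0 G j) (simp add: hat_diff[OF c0 G[OF j]] c_mode[OF j T0] prim_0)
  then show "AE x in dx. c j (0, x) = G j x" by eventually_elim simp
qed (auto intro: c_sec j)

text \<open>The equation is shown to hold almost everywhere in x for almost every t, since the weak
  time derivative agrees with \<open>nxt\<close>; testing is then immediate.\<close>

lemma c_weak_solution: "weak_solution T U n \<alpha> (\<lambda>z j. F j z) (\<lambda>x j. G j x) (\<lambda>z j. c j z)"
  unfolding weak_solution_def in_comps_def
proof (intro conjI ballI)
  fix j assume j: "j \<in> {1..n}"
  obtain V where V: "\<And>j is. j \<in> {1..n} \<Longrightarrow> 0 + length is \<le> q \<Longrightarrow> wderiv T 0 is (c j) (V j is)"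
    by (rule regularity_order[of 0]) auto
  have "wderivs_upto T 1 (c j) (V j)" unfolding wderivs_upto_def using V[OF j] q1 by auto
  then show "c j \<in> L2_Heta T U 1" by (rule L2_HetaI[OF U c[OF j]])
  show "\<exists>v. is_Dtx T U 1 [] (c j) v" using Cs_time_0[OF j] by (auto simp: is_Dtx_iff[OF U])
  show "has_initial_value T U (c j) (G j)" by (rule c_initial[OF j])
next
  let ?v = "\<lambda>j. Dtx T U 1 [] (c j)"
  have v: "wderiv T (Suc 0) [] (c j) (?v j)" if "j \<in> {1..n}" for j
    using wderiv_Dtx[OF U Cs_time_0[OF that]] by simp
  have d: "\<And>l j. j \<in> {1..n} \<Longrightarrow> wderiv T 0 [l] (c j) (dV T l (c j))" using Cs_dV[of 0] q1 by simp
  have f: "\<And>j. j \<in> {1..n} \<Longrightarrow> Fs 0 j \<in> L2 (dtx T)" by (intro Fs_L2) auto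
  have "AE t in dt T. nxt_sec (Fs 0) c t" by (rule nxt_sections[OF f c d])
  moreover have "AE t in dt T. \<forall>j\<in>{1..n}. slice (?v j) t \<in> L2 dx \<and> slice (F j) t \<in> L2 dx \<and>
    (AE x in dx. ?v j (t, x) = nxt (Fs 0) c j (t, x) \<and> Fs 0 j (t, x) = F j (t, x))"
  proof (intro AE_finite_allI finite_atLeastAtMost)
    fix j assume j: "j \<in> {1..n}"
    have "AE z in dtx T. ?v j z = nxt (Fs 0) c j z"
      using wderiv_unique[OF v[OF j] Cs_time_0[OF j]] by simp
    moreover have "AE z in dtx T. Fs 0 j z = F j z"
      using wderiv_unique[OF DF[OF j, of 0 "[]"] wderiv_refl[OF F[OF j]]] by (simp add: Fs_def)
    ultimately have "AE z in dtx T. ?v j z = nxt (Fs 0) c j z \<and> Fs 0 j z = F j z" by eventually_elim simp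
    from AE_cyl_iterated[OF this] cyl_section_L2[OF wderiv_L2[OF v[OF j]]] cyl_section_L2[OF F[OF j]]
    show "AE t in dt T. slice (?v j) t \<in> L2 dx \<and> slice (F j) t \<in> L2 dx \<and>
      (AE x in dx. ?v j (t, x) = nxt (Fs 0) c j (t, x) \<and> Fs 0 j (t, x) = F j (t, x))"
      by eventually_elim simp
  qed
  ultimately show "AE t in dt T. \<forall>\<phi>. (\<forall>j\<in>{1..n}. (\<lambda>z. \<phi> z j) \<in> Heta U 1) \<longrightarrow>
      inner_L2 U n (\<lambda>x j. ?v j (t, x) + Hop U n \<alpha> (\<lambda>y j. c j (t, y)) x j) \<phi> = inner_L2 U n (\<lambda>x j. F j (t, x)) \<phi>"
  proof eventually_elim
    case (elim t)
    note s = elim(1)[unfolded nxt_sec_def] and e = elim(2)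
    let ?w = "\<lambda>l. slice (c l) t"
    have w: "?w l \<in> L2 dx" if "l \<in> {1..n}" for l using s that by blast
    have dx: "is_Dx U [i] (?w l) (slice (dV T i (c l)) t)" if "l \<in> {1..n}" for i l
      using s that by (intro is_Dx_of_hat[OF U]) auto
    note D = is_Dx_Dx[OF dx]
    note H = Hop_L2[of ?w, OF w D]
    \<comment> \<open>The derivative selected on the slice and the slice of the derivative selected
      on the cylinder coincide almost everywhere.\<close>
    have "AE x in dx. \<forall>l\<in>{1..n}. \<forall>i\<in>UNIV. Dx U [i] (?w l) x = dV T i (c l) (t, x)"
      by (intro AE_finite_allI finite_atLeastAtMost finite Dx_unique[OF U D dx])
    moreover have "AE x in dx. \<forall>j\<in>{1..n}. ?v j (t, x) = nxt (Fs 0) c j (t, x) \<and> Fs 0 j (t, x) = F j (t, x)"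
      by (intro AE_finite_allI finite_atLeastAtMost) (use e in blast)
    ultimately have eq: "AE x in dx. \<forall>j\<in>{1..n}. ?v j (t, x) + Hop U n \<alpha> (\<lambda>y j. c j (t, y)) x j = F j (t, x)"
    proof eventually_elim
      case (elim x)
      show ?case
      proof
        fix j assume j: "j \<in> {1..n}"
        have "Hop U n \<alpha> (\<lambda>y j. c j (t, y)) x j =
            (-1) * (\<Sum>i\<in>UNIV. \<Sum>l=1..n. (- Sm i j l) * dV T i (c l) (t, x)) + RR ?w j x"
          unfolding Hop_eq using elim(1) by (intro arg_cong2[where f = "(+)"] arg_cong2[where f = "(*)"] refl sum.cong) auto
        moreover have "nxt (Fs 0) c j (t, x) = F j (t, x) + ((\<Sum>i\<in>UNIV. \<Sum>l=1..n. (- Sm i j l) * dV T i (c l) (t, x)) - RR ?w j x)"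
          using elim(2) j by (simp add: nxt_def RR_def sum_negf)
        ultimately show "?v j (t, x) + Hop U n \<alpha> (\<lambda>y j. c j (t, y)) x j = F j (t, x)" using elim(2) j by simp
      qed
    qed
    show ?case
    proof (intro allI impI)
      fix \<phi> assume "\<forall>j\<in>{1..n}. (\<lambda>z. \<phi> z j) \<in> Heta U 1"
      then have \<phi>: "(\<lambda>x. \<phi> x j) \<in> L2 dx" if "j \<in> {1..n}" for j using that by (auto simp: Heta_iff[OF U])
      have m: "(\<lambda>x. \<Sum>j=1..n. Z j x * \<phi> x j) \<in> borel_measurable (eta U)" if "\<And>j. j \<in> {1..n} \<Longrightarrow> Z j \<in> L2 dx" for Z
        using that \<phi> unfolding L2_eta[OF U, symmetric] by (intro borel_measurable_sum borel_measurable_times L2_meas)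
      show "inner_L2 U n (\<lambda>x j. ?v j (t, x) + Hop U n \<alpha> (\<lambda>y j. c j (t, y)) x j) \<phi> = inner_L2 U n (\<lambda>x j. F j (t, x)) \<phi>"
        unfolding inner_L2_def
      proof (rule integral_cong_AE)
        show "(\<lambda>x. \<Sum>j=1..n. (?v j (t, x) + Hop U n \<alpha> (\<lambda>y j. c j (t, y)) x j) * \<phi> x j) \<in> borel_measurable (eta U)"
          by (rule m, rule L2_add[OF _ H]) (use e in auto)
        show "(\<lambda>x. \<Sum>j=1..n. F j (t, x) * \<phi> x j) \<in> borel_measurable (eta U)" by (rule m) (use e in auto)
        show "AE x in eta U. (\<Sum>j=1..n. (?v j (t, x) + Hop U n \<alpha> (\<lambda>y j. c j (t, y)) x j) * \<phi> x j) = (\<Sum>j=1..n. F j (t, x) * \<phi> x j)"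
          unfolding AE_eta[OF U] using eq by eventually_elim (intro sum.cong refl, simp)
      qed
    qed
  qed
qed

lemma c_Htx: "j \<in> {1..n} \<Longrightarrow> c j \<in> Htx T U q"
  using c_wderivs[of j] c[of j] wderiv_Dtx[OF U] unfolding Htx_iff[OF U] by blast

end

lemma Htx_normsq_bounds:
  assumes u: "u \<in> Htx T U q" and U: "U \<in> Cinf_torus"
    and b: "\<And>v. v \<in> L2 (dtx T) \<Longrightarrow> lo * L2_normsq (dtx T) v \<le> L2_normsq (cyl_eta T U) v \<and>
      L2_normsq (cyl_eta T U) v \<le> hi * L2_normsq (dtx T) v"
  shows "lo * dnorms T q (\<lambda>i is. Dtx T U i is u) \<le> Htx_normsq T U q u"
    and "Htx_normsq T U q u \<le> hi * dnorms T q (\<lambda>i is. Dtx T U i is u)"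
proof -
  have "Dtx T U i is u \<in> L2 (dtx T)" if "i + length is \<le> q" for i "is"
    using u that wderiv_L2 unfolding Htx_iff[OF U] by blast
  note b = b[OF this]
  show "lo * dnorms T q (\<lambda>i is. Dtx T U i is u) \<le> Htx_normsq T U q u"
    "Htx_normsq T U q u \<le> hi * dnorms T q (\<lambda>i is. Dtx T U i is u)"
    unfolding Htx_normsq_def sum_pairs_le sum_distrib_left by (intro sum_mono; use b in auto)+
qed

text \<open>The bound depends on m only, so it holds for every admissible enumeration. A square root
  of a number at least 1 is at most that number, which gives m + 1 for the entries of B.\<close>

lemma moment_bounds:
  fixes \<alpha> :: "nat \<Rightarrow> 'd::finite \<Rightarrow> nat"
  assumes \<alpha>: "mi_enum m \<alpha>" and n: "n = num_mi TYPE('d) m" and j: "j \<in> {1..n}"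
  shows "\<bar>matA \<alpha> j l\<bar> \<le> real m + 1" and "\<bar>matB \<alpha> i j l\<bar> \<le> real m + 1"
proof -
  have "\<alpha> j \<in> {\<beta>. mi_size \<beta> \<le> m}"
    using \<alpha> j unfolding mi_enum_def n by (auto dest: bij_betwE)
  then have s: "mi_size (\<alpha> j) \<le> m" by simp
  then show "\<bar>matA \<alpha> j l\<bar> \<le> real m + 1" by (auto simp: matA_def)
  have "\<alpha> j i \<le> mi_size (\<alpha> j)" unfolding mi_size_def by (rule member_le_sum) auto
  then have a: "real (\<alpha> j i + 1) \<le> real m + 1" using s by simp
  have "sqrt (real (\<alpha> j i + 1)) \<le> sqrt ((real (\<alpha> j i + 1))\<^sup>2)"
    by (rule real_sqrt_le_mono) (simp add: power2_eq_square)
  then show "\<bar>matB \<alpha> i j l\<bar> \<le> real m + 1" using a by (simp add: matB_def)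
qed

text \<open>The multiplier constants for the finitely many orders and directions are nonnegative, so
  their sum serves for all of them.\<close>

lemma pderiv_mult_bound:
  fixes U :: "real^'d \<Rightarrow> real"
  assumes U: "U \<in> Cinf_torus"
  obtains C where "0 \<le> C" "\<And>i s u K N. s \<le> q \<Longrightarrow> u \<in> L2 dx \<Longrightarrow> (\<And>M. sobsum s M u \<le> K) \<Longrightarrow>
    sobsum s N (\<lambda>x. pd (axis i 1) U x * u x) \<le> C * K"
proof -
  let ?Q = "\<lambda>s i C. 0 \<le> C \<and> (\<forall>u\<in>L2 dx. \<forall>K. (\<forall>M. sobsum s M u \<le> K) \<longrightarrow>
      (\<forall>N. sobsum s N (\<lambda>x. pd (axis i 1) U x * u x) \<le> C * K))"
  have ex: "\<exists>C. ?Q s i C" for s i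
  proof (rule sobsum_mult[OF Cinf_torus_pderiv[OF U, of i], of s])
    fix C assume C: "0 \<le> C" "\<And>u K N. u \<in> L2 dx \<Longrightarrow> (\<And>M. sobsum s M u \<le> K) \<Longrightarrow>
      sobsum s N (\<lambda>x. pd (axis i 1) U x * u x) \<le> C * K"
    show ?thesis by (intro exI[of _ C] conjI ballI allI impI C) auto
  qed
  define C where "C s i = (SOME C. ?Q s i C)" for s i
  have Q: "?Q s i (C s i)" for s i unfolding C_def by (rule someI_ex[OF ex])
  have C: "\<And>s i. 0 \<le> C s i" "\<And>s i u K N. u \<in> L2 dx \<Longrightarrow> (\<And>M. sobsum s M u \<le> K) \<Longrightarrow>
      sobsum s N (\<lambda>x. pd (axis i 1) U x * u x) \<le> C s i * K"
    using Q by auto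
  show ?thesis
  proof
    show "0 \<le> (\<Sum>s\<le>q. \<Sum>i\<in>UNIV. C s i)" by (intro sum_nonneg C)
    fix i s K N and u :: "real^'d \<Rightarrow> real" assume s: "s \<le> q" and u: "u \<in> L2 dx" and K: "\<And>M. sobsum s M u \<le> K"
    have "0 \<le> K" using sobsum_nonneg[of s 0 u] K[of 0] by linarith
    moreover have "C s i \<le> (\<Sum>i\<in>UNIV. C s i)" by (rule member_le_sum) (auto intro: C)
    moreover have "\<dots> \<le> (\<Sum>s\<le>q. \<Sum>i\<in>UNIV. C s i)"
      using s by (intro member_le_sum[where f = "\<lambda>s. \<Sum>i\<in>UNIV. C s i"]) (auto intro!: sum_nonneg C)
    ultimately show "sobsum s N (\<lambda>x. pd (axis i 1) U x * u x) \<le> (\<Sum>s\<le>q. \<Sum>i\<in>UNIV. C s i) * K"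
      by (intro order_trans[OF C(2)[OF u K] mult_right_mono]) auto
  qed
qed

text \<open>Dividing by \<open>lo\<close> passes from the weighted norms of the data to unweighted
  ones, and \<open>hi\<close> returns to the weighted norm of the solution.\<close>

lemma (in hermite_system) well_posedness:
  assumes q: "1 \<le> q" and G: "\<And>j. j \<in> {1..n} \<Longrightarrow> G j \<in> Heta U q" and F: "\<And>j. j \<in> {1..n} \<Longrightarrow> F j \<in> Htx T U q"
    and lo: "0 < lo" and hi: "0 < hi"
    and b: "\<And>u. u \<in> L2 dx \<Longrightarrow> lo * L2_normsq dx u \<le> L2_normsq (eta U) u"
    and b': "\<And>v. v \<in> L2 (dtx T) \<Longrightarrow> lo * L2_normsq (dtx T) v \<le> L2_normsq (cyl_eta T U) v \<and>
      L2_normsq (cyl_eta T U) v \<le> hi * L2_normsq (dtx T) v"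
  obtains c where "weak_solution T U n \<alpha> (\<lambda>z j. F j z) (\<lambda>x j. G j x) (\<lambda>z j. c j z)"
    "\<And>j. j \<in> {1..n} \<Longrightarrow> c j \<in> Htx T U q"
    "(\<Sum>j=1..n. Htx_normsq T U q (c j)) \<le> hi * (\<Sum>i\<le>q. Pc i) / lo *
      ((\<Sum>j=1..n. Heta_normsq U q (G j)) + (\<Sum>j=1..n. Htx_normsq T U q (F j)))"
proof -
  define KG where "KG = (\<Sum>j=1..n. Heta_normsq U q (G j)) / lo"
  define KF where "KF = (\<Sum>j=1..n. Htx_normsq T U q (F j)) / lo"
  have G_L2: "\<And>j. j \<in> {1..n} \<Longrightarrow> G j \<in> L2 dx" using G by (simp add: Heta_iff[OF U])
  have F_L2: "\<And>j. j \<in> {1..n} \<Longrightarrow> F j \<in> L2 (dtx T)" using F by (simp add: Htx_iff[OF U])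
  have DF: "\<And>j i is. j \<in> {1..n} \<Longrightarrow> i + length is \<le> q \<Longrightarrow> wderiv T i is (F j) (Dtx T U i is (F j))"
    using F by (simp add: Htx_iff[OF U])
  have KG: "(\<Sum>j=1..n. sobsum q N (G j)) \<le> KG" for N
  proof -
    have "lo * sobsum q N (G j) \<le> Heta_normsq U q (G j)" if j: "j \<in> {1..n}" for j
    proof -
      have "lo * sobsum q N (G j) \<le> lo * (\<Sum>k\<le>q. \<Sum>is | length is = k. L2_normsq dx (Dx U is (G j)))"
        using lo by (intro mult_left_mono sobsum_le_Heta U G j) simp
      also have "\<dots> \<le> Heta_normsq U q (G j)"
        unfolding Heta_normsq_def sum_distrib_left using G[OF j] unfolding Heta_iff[OF U]
        by (intro sum_mono b Dx_L2[OF U]) auto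
      finally show ?thesis .
    qed
    then have "lo * (\<Sum>j=1..n. sobsum q N (G j)) \<le> (\<Sum>j=1..n. Heta_normsq U q (G j))"
      unfolding sum_distrib_left by (rule sum_mono)
    then show ?thesis using lo by (simp add: KG_def pos_le_divide_eq mult.commute)
  qed
  have KF: "(\<Sum>j=1..n. dnorms T q (\<lambda>i is. Dtx T U i is (F j))) \<le> KF" (is "?S \<le> KF")
  proof -
    have "lo * ?S \<le> (\<Sum>j=1..n. Htx_normsq T U q (F j))"
      unfolding sum_distrib_left[of _ _ "{1..n}"] by (intro sum_mono Htx_normsq_bounds(1)[OF F U b'])
    then show ?thesis using lo by (simp add: KF_def pos_le_divide_eq mult.commute)
  qed
  have KF': "(\<integral>t. (sobsums n q N F t) \<partial>dt T) \<le> KF" for N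
    by (rule order_trans[OF sobsum_integral_sum_le[where i = 0 and q = q and DF = "\<lambda>j i is. Dtx T U i is (F j)", OF F_L2] KF])
       (auto simp: wderivs_upto_def intro: DF)
  have KG0: "0 \<le> KG" using KG[of 0] by (rule order_trans[OF sum_nonneg, rotated]) simp
  obtain c where c: "\<And>j. j \<in> {1..n} \<Longrightarrow> c j \<in> L2 (dtx T)"
    and sec: "\<And>j t. j \<in> {1..n} \<Longrightarrow> t \<in> {0..T} \<Longrightarrow> slice (c j) t \<in> L2 dx"
    and mode: "\<And>j \<xi> t. j \<in> {1..n} \<Longrightarrow> t \<in> {0..T} \<Longrightarrow> hat (slice (c j) t) \<xi> = hat (G j) \<xi> +
      prim T (rhs F c \<xi> j) t"
    and bound: "\<And>N t. t \<in> {0..T} \<Longrightarrow> (sobsums n q N c t) \<le> (KG + KF) * exp ((2 + CR) * T)"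
    and cont: "\<And>j s. j \<in> {1..n} \<Longrightarrow> s \<in> {0..T} \<Longrightarrow>
      ((\<lambda>t. L2_normsq dx (\<lambda>x. c j (t, x) - c j (s, x))) \<longlongrightarrow> 0) (at s within {0..T})"
    using solution_exists[OF q F_L2 KG KF'] by blast
  interpret hermite_data U T n \<alpha> Bd Cm q F "\<lambda>j i is. Dtx T U i is (F j)" G c KG KF
    by unfold_locales (fact q KG0 F_L2 DF KF c mode bound G_L2 sec cont)+
  have "(\<Sum>j=1..n. Htx_normsq T U q (c j)) \<le>
      hi * (\<Sum>j=1..n. dnorms T q (\<lambda>i is. Dtx T U i is (c j)))"
    unfolding sum_distrib_left[of _ _ "{1..n}"] by (intro sum_mono Htx_normsq_bounds(2)[OF c_Htx U b'])
  also have "\<dots> \<le> hi * ((\<Sum>i\<le>q. Pc i) * (KG + KF))"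
    using hi c_Htx unfolding Htx_iff[OF U] by (intro mult_left_mono regularity) auto
  also have "\<dots> = hi * (\<Sum>i\<le>q. Pc i) / lo *
      ((\<Sum>j=1..n. Heta_normsq U q (G j)) + (\<Sum>j=1..n. Htx_normsq T U q (F j)))"
    unfolding KG_def KF_def add_divide_distrib[symmetric] by simp
  finally show ?thesis using that[OF c_weak_solution c_Htx] by blast
qed

theorem proposition3p7:
  fixes U :: "real^'d::finite \<Rightarrow> real" and k m n :: nat and T :: real
  assumes "m \<ge> 1" and "T > 0" and "U \<in> Cinf_torus"
    and "n = num_mi TYPE('d) m"
  shows "\<exists>C>0. \<forall>(\<alpha> :: nat \<Rightarrow> 'd \<Rightarrow> nat)
      (f :: real \<Rightarrow> real^'d \<Rightarrow> real^'d \<Rightarrow> real) (g :: real^'d \<Rightarrow> real^'d \<Rightarrow> real).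
    mi_enum m \<alpha> \<longrightarrow>
    in_comps n (gm \<alpha> g) (Heta U (k + 1)) \<longrightarrow>
    in_comps n (fm \<alpha> f) (Htx T U (k + 1)) \<longrightarrow>
    (\<exists>c. weak_solution T U n \<alpha> (fm \<alpha> f) (gm \<alpha> g) c \<and>
         (\<forall>c'. weak_solution T U n \<alpha> (fm \<alpha> f) (gm \<alpha> g) c' \<longrightarrow>
            (\<forall>j\<in>{1..n}. AE z in cyl_eta T U. c' z j = c z j)) \<and>
         in_comps n c (Htx T U (k + 1)) \<and>
         normsq_comps n (Htx_normsq T U (k + 1)) c
           \<le> C * (normsq_comps n (Heta_normsq U (k + 1)) (gm \<alpha> g)
                + normsq_comps n (Htx_normsq T U (k + 1)) (fm \<alpha> f)))"
proof -
  note U = assms(3) and n = assms(4)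
  obtain Cm where Cm: "0 \<le> Cm" "\<And>i s u K N. s \<le> k + 1 \<Longrightarrow> u \<in> L2 dx \<Longrightarrow> (\<And>M. sobsum s M u \<le> K) \<Longrightarrow>
      sobsum s N (\<lambda>x. pd (axis i 1) U x * u x) \<le> Cm * K"
  proof (rule pderiv_mult_bound[OF U, of "k + 1"])
    fix C assume C: "0 \<le> C" "\<And>i s u K N. s \<le> k + 1 \<Longrightarrow> u \<in> L2 dx \<Longrightarrow> (\<And>M. sobsum s M u \<le> K) \<Longrightarrow>
      sobsum s N (\<lambda>x. pd (axis i 1) U x * u x) \<le> C * K"
    show ?thesis by (rule that[of C, OF C])
  qed
  obtain lo hi where b: "0 < lo" "0 < hi" "\<And>u. u \<in> L2 dx \<Longrightarrow> lo * L2_normsq dx u \<le> L2_normsq (eta U) u"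
    "\<And>v. v \<in> L2 (dtx T) \<Longrightarrow> lo * L2_normsq (dtx T) v \<le> L2_normsq (cyl_eta T U) v \<and>
      L2_normsq (cyl_eta T U) v \<le> hi * L2_normsq (dtx T) v"
  proof -
    obtain lo hi where "0 < lo \<and> 0 < hi \<and> (\<forall>u\<in>L2 dx. lo * L2_normsq dx u \<le> L2_normsq (eta U) u \<and>
      L2_normsq (eta U) u \<le> hi * L2_normsq dx u) \<and>
      (\<forall>T. \<forall>u\<in>L2 (dtx T). lo * L2_normsq (dtx T) u \<le> L2_normsq (cyl_eta T U) u \<and>
      L2_normsq (cyl_eta T U) u \<le> hi * L2_normsq (dtx T) u)"
      using normsq_eta_bounds[OF U] by (elim exE)
    then show ?thesis by (intro that[of lo hi]) auto
  qed
  \<comment> \<open>The locale constant is taken outside any interpretation: it involves T, n, the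
    entry bound and the multiplier constant, but not \<alpha>, so it can be fixed before the
    quantifiers over \<alpha>, f and g.\<close>
  define P where "P = (\<Sum>i\<le>k + 1. moment_system.Pc TYPE('d) T n (real m + 1) Cm i)"
  show ?thesis
  \<comment> \<open>The maximum with 1 makes positivity of the constant immediate.\<close>
  proof (intro exI[of _ "hi * max 1 P / lo"] conjI allI impI)
    show "0 < hi * max 1 P / lo" using b by simp
    fix \<alpha> :: "nat \<Rightarrow> 'd \<Rightarrow> nat" and f :: "real \<Rightarrow> real^'d \<Rightarrow> real^'d \<Rightarrow> real" and g :: "real^'d \<Rightarrow> real^'d \<Rightarrow> real"
    assume \<alpha>: "mi_enum m \<alpha>" and g: "in_comps n (gm \<alpha> g) (Heta U (k + 1))" and f: "in_comps n (fm \<alpha> f) (Htx T U (k + 1))"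
    interpret hermite_system U T n \<alpha> "real m + 1" Cm "k + 1"
      by unfold_locales (use moment_bounds[OF \<alpha> n] Cm U assms(2) in auto)
    let ?F = "\<lambda>j z. fm \<alpha> f z j" and ?G = "\<lambda>j x. gm \<alpha> g x j"
    have G: "\<And>j. j \<in> {1..n} \<Longrightarrow> ?G j \<in> Heta U (k + 1)" using g by (simp add: in_comps_def)
    have F: "\<And>j. j \<in> {1..n} \<Longrightarrow> ?F j \<in> Htx T U (k + 1)" using f by (simp add: in_comps_def)
    obtain c where c: "weak_solution T U n \<alpha> (\<lambda>z j. ?F j z) (\<lambda>x j. ?G j x) (\<lambda>z j. c j z)"
      "\<And>j. j \<in> {1..n} \<Longrightarrow> c j \<in> Htx T U (k + 1)"
      "(\<Sum>j=1..n. Htx_normsq T U (k + 1) (c j)) \<le> hi * P / lo *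
        ((\<Sum>j=1..n. Heta_normsq U (k + 1) (?G j)) + (\<Sum>j=1..n. Htx_normsq T U (k + 1) (?F j)))"
      unfolding P_def by (rule well_posedness[OF _ G F b]) auto
    have c3: "(\<Sum>j=1..n. Htx_normsq T U (k + 1) (c j)) \<le> hi * max 1 P / lo *
        ((\<Sum>j=1..n. Heta_normsq U (k + 1) (?G j)) + (\<Sum>j=1..n. Htx_normsq T U (k + 1) (?F j)))"
    proof (rule order_trans[OF c(3)], intro mult_right_mono divide_right_mono mult_left_mono add_nonneg_nonneg sum_nonneg)
      show "0 \<le> Heta_normsq U q (u :: real^'d \<Rightarrow> real)" "0 \<le> Htx_normsq T U q (v :: real \<times> (real^'d) \<Rightarrow> real)" for q u v
        by (auto simp: Heta_normsq_def Htx_normsq_def intro!: sum_nonneg)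
    qed (use b in auto)
    show "\<exists>c. weak_solution T U n \<alpha> (fm \<alpha> f) (gm \<alpha> g) c \<and>
         (\<forall>c'. weak_solution T U n \<alpha> (fm \<alpha> f) (gm \<alpha> g) c' \<longrightarrow>
            (\<forall>j\<in>{1..n}. AE z in cyl_eta T U. c' z j = c z j)) \<and>
         in_comps n c (Htx T U (k + 1)) \<and>
         normsq_comps n (Htx_normsq T U (k + 1)) c
           \<le> hi * max 1 P / lo * (normsq_comps n (Heta_normsq U (k + 1)) (gm \<alpha> g)
                + normsq_comps n (Htx_normsq T U (k + 1)) (fm \<alpha> f))"
    proof (intro exI[of _ "\<lambda>z j. c j z"] conjI allI impI ballI)
      show "weak_solution T U n \<alpha> (fm \<alpha> f) (gm \<alpha> g) (\<lambda>z j. c j z)" using c(1) by simp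
      show "in_comps n (\<lambda>z j. c j z) (Htx T U (k + 1))" using c(2) by (simp add: in_comps_def)
      show "normsq_comps n (Htx_normsq T U (k + 1)) (\<lambda>z j. c j z) \<le>
          hi * max 1 P / lo * (normsq_comps n (Heta_normsq U (k + 1)) (gm \<alpha> g) + normsq_comps n (Htx_normsq T U (k + 1)) (fm \<alpha> f))"
        using c3 by (simp add: normsq_comps_def)
      fix c' j assume c': "weak_solution T U n \<alpha> (fm \<alpha> f) (gm \<alpha> g) c'" and j: "j \<in> {1..n}"
      have F2: "\<And>j. j \<in> {1..n} \<Longrightarrow> ?F j \<in> L2 (dtx T)" using F by (simp add: Htx_iff[OF U])
      have G2: "\<And>j. j \<in> {1..n} \<Longrightarrow> ?G j \<in> L2 dx" using G by (simp add: Heta_iff[OF U])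
      show "AE z in cyl_eta T U. c' z j = c j z"
        unfolding AE_cyl_eta[OF U]
        using weak_solution_unique[where F = ?F and G = ?G and c = c and c' = "\<lambda>j z. c' z j", OF c(1) _ F2 G2 j] c' by simp
    qed
  qed
qed

end
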